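(* Let $\sigma,\vartheta:[0,T]\times\mathbb{R}\to\mathbb{R}$ be continuous on $[0,T]\times\mathbb{R}$ and such that, for $g\in\{\sigma,\vartheta\}$, $$\sup_{t\in[0,T],\,x\neq y\in\mathbb{R}}\frac{|g(t,x)-g(t,y)|}{|x-y|}<+\infty\quad\text{and}\quad \sup_{t\in[0,T]}|g(t,0)|<+\infty .$$ Let $b(t,x)=\beta(t,x)=\lambda(t)+\mu(t)x$ with $\lambda,\mu:[0,T]\to\mathbb{R}$ continuous. For $X_0,Y_0\in L^1(\mathbb{P})$ with $(X_0,Y_0)$ independent of the Brownian motion $W$, let $X=(X_t)_{t\in[0,T]}$ and $Y=(Y_t)_{t\in[0,T]}$ be the solutions of $$X_t=X_0+\int_0^t b(s,X_s)\,ds+\int_0^t\sigma(s,X_s)\,dW_s,\qquad Y_t=Y_0+\int_0^t \beta(s,Y_s)\,ds+\int_0^t\vartheta(s,Y_s)\,dW_s .$$ (a) If $X$ is dominated by $Y$ for the $2$-marginal convex ordering, then $\mathbb{E}\,|\sigma(t,X_t)|\le\mathbb{E}\,|\vartheta(t,Y_t)|$ for each $t\in[0,T]$. (b) In particular, suppose $\vartheta=\sigma$. If, for all $X_0,Y_0\in L^1(\mathbb{P})$ (with $(X_0,Y_0)$ independent of $W$) such that $X_0\preceq_{cvx}Y_0$, the solution $X$ is dominated by the solution $Y$ for the $2$-marginal convex ordering, then $x\mapsto\mathbb{E}\,|\sigma(s,X^x_s)|$ is convex on $\mathbb{R}$ for each $s\in[0,T]$, where $X^x$ denotes the solution of the first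 equation started from $X_0=x$. (c) In the special case where moreover $\sigma$ is autonomous, i.e. $\sigma(t,x)=\sigma(x)$, the property assumed in (b) (the $2$-marginal convex ordering, with $\vartheta=\sigma$, for all $X_0,Y_0\in L^1(\mathbb{P})$ such that $X_0\preceq_{cvx}Y_0$) implies that $|\sigma|:\mathbb{R}\to\mathbb{R}$ is a convex function.
   Context: $T>0$ is fixed and $W=(W_t)_{t\in[0,T]}$ is a one-dimensional standard Brownian motion on a probability space $(\Omega,\mathcal{A},\mathbb{P})$, on which the initial conditions are defined; the space is rich enough to carry the needed initial conditions independent of $W$. Under the stated conditions the SDEs have unique adapted strong solutions. For $\mathbb{R}^m$-valued random vectors $U,V\in L^1(\mathbb{P})$, $U\preceq_{cvx}V$ means $\mathbb{E}f(U)\le\mathbb{E}f(V)\in\mathbb{R}\cup\{+\infty\}$ for every convex $f:\mathbb{R}^m\to\mathbb{R}$. A real-valued process $X=(X_t)_{t\in[0,T]}$ with $\mathbb{E}|X_t|<\infty$ for all $t$ is dominated by a real-valued process $Y=(Y_t)_{t\in[0,T]}$ with $\mathbb{E}|Y_t|<\infty$ for all $t$ for the $2$-marginal convex ordering if, for all $t_1\le t_2$ in $[0,T]$, $(X_{t_1},X_{t_2})\preceq_{cvx}(Y_{t_1},Y_{t_2})$. *)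

theory Defs
  imports "HOL-Probability.Probability"
begin

text \<open>
  Expectation with values in the extended reals, \<open>E f\<^sup>+ - E f\<^sup>-\<close> (\<^const>\<open>ennreal\<close> truncates
  negative reals to 0). For \<open>f\<close> convex and \<open>U\<close> integrable, \<open>E f\<^sup>-(U)\<close> is finite because \<open>f\<close> has
  an affine minorant, so \<open>E f(U)\<close> lies in \<open>(-\<infinity>, \<infinity>]\<close> and the indeterminate form never occurs.
\<close>

definition ext_expectation :: "'a measure \<Rightarrow> ('a \<Rightarrow> real) \<Rightarrow> ereal" where
  "ext_expectation M f =
     enn2ereal (\<integral>\<^sup>+\<omega>. ennreal (f \<omega>) \<partial>M) - enn2ereal (\<integral>\<^sup>+\<omega>. ennreal (- f \<omega>) \<partial>M)"

definition cvx_le :: "'a measure \<Rightarrow> ('a \<Rightarrow> 'v::euclidean_space) \<Rightarrow> ('a \<Rightarrow> 'v) \<Rightarrow> bool" where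
  "cvx_le M U V \<longleftrightarrow> integrable M U \<and> integrable M V \<and>
     (\<forall>f. convex_on UNIV f \<longrightarrow>
        ext_expectation M (\<lambda>\<omega>. f (U \<omega>)) \<le> ext_expectation M (\<lambda>\<omega>. f (V \<omega>)))"

text \<open>The plane is rendered as \<^typ>\<open>real \<times> real\<close>.\<close>

definition two_marginal_cvx_dominated ::
    "'a measure \<Rightarrow> real \<Rightarrow> (real \<Rightarrow> 'a \<Rightarrow> real) \<Rightarrow> (real \<Rightarrow> 'a \<Rightarrow> real) \<Rightarrow> bool" where
  "two_marginal_cvx_dominated M T X Y \<longleftrightarrow>
     (\<forall>t\<in>{0..T}. integrable M (X t) \<and> integrable M (Y t)) \<and>
     (\<forall>t1\<in>{0..T}. \<forall>t2\<in>{0..T}. t1 \<le> t2 \<longrightarrow>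
        cvx_le M (\<lambda>\<omega>. (X t1 \<omega>, X t2 \<omega>)) (\<lambda>\<omega>. (Y t1 \<omega>, Y t2 \<omega>)))"


definition brownian_motion :: "'a measure \<Rightarrow> real \<Rightarrow> (real \<Rightarrow> 'a \<Rightarrow> real) \<Rightarrow> bool" where
  "brownian_motion M T W \<longleftrightarrow>
     (\<forall>t\<in>{0..T}. W t \<in> borel_measurable M) \<and>
     (AE \<omega> in M. W 0 \<omega> = 0) \<and>
     (AE \<omega> in M. continuous_on {0..T} (\<lambda>t. W t \<omega>)) \<and>
     (\<forall>s t. 0 \<le> s \<and> s < t \<and> t \<le> T \<longrightarrow>
        distributed M lborel (\<lambda>\<omega>. W t \<omega> - W s \<omega>) (normal_density 0 (sqrt (t - s)))) \<and>
     (\<forall>(n::nat) (p::nat \<Rightarrow> real). 0 \<le> p 0 \<and> (\<forall>i<n. p i \<le> p (Suc i)) \<and> p n \<le> T \<longrightarrow>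
        prob_space.indep_vars M (\<lambda>_. borel) (\<lambda>i \<omega>. W (p (Suc i)) \<omega> - W (p i) \<omega>) {..<n})"

definition indep_of_process ::
    "'a measure \<Rightarrow> real \<Rightarrow> (real \<Rightarrow> 'a \<Rightarrow> real) \<Rightarrow> ('a \<Rightarrow> 'b::topological_space) \<Rightarrow> bool" where
  "indep_of_process M T W Z \<longleftrightarrow>
     Z \<in> borel_measurable M \<and>
     prob_space.indep_set M
       (sets (vimage_algebra (space M) Z borel))
       (sets (vimage_algebra (space M) (\<lambda>\<omega>. restrict (\<lambda>t. W t \<omega>) {0..T}) (Pi\<^sub>M {0..T} (\<lambda>_. borel))))"

text \<open>
  The probability space carries pairs of initial conditions, independent of \<open>W\<close>, with any
  prescribed integrable joint law.
\<close>

definition rich_enough :: "'a measure \<Rightarrow> real \<Rightarrow> (real \<Rightarrow> 'a \<Rightarrow> real) \<Rightarrow> bool" where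
  "rich_enough M T W \<longleftrightarrow>
     (\<forall>\<nu> :: (real \<times> real) measure.
        prob_space \<nu> \<and> sets \<nu> = sets borel \<and> integrable \<nu> (\<lambda>z. z) \<longrightarrow>
        (\<exists>Z. indep_of_process M T W Z \<and> distr M borel Z = \<nu>))"


text \<open>
  Simple integrands \<open>\<Sum>i<n. \<xi> i * 1_(p i, p (Suc i)]\<close> with \<open>0 = p 0 < \<dots> < p n = T\<close> and
  \<open>\<xi> i\<close> bounded and measurable at time \<open>p i\<close>.
\<close>

definition simple_integrand ::
    "(real \<Rightarrow> 'a measure) \<Rightarrow> real \<Rightarrow> nat \<Rightarrow> (nat \<Rightarrow> real) \<Rightarrow> (nat \<Rightarrow> 'a \<Rightarrow> real) \<Rightarrow> bool" where
  "simple_integrand F T n p \<xi> \<longleftrightarrow>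
     p 0 = 0 \<and> p n = T \<and> (\<forall>i<n. p i < p (Suc i)) \<and>
     (\<forall>i<n. \<xi> i \<in> borel_measurable (F (p i)) \<and> bounded (\<xi> i ` space (F (p i))))"

definition simple_process ::
    "nat \<Rightarrow> (nat \<Rightarrow> real) \<Rightarrow> (nat \<Rightarrow> 'a \<Rightarrow> real) \<Rightarrow> real \<Rightarrow> 'a \<Rightarrow> real" where
  "simple_process n p \<xi> s \<omega> = (\<Sum>i<n. \<xi> i \<omega> * indicator {p i<..p (Suc i)} s)"

definition simple_ito ::
    "(real \<Rightarrow> 'a \<Rightarrow> real) \<Rightarrow> nat \<Rightarrow> (nat \<Rightarrow> real) \<Rightarrow> (nat \<Rightarrow> 'a \<Rightarrow> real) \<Rightarrow> real \<Rightarrow> 'a \<Rightarrow> real" where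
  "simple_ito W n p \<xi> t \<omega> = (\<Sum>i<n. \<xi> i \<omega> * (W (min t (p (Suc i))) \<omega> - W (min t (p i)) \<omega>))"

text \<open>
  Convergence to 0 in probability of nonnegative \<open>Z k\<close>. The exceptional sets are enclosed in
  measurable ones, because the suprema and path integrals below need not be measurable when paths
  are continuous only almost surely on a space that need not be complete.
\<close>

definition null_in_probability :: "'a measure \<Rightarrow> (nat \<Rightarrow> 'a \<Rightarrow> ennreal) \<Rightarrow> bool" where
  "null_in_probability M Z \<longleftrightarrow>
     (\<forall>\<epsilon>>0. \<forall>\<^sub>F k in sequentially.
        \<exists>A\<in>sets M. emeasure M A < ennreal \<epsilon> \<and> (\<forall>\<omega>\<in>space M - A. Z k \<omega> \<le> ennreal \<epsilon>))"

text \<open>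
  The process \<open>I\<close> is (a version of) \<open>\<integral>\<^sub>0 H dW\<close> on \<open>[0, T]\<close>: \<open>I\<close> is adapted with continuous paths,
  and for some simple integrands \<open>H\<^sub>k\<close> both \<open>\<integral>\<^sub>0\<^sup>T (H\<^sub>k - H)\<^sup>2 ds\<close> and the supremum over \<open>[0, T]\<close> of
  \<open>\<bar>\<integral>\<^sub>0 H\<^sub>k dW - I\<bar>\<close> tend to 0 in probability. If \<open>W\<close> is a Brownian motion for the filtration
  \<open>F\<close>, then \<open>I\<close> is unique up to indistinguishability and does not depend on the \<open>H\<^sub>k\<close>, and it exists
  for every progressively measurable \<open>H\<close> with \<open>\<integral>\<^sub>0\<^sup>T H\<^sup>2 ds < \<infinity>\<close> almost surely.
\<close>

definition ito_integral ::
    "'a measure \<Rightarrow> (real \<Rightarrow> 'a measure) \<Rightarrow> real \<Rightarrow> (real \<Rightarrow> 'a \<Rightarrow> real) \<Rightarrow>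
     (real \<Rightarrow> 'a \<Rightarrow> real) \<Rightarrow> (real \<Rightarrow> 'a \<Rightarrow> real) \<Rightarrow> bool" where
  "ito_integral M F T W H I \<longleftrightarrow>
     (AE \<omega> in M. set_borel_measurable lborel {0..T} (\<lambda>s. H s \<omega>)) \<and>
     (\<forall>t\<in>{0..T}. I t \<in> borel_measurable (F t)) \<and>
     (AE \<omega> in M. continuous_on {0..T} (\<lambda>t. I t \<omega>)) \<and>
     (\<exists>(n :: nat \<Rightarrow> nat) (p :: nat \<Rightarrow> nat \<Rightarrow> real) (\<xi> :: nat \<Rightarrow> nat \<Rightarrow> 'a \<Rightarrow> real).
        (\<forall>k. simple_integrand F T (n k) (p k) (\<xi> k)) \<and>
        null_in_probability M
          (\<lambda>k \<omega>. \<integral>\<^sup>+s\<in>{0..T}. ennreal ((simple_process (n k) (p k) (\<xi> k) s \<omega> - H s \<omega>)\<^sup>2) \<partial>lborel) \<and>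
        null_in_probability M
          (\<lambda>k \<omega>. SUP t\<in>{0..T}. ennreal \<bar>simple_ito W (n k) (p k) (\<xi> k) t \<omega> - I t \<omega>\<bar>))"


text \<open>The filtration generated by \<open>X0\<close> and \<open>W\<close>, augmented with the null sets of \<open>M\<close>.\<close>

definition aug_filtration ::
    "'a measure \<Rightarrow> (real \<Rightarrow> 'a \<Rightarrow> real) \<Rightarrow> ('a \<Rightarrow> real) \<Rightarrow> real \<Rightarrow> 'a measure" where
  "aug_filtration M W X0 t = sigma (space M)
     ({X0 -` B \<inter> space M | B. B \<in> sets borel} \<union>
      {W s -` B \<inter> space M | s B. s \<in> {0..t} \<and> B \<in> sets borel} \<union>
      null_sets M)"

definition strong_solution ::
    "'a measure \<Rightarrow> real \<Rightarrow> (real \<Rightarrow> 'a \<Rightarrow> real) \<Rightarrow> (real \<Rightarrow> real \<Rightarrow> real) \<Rightarrow> (real \<Rightarrow> real \<Rightarrow> real) \<Rightarrow>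
     ('a \<Rightarrow> real) \<Rightarrow> (real \<Rightarrow> 'a \<Rightarrow> real) \<Rightarrow> bool" where
  "strong_solution M T W b \<sigma> X0 X \<longleftrightarrow>
     (\<forall>t\<in>{0..T}. X t \<in> borel_measurable (aug_filtration M W X0 t)) \<and>
     (AE \<omega> in M. continuous_on {0..T} (\<lambda>t. X t \<omega>)) \<and>
     (\<exists>I. ito_integral M (aug_filtration M W X0) T W (\<lambda>s \<omega>. \<sigma> s (X s \<omega>)) I \<and>
          (AE \<omega> in M. \<forall>t\<in>{0..T}. X t \<omega> = X0 \<omega> + (LINT s:{0..t}|lborel. b s (X s \<omega>)) + I t \<omega>))"

definition admissible_coefficient :: "real \<Rightarrow> (real \<Rightarrow> real \<Rightarrow> real) \<Rightarrow> bool" where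
  "admissible_coefficient T g \<longleftrightarrow>
     continuous_on ({0..T} \<times> UNIV) (\<lambda>(t, x). g t x) \<and>
     bdd_above {\<bar>g t x - g t y\<bar> / \<bar>x - y\<bar> | t x y. t \<in> {0..T} \<and> x \<noteq> y} \<and>
     bdd_above {\<bar>g t 0\<bar> | t. t \<in> {0..T}}"

text \<open>
  The convex order between initial conditions propagates to the 2-marginal convex order between the
  solutions of the equations with coefficients \<open>(b, \<sigma>)\<close> and \<open>(\<beta>, \<theta>)\<close>. Solutions are unique up to
  indistinguishability, so the solution is rendered by quantifying over all solutions.
\<close>

definition propagates_two_marginal_cvx ::
    "'a measure \<Rightarrow> real \<Rightarrow> (real \<Rightarrow> 'a \<Rightarrow> real) \<Rightarrow> (real \<Rightarrow> real \<Rightarrow> real) \<Rightarrow> (real \<Rightarrow> real \<Rightarrow> real) \<Rightarrow>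
     (real \<Rightarrow> real \<Rightarrow> real) \<Rightarrow> (real \<Rightarrow> real \<Rightarrow> real) \<Rightarrow> bool" where
  "propagates_two_marginal_cvx M T W b \<sigma> \<beta> \<theta> \<longleftrightarrow>
     (\<forall>X0 Y0 X Y.
        integrable M X0 \<and> integrable M Y0 \<and> indep_of_process M T W (\<lambda>\<omega>. (X0 \<omega>, Y0 \<omega>)) \<and>
        cvx_le M X0 Y0 \<and>
        strong_solution M T W b \<sigma> X0 X \<and> strong_solution M T W \<beta> \<theta> Y0 Y \<longrightarrow>
        two_marginal_cvx_dominated M T X Y)"

end

theory Submission
  imports Defs
begin

text \<open>
 Over a short time step a solution moves by \<open>\<sigma>(s, X\<^sub>s) (W\<^sub>t - W\<^sub>s)\<close>, up to an error that is \<open>o(\<surd>(t - s))\<close> in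
 first moment, and the two factors are independent. Hence \<open>E \<bar>X\<^sub>t - X\<^sub>s\<bar> / \<surd>(t - s)\<close> tends to
 \<open>\<surd>(2/\<pi>) E \<bar>\<sigma>(s, X\<^sub>s)\<bar>\<close> as \<open>t \<down> s\<close> (\<open>small_time_limit\<close>). The function \<open>(x\<^sub>1, x\<^sub>2) \<mapsto> \<bar>x\<^sub>2 - x\<^sub>1\<bar>\<close> is
 convex, so 2-marginal domination compares these first moments, and the limit compares
 \<open>E \<bar>\<sigma>(s, X\<^sub>s)\<bar>\<close> with \<open>E \<bar>\<theta>(s, Y\<^sub>s)\<bar>\<close>. At the final time, where there is no later time to look at, the
 comparison follows by continuity in \<open>s\<close> (\<open>dominated_diffusion_le\<close>).

 For the convexity in (b), start \<open>X\<close> at \<open>(1 - u) x + u y\<close> and \<open>Y\<close> at a variable with the two values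
 \<open>x\<close> and \<open>y\<close>, taken with probabilities \<open>1 - u\<close> and \<open>u\<close>. The process that follows the solution from \<open>x\<close> or
 the one from \<open>y\<close>, according to the value of \<open>Y\<^sub>0\<close>, is a solution started from \<open>Y\<^sub>0\<close>, and since \<open>Y\<^sub>0\<close> is
 independent of both, (a) becomes the convexity inequality (\<open>propagates_imp_convex\<close>). For (c) one
 reads (b) at time 0, where the solution is still at its starting point. This needs a solution for
 every starting point, since otherwise the assumption could hold for lack of solutions; it is
 constructed as the limit of Euler schemes (\<open>solution_exists\<close>).

 What makes the small-time limit delicate is that nothing is known about moments beforehand: the
 Ito integral is characterised by a limit in probability, and the initial value is only
 integrable. Two devices deal with this. Switching an approximating integral off before its
 energy exceeds a level \<open>C\<close> gives an Ito inequality on the event that the energy is below \<open>C\<close>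
 (\<open>ito_inequality_gated\<close>), with bounds that survive \<open>C \<rightarrow> \<infinity>\<close>. And the weight
 \<open>(1 + \<bar>X\<^sub>0\<bar>)\<close> to the power \<open>-1/2\<close>, which is known at time 0, gives the initial value a finite weighted second moment,
 while a weighted second moment still controls the first moment (\<open>first_moment_le\<close>).
\<close>

section \<open>Notation for integrals over time and over the probability space\<close>

abbreviation TI :: "real set => (real => ennreal) => ennreal" where
 "TI S f \<equiv> (\<integral>\<^sup>+s\<in>S. f s \<partial>lborel)"

context prob_space
begin

abbreviation nn_expectation :: "('a => ennreal) => ennreal" (binder "EE " 10) where
 "nn_expectation f \<equiv> (\<integral>\<^sup>+w. f w \<partial>M)"

end

section \<open>Gronwall's inequality and convergence in probability\<close>

text \<open>
 Feeding the bound \<open>B\<close> into the inequality \<open>n\<close> times leaves a remainder \<open>B (c t)\<^sup>n / n!\<close>.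
\<close>

lemma gronwall_bounded:
 fixes \<phi> :: "real => ennreal" and a c B T :: real
 assumes a: "0 \<le> a" and c: "0 \<le> c" and B: "0 \<le> B"
  and bound: "\<And>t. t \<in> {0..T} ==> \<phi> t \<le> ennreal B"
  and ineq: "\<And>t. t \<in> {0..T} ==> \<phi> t \<le> ennreal a + ennreal c * (TI {0..t} \<phi>)"
  and t: "t \<in> {0..T}"
 shows "\<phi> t \<le> ennreal (a * exp (c * t))"
proof -
 define g where "g n s = a * exp (c * s) + B * (c * s) ^ n / fact n" for n :: nat and s :: real
 have step: "\<phi> t \<le> ennreal (g n t)" if "t \<in> {0..T}" for n t
  using that
 proof (induction n arbitrary: t)
  case 0
  have "B \<le> g 0 t" using a by (simp add: g_def)
  then show ?case using bound[OF 0] by (meson ennreal_leI order_trans)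
 next
  case (Suc n)
  have t0: "0 \<le> t" using Suc.prems by simp
  have gn: "0 \<le> g n s" if "0 \<le> s" for s
   using that a B c by (simp add: g_def)
  have der: "((%s. g (Suc n) s) has_real_derivative c * g n s) (at s)" for s
  proof -
   have *: "(c * s) ^ n * (c * real (Suc n)) / fact (Suc n) = c * ((c * s) ^ n / fact n)"
   proof -
    have "fact (Suc n) = real (Suc n) * (fact n :: real)" by simp
    then show ?thesis by (simp add: field_simps del: fact_Suc of_nat_Suc)
   qed
   have p: "((%s. (c * s) ^ Suc n) has_real_derivative (c * s) ^ n * (c * real (Suc n))) (at s)"
    by (rule derivative_eq_intros refl | simp del: power_Suc)+
   have "((%s. a * exp (c * s) + B * ((c * s) ^ Suc n / fact (Suc n))) has_real_derivative
     a * (exp (c * s) * c) + B * ((c * s) ^ n * (c * real (Suc n)) / fact (Suc n))) (at s)"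
    by (intro DERIV_add DERIV_cmult DERIV_cdivide p) (rule derivative_eq_intros refl | simp)+
   then show ?thesis unfolding g_def * by (simp add: algebra_simps del: fact_Suc power_Suc)
  qed
  have "(\<integral>\<^sup>+s. ennreal (c * g n s) * indicator {0..t} s \<partial>lborel) = ennreal (g (Suc n) t - g (Suc n) 0)"
   apply (rule nn_integral_FTC_Icc)
   subgoal unfolding g_def by measurable
   subgoal for s using der[of s] by (simp add: has_real_derivative_iff_has_vector_derivative)
   subgoal for s using gn[of s] c by simp
   subgoal using t0 .
   done
  also have "(\<integral>\<^sup>+s. ennreal (c * g n s) * indicator {0..t} s \<partial>lborel)
    = ennreal c * (TI {0..t} (%s. ennreal (g n s)))"
   apply (subst nn_integral_cmult[symmetric])
   subgoal unfolding g_def by measurable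
   by (intro nn_integral_cong) (auto simp: indicator_def c gn ennreal_mult)
  finally have I: "ennreal c * (TI {0..t} (%s. ennreal (g n s))) = ennreal (g (Suc n) t - a)"
   by (simp add: g_def)
  have "\<phi> t \<le> ennreal a + ennreal c * (TI {0..t} \<phi>)"
   by (rule ineq[OF Suc.prems])
  also have "... \<le> ennreal a + ennreal c * (TI {0..t} (%s. ennreal (g n s)))"
   using Suc.prems by (intro add_mono mult_left_mono nn_integral_mono order_refl)
    (auto simp: indicator_def intro!: Suc.IH)
  also have "... = ennreal a + ennreal (g (Suc n) t - a)" by (simp add: I)
  also have "... = ennreal (g (Suc n) t)"
  proof -
   have "a \<le> g (Suc n) t"
   proof -
    have "a * 1 \<le> a * exp (c * t)" using a c t0 by (intro mult_left_mono) auto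
    moreover have "0 \<le> B * (c * t) ^ Suc n / fact (Suc n)" using B c t0 by simp
    ultimately show ?thesis unfolding g_def by linarith
   qed
   then show ?thesis using a by (subst ennreal_plus[symmetric]) auto
  qed
  finally show ?case .
 qed
 have "(%n. g n t) \<longlonglongrightarrow> a * exp (c * t) + B * 0"
 proof -
  have "(%n. (c * t) ^ n / fact n) \<longlonglongrightarrow> 0"
   using summable_LIMSEQ_zero[OF summable_exp[of "c * t"]] by (simp add: field_simps)
  then have "(%n. a * exp (c * t) + B * ((c * t) ^ n / fact n)) \<longlonglongrightarrow> a * exp (c * t) + B * 0"
   by (intro tendsto_intros)
  then show ?thesis by (simp add: g_def)
 qed
 then have "(%n. ennreal (g n t)) \<longlonglongrightarrow> ennreal (a * exp (c * t))"
  by (simp add: tendsto_ennrealI)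
 then show ?thesis
  by (rule tendsto_lowerbound) (auto simp: step[OF t])
qed

lemma gronwall_integrable:
 fixes \<phi> :: "real => ennreal" and a c T :: real
 assumes a: "0 \<le> a" and c: "0 \<le> c"
  and fin: "(TI {0..T} \<phi>) < \<infinity>"
  and ineq: "\<And>t. t \<in> {0..T} ==> \<phi> t \<le> ennreal a + ennreal c * (TI {0..t} \<phi>)"
  and t: "t \<in> {0..T}"
 shows "\<phi> t \<le> ennreal (a * exp (c * t))"
proof -
 obtain K where K: "(TI {0..T} \<phi>) = ennreal K" "0 \<le> K"
  using fin by (cases "(TI {0..T} \<phi>)") auto
 have "\<phi> t \<le> ennreal (a + c * K)" if "t \<in> {0..T}" for t
 proof -
  have "\<phi> t \<le> ennreal a + ennreal c * (TI {0..t} \<phi>)" by (rule ineq[OF that])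
  also have "... \<le> ennreal a + ennreal c * (TI {0..T} \<phi>)"
   using that by (intro add_mono mult_left_mono nn_integral_mono order_refl) (auto simp: indicator_def)
  finally show ?thesis using K a c by (simp add: ennreal_mult ennreal_plus)
 qed
 from gronwall_bounded[OF a c _ this ineq t] show ?thesis using K a c by simp
qed

lemma null_in_probability_le:
 assumes Z: "null_in_probability M Z" and N: "N \<in> null_sets M" and c: "0 \<le> c"
  and le: "\<And>k w. w \<in> space M - N ==> Y k w \<le> ennreal c * Z k w"
 shows "null_in_probability M Y"
 unfolding null_in_probability_def
proof (intro allI impI)
 fix \<epsilon> :: real assume e: "0 < \<epsilon>"
 define d where "d = \<epsilon> / (c + 1)"
 have d: "0 < d" "c * d \<le> \<epsilon>" "d \<le> \<epsilon>" using e c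
  by (auto simp: d_def field_simps)
 from Z d(1) have "\<forall>\<^sub>F k in sequentially. \<exists>A\<in>sets M. emeasure M A < ennreal d \<and> (\<forall>w\<in>space M - A. Z k w \<le> ennreal d)"
  unfolding null_in_probability_def by blast
 then show "\<forall>\<^sub>F k in sequentially. \<exists>A\<in>sets M. emeasure M A < ennreal \<epsilon> \<and> (\<forall>w\<in>space M - A. Y k w \<le> ennreal \<epsilon>)"
 proof eventually_elim
  case (elim k)
  then obtain A where A: "A \<in> sets M" "emeasure M A < ennreal d" "\<And>w. w \<in> space M - A ==> Z k w \<le> ennreal d" by blast
  have "emeasure M (A \<union> N) = emeasure M A" using A N by (simp add: emeasure_Un_null_set)
  moreover have "Y k w \<le> ennreal \<epsilon>" if "w \<in> space M - (A \<union> N)" for w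
  proof -
   have "Y k w \<le> ennreal c * Z k w" using le that by auto
   also have "... \<le> ennreal c * ennreal d" using A(3) that by (intro mult_left_mono) auto
   also have "... \<le> ennreal \<epsilon>" using d c by (simp add: ennreal_mult[symmetric] ennreal_leI)
   finally show ?thesis .
  qed
  moreover have "ennreal d \<le> ennreal \<epsilon>" using d by (simp add: ennreal_leI)
  ultimately show ?case using A(1,2) N by (intro bexI[of _ "A \<union> N"]) auto
 qed
qed

lemma null_in_probability_add:
 assumes Y: "null_in_probability M Y" and Z: "null_in_probability M Z"
 shows "null_in_probability M (%k w. Y k w + Z k w)"
 unfolding null_in_probability_def
proof (intro allI impI)
 fix \<epsilon> :: real assume e: "0 < \<epsilon>"
 have half: "ennreal (\<epsilon>/2) + ennreal (\<epsilon>/2) = ennreal \<epsilon>" using e by (subst ennreal_plus[symmetric]) auto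
 have e2: "0 < \<epsilon>/2" using e by simp
 from Y[unfolded null_in_probability_def, rule_format, OF e2] Z[unfolded null_in_probability_def, rule_format, OF e2]
 show "\<forall>\<^sub>F k in sequentially. \<exists>A\<in>sets M. emeasure M A < ennreal \<epsilon> \<and> (\<forall>w\<in>space M - A. Y k w + Z k w \<le> ennreal \<epsilon>)"
 proof eventually_elim
  case (elim k)
  then obtain A B where A: "A \<in> sets M" "emeasure M A < ennreal (\<epsilon>/2)" "\<And>w. w \<in> space M - A ==> Y k w \<le> ennreal (\<epsilon>/2)"
   and B: "B \<in> sets M" "emeasure M B < ennreal (\<epsilon>/2)" "\<And>w. w \<in> space M - B ==> Z k w \<le> ennreal (\<epsilon>/2)" by blast
  have "emeasure M (A \<union> B) \<le> emeasure M A + emeasure M B" using A B by (intro emeasure_subadditive) auto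
  also have "... < ennreal \<epsilon>" unfolding half[symmetric] using A B by (intro add_strict_mono)
  finally have "emeasure M (A \<union> B) < ennreal \<epsilon>" .
  moreover have "Y k w + Z k w \<le> ennreal \<epsilon>" if "w \<in> space M - (A \<union> B)" for w
   unfolding half[symmetric] using A B that by (intro add_mono) auto
  ultimately show ?case using A B by (intro bexI[of _ "A \<union> B"]) auto
 qed
qed

lemma null_in_probability_nn_integral:
 assumes m: "\<And>k. Z k \<in> borel_measurable M"
  and lim: "(%k. \<integral>\<^sup>+w. Z k w \<partial>M) \<longlonglongrightarrow> 0"
 shows "null_in_probability M Z"
 unfolding null_in_probability_def
proof (intro allI impI)
 fix \<epsilon> :: real assume e: "0 < \<epsilon>"
 have "\<forall>\<^sub>F k in sequentially. (\<integral>\<^sup>+w. Z k w \<partial>M) < ennreal (\<epsilon> * \<epsilon>)"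
  using e by (intro order_tendstoD(2)[OF lim]) simp
 then show "\<forall>\<^sub>F k in sequentially. \<exists>A\<in>sets M. emeasure M A < ennreal \<epsilon> \<and> (\<forall>w\<in>space M - A. Z k w \<le> ennreal \<epsilon>)"
 proof eventually_elim
  case (elim k)
  let ?A = "{w\<in>space M. ennreal \<epsilon> < Z k w}"
  have A: "?A \<in> sets M" using m by measurable
  have "ennreal \<epsilon> * emeasure M ?A = (\<integral>\<^sup>+w. ennreal \<epsilon> * indicator ?A w \<partial>M)"
   using A by (simp add: nn_integral_cmult_indicator)
  also have "... \<le> (\<integral>\<^sup>+w. Z k w \<partial>M)" by (intro nn_integral_mono) (auto simp: indicator_def)
  also have "... < ennreal \<epsilon> * ennreal \<epsilon>" using elim e by (simp add: ennreal_mult)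
  finally have "emeasure M ?A < ennreal \<epsilon>"
   using mult_left_mono[of "ennreal \<epsilon>" "emeasure M ?A" "ennreal \<epsilon>"] by (meson leD le_less_linear zero_le)
  then show ?case using A by (intro bexI[of _ ?A]) (auto simp: not_less)
 qed
qed

text \<open>
 The Borel-Cantelli argument: along a subsequence the exceptional sets have summable measures.
\<close>

lemma null_in_probability_AE_subseq:
 assumes Z: "null_in_probability M Z"
 shows "\<exists>r::nat=>nat. AE w in M. (%k. Z (r k) w) \<longlonglongrightarrow> 0"
proof -
 have "\<exists>r A. A \<in> sets M \<and> emeasure M A < ennreal ((1/2)^k) \<and> (\<forall>w\<in>space M - A. Z r w \<le> ennreal ((1/2)^k))" for k :: nat
  using eventually_happens'[OF sequentially_bot Z[unfolded null_in_probability_def, rule_format, of "(1/2)^k"]] by auto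
 then obtain r A where rA: "\<And>k::nat. A k \<in> sets M" "\<And>k. emeasure M (A k) < ennreal ((1/2)^k)"
  "\<And>k w. w \<in> space M - A k ==> Z (r k) w \<le> ennreal ((1/2)^k)"
  by metis
 have "AE w in M. \<forall>\<^sub>F k in sequentially. w \<in> space M - A k"
 proof (rule borel_cantelli_AE1)
  show "A k \<in> sets M" for k by fact
  show "emeasure M (A k) < \<infinity>" for k using rA(2)[of k] by (metis ennreal_less_top less_trans infinity_ennreal_def)
  show "summable (%k. measure M (A k))"
  proof (rule summable_comparison_test)
   show "\<exists>N. \<forall>n\<ge>N. norm (measure M (A n)) \<le> (1/2)^n"
    proof (intro exI[of _ 0] allI impI)
    fix n show "norm (measure M (A n)) \<le> (1/2)^n"
     using rA(2)[of n] by (simp add: measure_def enn2real_leI less_imp_le)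
   qed
   show "summable (%n. (1/2::real)^n)" by (rule summable_geometric) simp
  qed
 qed
 then have "AE w in M. (%k. Z (r k) w) \<longlonglongrightarrow> 0"
 proof eventually_elim
  case (elim w)
  have "(%k. ennreal ((1/2)^k)) \<longlonglongrightarrow> ennreal 0"
   by (intro tendsto_ennrealI LIMSEQ_power_zero) simp
  then have up: "(%k. ennreal ((1/2)^k)) \<longlonglongrightarrow> 0" by simp
  have "\<forall>\<^sub>F k in sequentially. Z (r k) w \<le> ennreal ((1/2)^k)"
   using elim by eventually_elim (rule rA(3))
  from tendsto_sandwich[OF _ this tendsto_const up] show ?case by simp
 qed
 then show ?thesis by blast
qed

lemma null_in_probability_AE:
 assumes "finite_measure M" and m: "\<And>k. Z k \<in> borel_measurable M"
  and lim: "AE w in M. (%k. Z k w) \<longlonglongrightarrow> (0::ennreal)"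
 shows "null_in_probability M Z"
proof -
 interpret finite_measure M by fact
 have "null_in_probability M (%k w. min 1 (Z k w))"
 proof (rule null_in_probability_nn_integral)
  show "(%w. min 1 (Z k w)) \<in> borel_measurable M" for k using m by measurable
  have "(%k. \<integral>\<^sup>+w. min 1 (Z k w) \<partial>M) \<longlonglongrightarrow> (\<integral>\<^sup>+w. 0 \<partial>M)"
  proof (rule nn_integral_dominated_convergence[where w="%_. 1"])
   show "AE w in M. (%k. min 1 (Z k w)) \<longlonglongrightarrow> 0" using lim
   proof eventually_elim
    case (elim w)
    from tendsto_min[OF tendsto_const this, of 1] show ?case by simp
   qed
  qed (use m emeasure_finite[of "space M"] in \<open>auto simp: less_top[symmetric]\<close>)
  then show "(%k. \<integral>\<^sup>+w. min 1 (Z k w) \<partial>M) \<longlonglongrightarrow> 0" by simp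
 qed
 note * = this[unfolded null_in_probability_def, rule_format]
 show ?thesis unfolding null_in_probability_def
 proof (intro allI impI)
  fix \<epsilon> :: real assume e: "0 < \<epsilon>"
  have "0 < min \<epsilon> (1/2)" using e by simp
  from *[OF this]
  show "\<forall>\<^sub>F k in sequentially. \<exists>A\<in>sets M. emeasure M A < ennreal \<epsilon> \<and> (\<forall>w\<in>space M - A. Z k w \<le> ennreal \<epsilon>)"
  proof eventually_elim
   case (elim k)
   then obtain A where A: "A \<in> sets M" "emeasure M A < ennreal (min \<epsilon> (1/2))"
    "\<And>w. w \<in> space M - A ==> min 1 (Z k w) \<le> ennreal (min \<epsilon> (1/2))" by blast
   have "ennreal (min \<epsilon> (1/2)) \<le> ennreal \<epsilon>" by (intro ennreal_leI) simp
   moreover have "ennreal (min \<epsilon> (1/2)) < 1"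
   proof -
    have "ennreal (min \<epsilon> (1/2)) < ennreal 1" using e by (intro ennreal_lessI) auto
    then show ?thesis by simp
   qed
   moreover have "Z k w \<le> ennreal \<epsilon>" if "w \<in> space M - A" for w
   proof -
    have "Z k w \<le> ennreal (min \<epsilon> (1/2))"
     using A(3)[OF that] calculation(2) unfolding min_le_iff_disj by (meson leD)
    then show ?thesis using calculation(1) by (rule order_trans)
   qed
   ultimately show ?case using A(1,2) by (intro bexI[of _ A]) (auto intro: less_le_trans)
  qed
 qed
qed

section \<open>Brownian increments are independent of the past\<close>

locale brownian_filtration = prob_space M for M :: "'a measure" +
 fixes T :: real and W :: "real => 'a => real" and F :: "real => 'a measure"
 assumes T_pos: "0 < T"
  and F_sub: "t \<in> {0..T} ==> subalgebra M (F t)"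
  and F_mono: "0 \<le> s ==> s \<le> t ==> t \<le> T ==> subalgebra (F t) (F s)"
  and F_null: "t \<in> {0..T} ==> A \<in> null_sets M ==> A \<in> sets (F t)"
  and W_adapted: "t \<in> {0..T} ==> W t \<in> borel_measurable (F t)"
  and W_cont: "AE w in M. continuous_on {0..T} (%t. W t w)"
  and W_normal: "0 \<le> s ==> s < t ==> t \<le> T ==>
    distributed M lborel (%w. W t w - W s w) (normal_density 0 (sqrt (t - s)))"
  and W_indep: "0 \<le> s ==> s < t ==> t \<le> T ==>
    indep_set (sets (F s)) (sets (vimage_algebra (space M) (%w. W t w - W s w) borel))"

text \<open>
 A generator of the augmented filtration, up to null sets, that is closed under intersection and
 whose members involve finitely many times. Independence can be tested on it.
\<close>

definition past_cylinders ::
  "'a measure => (real => 'a => real) => ('a => real) => real => 'a set set" where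
 "past_cylinders M W X0 s =
   {{w\<in>space M. X0 w \<in> B \<and> (\<forall>u\<in>U. W u w \<in> C u)} | B U C.
    B \<in> sets borel \<and> finite U \<and> U \<subseteq> {0..s} \<and> (\<forall>u. C u \<in> sets borel)}"

lemma sets_Collect_finite_all_in:
 assumes "finite U" "\<And>u. u \<in> U ==> g u \<in> borel_measurable N" "\<And>u. C u \<in> sets borel"
 shows "{w\<in>space N. \<forall>u\<in>U. g u w \<in> C u} \<in> sets N"
proof (rule sets.sets_Collect_finite_All)
 show "{w\<in>space N. g u w \<in> C u} \<in> sets N" if "u \<in> U" for u
  using measurable_sets[OF assms(2)[OF that] assms(3)[of u]] by (simp add: vimage_def Int_def conj_commute)
qed (fact assms(1))

lemma Int_stable_past_cylinders: "Int_stable (past_cylinders M W X0 s)"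
proof (rule Int_stableI)
 fix a b assume "a \<in> past_cylinders M W X0 s" "b \<in> past_cylinders M W X0 s"
 then obtain B U C B' U' C' where
  a: "a = {w\<in>space M. X0 w \<in> B \<and> (\<forall>u\<in>U. W u w \<in> C u)}" "B \<in> sets borel" "finite U" "U \<subseteq> {0..s}" "\<forall>u. C u \<in> sets borel"
  and b: "b = {w\<in>space M. X0 w \<in> B' \<and> (\<forall>u\<in>U'. W u w \<in> C' u)}" "B' \<in> sets borel" "finite U'" "U' \<subseteq> {0..s}" "\<forall>u. C' u \<in> sets borel"
  unfolding past_cylinders_def by blast
 let ?C = "%u. (if u \<in> U then C u else UNIV) \<inter> (if u \<in> U' then C' u else UNIV)"
 have "a \<inter> b = {w\<in>space M. X0 w \<in> B \<inter> B' \<and> (\<forall>u\<in>U \<union> U'. W u w \<in> ?C u)}"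
 proof (intro set_eqI iffI)
  fix w assume "w \<in> a \<inter> b"
  then show "w \<in> {w\<in>space M. X0 w \<in> B \<inter> B' \<and> (\<forall>u\<in>U \<union> U'. W u w \<in> ?C u)}"
   unfolding a(1) b(1) by simp
 next
  fix w assume w: "w \<in> {w\<in>space M. X0 w \<in> B \<inter> B' \<and> (\<forall>u\<in>U \<union> U'. W u w \<in> ?C u)}"
  have *: "W u w \<in> ?C u" if "u \<in> U \<union> U'" for u using w that by blast
  have "W u w \<in> C u" if "u \<in> U" for u using *[of u] that by simp
  moreover have "W u w \<in> C' u" if "u \<in> U'" for u using *[of u] that by simp
  ultimately show "w \<in> a \<inter> b" using w unfolding a(1) b(1) by simp
 qed
 moreover have "\<forall>u. ?C u \<in> sets borel" using a b by auto
 ultimately show "a \<inter> b \<in> past_cylinders M W X0 s"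
  unfolding past_cylinders_def using a(2-4) b(2-4)
  by (intro CollectI exI[of _ "B \<inter> B'"] exI[of _ "U \<union> U'"] exI[of _ ?C]) simp
qed

lemma space_aug_filtration [simp]: "space (aug_filtration M W X0 t) = space M"
 unfolding aug_filtration_def by (rule space_measure_of) (use sets.sets_into_space in \<open>auto dest!: null_setsD2\<close>)

lemma sets_aug_filtration: "sets (aug_filtration M W X0 t) = sigma_sets (space M)
   ({X0 -` B \<inter> space M | B. B \<in> sets borel} \<union>
   {W s -` B \<inter> space M | s B. s \<in> {0..t} \<and> B \<in> sets borel} \<union> null_sets M)"
 unfolding aug_filtration_def by (rule sets_measure_of) (use sets.sets_into_space in \<open>auto dest!: null_setsD2\<close>)

context
 fixes M :: "'a measure" and T :: real and W :: "real => 'a => real"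
 assumes prob: "prob_space M" and BM: "brownian_motion M T W"
begin

interpretation prob_space M by (rule prob)

lemma brownian_measurable: "t \<in> {0..T} ==> W t \<in> borel_measurable M"
 using BM unfolding brownian_motion_def by blast

lemma brownian_measurable_process:
 assumes "u \<in> {0..T}"
 shows "W u \<in> borel_measurable (vimage_algebra (space M) (%w. restrict (%t. W t w) {0..T}) (Pi\<^sub>M {0..T} (%_. borel)))"
proof -
 have "(%w. restrict (%t. W t w) {0..T}) \<in> measurable (vimage_algebra (space M) (%w. restrict (%t. W t w) {0..T}) (Pi\<^sub>M {0..T} (%_. borel))) (Pi\<^sub>M {0..T} (%_. borel))"
  by (rule measurable_vimage_algebra1) (auto simp: space_PiM)
 from measurable_compose[OF this measurable_component_singleton[OF assms]]
 show ?thesis using assms by simp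
qed

text \<open>
 Order the times of \<open>U\<close> together with \<open>0\<close>, \<open>s\<close> and \<open>t\<close>. The increments between neighbours are
 independent, and almost surely the earlier values of \<open>W\<close> are sums of all increments but the last.
\<close>

lemma brownian_increment_indep_cylinder:
 assumes s: "0 \<le> s" "s < t" "t \<le> T"
  and U: "finite U" "U \<subseteq> {0..s}" and C: "\<And>u. C u \<in> sets borel" and D: "D \<in> sets borel"
 shows "prob {w\<in>space M. (\<forall>u\<in>U. W u w \<in> C u) \<and> W t w - W s w \<in> D}
  = prob {w\<in>space M. \<forall>u\<in>U. W u w \<in> C u} * prob {w\<in>space M. W t w - W s w \<in> D}"
proof -
 define L where "L = sorted_list_of_set (U \<union> {0,s})"
 define n where "n = length L"
 define p where "p i = (L @ [t]) ! i" for i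
 have fin: "finite (U \<union> {0,s})" using U by simp
 have setL: "set L = U \<union> {0,s}" unfolding L_def using fin by (rule set_sorted_list_of_set)
 have srt: "sorted L" unfolding L_def by (rule sorted_sorted_list_of_set)
 have n0: "0 < n" unfolding n_def using setL by (cases L) auto
 have Lle: "x \<in> set L ==> 0 \<le> x \<and> x \<le> s" for x using setL U s by auto
 have pn: "p n = t" by (simp add: p_def n_def)
 have pL: "i < n ==> p i = L ! i" for i by (simp add: p_def n_def nth_append)
 have pmem: "i < n ==> p i \<in> set L" for i by (simp add: pL n_def)
 have p0: "p 0 = 0"
 proof -
  obtain j where j: "j < n" "L ! j = 0" using setL unfolding n_def by (metis Un_iff in_set_conv_nth insertCI)
  have "L ! 0 \<le> L ! j" using j by (intro sorted_nth_mono[OF srt]) (auto simp: n_def)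
  then show ?thesis using j n0 Lle[OF pmem[OF n0]] by (simp add: pL)
 qed
 have ps: "p (n - 1) = s"
 proof -
  obtain j where j: "j < n" "L ! j = s" using setL unfolding n_def by (metis Un_iff in_set_conv_nth insertCI)
  have "L ! j \<le> L ! (n - 1)" using j by (intro sorted_nth_mono[OF srt]) (auto simp: n_def)
  then show ?thesis using j n0 Lle[OF pmem[of "n - 1"]] by (simp add: pL)
 qed
 have pmono: "p i \<le> p (Suc i)" if "i < n" for i
 proof (cases "Suc i = n")
  case True then show ?thesis using Lle[OF pmem[OF that]] pn s by simp
 next
  case False
  then have "L ! i \<le> L ! Suc i" using that by (intro sorted_nth_mono[OF srt]) (auto simp: n_def)
  then show ?thesis using False that by (simp add: pL)
 qed
 have "indep_vars (%_. borel) (%i w. W (p (Suc i)) w - W (p i) w) {..<n}"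
  using BM pmono p0 pn s unfolding brownian_motion_def by auto
 from indep_var_restrict[OF this, of "{..<n-1}" "{n-1}"] n0
 have ind: "indep_var (Pi\<^sub>M {..<n-1} (%_. borel)) (%w. \<lambda>i\<in>{..<n-1}. W (p (Suc i)) w - W (p i) w)
   (Pi\<^sub>M {n-1} (%_. borel)) (%w. \<lambda>i\<in>{n-1}. W (p (Suc i)) w - W (p i) w)" by auto
 define f where "f u x = (\<Sum>i\<in>{i\<in>{..<n-1}. p i < u}. x i)" for u and x :: "nat => real"
 have fm: "f u \<in> borel_measurable (Pi\<^sub>M {..<n-1} (%_. borel))" for u
  unfolding f_def by (rule borel_measurable_sum) (auto intro!: measurable_component_singleton)
 have Wf: "f u (\<lambda>i\<in>{..<n-1}. W (p (Suc i)) w - W (p i) w) = W u w - W 0 w" if u: "u \<in> U" for u w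
 proof -
  have "distinct L" by (simp add: L_def)
  obtain k where k: "k < n" "L ! k = u" using setL u unfolding n_def by (metis Un_iff in_set_conv_nth)
  have "p i < u \<longleftrightarrow> i < k" if "i < n" for i
  proof (cases "i < k")
   case True
   then have "L ! i \<le> L ! k" using k by (intro sorted_nth_mono[OF srt]) (auto simp: n_def)
   moreover have "L ! i \<noteq> L ! k" using nth_eq_iff_index_eq[OF \<open>distinct L\<close>, of i k] True k that by (simp add: n_def)
   ultimately show ?thesis using True that k by (simp add: pL)
  next
   case False
   then have "L ! k \<le> L ! i" using that by (intro sorted_nth_mono[OF srt]) (auto simp: n_def)
   then show ?thesis using False that k by (simp add: pL)
  qed
  then have "{i\<in>{..<n-1}. p i < u} = {..<k}" using k by auto
  then have "f u (\<lambda>i\<in>{..<n-1}. W (p (Suc i)) w - W (p i) w) = (\<Sum>i<k. W (p (Suc i)) w - W (p i) w)"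
   unfolding f_def using k by (intro sum.cong) auto
  also have "... = W (p k) w - W (p 0) w" by (rule sum_lessThan_telescope)
  finally show ?thesis using k p0 by (simp add: pL)
 qed
 let ?A = "{x\<in>space (Pi\<^sub>M {..<n-1} (%_. borel)). \<forall>u\<in>U. f u x \<in> C u}"
 let ?B = "{x\<in>space (Pi\<^sub>M {n-1} (%_. borel)). x (n-1) \<in> D}"
 have A: "?A \<in> sets (Pi\<^sub>M {..<n-1} (%_. borel))"
  by (intro sets_Collect_finite_all_in U(1) C fm)
 have B: "?B \<in> sets (Pi\<^sub>M {n-1} (%_. borel))"
  using D by measurable
 have W0: "AE w in M. W 0 w = 0" using BM unfolding brownian_motion_def by blast
 have Wm: "W u \<in> borel_measurable M" if "u \<in> {0..T}" for u using brownian_measurable that .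
 have Um: "u \<in> U ==> W u \<in> borel_measurable M" for u using U s by (intro Wm) auto
 have st: "W s \<in> borel_measurable M" "W t \<in> borel_measurable M" using s by (auto intro!: Wm)
 have m1: "{w\<in>space M. \<forall>u\<in>U. W u w \<in> C u} \<in> events"
  by (intro sets_Collect_finite_all_in U(1) C Um)
 have m2: "{w\<in>space M. W t w - W s w \<in> D} \<in> events"
  using st D by measurable
 have hA: "(\<lambda>i\<in>{..<n-1}. W (p (Suc i)) w - W (p i) w) \<in> ?A \<longleftrightarrow> (\<forall>u\<in>U. W u w - W 0 w \<in> C u)" for w
 proof -
  have "(\<lambda>i\<in>{..<n-1}. W (p (Suc i)) w - W (p i) w) \<in> space (Pi\<^sub>M {..<n-1} (%_. borel))"
   by (simp add: space_PiM)
  then show ?thesis using Wf by simp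
 qed
 have hB: "(\<lambda>i\<in>{n-1}. W (p (Suc i)) w - W (p i) w) \<in> ?B \<longleftrightarrow> W t w - W s w \<in> D" for w
 proof -
  have "(\<lambda>i\<in>{n-1}. W (p (Suc i)) w - W (p i) w) \<in> space (Pi\<^sub>M {n-1} (%_. borel))"
   by (simp add: space_PiM)
  then show ?thesis using n0 ps by (simp add: pn)
 qed
 have "prob ((%w. (\<lambda>i\<in>{..<n-1}. W (p (Suc i)) w - W (p i) w, \<lambda>i\<in>{n-1}. W (p (Suc i)) w - W (p i) w)) -` (?A \<times> ?B) \<inter> space M)
  = prob ((%w. \<lambda>i\<in>{..<n-1}. W (p (Suc i)) w - W (p i) w) -` ?A \<inter> space M) *
   prob ((%w. \<lambda>i\<in>{n-1}. W (p (Suc i)) w - W (p i) w) -` ?B \<inter> space M)"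
  by (rule indep_varD[OF ind A B])
 also have "(%w. (\<lambda>i\<in>{..<n-1}. W (p (Suc i)) w - W (p i) w, \<lambda>i\<in>{n-1}. W (p (Suc i)) w - W (p i) w)) -` (?A \<times> ?B) \<inter> space M
   = {w\<in>space M. \<forall>u\<in>U. W u w - W 0 w \<in> C u} \<inter> {w\<in>space M. W t w - W s w \<in> D}"
  unfolding vimage_def mem_Times_iff fst_conv snd_conv hA hB by blast
 also have "(%w. \<lambda>i\<in>{..<n-1}. W (p (Suc i)) w - W (p i) w) -` ?A \<inter> space M
   = {w\<in>space M. \<forall>u\<in>U. W u w - W 0 w \<in> C u}"
  unfolding vimage_def hA by blast
 also have "(%w. \<lambda>i\<in>{n-1}. W (p (Suc i)) w - W (p i) w) -` ?B \<inter> space M = {w\<in>space M. W t w - W s w \<in> D}"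
  unfolding vimage_def hB by blast
 also have "prob {w\<in>space M. \<forall>u\<in>U. W u w - W 0 w \<in> C u} = prob {w\<in>space M. \<forall>u\<in>U. W u w \<in> C u}"
 proof (rule finite_measure_eq_AE)
  have "W 0 \<in> borel_measurable M" using s by (intro Wm) auto
  then show "{w\<in>space M. \<forall>u\<in>U. W u w - W 0 w \<in> C u} \<in> events"
   by (intro sets_Collect_finite_all_in U(1) C borel_measurable_diff) (auto intro: Um)
  show "AE w in M. (w \<in> {w\<in>space M. \<forall>u\<in>U. W u w - W 0 w \<in> C u}) = (w \<in> {w\<in>space M. \<forall>u\<in>U. W u w \<in> C u})"
   using W0 by eventually_elim simp
 qed (rule m1)
 also have "prob ({w\<in>space M. \<forall>u\<in>U. W u w - W 0 w \<in> C u} \<inter> {w\<in>space M. W t w - W s w \<in> D})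
   = prob ({w\<in>space M. \<forall>u\<in>U. W u w \<in> C u} \<inter> {w\<in>space M. W t w - W s w \<in> D})"
 proof (rule finite_measure_eq_AE)
  have "W 0 \<in> borel_measurable M" using s by (intro Wm) auto
  then have "{w\<in>space M. \<forall>u\<in>U. W u w - W 0 w \<in> C u} \<in> events"
   by (intro sets_Collect_finite_all_in U(1) C borel_measurable_diff) (auto intro: Um)
  then show "{w\<in>space M. \<forall>u\<in>U. W u w - W 0 w \<in> C u} \<inter> {w\<in>space M. W t w - W s w \<in> D} \<in> events" using m2 by auto
  show "AE w in M. (w \<in> {w\<in>space M. \<forall>u\<in>U. W u w - W 0 w \<in> C u} \<inter> {w\<in>space M. W t w - W s w \<in> D})
   = (w \<in> {w\<in>space M. \<forall>u\<in>U. W u w \<in> C u} \<inter> {w\<in>space M. W t w - W s w \<in> D})"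
   using W0 by eventually_elim simp
 qed (use m1 m2 in auto)
 also have "{w\<in>space M. \<forall>u\<in>U. W u w \<in> C u} \<inter> {w\<in>space M. W t w - W s w \<in> D}
   = {w\<in>space M. (\<forall>u\<in>U. W u w \<in> C u) \<and> W t w - W s w \<in> D}" by auto
 finally show ?thesis .
qed

lemma indep_of_process_compose:
 assumes "indep_of_process M T W Z" "f \<in> borel_measurable borel"
 shows "indep_of_process M T W (%w. f (Z w))"
proof -
 have Zm: "Z \<in> borel_measurable M" and
  ind: "indep_set (sets (vimage_algebra (space M) Z borel))
    (sets (vimage_algebra (space M) (%w. restrict (%t. W t w) {0..T}) (Pi\<^sub>M {0..T} (%_. borel))))"
  using assms unfolding indep_of_process_def by auto
 have Zv: "Z \<in> borel_measurable (vimage_algebra (space M) Z borel)"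
  by (rule measurable_vimage_algebra1) auto
 have "sets (vimage_algebra (space M) (%w. f (Z w)) borel) \<subseteq> sets (vimage_algebra (space M) Z borel)"
  by (rule sets_image_in_sets) (use measurable_compose[OF Zv assms(2)] in auto)
 then show ?thesis
  using ind measurable_compose[OF Zm assms(2)] unfolding indep_of_process_def indep_sets2_eq by auto
qed

lemma indep_of_process_const: "indep_of_process M T W (%_. x :: 'c :: topological_space)"
proof -
 let ?P = "vimage_algebra (space M) (%w. restrict (%t. W t w) {0..T}) (Pi\<^sub>M {0..T} (%_. borel))"
 have "sets ?P \<subseteq> events"
  by (rule sets_image_in_sets) (auto intro!: measurable_restrict brownian_measurable)
 moreover have "A = {} \<or> A = space M" if "A \<in> sets (vimage_algebra (space M) (%_. x) borel)" for A
 proof -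
  from that obtain B where "A = (%_. x) -` B \<inter> space M" by (subst (asm) sets_vimage_algebra2) auto
  then show ?thesis by (cases "x \<in> B") auto
 qed
 ultimately show ?thesis unfolding indep_of_process_def indep_sets2_eq
 proof (intro conjI ballI)
  fix a b assume a: "a \<in> sets (vimage_algebra (space M) (%_. x) borel)" and b: "b \<in> sets ?P"
   and ev: "sets ?P \<subseteq> events" and triv: "\<And>A. A \<in> sets (vimage_algebra (space M) (%_. x) borel) ==> A = {} \<or> A = space M"
  have "b \<subseteq> space M" using ev b sets.sets_into_space by auto
  then show "prob (a \<inter> b) = prob a * prob b" using triv[OF a] by (auto simp: prob_space Int_absorb1)
 qed auto
qed

text \<open>
 The initial value is independent of the whole path and the past of the path is independent of the
 increment; together the three are independent, which is checked on cylinders.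
\<close>

lemma indep_set_past_increment:
 assumes s: "0 \<le> s" "s < t" "t \<le> T" and X0: "indep_of_process M T W X0"
 shows "indep_set (sigma_sets (space M) (past_cylinders M W X0 s))
  (sets (vimage_algebra (space M) (%w. W t w - W s w) borel))"
 unfolding sets_vimage_algebra
proof (rule indep_set_sigma_sets)
 let ?P = "vimage_algebra (space M) (%w. restrict (%t. W t w) {0..T}) (Pi\<^sub>M {0..T} (%_. borel))"
 have X0m: "X0 \<in> borel_measurable M" and
  ind: "indep_set (sets (vimage_algebra (space M) X0 borel)) (sets ?P)"
  using X0 unfolding indep_of_process_def by auto
 have PM: "sets ?P \<subseteq> events" using ind unfolding indep_sets2_eq by auto
 have cylP: "{w\<in>space M. \<forall>u\<in>U. W u w \<in> C u} \<in> sets ?P" if "finite U" "U \<subseteq> {0..s}" "\<forall>u. C u \<in> sets borel" for U C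
 proof -
  have "{w\<in>space ?P. \<forall>u\<in>U. W u w \<in> C u} \<in> sets ?P"
   using that s by (intro sets_Collect_finite_all_in brownian_measurable_process) auto
  then show ?thesis by simp
 qed
 have incP: "{w\<in>space M. W t w - W s w \<in> D} \<in> sets ?P" if "D \<in> sets borel" for D
 proof -
  have [measurable]: "W t \<in> borel_measurable ?P" "W s \<in> borel_measurable ?P"
   using s by (auto intro!: brownian_measurable_process)
  have "{w\<in>space ?P. W t w - W s w \<in> D} \<in> sets ?P" using that by measurable
  then show ?thesis by simp
 qed
 show "indep_set (past_cylinders M W X0 s) {(%w. W t w - W s w) -` A \<inter> space M |A. A \<in> sets borel}"
  unfolding indep_sets2_eq
 proof (intro conjI ballI subsetI)
  fix a assume "a \<in> past_cylinders M W X0 s"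
  then obtain B U C where a: "a = {w\<in>space M. X0 w \<in> B \<and> (\<forall>u\<in>U. W u w \<in> C u)}" "B \<in> sets borel" "finite U" "U \<subseteq> {0..s}" "\<forall>u. C u \<in> sets borel"
   unfolding past_cylinders_def by blast
  have a': "a = (X0 -` B \<inter> space M) \<inter> {w\<in>space M. \<forall>u\<in>U. W u w \<in> C u}" using a(1) by auto
  show "a \<in> events" unfolding a' using measurable_sets[OF X0m a(2)] cylP[OF a(3-5)] PM by blast
  fix b assume "b \<in> {(%w. W t w - W s w) -` A \<inter> space M |A. A \<in> sets borel}"
  then obtain D where D: "D \<in> sets borel" "b = {w\<in>space M. W t w - W s w \<in> D}" by auto
  have XB: "X0 -` B \<inter> space M \<in> sets (vimage_algebra (space M) X0 borel)" using a(2) by (rule in_vimage_algebra)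
  have "prob (a \<inter> b) = prob ((X0 -` B \<inter> space M) \<inter> ({w\<in>space M. \<forall>u\<in>U. W u w \<in> C u} \<inter> b))"
   by (simp only: a' Int_assoc)
  also have "... = prob (X0 -` B \<inter> space M) * prob ({w\<in>space M. \<forall>u\<in>U. W u w \<in> C u} \<inter> b)"
   using cylP[OF a(3-5)] incP[OF D(1)] unfolding D(2) by (intro indep_setD[OF ind XB] sets.Int)
  also have "{w\<in>space M. \<forall>u\<in>U. W u w \<in> C u} \<inter> b = {w\<in>space M. (\<forall>u\<in>U. W u w \<in> C u) \<and> W t w - W s w \<in> D}"
   unfolding D(2) by blast
  also have "prob ... = prob {w\<in>space M. \<forall>u\<in>U. W u w \<in> C u} * prob b"
   unfolding D(2) using a(5) by (intro brownian_increment_indep_cylinder[OF s a(3,4) _ D(1)]) blast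
  also have "prob (X0 -` B \<inter> space M) * (prob {w\<in>space M. \<forall>u\<in>U. W u w \<in> C u} * prob b)
    = prob a * prob b"
   unfolding a' indep_setD[OF ind XB cylP[OF a(3-5)]] by simp
  finally show "prob (a \<inter> b) = prob a * prob b" .
 next
  fix b assume "b \<in> {(%w. W t w - W s w) -` A \<inter> space M |A. A \<in> sets borel}"
  then obtain D where D: "D \<in> sets borel" "b = {w\<in>space M. W t w - W s w \<in> D}" by auto
  then show "b \<in> events" using incP PM by auto
 qed
 show "Int_stable (past_cylinders M W X0 s)" by (rule Int_stable_past_cylinders)
 show "Int_stable {(%w. W t w - W s w) -` A \<inter> space M |A. A \<in> sets borel}"
  unfolding Int_stable_def
 proof (intro ballI, clarify)
  fix A B :: "real set" assume "A \<in> sets borel" "B \<in> sets borel"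
  then show "\<exists>C. (%w. W t w - W s w) -` A \<inter> space M \<inter> ((%w. W t w - W s w) -` B \<inter> space M)
    = (%w. W t w - W s w) -` C \<inter> space M \<and> C \<in> sets borel"
   by (intro exI[of _ "A \<inter> B"]) auto
 qed
qed

lemma aug_filtration_subalgebra:
 assumes "X0 \<in> borel_measurable M" "t \<le> T"
 shows "subalgebra M (aug_filtration M W X0 t)"
 unfolding subalgebra_def sets_aug_filtration
proof (intro conjI sets.sigma_sets_subset)
 have "W s -` B \<inter> space M \<in> events" if "s \<in> {0..t}" "B \<in> sets borel" for s B
  using that assms(2) by (intro measurable_sets[OF brownian_measurable]) auto
 then show "{X0 -` B \<inter> space M | B. B \<in> sets borel} \<union>
   {W s -` B \<inter> space M | s B. s \<in> {0..t} \<and> B \<in> sets borel} \<union> null_sets M \<subseteq> events"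
  using assms(1) by (auto intro: measurable_sets)
qed simp

text \<open>Augmentation adds no events beyond changes on null sets, so independence carries over.\<close>

lemma aug_filtration_AE_eq_past:
 assumes A: "A \<in> sets (aug_filtration M W X0 t)"
 shows "\<exists>A'\<in>sigma_sets (space M) (past_cylinders M W X0 t). AE w in M. w \<in> A \<longleftrightarrow> w \<in> A'"
 using A unfolding sets_aug_filtration
proof (induction rule: sigma_sets.induct)
 case (Basic a)
 then consider (X0) B where "B \<in> sets borel" "a = X0 -` B \<inter> space M"
  | (W) s B where "s \<in> {0..t}" "B \<in> sets borel" "a = W s -` B \<inter> space M" | (N) "a \<in> null_sets M" by blast
 then show ?case
 proof cases
  case X0
  then have "a \<in> past_cylinders M W X0 t" unfolding past_cylinders_def
   by (intro CollectI exI[of _ B] exI[of _ "{}"] exI[of _ "%_. UNIV"]) auto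
  then show ?thesis by (intro bexI[of _ a] sigma_sets.Basic) auto
 next
  case W
  then have "a \<in> past_cylinders M W X0 t" unfolding past_cylinders_def
   by (intro CollectI exI[of _ UNIV] exI[of _ "{s}"] exI[of _ "%_. B"]) auto
  then show ?thesis by (intro bexI[of _ a] sigma_sets.Basic) auto
 next
  case N
  then show ?thesis by (intro bexI[of _ "{}"] sigma_sets.Empty) (auto dest: AE_not_in)
 qed
next
 case Empty
 then show ?case by (intro bexI[of _ "{}"] sigma_sets.Empty) auto
next
 case (Compl a)
 then obtain A' where "A' \<in> sigma_sets (space M) (past_cylinders M W X0 t)" "AE w in M. w \<in> a \<longleftrightarrow> w \<in> A'" by blast
 then show ?case by (intro bexI[of _ "space M - A'"] sigma_sets.Compl) auto
next
 case (Union a)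
 then obtain A' where A': "\<And>i::nat. A' i \<in> sigma_sets (space M) (past_cylinders M W X0 t)" "\<And>i. AE w in M. w \<in> a i \<longleftrightarrow> w \<in> A' i" by metis
 have "AE w in M. \<forall>i. w \<in> a i \<longleftrightarrow> w \<in> A' i" using A'(2) by (simp add: AE_all_countable)
 then show ?case using A'(1) proof (intro bexI[of _ "\<Union>i. A' i"] sigma_sets.Union)
  show "AE w in M. (w \<in> (\<Union>i. a i)) = (w \<in> (\<Union>i. A' i))"
   using \<open>AE w in M. \<forall>i. w \<in> a i \<longleftrightarrow> w \<in> A' i\<close> by eventually_elim simp
 qed
qed

lemma indep_set_aug_filtration:
 assumes ind: "indep_set (sigma_sets (space M) (past_cylinders M W X0 t)) B"
  and X0: "X0 \<in> borel_measurable M" and t: "t \<le> T"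
 shows "indep_set (sets (aug_filtration M W X0 t)) B"
 unfolding indep_sets2_eq
proof (intro conjI ballI)
 show sub: "sets (aug_filtration M W X0 t) \<subseteq> events"
  using aug_filtration_subalgebra[OF X0 t] by (simp add: subalgebra_def)
 show Be: "B \<subseteq> events" using ind unfolding indep_sets2_eq by simp
 fix a b assume a: "a \<in> sets (aug_filtration M W X0 t)" and b: "b \<in> B"
 obtain a' where a': "a' \<in> sigma_sets (space M) (past_cylinders M W X0 t)" "AE w in M. w \<in> a \<longleftrightarrow> w \<in> a'"
  using aug_filtration_AE_eq_past[OF a] by blast
 have ev: "a \<in> events" "a' \<in> events" "b \<in> events" using a sub b Be a'(1) ind unfolding indep_sets2_eq by auto
 have "prob (a \<inter> b) = prob (a' \<inter> b)" by (rule finite_measure_eq_AE) (use a'(2) ev in auto)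
 also have "... = prob a' * prob b" by (rule indep_setD[OF ind a'(1) b])
 also have "prob a' = prob a" by (rule finite_measure_eq_AE) (use a'(2) ev in auto)
 finally show "prob (a \<inter> b) = prob a * prob b" .
qed

lemma brownian_filtration_aug:
 assumes T: "0 < T" and X0: "indep_of_process M T W X0"
 shows "brownian_filtration M T W (aug_filtration M W X0)"
proof
 have X0m: "X0 \<in> borel_measurable M" using X0 by (simp add: indep_of_process_def)
 show "0 < T" by fact
 show "subalgebra M (aug_filtration M W X0 t)" if "t \<in> {0..T}" for t
  using aug_filtration_subalgebra[OF X0m] that by simp
 show "subalgebra (aug_filtration M W X0 t) (aug_filtration M W X0 s)" if "0 \<le> s" "s \<le> t" "t \<le> T" for s t
 proof -
  have "sets (aug_filtration M W X0 s) \<subseteq> sets (aug_filtration M W X0 t)"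
   unfolding sets_aug_filtration
  proof (intro sigma_sets_mono' Un_mono order_refl subsetI)
   fix a assume "a \<in> {W u -` B \<inter> space M |u B. u \<in> {0..s} \<and> B \<in> sets borel}"
   then obtain u B where "u \<in> {0..s}" "B \<in> sets borel" "a = W u -` B \<inter> space M" by blast
   then show "a \<in> {W u -` B \<inter> space M |u B. u \<in> {0..t} \<and> B \<in> sets borel}"
    using that by (intro CollectI exI[of _ u] exI[of _ B]) simp
  qed
  then show ?thesis unfolding subalgebra_def by simp
 qed
 show "A \<in> sets (aug_filtration M W X0 t)" if "A \<in> null_sets M" for A t
  unfolding sets_aug_filtration using that by (intro sigma_sets.Basic) auto
 show "W t \<in> borel_measurable (aug_filtration M W X0 t)" if "t \<in> {0..T}" for t
 proof (rule measurableI)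
  fix B :: "real set" assume B: "B \<in> sets borel"
  have "W t -` B \<inter> space M \<in> {W u -` B \<inter> space M |u B. u \<in> {0..t} \<and> B \<in> sets borel}"
   using B that by (intro CollectI exI[of _ t] exI[of _ B]) simp
  then show "W t -` B \<inter> space (aug_filtration M W X0 t) \<in> sets (aug_filtration M W X0 t)"
   unfolding sets_aug_filtration space_aug_filtration by (intro sigma_sets.Basic) blast
 qed simp
 show "AE w in M. continuous_on {0..T} (%t. W t w)" using BM unfolding brownian_motion_def by blast
 fix s t assume st: "0 \<le> s" "s < t" "t \<le> T"
 then show "distributed M lborel (%w. W t w - W s w) (normal_density 0 (sqrt (t - s)))"
  using BM unfolding brownian_motion_def by blast
 show "indep_set (sets (aug_filtration M W X0 s)) (sets (vimage_algebra (space M) (%w. W t w - W s w) borel))"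
  by (rule indep_set_aug_filtration[OF indep_set_past_increment[OF st X0] X0m]) (use st in auto)
qed

text \<open>
 For a deterministic starting point the filtration is generated by \<open>W\<close> and the null sets, so an
 initial variable independent of \<open>W\<close> is independent of everything that the solution depends on.
\<close>

lemma indep_set_initial_driving_filtration:
 assumes Z: "indep_of_process M T W Z" and t: "t \<in> {0..T}"
 shows "indep_set (sets (aug_filtration M W (%_. x) t)) (sets (vimage_algebra (space M) Z borel))"
proof (rule indep_set_aug_filtration)
 let ?P = "vimage_algebra (space M) (%w. restrict (%t. W t w) {0..T}) (Pi\<^sub>M {0..T} (%_. borel))"
 have "past_cylinders M W (%_. x) t \<subseteq> sets ?P"
 proof
  fix a assume "a \<in> past_cylinders M W (%_. x) t"
  then obtain B U C where a: "a = {w\<in>space M. x \<in> B \<and> (\<forall>u\<in>U. W u w \<in> C u)}" "finite U" "U \<subseteq> {0..t}" "\<forall>u. C u \<in> sets borel"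
   unfolding past_cylinders_def by blast
  have "{w\<in>space ?P. \<forall>u\<in>U. W u w \<in> C u} \<in> sets ?P"
  proof (rule sets_Collect_finite_all_in[OF a(2)])
   show "W u \<in> borel_measurable ?P" if "u \<in> U" for u
   proof (rule brownian_measurable_process)
    show "u \<in> {0..T}" using that a(3) t by (meson atLeastAtMost_iff order_trans subsetD)
   qed
   show "C u \<in> sets borel" for u using a(4) by blast
  qed
  then show "a \<in> sets ?P" unfolding a(1) by (cases "x \<in> B") simp_all
 qed
 then have "sigma_sets (space M) (past_cylinders M W (%_. x) t) \<subseteq> sets ?P"
  using sets.sigma_sets_subset[of _ ?P] by simp
 then show "indep_set (sigma_sets (space M) (past_cylinders M W (%_. x) t)) (sets (vimage_algebra (space M) Z borel))"
  using Z unfolding indep_of_process_def indep_sets2_eq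
  by (metis (no_types, lifting) Int_commute mult.commute subset_eq)
qed (use t in simp_all)

end

section \<open>Elementary processes and their integrals\<close>

definition grid :: "real => nat => (nat => real) => bool" where
 "grid T n p \<longleftrightarrow> p 0 = 0 \<and> p n = T \<and> (\<forall>i<n. p i < p (Suc i))"

lemma grid_strict: "grid T n p ==> i < j ==> j \<le> n ==> p i < p j"
proof (induction j)
 case (Suc j)
 have "p j < p (Suc j)" using Suc.prems unfolding grid_def by simp
 moreover have "p i \<le> p j" using Suc by (cases "i = j") auto
 ultimately show ?case by simp
qed simp

lemma grid_mono: "grid T n p ==> i \<le> j ==> j \<le> n ==> p i \<le> p j"
 using grid_strict[of T n p i j] by (cases "i = j") auto

lemma grid_less_iff: "grid T n p ==> i \<le> n ==> j \<le> n ==> p i < p j \<longleftrightarrow> i < j"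
 using grid_strict[of T n p i j] grid_mono[of T n p j i] by (cases "i < j") auto

lemma grid_le_iff: "grid T n p ==> i \<le> n ==> j \<le> n ==> p i \<le> p j \<longleftrightarrow> i \<le> j"
 using grid_strict[of T n p j i] grid_mono[of T n p i j] by (cases "i \<le> j") auto

lemma grid_in: "grid T n p ==> i \<le> n ==> p i \<in> {0..T}"
 using grid_mono[of T n p 0 i] grid_mono[of T n p i n] unfolding grid_def by auto

lemma grid_locate:
 assumes g: "grid T n p" and x: "0 \<le> x" "x < T"
 shows "\<exists>j<n. p j \<le> x \<and> x < p (Suc j)"
proof -
 define k where "k = (LEAST k. x < p k)"
 have ex: "x < p n" using g x unfolding grid_def by simp
 have k: "x < p k" unfolding k_def using ex by (rule LeastI)
 have kn: "k \<le> n" unfolding k_def using ex by (rule Least_le)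
 have k0: "k \<noteq> 0" using k x g unfolding grid_def by (metis leD)
 then obtain j where j: "k = Suc j" by (cases k) auto
 have "\<not> x < p j" using not_less_Least[of j "%k. x < p k"] j unfolding k_def[symmetric] by simp
 then show ?thesis using k kn j by (intro exI[of _ j]) auto
qed

lemma grid_locate_unique:
 assumes g: "grid T n p" and j: "j < n" "p j \<le> x" "x < p (Suc j)" and k: "k < n" "p k \<le> x" "x < p (Suc k)"
 shows "j = k"
proof -
 have "p j < p (Suc k)" "p k < p (Suc j)" using j k by auto
 then have "j < Suc k" "k < Suc j" using j k grid_less_iff[OF g] by auto
 then show ?thesis by simp
qed

lemma grid_locate_left:
 assumes g: "grid T n p" and x: "0 < x" "x \<le> T"
 shows "\<exists>j<n. p j < x \<and> x \<le> p (Suc j)"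
proof -
 define k where "k = (LEAST k. x \<le> p k)"
 have ex: "x \<le> p n" using g x unfolding grid_def by simp
 have k: "x \<le> p k" unfolding k_def using ex by (rule LeastI)
 have kn: "k \<le> n" unfolding k_def using ex by (rule Least_le)
 have k0: "k \<noteq> 0" using k x g unfolding grid_def by (metis leD)
 then obtain j where j: "k = Suc j" by (cases k) auto
 have "\<not> x \<le> p j" using not_less_Least[of j "%k. x \<le> p k"] j unfolding k_def[symmetric] by simp
 then show ?thesis using k kn j by (intro exI[of _ j]) auto
qed

lemma grid_of_finite_set:
 assumes S: "finite S" "S \<subseteq> {0..T}" "0 \<in> S" "T \<in> S" and T: "0 < T"
 shows "\<exists>n p. grid T n p \<and> p ` {..n} = S"
proof -
 define L where "L = sorted_list_of_set S"
 have L: "set L = S" "sorted L" "distinct L" using S(1) by (auto simp: L_def)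
 have len: "0 < length L" using L S by (cases L) auto
 define n where "n = length L - 1"
 have idx: "i \<le> n \<longleftrightarrow> i < length L" for i using len unfolding n_def by linarith
 have strict: "L ! i < L ! j" if "i < j" "j \<le> n" for i j
 proof -
  have "L ! i \<le> L ! j" using that idx by (intro sorted_nth_mono[OF L(2)]) auto
  moreover have "L ! i \<noteq> L ! j" using nth_eq_iff_index_eq[OF L(3), of i j] that idx[of j] by simp
  ultimately show ?thesis by simp
 qed
 have img: "(%i. L ! i) ` {..n} = S"
 proof -
  have "(%i. L ! i) ` {..n} = set L" unfolding set_conv_nth using idx by auto
  then show ?thesis using L by simp
 qed
 have "L ! 0 = 0"
 proof -
  have "0 \<in> (%i. L ! i) ` {..n}" using img S by simp
  then obtain j where j: "j \<le> n" "L ! j = 0" by auto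
  have "L ! 0 \<in> {0..T}" using img S(2) by auto
  then show ?thesis using strict[of 0 j] j by (cases "j = 0") auto
 qed
 moreover have "L ! n = T"
 proof -
  have "T \<in> (%i. L ! i) ` {..n}" using img S by simp
  then obtain j where j: "j \<le> n" "L ! j = T" by auto
  have "L ! n \<in> {0..T}" using img S(2) by auto
  then show ?thesis using strict[of j n] j by (cases "j = n") auto
 qed
 ultimately have "grid T n (%i. L ! i)" unfolding grid_def using strict by simp
 then show ?thesis using img by blast
qed

definition step_sum :: "nat => (nat => real) => (nat => real) => (real => real) => real" where
 "step_sum n p x g = (\<Sum>i<n. x i * (g (p (Suc i)) - g (p i)))"

lemma step_sum_block:
 assumes g: "grid T n p" and i: "i0 \<le> i1" "i1 \<le> n"
 shows "(\<Sum>i<n. if p i0 \<le> p i \<and> p i < p i1 then g (p (Suc i)) - g (p i) else 0) = (g (p i1) - g (p i0) :: real)"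
proof -
 have "(\<Sum>i<n. if p i0 \<le> p i \<and> p i < p i1 then g (p (Suc i)) - g (p i) else 0)
   = (\<Sum>i<n. if i0 \<le> i \<and> i < i1 then g (p (Suc i)) - g (p i) else 0)"
  using i by (intro sum.cong) (auto simp: grid_le_iff[OF g] grid_less_iff[OF g])
 also have "... = (\<Sum>i\<in>{i0..<i1}. g (p (Suc i)) - g (p i))"
  using i by (intro sum.mono_neutral_cong_right) auto
 also have "... = g (p i1) - g (p i0)" by (rule sum_Suc_diff'[OF i(1)])
 finally show ?thesis .
qed

text \<open>
 Refining a grid leaves every step sum unchanged. Both the value of a simple process at a time \<open>s\<close>
 and the value of its stochastic integral are step sums, of \<open>u \<mapsto> 1\<^bsub>s \<le> u\<^esub>\<close> and of the stopped
 driving path respectively, so this single identity handles both.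
\<close>

lemma step_sum_refine:
 assumes g: "grid T n p" and g': "grid T n' p'" and sub: "p ` {..n} \<subseteq> p' ` {..n'}"
 shows "\<exists>f. (\<forall>i<n'. f i < n \<and> p (f i) \<le> p' i) \<and> (\<forall>x g. step_sum n' p' (%i. x (f i)) g = step_sum n p x g)"
proof -
 have "\<exists>j<n. p j \<le> p' i \<and> p' i < p (Suc j)" if "i < n'" for i
 proof (rule grid_locate[OF g])
  show "0 \<le> p' i" using grid_in[OF g', of i] that by simp
  show "p' i < T" using grid_strict[OF g', of i n'] that g' unfolding grid_def by simp
 qed
 then obtain f where f: "\<And>i. i < n' ==> f i < n \<and> p (f i) \<le> p' i \<and> p' i < p (Suc (f i))" by metis
 have "step_sum n' p' (%i. x (f i)) h = step_sum n p x h" for x h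
 proof -
  have "step_sum n' p' (%i. x (f i)) h
    = (\<Sum>i<n'. \<Sum>j<n. x j * (if p j \<le> p' i \<and> p' i < p (Suc j) then h (p' (Suc i)) - h (p' i) else 0))"
   unfolding step_sum_def
  proof (rule sum.cong[OF refl])
   fix i assume "i \<in> {..<n'}"
   then have i: "i < n'" by simp
   have "(\<Sum>j<n. x j * (if p j \<le> p' i \<and> p' i < p (Suc j) then h (p' (Suc i)) - h (p' i) else 0))
     = (\<Sum>j\<in>{f i}. x j * (if p j \<le> p' i \<and> p' i < p (Suc j) then h (p' (Suc i)) - h (p' i) else 0))"
    using f[OF i] grid_locate_unique[OF g, of "f i" "p' i"] by (intro sum.mono_neutral_right) auto
   then show "x (f i) * (h (p' (Suc i)) - h (p' i))
     = (\<Sum>j<n. x j * (if p j \<le> p' i \<and> p' i < p (Suc j) then h (p' (Suc i)) - h (p' i) else 0))"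
    using f[OF i] by simp
  qed
  also have "... = (\<Sum>j<n. x j * (\<Sum>i<n'. if p j \<le> p' i \<and> p' i < p (Suc j) then h (p' (Suc i)) - h (p' i) else 0))"
   by (subst sum.swap) (simp add: sum_distrib_left)
  also have "... = step_sum n p x h" unfolding step_sum_def
  proof (intro sum.cong refl arg_cong2[where f="(*)"])
   fix j assume "j \<in> {..<n}"
   then have j: "j \<le> n" "Suc j \<le> n" by auto
   have "p j \<in> p' ` {..n'}" "p (Suc j) \<in> p' ` {..n'}" using sub j by blast+
   then obtain a b where ab: "a \<le> n'" "b \<le> n'" "p j = p' a" "p (Suc j) = p' b"
    by (elim imageE) simp
   have "a \<le> b" using grid_le_iff[OF g' ab(1,2)] grid_mono[OF g, of j "Suc j"] j ab by simp
   from step_sum_block[OF g' this ab(2)]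
   show "(\<Sum>i<n'. if p j \<le> p' i \<and> p' i < p (Suc j) then h (p' (Suc i)) - h (p' i) else 0) = h (p (Suc j)) - h (p j)"
    by (simp add: ab)
  qed
  finally show ?thesis .
 qed
 with f show ?thesis by (intro exI[of _ f]) auto
qed

text \<open>
 An elementary process \<open>h\<close> with stochastic integral \<open>J\<close>; the predicate \<open>P\<close> restricts the size of the
 coefficients (bounded, or square integrable). The grid is hidden, so that elementary processes on
 different grids can be combined.
\<close>

definition elementary_on :: "(real => 'a measure) => (real => 'a => real) => (('a => real) => bool) =>
  nat => (nat => real) => (nat => 'a => real) => (real => 'a => real) => (real => 'a => real) => bool" where
 "elementary_on F W P n p \<xi> h J \<longleftrightarrow>
   (\<forall>i<n. \<xi> i \<in> borel_measurable (F (p i)) \<and> P (\<xi> i)) \<and>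
   (\<forall>s w. h s w = step_sum n p (%i. \<xi> i w) (%u. if s \<le> u then 1 else 0)) \<and>
   (\<forall>t w. J t w = step_sum n p (%i. \<xi> i w) (%u. W (min t u) w))"

definition elementary :: "(real => 'a measure) => real => (real => 'a => real) => (('a => real) => bool) =>
  (real => 'a => real) => (real => 'a => real) => bool" where
 "elementary F T W P h J \<longleftrightarrow> (\<exists>n p \<xi>. grid T n p \<and> elementary_on F W P n p \<xi> h J)"

lemma simple_process_eq_step_sum:
 assumes "grid T n p"
 shows "simple_process n p \<xi> s w = step_sum n p (%i. \<xi> i w) (%u. if s \<le> u then 1 else 0)"
 unfolding simple_process_def step_sum_def
proof (intro sum.cong refl arg_cong2[where f="(*)"])
 fix i assume "i \<in> {..<n}"
 then have "p i < p (Suc i)" using assms unfolding grid_def by simp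
 then show "indicator {p i<..p (Suc i)} s = (if s \<le> p (Suc i) then 1 else 0) - (if s \<le> p i then 1 else (0::real))"
  by (auto simp: indicator_def)
qed

lemma simple_ito_eq_step_sum:
 "simple_ito W n p \<xi> t w = step_sum n p (%i. \<xi> i w) (%u. W (min t u) w)"
 unfolding simple_ito_def step_sum_def ..

lemma elementary_on_simple:
 assumes "grid T n p" "\<And>i. i < n ==> \<xi> i \<in> borel_measurable (F (p i))" "\<And>i. i < n ==> P (\<xi> i)"
 shows "elementary_on F W P n p \<xi> (simple_process n p \<xi>) (simple_ito W n p \<xi>)"
 using assms unfolding elementary_on_def
 by (simp add: simple_process_eq_step_sum[OF assms(1)] simple_ito_eq_step_sum)

lemma elementary_on_value:
 assumes g: "grid T n p" and e: "elementary_on F W P n p \<xi> h J" and i: "i < n" "p i < s" "s \<le> p (Suc i)"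
 shows "h s w = \<xi> i w"
proof -
 have "h s w = (\<Sum>j<n. \<xi> j w * ((if s \<le> p (Suc j) then 1 else 0) - (if s \<le> p j then 1 else 0)))"
  using e unfolding elementary_on_def step_sum_def by simp
 also have "... = (\<Sum>j\<in>{i}. \<xi> j w * ((if s \<le> p (Suc j) then 1 else 0) - (if s \<le> p j then 1 else 0)))"
 proof (rule sum.mono_neutral_right)
  show "\<forall>j\<in>{..<n} - {i}. \<xi> j w * ((if s \<le> p (Suc j) then 1 else 0) - (if s \<le> p j then 1 else 0)) = 0"
  proof
   fix j assume j: "j \<in> {..<n} - {i}"
   then consider "Suc j \<le> i" | "Suc i \<le> j" by force
   then show "\<xi> j w * ((if s \<le> p (Suc j) then 1 else 0) - (if s \<le> p j then 1 else 0)) = 0"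
   proof cases
    case 1
    then have "p (Suc j) \<le> p i" "p j \<le> p i" using i by (auto intro!: grid_mono[OF g])
    then show ?thesis using i by simp
   next
    case 2
    then have "p (Suc i) \<le> p j" "p (Suc i) \<le> p (Suc j)" using i j by (auto intro!: grid_mono[OF g])
    then show ?thesis using i by simp
   qed
  qed
 qed (use i in auto)
 also have "... = \<xi> i w" using i by simp
 finally show ?thesis .
qed

lemma elementary_on_outside:
 assumes g: "grid T n p" and e: "elementary_on F W P n p \<xi> h J" and s: "s \<le> 0 \<or> T < s"
 shows "h s w = 0"
proof -
 have "(if s \<le> p (Suc j) then 1 else 0) - (if s \<le> p j then 1 else 0) = (0::real)" if "j < n" for j
  using grid_in[OF g, of j] grid_in[OF g, of "Suc j"] that s by auto
 then have "step_sum n p (%i. \<xi> i w) (%u. if s \<le> u then 1 else 0) = 0"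
  unfolding step_sum_def by (intro sum.neutral) simp
 then show ?thesis using e unfolding elementary_on_def by simp
qed

lemma elementary_outside: "elementary F T W P h J ==> s \<le> 0 \<or> T < s ==> h s w = 0"
 unfolding elementary_def using elementary_on_outside by metis

lemma elementary_mono:
 assumes "elementary F T W P h J" "\<And>\<xi> n p i. P \<xi> ==> grid T n p ==> i < n ==> \<xi> \<in> borel_measurable (F (p i)) ==> Q \<xi>"
 shows "elementary F T W Q h J"
 using assms unfolding elementary_def elementary_on_def by metis

lemma elementary_on_change_filtration:
 assumes e: "elementary_on F W P n p \<xi> h J" and g: "grid T n p"
  and sub: "\<And>t. t \<in> {0..T} ==> subalgebra (G t) (F t)"
 shows "elementary_on G W P n p \<xi> h J"
proof -
 have "\<xi> i \<in> borel_measurable (G (p i))" if "i < n" for i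
  using measurable_from_subalg[OF sub, of "p i" "\<xi> i" borel] grid_in[OF g, of i] that e
  unfolding elementary_on_def by auto
 then show ?thesis using e unfolding elementary_on_def by auto
qed

lemma elementary_change_filtration:
 "elementary F T W P h J ==> (\<And>t. t \<in> {0..T} ==> subalgebra (G t) (F t)) ==> elementary G T W P h J"
 unfolding elementary_def using elementary_on_change_filtration by metis

context brownian_filtration
begin

lemma elementary_on_coeff_measurable:
 assumes g: "grid T n p" and e: "elementary_on F W P n p \<xi> h J" and i: "i < n"
 shows "\<xi> i \<in> borel_measurable M"
proof (rule measurable_from_subalg)
 show "subalgebra M (F (p i))" using grid_in[OF g, of i] i by (intro F_sub) simp
 show "\<xi> i \<in> borel_measurable (F (p i))" using e i unfolding elementary_on_def by blast
qed

lemma elementary_on_refine: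
 assumes e: "elementary_on F W P n p \<xi> h J" and g: "grid T n p" and g': "grid T n' p'" and sub: "p ` {..n} \<subseteq> p' ` {..n'}"
 shows "\<exists>\<xi>'. elementary_on F W P n' p' \<xi>' h J"
proof -
 obtain f where f: "\<And>i. i < n' ==> f i < n \<and> p (f i) \<le> p' i"
  "\<And>x g. step_sum n' p' (%i. x (f i)) g = step_sum n p x g"
  using step_sum_refine[OF g g' sub] by blast
 have "\<xi> (f i) \<in> borel_measurable (F (p' i))" if i: "i < n'" for i
 proof (rule measurable_from_subalg)
  show "subalgebra (F (p' i)) (F (p (f i)))"
   using f(1)[OF i] grid_in[OF g, of "f i"] grid_in[OF g', of i] i by (intro F_mono) auto
  show "\<xi> (f i) \<in> borel_measurable (F (p (f i)))" using e f(1)[OF i] unfolding elementary_on_def by blast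
 qed
 moreover have "step_sum n' p' (%i. \<xi> (f i) w) k = step_sum n p (%i. \<xi> i w) k" for w k
  using f(2)[of "%i. \<xi> i w"] .
 ultimately have "elementary_on F W P n' p' (%i. \<xi> (f i)) h J"
  using e f(1) unfolding elementary_on_def by simp
 then show ?thesis by blast
qed

lemma elementary_common_grid:
 assumes e1: "elementary F T W P h1 J1" and e2: "elementary F T W Q h2 J2" and S: "finite S" "S \<subseteq> {0..T}"
 shows "\<exists>n p \<xi>1 \<xi>2. grid T n p \<and> S \<subseteq> p ` {..n} \<and> elementary_on F W P n p \<xi>1 h1 J1 \<and> elementary_on F W Q n p \<xi>2 h2 J2"
proof -
 obtain n1 p1 x1 where 1: "grid T n1 p1" "elementary_on F W P n1 p1 x1 h1 J1" using e1 unfolding elementary_def by blast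
 obtain n2 p2 x2 where 2: "grid T n2 p2" "elementary_on F W Q n2 p2 x2 h2 J2" using e2 unfolding elementary_def by blast
 let ?S = "S \<union> p1 ` {..n1} \<union> p2 ` {..n2}"
 have "\<exists>n p. grid T n p \<and> p ` {..n} = ?S"
 proof (rule grid_of_finite_set[OF _ _ _ _ T_pos])
  show "finite ?S" using S by simp
  have "p1 ` {..n1} \<subseteq> {0..T}" "p2 ` {..n2} \<subseteq> {0..T}"
   using grid_in[OF 1(1)] grid_in[OF 2(1)] by (blast intro: image_subsetI)+
  then show "?S \<subseteq> {0..T}" using S by blast
  have "p1 0 = 0" "p1 n1 = T" using 1 unfolding grid_def by auto
  then show "0 \<in> ?S" "T \<in> ?S" by (metis UnI1 UnI2 atMost_iff image_eqI le0 order_refl)+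
 qed
 then obtain n p where np: "grid T n p" "p ` {..n} = ?S" by blast
 obtain y1 where "elementary_on F W P n p y1 h1 J1"
  using elementary_on_refine[OF 1(2,1) np(1)] np(2) by blast
 moreover obtain y2 where "elementary_on F W Q n p y2 h2 J2"
  using elementary_on_refine[OF 2(2,1) np(1)] np(2) by blast
 ultimately show ?thesis using np by blast
qed

lemma elementary_diff:
 assumes e1: "elementary F T W P h1 J1" and e2: "elementary F T W P h2 J2"
  and P: "\<And>n p i f g. P f ==> P g ==> f \<in> borel_measurable M ==> g \<in> borel_measurable M ==> P (%w. f w - g w)"
 shows "elementary F T W P (%s w. h1 s w - h2 s w) (%t w. J1 t w - J2 t w)"
proof -
 obtain n p x1 x2 where np: "grid T n p" "elementary_on F W P n p x1 h1 J1" "elementary_on F W P n p x2 h2 J2"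
  using elementary_common_grid[OF e1 e2, of "{}"] by blast
 have "step_sum n p (%i. x1 i w - x2 i w) g = step_sum n p (%i. x1 i w) g - step_sum n p (%i. x2 i w) g" for w g
  unfolding step_sum_def by (simp add: left_diff_distrib sum_subtractf)
 moreover have "x1 i \<in> borel_measurable M" "x2 i \<in> borel_measurable M" if "i < n" for i
  using elementary_on_coeff_measurable[OF np(1,2) that] elementary_on_coeff_measurable[OF np(1,3) that] by auto
 ultimately have "elementary_on F W P n p (%i w. x1 i w - x2 i w) (%s w. h1 s w - h2 s w) (%t w. J1 t w - J2 t w)"
  using np(2,3) unfolding elementary_on_def by (auto intro: P borel_measurable_diff)
 then show ?thesis using np unfolding elementary_def by blast
qed

text \<open>
 The integral started afresh at time \<open>a\<close> and multiplied by a variable \<open>G\<close> known at time \<open>a\<close> is again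
 an elementary integral: known variables pass through the integral.
\<close>

lemma elementary_restart:
 assumes e: "elementary F T W P h J" and a: "a \<in> {0..T}" and G: "G \<in> borel_measurable (F a)"
  and P0: "P (%_. 0)" and PG: "\<And>\<xi>. P \<xi> ==> \<xi> \<in> borel_measurable M ==> P (%w. G w * \<xi> w)"
 shows "elementary F T W P (%s w. if a < s then G w * h s w else 0) (%t w. G w * (J t w - J (min t a) w))"
proof -
 obtain n p x y where np: "grid T n p" "{a} \<subseteq> p ` {..n}" "elementary_on F W P n p x h J"
  using elementary_common_grid[OF e e, of "{a}"] a by blast
 have xM: "x i \<in> borel_measurable M" if "i < n" for i
  using elementary_on_coeff_measurable[OF np(1,3) that] .
 obtain k where k: "k \<le> n" "p k = a" using np(2) by auto
 define y where "y i = (if a \<le> p i then (%w. G w * x i w) else (%_. 0))" for i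
 have ym: "y i \<in> borel_measurable (F (p i))" "P (y i)" if i: "i < n" for i
 proof -
  have x: "x i \<in> borel_measurable (F (p i))" "P (x i)" using np(3) i unfolding elementary_on_def by auto
  have "G \<in> borel_measurable (F (p i))" if "a \<le> p i"
   by (rule measurable_from_subalg[OF F_mono G]) (use a that grid_in[OF np(1), of i] i in auto)
  then show "y i \<in> borel_measurable (F (p i))" using x unfolding y_def by simp
  show "P (y i)" using x xM[OF i] P0 PG unfolding y_def by simp
 qed
 have dich: "(a \<le> p i \<and> a \<le> p (Suc i)) \<or> (\<not> a \<le> p i \<and> p i \<le> a \<and> p (Suc i) \<le> a)" if "i < n" for i
 proof (cases "k \<le> i")
  case True
  then show ?thesis using grid_mono[OF np(1), of k i] grid_mono[OF np(1), of k "Suc i"] that k by auto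
 next
  case False
  then show ?thesis using grid_strict[OF np(1), of i k] grid_mono[OF np(1), of "Suc i" k] that k by auto
 qed
 have h: "(if a < s then G w * h s w else 0) = step_sum n p (%i. y i w) (%u. if s \<le> u then 1 else 0)" for s w
 proof -
  have "(if a < s then G w * h s w else 0)
    = (\<Sum>i<n. if a < s then G w * (x i w * ((if s \<le> p (Suc i) then 1 else 0) - (if s \<le> p i then 1 else 0))) else 0)"
   using np(3) unfolding elementary_on_def step_sum_def by (simp add: sum_distrib_left)
  also have "... = step_sum n p (%i. y i w) (%u. if s \<le> u then 1 else 0)" unfolding step_sum_def
  proof (rule sum.cong[OF refl])
   fix i assume "i \<in> {..<n}"
   then have "i < n" by simp
   from dich[OF this] show "(if a < s then G w * (x i w * ((if s \<le> p (Suc i) then 1 else 0) - (if s \<le> p i then 1 else 0))) else 0)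
     = y i w * ((if s \<le> p (Suc i) then 1 else 0) - (if s \<le> p i then 1 else 0))"
    unfolding y_def by (elim disjE conjE) (cases "a < s"; simp)+
  qed
  finally show ?thesis .
 qed
 have J: "G w * (J t w - J (min t a) w) = step_sum n p (%i. y i w) (%u. W (min t u) w)" for t w
 proof -
  have "G w * (J t w - J (min t a) w)
    = (\<Sum>i<n. G w * (x i w * (W (min t (p (Suc i))) w - W (min t (p i)) w)
       - x i w * (W (min (min t a) (p (Suc i))) w - W (min (min t a) (p i)) w)))"
  proof -
   have "J r w = (\<Sum>i<n. x i w * (W (min r (p (Suc i))) w - W (min r (p i)) w))" for r
    using np(3) unfolding elementary_on_def step_sum_def by simp
   then show ?thesis by (simp only: sum_subtractf[symmetric] sum_distrib_left)
  qed
  also have "... = step_sum n p (%i. y i w) (%u. W (min t u) w)" unfolding step_sum_def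
  proof (rule sum.cong[OF refl])
   fix i assume "i \<in> {..<n}"
   then have "i < n" by simp
   from dich[OF this] show "G w * (x i w * (W (min t (p (Suc i))) w - W (min t (p i)) w)
       - x i w * (W (min (min t a) (p (Suc i))) w - W (min (min t a) (p i)) w))
     = y i w * (W (min t (p (Suc i))) w - W (min t (p i)) w)"
   proof (elim disjE conjE)
    assume "a \<le> p i" "a \<le> p (Suc i)"
    then have "min (min t a) (p (Suc i)) = min t a" "min (min t a) (p i) = min t a" by auto
    then show ?thesis using \<open>a \<le> p i\<close> by (simp add: y_def)
   next
    assume "\<not> a \<le> p i" "p i \<le> a" "p (Suc i) \<le> a"
    then have "min (min t a) (p (Suc i)) = min t (p (Suc i))" "min (min t a) (p i) = min t (p i)" by auto
    then show ?thesis using \<open>\<not> a \<le> p i\<close> by (simp add: y_def)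
   qed
  qed
  finally show ?thesis .
 qed
 have "elementary_on F W P n p y (%s w. if a < s then G w * h s w else 0) (%t w. G w * (J t w - J (min t a) w))"
  unfolding elementary_on_def using ym h J by simp
 then show ?thesis using np unfolding elementary_def by blast
qed

lemma elementary_stop:
 assumes e: "elementary F T W P h J" and a: "a \<in> {0..T}" and P0: "P (%_. 0)"
  and P: "\<And>n p i f g. P f ==> P g ==> f \<in> borel_measurable M ==> g \<in> borel_measurable M ==> P (%w. f w - g w)"
 shows "elementary F T W P (%s w. if s \<le> a then h s w else 0) (%t w. J (min t a) w)"
proof -
 have "elementary F T W P (%s w. if a < s then 1 * h s w else 0) (%t w. 1 * (J t w - J (min t a) w))"
  by (rule elementary_restart[OF e a _ P0]) auto
 from elementary_diff[OF e this P]
 have "elementary F T W P (%s w. h s w - (if a < s then 1 * h s w else 0)) (%t w. J t w - 1 * (J t w - J (min t a) w))" .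
 moreover have "(%s w. h s w - (if a < s then 1 * h s w else 0)) = (%s w. if s \<le> a then h s w else 0)"
  by (auto simp: fun_eq_iff)
 ultimately show ?thesis by simp
qed

end

section \<open>The Ito isometry and Kolmogorov's inequality\<close>

text \<open>
 At any time at most one summand of a simple process is active; hence \<open>\<phi> 0 = 0\<close> is all that is needed
 to apply \<open>\<phi>\<close> to the coefficients instead of the process.
\<close>

lemma map_elementary_on:
 assumes g: "grid T n p" and e: "elementary_on F W P n p \<xi> h J" and \<phi>: "\<phi> 0 = 0"
 shows "\<phi> (h s w) = simple_process n p (%i w. \<phi> (\<xi> i w)) s w"
proof -
 have e': "elementary_on (%_. count_space UNIV) W (%_. True) n p (%i w. \<phi> (\<xi> i w))
   (simple_process n p (%i w. \<phi> (\<xi> i w))) (simple_ito W n p (%i w. \<phi> (\<xi> i w)))"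
  by (rule elementary_on_simple[OF g]) auto
 show ?thesis
 proof (cases "0 < s \<and> s \<le> T")
  case True
  then obtain i where i: "i < n" "p i < s" "s \<le> p (Suc i)" using grid_locate_left[OF g] by blast
  show ?thesis using elementary_on_value[OF g e i] elementary_on_value[OF g e' i] by simp
 next
  case False
  then show ?thesis using elementary_on_outside[OF g e, of s] elementary_on_outside[OF g e', of s] \<phi> by auto
 qed
qed

lemma nn_integral_simple_process:
 assumes g: "grid T n p" and x: "\<And>i. i < n ==> 0 \<le> x i w"
 shows "(TI {0..T} (%s. ennreal (simple_process n p x s w))) = ennreal (\<Sum>i<n. x i w * (p (Suc i) - p i))"
proof -
 have sub: "{p i<..p (Suc i)} \<subseteq> {0..T}" if "i < n" for i
  using grid_in[OF g, of i] grid_in[OF g, of "Suc i"] that by auto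
 have "(TI {0..T} (%s. ennreal (simple_process n p x s w)))
   = (\<integral>\<^sup>+s. (\<Sum>i<n. ennreal (x i w) * indicator {p i<..p (Suc i)} s) \<partial>lborel)"
 proof (rule nn_integral_cong)
  fix s :: real
  have "ennreal (simple_process n p x s w) = (\<Sum>i<n. ennreal (x i w * indicator {p i<..p (Suc i)} s))"
   unfolding simple_process_def using x by (intro sum_ennreal[symmetric]) auto
  also have "... = (\<Sum>i<n. ennreal (x i w) * indicator {p i<..p (Suc i)} s)"
   by (intro sum.cong refl) (auto simp: indicator_def)
  finally have *: "ennreal (simple_process n p x s w) = (\<Sum>i<n. ennreal (x i w) * indicator {p i<..p (Suc i)} s)" .
  show "ennreal (simple_process n p x s w) * indicator {0..T} s = (\<Sum>i<n. ennreal (x i w) * indicator {p i<..p (Suc i)} s)"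
  proof (cases "s \<in> {0..T}")
   case False
   then have "(\<Sum>i<n. ennreal (x i w) * indicator {p i<..p (Suc i)} s) = 0"
   proof (intro sum.neutral ballI)
    fix i assume "i \<in> {..<n}"
    then have "s \<notin> {p i<..p (Suc i)}" using sub[of i] False by blast
    then show "ennreal (x i w) * indicator {p i<..p (Suc i)} s = 0" by simp
   qed
   then show ?thesis using False by simp
  qed (simp add: *)
 qed
 also have "... = (\<Sum>i<n. \<integral>\<^sup>+s. ennreal (x i w) * indicator {p i<..p (Suc i)} s \<partial>lborel)"
  by (rule nn_integral_sum) simp
 also have "... = (\<Sum>i<n. ennreal (x i w * (p (Suc i) - p i)))"
 proof (rule sum.cong[OF refl])
  fix i assume "i \<in> {..<n}"
  then have i: "i < n" "p i \<le> p (Suc i)" using grid_mono[OF g, of i "Suc i"] by auto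
  show "(\<integral>\<^sup>+s. ennreal (x i w) * indicator {p i<..p (Suc i)} s \<partial>lborel) = ennreal (x i w * (p (Suc i) - p i))"
   using i x[OF i(1)] by (simp add: nn_integral_cmult_indicator ennreal_mult)
 qed
 also have "... = ennreal (\<Sum>i<n. x i w * (p (Suc i) - p i))"
  using x grid_mono[OF g] by (intro sum_ennreal) (auto intro!: mult_nonneg_nonneg)
 finally show ?thesis .
qed

lemma elementary_on_energy:
 assumes g: "grid T n p" and e: "elementary_on F W P n p \<xi> h J"
 shows "(TI {0..T} (%s. ennreal ((h s w)^2))) = ennreal (\<Sum>i<n. (\<xi> i w)^2 * (p (Suc i) - p i))"
proof -
 have "(h s w)^2 = simple_process n p (%i w. (\<xi> i w)^2) s w" for s
  using map_elementary_on[OF g e, of "%x. x^2"] by simp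
 then show ?thesis using nn_integral_simple_process[OF g, of "%i w. (\<xi> i w)^2" w] by simp
qed

lemma elementary_on_integral_at_grid:
 assumes g: "grid T n p" and e: "elementary_on F W P n p \<xi> h J" and k: "k \<le> n"
 shows "J (p k) w = (\<Sum>i<k. \<xi> i w * (W (p (Suc i)) w - W (p i) w))"
proof -
 have "J (p k) w = (\<Sum>i<n. \<xi> i w * (W (min (p k) (p (Suc i))) w - W (min (p k) (p i)) w))"
  using e unfolding elementary_on_def step_sum_def by simp
 also have "... = (\<Sum>i<k. \<xi> i w * (W (min (p k) (p (Suc i))) w - W (min (p k) (p i)) w))"
 proof (rule sum.mono_neutral_right)
  show "\<forall>i\<in>{..<n} - {..<k}. \<xi> i w * (W (min (p k) (p (Suc i))) w - W (min (p k) (p i)) w) = 0"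
  proof
   fix i assume i: "i \<in> {..<n} - {..<k}"
   then have "p k \<le> p i" "p k \<le> p (Suc i)" by (auto intro!: grid_mono[OF g])
   then show "\<xi> i w * (W (min (p k) (p (Suc i))) w - W (min (p k) (p i)) w) = 0" by (simp add: min_absorb1)
  qed
 qed (use k in auto)
 also have "... = (\<Sum>i<k. \<xi> i w * (W (p (Suc i)) w - W (p i) w))"
 proof (rule sum.cong[OF refl])
  fix i assume "i \<in> {..<k}"
  then have "p i \<le> p k" "p (Suc i) \<le> p k" using k by (auto intro!: grid_mono[OF g])
  then show "\<xi> i w * (W (min (p k) (p (Suc i))) w - W (min (p k) (p i)) w) = \<xi> i w * (W (p (Suc i)) w - W (p i) w)"
   by (simp add: min_absorb2)
 qed
 finally show ?thesis .
qed

lemma continuous_on_le_of_dyadic: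
 fixes f :: "real => real"
 assumes T: "0 < T" and f: "continuous_on {0..T} f"
  and le: "\<And>k i. i \<le> 2 ^ k ==> f (T * real i / 2 ^ k) \<le> c" and t: "t \<in> {0..T}"
 shows "f t \<le> c"
proof -
 define i where "i k = nat \<lfloor>t * 2 ^ k / T\<rfloor>" for k :: nat
 define r where "r k = T * real (i k) / 2 ^ k" for k :: nat
 have pos: "0 \<le> t * 2 ^ k / T" for k :: nat using t T by simp
 have ri: "real (i k) = of_int \<lfloor>t * 2 ^ k / T\<rfloor>" for k using pos[of k] by (simp add: i_def)
 have up: "real (i k) \<le> t * 2 ^ k / T" and lo: "t * 2 ^ k / T < real (i k) + 1" for k
  unfolding ri by linarith+
 have rt: "r k \<le> t" for k
 proof -
  have "real (i k) * T \<le> t * 2 ^ k" using up[of k] T by (simp add: pos_le_divide_eq)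
  then show ?thesis unfolding r_def by (simp add: pos_divide_le_eq mult.commute)
 qed
 have tr: "t - T / 2 ^ k \<le> r k" for k
 proof -
  have "t * 2 ^ k < (real (i k) + 1) * T" using lo[of k] T by (simp add: pos_divide_less_eq)
  then have "t < (T * real (i k) + T) / 2 ^ k" by (simp add: pos_less_divide_eq algebra_simps)
  then show ?thesis unfolding r_def by (simp add: add_divide_distrib)
 qed
 have r0: "0 \<le> r k" for k unfolding r_def using T by simp
 have "(%k. t - T * (1/2) ^ k) \<longlonglongrightarrow> t - T * 0"
  by (intro tendsto_diff tendsto_mult tendsto_const LIMSEQ_power_zero) simp
 then have lim: "(%k. t - T / 2 ^ k) \<longlonglongrightarrow> t" by (simp add: power_one_over field_simps)
 have "r \<longlonglongrightarrow> t" by (rule tendsto_sandwich[OF _ _ lim tendsto_const]) (auto simp: rt tr)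
 then have "(%k. f (r k)) \<longlonglongrightarrow> f t"
  using f t r0 rt by (intro continuous_on_tendsto_compose[OF f]) (auto intro!: always_eventually order_trans[OF rt])
 moreover have "f (r k) \<le> c" for k
 proof -
  have "real (i k) * T \<le> T * 2 ^ k"
   using rt[of k] t unfolding r_def by (simp add: pos_divide_le_eq) (metis mult.commute mult_right_mono order_trans zero_le_numeral zero_le_power)
  then have "real (i k) \<le> 2 ^ k" using T by simp
  then have "i k \<le> 2 ^ k" by (metis numeral_power_le_of_nat_cancel_iff of_nat_le_iff of_nat_numeral of_nat_power)
  then show ?thesis unfolding r_def by (rule le)
 qed
 ultimately show ?thesis by (intro LIMSEQ_le_const2) auto
qed

context brownian_filtration
begin

abbreviation square_integrable :: "('a => real) => bool" where
 "square_integrable \<xi> \<equiv> integrable M (%w. (\<xi> w)^2)"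

abbreviation uniformly_bounded :: "('a => real) => bool" where
 "uniformly_bounded \<xi> \<equiv> \<exists>B. \<forall>w\<in>space M. \<bar>\<xi> w\<bar> \<le> B"

lemma square_integrable_product:
 assumes [measurable]: "f \<in> borel_measurable M" "g \<in> borel_measurable M" and "square_integrable f" "square_integrable g"
 shows "integrable M (%w. f w * g w)"
proof (rule Bochner_Integration.integrable_bound)
 show "integrable M (%w. (f w)^2 + (g w)^2)" using assms by simp
 have "\<bar>f w * g w\<bar> \<le> (f w)^2 + (g w)^2" for w
 proof -
  have "2 * (\<bar>f w\<bar> * \<bar>g w\<bar>) \<le> (f w)^2 + (g w)^2"
   using sum_squares_bound[of "\<bar>f w\<bar>" "\<bar>g w\<bar>"] by simp
  moreover have "0 \<le> \<bar>f w\<bar> * \<bar>g w\<bar>" by simp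
  ultimately show ?thesis unfolding abs_mult by linarith
 qed
 then show "AE w in M. norm (f w * g w) \<le> norm ((f w)^2 + (g w)^2)" by simp
qed simp

lemma square_integrable_diff:
 assumes "square_integrable f" "square_integrable g" and m: "f \<in> borel_measurable M" "g \<in> borel_measurable M"
 shows "square_integrable (%w. f w - g w)"
 using assms square_integrable_product[OF m] by (simp add: power2_diff mult.assoc)

lemma square_integrable_add:
 assumes "square_integrable f" "square_integrable g" and m: "f \<in> borel_measurable M" "g \<in> borel_measurable M"
 shows "square_integrable (%w. f w + g w)"
 using assms square_integrable_product[OF m] by (simp add: power2_sum mult.assoc)

lemma uniformly_bounded_diff:
 assumes "uniformly_bounded f" "uniformly_bounded g"
 shows "uniformly_bounded (%w. f w - g w)"
proof -
 obtain A B where "\<forall>w\<in>space M. \<bar>f w\<bar> \<le> A" "\<forall>w\<in>space M. \<bar>g w\<bar> \<le> B" using assms by blast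
 then have "\<forall>w\<in>space M. \<bar>f w - g w\<bar> \<le> A + B" by (meson abs_triangle_ineq4 add_mono order_trans)
 then show ?thesis by blast
qed

lemma uniformly_bounded_mult:
 assumes "uniformly_bounded f" "uniformly_bounded g"
 shows "uniformly_bounded (%w. f w * g w)"
proof -
 obtain A B where "\<forall>w\<in>space M. \<bar>f w\<bar> \<le> A" "\<forall>w\<in>space M. \<bar>g w\<bar> \<le> B" using assms by blast
 then have "\<forall>w\<in>space M. \<bar>f w * g w\<bar> \<le> A * B" unfolding abs_mult by (meson abs_ge_zero mult_mono order_trans)
 then show ?thesis by blast
qed

lemma uniformly_bounded_square_integrable:
 assumes "uniformly_bounded f" and [measurable]: "f \<in> borel_measurable M"
 shows "square_integrable f"
proof -
 obtain B where B: "\<And>w. w \<in> space M ==> \<bar>f w\<bar> \<le> B" using assms(1) by blast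
 show ?thesis
 proof (rule integrable_const_bound[where B="B^2"])
  show "AE w in M. norm ((f w)^2) \<le> B^2"
  proof (rule AE_I2)
   fix w assume "w \<in> space M"
   then have "\<bar>f w\<bar> \<le> \<bar>B\<bar>" using B[of w] by linarith
   then have "(f w)^2 \<le> B^2" unfolding abs_le_square_iff .
   then show "norm ((f w)^2) \<le> B^2" by simp
  qed
 qed simp
qed

lemma F_measurable_M: "t \<in> {0..T} ==> f \<in> borel_measurable (F t) ==> f \<in> borel_measurable M"
 using measurable_from_subalg[OF F_sub] by blast

lemma F_measurable_mono: "0 \<le> s ==> s \<le> t ==> t \<le> T ==> f \<in> borel_measurable (F s) ==> f \<in> borel_measurable (F t)"
 using measurable_from_subalg[OF F_mono] by blast

lemma W_measurable: "t \<in> {0..T} ==> W t \<in> borel_measurable M"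
 using F_measurable_M W_adapted by blast

lemma elementary_bounded_imp_square:
 "elementary F T W uniformly_bounded h J ==> elementary F T W square_integrable h J"
proof (erule elementary_mono)
 fix \<xi> :: "'a => real" and n p i
 assume "uniformly_bounded \<xi>" and "grid T n p" "i < n" "\<xi> \<in> borel_measurable (F (p i))"
 moreover from this have "\<xi> \<in> borel_measurable M" using grid_in[of T n p i] by (intro F_measurable_M) auto
 ultimately show "square_integrable \<xi>" by (intro uniformly_bounded_square_integrable)
qed

lemma increment_moments:
 assumes st: "0 \<le> s" "s < t" "t \<le> T"
 shows "integrable M (%w. W t w - W s w)" "expectation (%w. W t w - W s w) = 0"
  "square_integrable (%w. W t w - W s w)" "expectation (%w. (W t w - W s w)^2) = t - s"
  "expectation (%w. \<bar>W t w - W s w\<bar>) = sqrt (2 / pi) * sqrt (t - s)"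
proof -
 have pos: "0 < sqrt (t - s)" using st by simp
 note D = W_normal[OF st]
 have nn: "0 \<le> normal_density 0 (sqrt (t - s)) x" for x by simp
 have 1: "integrable lborel (%x. normal_density 0 (sqrt (t - s)) x * x)"
  using integrable_normal_moment_nz_1[OF pos] .
 show "integrable M (%w. W t w - W s w)"
  using distributed_integrable[OF D, of "%x. x"] 1 by simp
 show E: "expectation (%w. W t w - W s w) = 0" by (rule normal_distributed_expectation[OF pos D])
 show "square_integrable (%w. W t w - W s w)"
  using distributed_integrable[OF D, of "%x. x^2"] integrable_normal_moment[OF pos, of 0 2] by simp
 show "expectation (%w. (W t w - W s w)^2) = t - s"
  using normal_distributed_variance[OF pos D] E st by simp
 show "expectation (%w. \<bar>W t w - W s w\<bar>) = sqrt (2 / pi) * sqrt (t - s)"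
  using distributed_integral[OF D, of "%x. \<bar>x\<bar>"] integral_normal_moment_abs_odd[OF pos, of 0 0] by simp
qed

lemma increment_indep:
 assumes st: "0 \<le> s" "s < t" "t \<le> T" and G: "G \<in> borel_measurable (F s)"
 shows "indep_var borel G borel (%w. W t w - W s w)"
 unfolding indep_var_eq
proof (intro conjI)
 have s: "s \<in> {0..T}" "t \<in> {0..T}" using st by auto
 show "random_variable borel G" using F_measurable_M[OF s(1) G] .
 show "random_variable borel (%w. W t w - W s w)"
  using W_measurable[OF s(1)] W_measurable[OF s(2)] by simp
 have sp: "space (F s) = space M" using F_sub[OF s(1)] by (simp add: subalgebra_def)
 have "sigma_sets (space M) {G -` A \<inter> space M |A. A \<in> sets borel} \<subseteq> sets (F s)"
  using sets.sigma_sets_subset[of "{G -` A \<inter> space M |A. A \<in> sets borel}" "F s"] measurable_sets[OF G] sp by auto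
 then show "indep_set (sigma_sets (space M) {G -` A \<inter> space M |A. A \<in> sets borel})
   (sigma_sets (space M) {(%w. W t w - W s w) -` A \<inter> space M |A. A \<in> sets borel})"
  using W_indep[OF st] unfolding indep_sets2_eq sets_vimage_algebra by blast
qed

text \<open>
 One step of the isometry: the cross term vanishes because the increment is centred and independent
 of everything known at time \<open>s\<close>.
\<close>

lemma isometry_step:
 assumes st: "0 \<le> s" "s < t" "t \<le> T" and m: "N \<in> borel_measurable (F s)" "\<xi> \<in> borel_measurable (F s)"
  and sq: "square_integrable N" "square_integrable \<xi>"
 shows "square_integrable (%w. N w + \<xi> w * (W t w - W s w))"
  "expectation (%w. (N w + \<xi> w * (W t w - W s w))^2) = expectation (%w. (N w)^2) + expectation (%w. (\<xi> w)^2) * (t - s)"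
proof -
 let ?D = "%w. W t w - W s w"
 note D = increment_moments[OF st]
 have s: "s \<in> {0..T}" using st by auto
 note mM = F_measurable_M[OF s m(1)] F_measurable_M[OF s m(2)]
 have prod: "integrable M (%w. N w * \<xi> w)" by (rule square_integrable_product[OF mM sq])
 have i1: "indep_var borel (%w. N w * \<xi> w) borel ?D" using m by (intro increment_indep[OF st]) simp
 have "indep_var borel ((%x. x^2) \<circ> \<xi>) borel ((%x. x^2) \<circ> ?D)"
  by (rule indep_var_compose[OF increment_indep[OF st m(2)]]) auto
 then have i2: "indep_var borel (%w. (\<xi> w)^2) borel (%w. (?D w)^2)" by (simp add: comp_def)
 note c = indep_var_integrable[OF i1 prod D(1)] indep_var_integrable[OF i2 sq(2) D(3)]
 have eq: "(N w + \<xi> w * ?D w)^2 = (N w)^2 + 2 * (N w * \<xi> w * ?D w) + (\<xi> w)^2 * (?D w)^2" for w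
 proof -
  have "(a + x * d)^2 = a^2 + 2 * (a * x * d) + x^2 * d^2" for a x d :: real
   by (simp add: power2_sum power_mult_distrib)
  then show ?thesis .
 qed
 show "square_integrable (%w. N w + \<xi> w * ?D w)" unfolding eq using sq c by simp
 show "expectation (%w. (N w + \<xi> w * (W t w - W s w))^2) = expectation (%w. (N w)^2) + expectation (%w. (\<xi> w)^2) * (t - s)"
  unfolding eq using sq c indep_var_lebesgue_integral[OF i1 prod D(1)] indep_var_lebesgue_integral[OF i2 sq(2) D(3)] D(2,4)
  by simp
qed

lemma elementary_on_partial_isometry:
 assumes g: "grid T n p" and e: "elementary_on F W square_integrable n p \<xi> h J" and k: "k \<le> n"
 shows "J (p k) \<in> borel_measurable (F (p k)) \<and> square_integrable (J (p k)) \<and>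
  expectation (%w. (J (p k) w)^2) = (\<Sum>i<k. expectation (%w. (\<xi> i w)^2) * (p (Suc i) - p i))"
 using k
proof (induction k)
 case 0
 have "J (p 0) = (%_. 0)" using elementary_on_integral_at_grid[OF g e, of 0] by (simp add: fun_eq_iff)
 then show ?case by simp
next
 case (Suc k)
 have k: "k < n" using Suc.prems by simp
 have IH: "J (p k) \<in> borel_measurable (F (p k))" "square_integrable (J (p k))"
  "expectation (%w. (J (p k) w)^2) = (\<Sum>i<k. expectation (%w. (\<xi> i w)^2) * (p (Suc i) - p i))"
  using Suc by auto
 have x: "\<xi> k \<in> borel_measurable (F (p k))" "square_integrable (\<xi> k)" using e k unfolding elementary_on_def by auto
 have J: "J (p (Suc k)) = (%w. J (p k) w + \<xi> k w * (W (p (Suc k)) w - W (p k) w))"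
  using elementary_on_integral_at_grid[OF g e, of "Suc k"] elementary_on_integral_at_grid[OF g e, of k] k
  by (simp add: fun_eq_iff)
 have pk: "0 \<le> p k" "p k < p (Suc k)" "p (Suc k) \<le> T"
  using grid_in[OF g, of k] grid_in[OF g, of "Suc k"] grid_strict[OF g, of k "Suc k"] k by auto
 have "J (p (Suc k)) \<in> borel_measurable (F (p (Suc k)))"
 proof -
  have "J (p k) \<in> borel_measurable (F (p (Suc k)))" "\<xi> k \<in> borel_measurable (F (p (Suc k)))"
   "W (p k) \<in> borel_measurable (F (p (Suc k)))" "W (p (Suc k)) \<in> borel_measurable (F (p (Suc k)))"
   using F_measurable_mono[of "p k" "p (Suc k)"] pk IH(1) x(1) W_adapted[of "p k"] W_adapted[of "p (Suc k)"] by auto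
  then show ?thesis unfolding J by simp
 qed
 then show ?case using isometry_step[OF pk IH(1) x(1) IH(2) x(2)] IH(3) unfolding J by simp
qed

lemma ito_isometry:
 assumes e: "elementary F T W square_integrable h J"
 shows "(EE w. ennreal ((J T w)^2)) = (EE w. (TI {0..T} (%s. ennreal ((h s w)^2))))"
  "square_integrable (J T)"
proof -
 obtain n p \<xi> where g: "grid T n p" and on: "elementary_on F W square_integrable n p \<xi> h J"
  using e unfolding elementary_def by blast
 have pn: "p n = T" using g unfolding grid_def by simp
 note iso = elementary_on_partial_isometry[OF g on order_refl, unfolded pn]
 show sq: "square_integrable (J T)" using iso by simp
 have sqx: "square_integrable (\<xi> i)" if "i < n" for i using on that unfolding elementary_on_def by auto
 have "(EE w. ennreal ((J T w)^2)) = ennreal (\<Sum>i<n. expectation (%w. (\<xi> i w)^2) * (p (Suc i) - p i))"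
  using iso by (subst nn_integral_eq_integral) auto
 also have "(\<Sum>i<n. expectation (%w. (\<xi> i w)^2) * (p (Suc i) - p i))
   = expectation (%w. \<Sum>i<n. (\<xi> i w)^2 * (p (Suc i) - p i))"
  using sqx by (subst Bochner_Integration.integral_sum) auto
 also have "ennreal ... = (EE w. ennreal (\<Sum>i<n. (\<xi> i w)^2 * (p (Suc i) - p i)))"
  using sqx grid_mono[OF g] by (intro nn_integral_eq_integral[symmetric]) (auto intro!: AE_I2 sum_nonneg)
 finally show "(EE w. ennreal ((J T w)^2)) = (EE w. (TI {0..T} (%s. ennreal ((h s w)^2))))"
  by (simp add: elementary_on_energy[OF g on])
qed

lemma elementary_adapted:
 assumes e: "elementary F T W P h J" and t: "t \<in> {0..T}"
 shows "J t \<in> borel_measurable (F t)"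
proof -
 obtain n p \<xi> where g: "grid T n p" and on: "elementary_on F W P n p \<xi> h J"
  using e unfolding elementary_def by blast
 have "(%w. \<xi> i w * (W (min t (p (Suc i))) w - W (min t (p i)) w)) \<in> borel_measurable (F t)" if i: "i < n" for i
 proof (cases "p i \<le> t")
  case True
  have pi: "p i \<in> {0..T}" "p (Suc i) \<in> {0..T}" using grid_in[OF g, of i] grid_in[OF g, of "Suc i"] i by auto
  have "\<xi> i \<in> borel_measurable (F t)"
  proof (rule F_measurable_mono[of "p i"])
   show "\<xi> i \<in> borel_measurable (F (p i))" using on i unfolding elementary_on_def by blast
  qed (use pi(1) t True in auto)
  moreover have "W (min t u) \<in> borel_measurable (F t)" if "u \<in> {0..T}" for u
   using that t by (intro F_measurable_mono[of "min t u" t] W_adapted) auto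
  ultimately show ?thesis using pi by simp
 next
  case False
  then have "min t (p (Suc i)) = t" "min t (p i) = t" using grid_mono[OF g, of i "Suc i"] i by auto
  then show ?thesis by simp
 qed
 then have "(%w. \<Sum>i<n. \<xi> i w * (W (min t (p (Suc i))) w - W (min t (p i)) w)) \<in> borel_measurable (F t)"
  by (intro borel_measurable_sum) auto
 moreover have "J t = (%w. \<Sum>i<n. \<xi> i w * (W (min t (p (Suc i))) w - W (min t (p i)) w))"
  using on unfolding elementary_on_def step_sum_def by (simp add: fun_eq_iff)
 ultimately show ?thesis by simp
qed

lemma elementary_measurable:
 assumes e: "elementary F T W P h J"
 shows "(%(w, s). h s w) \<in> borel_measurable (M \<Otimes>\<^sub>M lborel)"
proof -
 obtain n p \<xi> where g: "grid T n p" and on: "elementary_on F W P n p \<xi> h J"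
  using e unfolding elementary_def by blast
 have x: "\<xi> i \<in> borel_measurable M" if "i < n" for i by (rule elementary_on_coeff_measurable[OF g on that])
 have "(%z. \<Sum>i<n. \<xi> i (fst z) * ((if snd z \<le> p (Suc i) then 1 else 0) - (if snd z \<le> p i then 1 else 0))) \<in> borel_measurable (M \<Otimes>\<^sub>M lborel)"
 proof (rule borel_measurable_sum)
  fix i assume "i \<in> {..<n}"
  then have [measurable]: "\<xi> i \<in> borel_measurable M" using x by simp
  show "(%z. \<xi> i (fst z) * ((if snd z \<le> p (Suc i) then 1 else 0) - (if snd z \<le> p i then 1 else 0))) \<in> borel_measurable (M \<Otimes>\<^sub>M lborel)"
   by measurable
 qed
 moreover have "(%(w, s). h s w) = (%z. \<Sum>i<n. \<xi> i (fst z) * ((if snd z \<le> p (Suc i) then 1 else 0) - (if snd z \<le> p i then 1 else 0)))"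
  using on unfolding elementary_on_def step_sum_def by (simp add: fun_eq_iff)
 ultimately show ?thesis by simp
qed

lemma elementary_continuous:
 assumes e: "elementary F T W P h J" and c: "continuous_on {0..T} (%t. W t w)"
 shows "continuous_on {0..T} (%t. J t w)"
proof -
 obtain n p \<xi> where g: "grid T n p" and on: "elementary_on F W P n p \<xi> h J"
  using e unfolding elementary_def by blast
 have W: "continuous_on {0..T} (%t. W (min t u) w)" if "u \<in> {0..T}" for u
  using that by (intro continuous_on_compose2[OF c]) (auto intro!: continuous_intros)
 have "continuous_on {0..T} (%t. \<Sum>i<n. \<xi> i w * (W (min t (p (Suc i))) w - W (min t (p i)) w))"
  using grid_in[OF g] by (intro continuous_on_sum continuous_on_mult continuous_on_const continuous_on_diff W) auto
 then show ?thesis using on unfolding elementary_on_def step_sum_def by simp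
qed

text \<open>
 Kolmogorov's inequality. Switching the coefficients off as soon as the integral has left
 \<open>[-\<epsilon>, \<epsilon>]\<close> at a grid point keeps them adapted and freezes the integral at its first exit value, so
 the isometry for the switched process gives the maximal inequality.
\<close>

lemma kolmogorov_finite:
 assumes e: "elementary F T W square_integrable h J" and \<epsilon>: "0 < \<epsilon>" and S: "finite S" "S \<subseteq> {0..T}"
 shows "{w\<in>space M. \<exists>r\<in>S. \<epsilon> < \<bar>J r w\<bar>} \<in> events"
  "ennreal (\<epsilon>^2) * emeasure M {w\<in>space M. \<exists>r\<in>S. \<epsilon> < \<bar>J r w\<bar>}
   \<le> (EE w. (TI {0..T} (%s. ennreal ((h s w)^2))))"
proof -
 let ?A = "{w\<in>space M. \<exists>r\<in>S. \<epsilon> < \<bar>J r w\<bar>}"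
 have JM: "J r \<in> borel_measurable M" if "r \<in> {0..T}" for r
  using F_measurable_M elementary_adapted[OF e] that by blast
 show A: "?A \<in> events"
 proof (rule sets.sets_Collect_finite_Ex)
  fix r assume "r \<in> S"
  then have [measurable]: "J r \<in> borel_measurable M" using JM S by blast
  show "{w\<in>space M. \<epsilon> < \<bar>J r w\<bar>} \<in> events" by measurable
 qed (fact S)
 obtain n p \<xi> where np: "grid T n p" "S \<subseteq> p ` {..n}" "elementary_on F W square_integrable n p \<xi> h J"
  using elementary_common_grid[OF e e S] by blast
 note g = np(1)
 define ok where "ok i w \<longleftrightarrow> (\<forall>j\<le>i. \<bar>J (p j) w\<bar> \<le> \<epsilon>)" for i w
 define y where "y i w = (if ok i w then \<xi> i w else 0)" for i w
 have x: "\<xi> i \<in> borel_measurable (F (p i))" "square_integrable (\<xi> i)" if "i < n" for i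
  using np(3) that unfolding elementary_on_def by auto
 have ym: "y i \<in> borel_measurable (F (p i))" if i: "i < n" for i
 proof -
  have [measurable]: "J (p j) \<in> borel_measurable (F (p i))" if "j \<le> i" for j
   using that i grid_in[OF g, of j] grid_in[OF g, of i] grid_mono[OF g, of j i]
   by (intro F_measurable_mono[of "p j" "p i"] elementary_adapted[OF e]) auto
  have "{w\<in>space (F (p i)). \<forall>j\<in>{..i}. \<bar>J (p j) w\<bar> \<le> \<epsilon>} \<in> sets (F (p i))"
  proof (rule sets.sets_Collect_finite_All)
   fix j assume "j \<in> {..i}"
   then have [measurable]: "J (p j) \<in> borel_measurable (F (p i))" using that i grid_in[OF g, of j] grid_in[OF g, of i] grid_mono[OF g, of j i]
    by (intro F_measurable_mono[of "p j" "p i"] elementary_adapted[OF e]) auto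
   show "{w\<in>space (F (p i)). \<bar>J (p j) w\<bar> \<le> \<epsilon>} \<in> sets (F (p i))" by measurable
  qed simp
  then have "{w\<in>space (F (p i)). ok i w} \<in> sets (F (p i))" unfolding ok_def by (simp add: Ball_def)
  then show ?thesis unfolding y_def using x[OF i] by (intro measurable_If) auto
 qed
 have ysq: "square_integrable (y i)" if i: "i < n" for i
 proof (rule Bochner_Integration.integrable_bound[OF x(2)[OF i]])
  have [measurable]: "y i \<in> borel_measurable M"
   using F_measurable_M[of "p i"] ym[OF i] grid_in[OF g, of i] i by auto
  show "(%w. (y i w)^2) \<in> borel_measurable M" by measurable
  show "AE w in M. norm ((y i w)^2) \<le> norm ((\<xi> i w)^2)" by (simp add: y_def)
 qed
 let ?h = "simple_process n p y" and ?J = "simple_ito W n p y"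
 have on': "elementary_on F W square_integrable n p y ?h ?J"
  by (rule elementary_on_simple[OF g]) (auto simp: ym ysq)
 then have e': "elementary F T W square_integrable ?h ?J" using g unfolding elementary_def by blast
 have pn: "p n = T" using g unfolding grid_def by simp
 have big: "\<epsilon>^2 \<le> (?J T w)^2" if w: "w \<in> ?A" for w
 proof -
  obtain j where j: "j \<le> n" "\<epsilon> < \<bar>J (p j) w\<bar>" using w np(2) by blast
  define k where "k = (LEAST j. \<epsilon> < \<bar>J (p j) w\<bar>)"
  have k: "\<epsilon> < \<bar>J (p k) w\<bar>" unfolding k_def using j(2) by (rule LeastI)
  have kn: "k \<le> n" unfolding k_def using Least_le[of "%j. \<epsilon> < \<bar>J (p j) w\<bar>" j] j by simp
  have min: "\<bar>J (p i) w\<bar> \<le> \<epsilon>" if "i < k" for i using not_less_Least[of i "%j. \<epsilon> < \<bar>J (p j) w\<bar>"] that unfolding k_def by simp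
  have okk: "ok i w \<longleftrightarrow> i < k" for i
   unfolding ok_def using k min by (meson leD le_less_linear le_less_trans)
  have "?J T w = (\<Sum>i<n. y i w * (W (p (Suc i)) w - W (p i) w))"
   using elementary_on_integral_at_grid[OF g on' order_refl] pn by simp
  also have "... = (\<Sum>i<k. y i w * (W (p (Suc i)) w - W (p i) w))"
   using kn by (intro sum.mono_neutral_right) (auto simp: y_def okk)
  also have "... = (\<Sum>i<k. \<xi> i w * (W (p (Suc i)) w - W (p i) w))"
   by (intro sum.cong) (auto simp: y_def okk)
  also have "... = J (p k) w" using elementary_on_integral_at_grid[OF g np(3) kn] by simp
  finally have "\<epsilon> \<le> \<bar>?J T w\<bar>" using k by simp
  then have "\<epsilon>^2 \<le> \<bar>?J T w\<bar>^2" using \<epsilon> by (intro power_mono) auto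
  then show ?thesis by simp
 qed
 have "ennreal (\<epsilon>^2) * emeasure M ?A = (EE w. ennreal (\<epsilon>^2) * indicator ?A w)"
  using A by (simp add: nn_integral_cmult_indicator)
 also have "... \<le> (EE w. ennreal ((?J T w)^2))"
 proof (rule nn_integral_mono)
  fix w show "ennreal (\<epsilon>^2) * indicator ?A w \<le> ennreal ((?J T w)^2)"
   using big[of w] by (cases "w \<in> ?A") (simp_all add: ennreal_leI)
 qed
 also have "... = (EE w. (TI {0..T} (%s. ennreal ((?h s w)^2))))"
  by (rule ito_isometry(1)[OF e'])
 also have "... \<le> (EE w. (TI {0..T} (%s. ennreal ((h s w)^2))))"
  unfolding elementary_on_energy[OF g on'] elementary_on_energy[OF g np(3)]
  using grid_mono[OF g] by (intro nn_integral_mono ennreal_leI sum_mono mult_right_mono) (auto simp: y_def)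
 finally show "ennreal (\<epsilon>^2) * emeasure M ?A \<le> (EE w. (TI {0..T} (%s. ennreal ((h s w)^2))))" .
qed

text \<open>Path continuity reduces the supremum to the dyadic times, an increasing union of finite sets.\<close>

lemma kolmogorov_sup:
 assumes e: "elementary F T W square_integrable h J" and \<epsilon>: "0 < \<epsilon>"
 shows "\<exists>A\<in>events. ennreal (\<epsilon>^2) * emeasure M A \<le> (EE w. (TI {0..T} (%s. ennreal ((h s w)^2))))
   \<and> (\<forall>w\<in>space M - A. \<forall>t\<in>{0..T}. \<bar>J t w\<bar> \<le> \<epsilon>)"
proof -
 let ?E = "EE w. (TI {0..T} (%s. ennreal ((h s w)^2)))"
 define S where "S k = (\<Union>j\<in>{..k}. (%i. T * real i / 2 ^ j) ` {..2 ^ j :: nat})" for k :: nat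
 define A where "A k = {w\<in>space M. \<exists>r\<in>S k. \<epsilon> < \<bar>J r w\<bar>}" for k
 have S: "finite (S k)" "S k \<subseteq> {0..T}" for k
 proof -
  show "finite (S k)" unfolding S_def by simp
  have "T * real i / 2 ^ j \<in> {0..T}" if "i \<le> 2 ^ j" for i j
  proof -
   have "real i \<le> 2 ^ j" using that by (metis of_nat_le_iff of_nat_numeral of_nat_power)
   then have "T * real i \<le> T * 2 ^ j" using T_pos by simp
   then show ?thesis using T_pos by (simp add: pos_divide_le_eq)
  qed
  then show "S k \<subseteq> {0..T}" unfolding S_def by blast
 qed
 have Am: "A k \<in> events" and Ab: "ennreal (\<epsilon>^2) * emeasure M (A k) \<le> ?E" for k
  unfolding A_def using kolmogorov_finite[OF e \<epsilon> S] by auto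
 have "S k \<subseteq> S (Suc k)" for k unfolding S_def by (intro UN_mono) auto
 then have inc: "incseq A" unfolding A_def by (intro incseq_SucI) blast
 obtain N where N: "N \<in> null_sets M" "{w\<in>space M. \<not> continuous_on {0..T} (%t. W t w)} \<subseteq> N"
  using W_cont by (auto elim: AE_E simp: null_sets_def)
 let ?A = "(\<Union>k. A k) \<union> N"
 have "emeasure M ?A = emeasure M (\<Union>k. A k)" using Am N by (intro emeasure_Un_null_set) auto
 also have "... = (SUP k. emeasure M (A k))" using Am inc by (intro SUP_emeasure_incseq[symmetric]) auto
 finally have "ennreal (\<epsilon>^2) * emeasure M ?A = (SUP k. ennreal (\<epsilon>^2) * emeasure M (A k))"
  by (simp add: SUP_mult_left_ennreal)
 also have "... \<le> ?E" using Ab by (intro SUP_least)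
 finally have b: "ennreal (\<epsilon>^2) * emeasure M ?A \<le> ?E" .
 have "\<bar>J t w\<bar> \<le> \<epsilon>" if w: "w \<in> space M - ?A" and t: "t \<in> {0..T}" for w t
 proof (rule continuous_on_le_of_dyadic[OF T_pos _ _ t, of "%t. \<bar>J t w\<bar>"])
  have "continuous_on {0..T} (%t. W t w)" using N(2) w by blast
  from elementary_continuous[OF e this] show "continuous_on {0..T} (%t. \<bar>J t w\<bar>)"
   by (intro continuous_on_rabs)
  fix k i :: nat assume "i \<le> 2 ^ k"
  then have "T * real i / 2 ^ k \<in> S k" unfolding S_def by blast
  moreover have "\<not> (\<exists>r\<in>S k. \<epsilon> < \<bar>J r w\<bar>)" using w unfolding A_def by blast
  ultimately show "\<bar>J (T * real i / 2 ^ k) w\<bar> \<le> \<epsilon>" by (simp add: not_less)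
 qed
 then show ?thesis using b Am N by (intro bexI[of _ ?A]) auto
qed

text \<open>
 Switching the coefficients off just before the energy \<open>\<integral> h^2\<close> exceeds \<open>C\<close>. The energy up to the end
 of a grid interval is known at its beginning, so the switched coefficients are adapted.
\<close>

lemma energy_gate:
 assumes e: "elementary F T W uniformly_bounded h J" and C: "0 \<le> C"
 shows "\<exists>h' J'. elementary F T W uniformly_bounded h' J' \<and>
   (\<forall>w. (TI {0..T} (%s. ennreal ((h' s w)^2))) \<le> min (ennreal C) (TI {0..T} (%s. ennreal ((h s w)^2)))) \<and>
   (\<forall>w. (TI {0..T} (%s. ennreal ((h s w)^2))) \<le> ennreal C --> J' T w = J T w)"
proof -
 obtain n p \<xi> where g: "grid T n p" and on: "elementary_on F W uniformly_bounded n p \<xi> h J"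
  using e unfolding elementary_def by blast
 define en where "en k w = (\<Sum>j<k. (\<xi> j w)^2 * (p (Suc j) - p j))" for k w
 define y where "y i w = (if en (Suc i) w \<le> C then \<xi> i w else 0)" for i w
 have step: "0 \<le> p (Suc i) - p i" if "i < n" for i using grid_mono[OF g, of i "Suc i"] that by simp
 have x: "\<xi> i \<in> borel_measurable (F (p i))" "uniformly_bounded (\<xi> i)" if "i < n" for i
  using on that unfolding elementary_on_def by auto
 have ym: "y i \<in> borel_measurable (F (p i))" if i: "i < n" for i
 proof -
  have "en (Suc i) \<in> borel_measurable (F (p i))" unfolding en_def
  proof (rule borel_measurable_sum)
   fix j assume "j \<in> {..<Suc i}"
   then have "\<xi> j \<in> borel_measurable (F (p i))"
    using i x(1)[of j] grid_in[OF g, of j] grid_in[OF g, of i] grid_mono[OF g, of j i]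
    by (intro F_measurable_mono[of "p j" "p i"]) auto
   then show "(%w. (\<xi> j w)^2 * (p (Suc j) - p j)) \<in> borel_measurable (F (p i))" by simp
  qed
  then show ?thesis unfolding y_def using x(1)[OF i] by measurable
 qed
 have yb: "uniformly_bounded (y i)" if i: "i < n" for i
 proof -
  obtain B where "\<forall>w\<in>space M. \<bar>\<xi> i w\<bar> \<le> B" using x(2)[OF i] by blast
  then have "\<forall>w\<in>space M. \<bar>y i w\<bar> \<le> B" unfolding y_def by (auto intro: order_trans[OF abs_ge_zero])
  then show ?thesis by blast
 qed
 let ?h = "simple_process n p y" and ?J = "simple_ito W n p y"
 have on': "elementary_on F W uniformly_bounded n p y ?h ?J"
  by (rule elementary_on_simple[OF g]) (use ym yb in auto)
 have enmono: "en j w \<le> en k w" if "j \<le> k" "k \<le> n" for j k w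
  unfolding en_def using that step by (intro sum_mono2) auto
 have partial: "(\<Sum>i<k. (y i w)^2 * (p (Suc i) - p i)) \<le> min C (en k w)" if "k \<le> n" for k w
  using that
 proof (induction k)
  case 0 then show ?case using C by (simp add: en_def)
 next
  case (Suc k)
  then have IH: "(\<Sum>i<k. (y i w)^2 * (p (Suc i) - p i)) \<le> min C (en k w)" by simp
  have s: "en (Suc k) w = en k w + (\<xi> k w)^2 * (p (Suc k) - p k)" by (simp add: en_def)
  show ?case
  proof (cases "en (Suc k) w \<le> C")
   case True then show ?thesis using IH s by (simp add: y_def)
  next
   case False
   then show ?thesis using IH enmono[of k "Suc k" w] Suc.prems by (simp add: y_def)
  qed
 qed
 have "(TI {0..T} (%s. ennreal ((?h s w)^2))) \<le> min (ennreal C) (TI {0..T} (%s. ennreal ((h s w)^2)))" for w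
  unfolding elementary_on_energy[OF g on'] elementary_on_energy[OF g on]
  using partial[OF order_refl, of w] by (auto simp: en_def intro!: ennreal_leI)
 moreover have "?J T w = J T w" if "(TI {0..T} (%s. ennreal ((h s w)^2))) \<le> ennreal C" for w
 proof -
  have "en n w \<le> C" using that unfolding elementary_on_energy[OF g on] en_def using C by (simp add: ennreal_le_iff)
  then have "y i w = \<xi> i w" if "i < n" for i using enmono[of "Suc i" n w] that unfolding y_def by auto
  then show ?thesis using on on' unfolding elementary_on_def step_sum_def by simp
 qed
 moreover have "elementary F T W uniformly_bounded ?h ?J" using g on' unfolding elementary_def by blast
 ultimately show ?thesis by blast
qed

end

section \<open>The Ito inequality\<close>

lemma nn_integral_le_of_level_sets:
 assumes f: "f \<in> borel_measurable M" and E: "E \<in> borel_measurable M" and fin: "AE w in M. E w < (\<infinity>::ennreal)"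
  and le: "\<And>n::nat. (\<integral>\<^sup>+w. (if E w < of_nat n then f w else 0) \<partial>M) \<le> B"
 shows "(\<integral>\<^sup>+w. f w \<partial>M) \<le> B"
proof -
 have "(\<integral>\<^sup>+w. f w \<partial>M) = (\<integral>\<^sup>+w. (SUP n::nat. (if E w < of_nat n then f w else 0)) \<partial>M)"
 proof (rule nn_integral_cong_AE)
  show "AE w in M. f w = (SUP n::nat. (if E w < of_nat n then f w else 0))"
   using fin
  proof eventually_elim
   case (elim w)
   then obtain n :: nat where "E w < of_nat n" using ennreal_Ex_less_of_nat[of "E w"] by auto
   then have "f w \<le> (SUP n::nat. (if E w < of_nat n then f w else 0))" by (intro SUP_upper2[of n]) auto
   moreover have "(SUP n::nat. (if E w < of_nat n then f w else 0)) \<le> f w" by (intro SUP_least) auto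
   ultimately show ?case by (rule antisym)
  qed
 qed
 also have "... = (SUP n::nat. \<integral>\<^sup>+w. (if E w < of_nat n then f w else 0) \<partial>M)"
 proof (rule nn_integral_monotone_convergence_SUP)
  show "incseq (%n w. if E w < of_nat n then f w else 0)"
   by (intro incseq_SucI le_funI) (auto intro: less_le_trans)
  show "(%w. if E w < of_nat n then f w else 0) \<in> borel_measurable M" for n :: nat using f E by measurable
 qed
 also have "... \<le> B" by (intro SUP_least le)
 finally show ?thesis .
qed

lemma square_le_perturbation:
 fixes a b d :: real assumes "0 < d"
 shows "a^2 \<le> (1 + d) * b^2 + (1 + 1 / d) * (a - b)^2"
proof -
 have "0 \<le> (sqrt d * b - (a - b) / sqrt d)^2" by simp
 also have "... = d * b^2 - 2 * b * (a - b) + (a - b)^2 / d"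
  using assms by (simp add: power2_diff power_mult_distrib power_divide)
 finally show ?thesis by (simp add: power2_eq_square algebra_simps add_divide_distrib diff_divide_distrib)
qed

lemma energy_eventually_less:
 fixes h :: "nat => real => real"
 assumes hm: "\<And>k. (%s. indicator {0..T} s * h k s) \<in> borel_measurable lborel"
  and Hm: "(%s. indicator {0..T} s * H s) \<in> borel_measurable lborel"
  and lim: "(%k. (TI {0..T} (%s. ennreal ((h k s - H s)^2)))) \<longlonglongrightarrow> 0"
  and y: "(TI {0..T} (%s. ennreal ((H s)^2))) < y"
 shows "\<forall>\<^sub>F k in sequentially. (TI {0..T} (%s. ennreal ((h k s)^2))) < y"
proof -
 let ?E = "TI {0..T} (%s. ennreal ((H s)^2))"
 have fin: "?E \<noteq> \<top>" using y by auto
 have "(%n. ennreal (1 + inverse (real (Suc n))) * ?E) \<longlonglongrightarrow> ennreal (1 + 0) * ?E"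
  using fin by (intro tendsto_mult_ennreal tendsto_ennrealI tendsto_add tendsto_const LIMSEQ_inverse_real_of_nat) auto
 then have "\<forall>\<^sub>F n in sequentially. ennreal (1 + inverse (real (Suc n))) * ?E < y"
  using y by (intro order_tendstoD(2)) auto
 then obtain n where n: "ennreal (1 + inverse (real (Suc n))) * ?E < y" by (auto simp: eventually_sequentially)
 define d where "d = inverse (real (Suc n))"
 have d: "0 < d" by (simp add: d_def)
 have "(%k. ennreal (1 + d) * ?E + ennreal (1 + 1/d) * (TI {0..T} (%s. ennreal ((h k s - H s)^2))))
   \<longlonglongrightarrow> ennreal (1 + d) * ?E + ennreal (1 + 1/d) * 0"
  by (intro tendsto_add tendsto_const tendsto_mult_ennreal lim) auto
 then have "\<forall>\<^sub>F k in sequentially. ennreal (1 + d) * ?E + ennreal (1 + 1/d) * (TI {0..T} (%s. ennreal ((h k s - H s)^2))) < y"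
  using n unfolding d_def[symmetric] by (intro order_tendstoD(2)) auto
 then show ?thesis
 proof eventually_elim
  case (elim k)
  have i: "ennreal ((f s)^2) * indicator {0..T} s = ennreal ((indicator {0..T} s * f s)^2)" for f :: "real => real" and s
   by (auto simp: indicator_def)
  have i2: "ennreal ((f s - g s)^2) * indicator {0..T} s = ennreal ((indicator {0..T} s * f s - indicator {0..T} s * g s)^2)"
   for f g :: "real => real" and s by (auto simp: indicator_def)
  have "(TI {0..T} (%s. ennreal ((h k s)^2)))
   \<le> (\<integral>\<^sup>+s. ennreal (1 + d) * ennreal ((indicator {0..T} s * H s)^2)
      + ennreal (1 + 1/d) * ennreal ((indicator {0..T} s * h k s - indicator {0..T} s * H s)^2) \<partial>lborel)"
  proof (rule nn_integral_mono)
   fix s :: real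
   have "ennreal ((h k s)^2) \<le> ennreal ((1 + d) * (H s)^2 + (1 + 1 / d) * (h k s - H s)^2)"
    by (intro ennreal_leI square_le_perturbation d)
   also have "... = ennreal (1 + d) * ennreal ((H s)^2) + ennreal (1 + 1/d) * ennreal ((h k s - H s)^2)"
    using d by (simp add: ennreal_plus ennreal_mult)
   finally show "ennreal ((h k s)^2) * indicator {0..T} s \<le> ennreal (1 + d) * ennreal ((indicator {0..T} s * H s)^2)
      + ennreal (1 + 1/d) * ennreal ((indicator {0..T} s * h k s - indicator {0..T} s * H s)^2)"
    by (cases "s \<in> {0..T}") simp_all
  qed
  also have "... = ennreal (1 + d) * (\<integral>\<^sup>+s. ennreal ((indicator {0..T} s * H s)^2) \<partial>lborel)
    + ennreal (1 + 1/d) * (\<integral>\<^sup>+s. ennreal ((indicator {0..T} s * h k s - indicator {0..T} s * H s)^2) \<partial>lborel)"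
   using hm[of k] Hm by (subst nn_integral_add) (auto simp: nn_integral_cmult)
  also have "... = ennreal (1 + d) * ?E + ennreal (1 + 1/d) * (TI {0..T} (%s. ennreal ((h k s - H s)^2)))"
   by (simp only: i i2)
  finally show ?case using elim by (rule le_less_trans)
 qed
qed

lemma tendsto_of_ennreal_abs_diff:
 assumes "(%k. Z k) \<longlonglongrightarrow> (0::ennreal)" "\<And>k. ennreal \<bar>x k - y\<bar> \<le> Z k"
 shows "x \<longlonglongrightarrow> (y::real)"
proof -
 have "(%k. ennreal \<bar>x k - y\<bar>) \<longlonglongrightarrow> ennreal 0"
  using tendsto_sandwich[OF _ _ tendsto_const assms(1), of "%k. ennreal \<bar>x k - y\<bar>"] assms(2) by simp
 then have "(%k. \<bar>x k - y\<bar>) \<longlonglongrightarrow> 0" by (subst (asm) tendsto_ennreal_iff) auto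
 then have "(%k. x k - y) \<longlonglongrightarrow> 0" by (rule tendsto_rabs_zero_cancel)
 then show ?thesis by (simp add: LIM_zero_iff)
qed

context brownian_filtration
begin

text \<open>
 The approximation clause of the Ito integral, without adaptedness and path continuity of the
 integral. It is stable under the operations needed below, in the same way as elementary processes.
\<close>

definition approximable :: "(real => 'a => real) => (real => 'a => real) => bool" where
 "approximable H I \<longleftrightarrow>
   (AE w in M. (%s. indicator {0..T} s * H s w) \<in> borel_measurable lborel) \<and>
   (\<exists>h J. (\<forall>k::nat. elementary F T W uniformly_bounded (h k) (J k)) \<and>
    null_in_probability M (%k w. (TI {0..T} (%s. ennreal ((h k s w - H s w)^2)))) \<and>
    null_in_probability M (%k w. SUP t\<in>{0..T}. ennreal \<bar>J k t w - I t w\<bar>))"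

lemma space_F: "t \<in> {0..T} ==> space (F t) = space M"
 using F_sub by (simp add: subalgebra_def)

lemma simple_integrand_iff:
 "simple_integrand F T n p \<xi> \<longleftrightarrow> grid T n p \<and> (\<forall>i<n. \<xi> i \<in> borel_measurable (F (p i)) \<and> uniformly_bounded (\<xi> i))"
proof -
 have "bounded (\<xi> i ` space (F (p i))) \<longleftrightarrow> uniformly_bounded (\<xi> i)" if "grid T n p" "i < n" for i
  using space_F[of "p i"] grid_in[OF that(1), of i] that(2) by (auto simp: bounded_real)
 then show ?thesis unfolding simple_integrand_def grid_def by blast
qed

lemma ito_integral_iff_approximable:
 "ito_integral M F T W H I \<longleftrightarrow> approximable H I \<and> (\<forall>t\<in>{0..T}. I t \<in> borel_measurable (F t)) \<and>
   (AE w in M. continuous_on {0..T} (%t. I t w))" (is "?L \<longleftrightarrow> ?R")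
proof
 assume L: ?L
 then obtain n p \<xi> where si: "\<And>k. simple_integrand F T (n k) (p k) (\<xi> k)"
  and 1: "null_in_probability M
     (%k w. (TI {0..T} (%s. ennreal ((simple_process (n k) (p k) (\<xi> k) s w - H s w)^2))))"
  and 2: "null_in_probability M
     (%k w. SUP t\<in>{0..T}. ennreal \<bar>simple_ito W (n k) (p k) (\<xi> k) t w - I t w\<bar>)"
  unfolding ito_integral_def by blast
 have "elementary F T W uniformly_bounded (simple_process (n k) (p k) (\<xi> k)) (simple_ito W (n k) (p k) (\<xi> k))" for k
 proof -
  have "elementary_on F W uniformly_bounded (n k) (p k) (\<xi> k) (simple_process (n k) (p k) (\<xi> k)) (simple_ito W (n k) (p k) (\<xi> k))"
   using si[of k] unfolding simple_integrand_iff by (intro elementary_on_simple) auto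
  then show ?thesis using si[of k] unfolding simple_integrand_iff elementary_def by blast
 qed
 then have ex: "\<exists>h J. (\<forall>k::nat. elementary F T W uniformly_bounded (h k) (J k)) \<and>
    null_in_probability M (%k w. (TI {0..T} (%s. ennreal ((h k s w - H s w)^2)))) \<and>
    null_in_probability M (%k w. SUP t\<in>{0..T}. ennreal \<bar>J k t w - I t w\<bar>)"
  using 1 2 by (intro exI[of _ "%k. simple_process (n k) (p k) (\<xi> k)"] exI[of _ "%k. simple_ito W (n k) (p k) (\<xi> k)"]) simp
 have "AE w in M. (%s. indicator {0..T} s * H s w) \<in> borel_measurable lborel"
  using L unfolding ito_integral_def set_borel_measurable_def by simp
 then show ?R using L ex unfolding ito_integral_def approximable_def by simp
next
 assume R: ?R
 then obtain h J where el: "\<And>k::nat. elementary F T W uniformly_bounded (h k) (J k)"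
  and 1: "null_in_probability M (%k w. (TI {0..T} (%s. ennreal ((h k s w - H s w)^2))))"
  and 2: "null_in_probability M (%k w. SUP t\<in>{0..T}. ennreal \<bar>J k t w - I t w\<bar>)"
  unfolding approximable_def by blast
 have "\<forall>k. \<exists>n p \<xi>. simple_integrand F T n p \<xi> \<and> h k = simple_process n p \<xi> \<and> J k = simple_ito W n p \<xi>"
 proof
  fix k
  obtain n p \<xi> where g: "grid T n p" and on: "elementary_on F W uniformly_bounded n p \<xi> (h k) (J k)"
   using el[of k] unfolding elementary_def by blast
  have "h k = simple_process n p \<xi>" "J k = simple_ito W n p \<xi>"
   using on unfolding elementary_on_def
   by (simp_all add: fun_eq_iff simple_process_eq_step_sum[OF g] simple_ito_eq_step_sum)
  moreover have "simple_integrand F T n p \<xi>" unfolding simple_integrand_iff using g on unfolding elementary_on_def by blast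
  ultimately show "\<exists>n p \<xi>. simple_integrand F T n p \<xi> \<and> h k = simple_process n p \<xi> \<and> J k = simple_ito W n p \<xi>" by blast
 qed
 then obtain n p \<xi> where si: "\<And>k. simple_integrand F T (n k) (p k) (\<xi> k)"
  and h: "\<And>k. h k = simple_process (n k) (p k) (\<xi> k)" and J: "\<And>k. J k = simple_ito W (n k) (p k) (\<xi> k)" by metis
 have "AE w in M. set_borel_measurable lborel {0..T} (%s. H s w)"
  using R unfolding approximable_def set_borel_measurable_def by simp
 moreover have "\<exists>n p \<xi>. (\<forall>k. simple_integrand F T (n k) (p k) (\<xi> k)) \<and>
    null_in_probability M
     (%k w. (TI {0..T} (%s. ennreal ((simple_process (n k) (p k) (\<xi> k) s w - H s w)^2)))) \<and>
    null_in_probability M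
     (%k w. SUP t\<in>{0..T}. ennreal \<bar>simple_ito W (n k) (p k) (\<xi> k) t w - I t w\<bar>)"
  using si 1 2 unfolding h J by blast
 ultimately show ?L using R unfolding ito_integral_def by simp
qed

lemma elementary_path_measurable:
 assumes "elementary F T W P h J"
 shows "(%s. h s w) \<in> borel_measurable lborel"
proof -
 obtain n p \<xi> where "elementary_on F W P n p \<xi> h J" using assms unfolding elementary_def by blast
 then have "(%s. h s w) = (%s. \<Sum>i<n. \<xi> i w * ((if s \<le> p (Suc i) then 1 else 0) - (if s \<le> p i then 1 else 0)))"
  unfolding elementary_on_def step_sum_def by (simp add: fun_eq_iff)
 then show ?thesis by simp
qed

lemma approximableI:
 assumes "AE w in M. (%s. indicator {0..T} s * H s w) \<in> borel_measurable lborel"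
  and "\<And>k::nat. elementary F T W uniformly_bounded (h k) (J k)"
  and "null_in_probability M (%k w. (TI {0..T} (%s. ennreal ((h k s w - H s w)^2))))"
  and "null_in_probability M (%k w. SUP t\<in>{0..T}. ennreal \<bar>J k t w - I t w\<bar>)"
 shows "approximable H I"
 unfolding approximable_def using assms by blast

lemma approximable_elementary:
 assumes e: "elementary F T W uniformly_bounded h J"
 shows "approximable h J"
proof (rule approximableI[where h="%_. h" and J="%_. J"])
 show "AE w in M. (%s. indicator {0..T} s * h s w) \<in> borel_measurable lborel"
  using elementary_path_measurable[OF e] by simp
 have "null_in_probability M (%k w. 0)" by (rule null_in_probability_nn_integral) auto
 moreover have "(%k w. SUP t\<in>{0..T}. ennreal \<bar>J t w - J t w\<bar>) = (%(k::nat) w. 0)"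
  using T_pos by (auto simp: fun_eq_iff)
 moreover have "(%k w. (TI {0..T} (%s. ennreal ((h s w - h s w)^2)))) = (%(k::nat) w. 0)" by (auto simp: fun_eq_iff)
 ultimately show "null_in_probability M (%k w. (TI {0..T} (%s. ennreal ((h s w - h s w)^2))))"
  "null_in_probability M (%k w. SUP t\<in>{0..T}. ennreal \<bar>J t w - J t w\<bar>)" by simp_all
qed (rule e)

lemma nn_integral_square_diff_le:
 fixes h H h' H' k K :: "real => real"
 assumes m: "(%s. indicator {0..T} s * h s) \<in> borel_measurable lborel" "(%s. indicator {0..T} s * H s) \<in> borel_measurable lborel"
  "(%s. indicator {0..T} s * h' s) \<in> borel_measurable lborel" "(%s. indicator {0..T} s * H' s) \<in> borel_measurable lborel"
  and B: "0 \<le> B" and le: "AE s in lborel. s \<in> {0..T} --> (k s - K s)^2 \<le> B * ((h s - H s)^2 + (h' s - H' s)^2)"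
 shows "(TI {0..T} (%s. ennreal ((k s - K s)^2))) \<le>
  ennreal B * ((TI {0..T} (%s. ennreal ((h s - H s)^2))) + (TI {0..T} (%s. ennreal ((h' s - H' s)^2))))"
proof -
 have i: "ennreal ((f s - g s)^2) * indicator {0..T} s = ennreal ((indicator {0..T} s * f s - indicator {0..T} s * g s)^2)"
  for f g :: "real => real" and s by (auto simp: indicator_def)
 have "(TI {0..T} (%s. ennreal ((k s - K s)^2)))
   \<le> (\<integral>\<^sup>+s. ennreal B * (ennreal ((indicator {0..T} s * h s - indicator {0..T} s * H s)^2)
      + ennreal ((indicator {0..T} s * h' s - indicator {0..T} s * H' s)^2)) \<partial>lborel)"
 proof (rule nn_integral_mono_AE)
  show "AE s in lborel. ennreal ((k s - K s)^2) * indicator {0..T} s \<le> ennreal B * (ennreal ((indicator {0..T} s * h s - indicator {0..T} s * H s)^2)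
      + ennreal ((indicator {0..T} s * h' s - indicator {0..T} s * H' s)^2))"
   using le
  proof eventually_elim
   case (elim s)
   show ?case
   proof (cases "s \<in> {0..T}")
    case True
    then have "ennreal ((k s - K s)^2) \<le> ennreal (B * ((h s - H s)^2 + (h' s - H' s)^2))"
     using elim by (intro ennreal_leI) simp
    then show ?thesis using True B by (simp add: ennreal_mult ennreal_plus)
   qed simp
  qed
 qed
 also have "... = ennreal B * ((\<integral>\<^sup>+s. ennreal ((indicator {0..T} s * h s - indicator {0..T} s * H s)^2) \<partial>lborel) +
   (\<integral>\<^sup>+s. ennreal ((indicator {0..T} s * h' s - indicator {0..T} s * H' s)^2) \<partial>lborel))"
  using m by (subst nn_integral_cmult) (auto simp: nn_integral_add)
 finally show ?thesis by (simp only: i)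
qed

text \<open>
 The general stability principle: a pathwise operation on pairs of processes passes to the limit as
 soon as it preserves elementary integrals and is Lipschitz continuous.
\<close>

lemma approximable_transfer:
 assumes 1: "approximable H1 I1" and 2: "approximable H2 I2" and B: "0 \<le> B"
  and el: "\<And>h1 J1 h2 J2. elementary F T W uniformly_bounded h1 J1 ==> elementary F T W uniformly_bounded h2 J2 ==>
    elementary F T W uniformly_bounded (\<Phi> h1 h2) (\<Psi> J1 J2)"
  and meas: "AE w in M. (%s. indicator {0..T} s * H1 s w) \<in> borel_measurable lborel -->
    (%s. indicator {0..T} s * H2 s w) \<in> borel_measurable lborel --> (%s. indicator {0..T} s * H s w) \<in> borel_measurable lborel"
  and lip1: "\<And>h1 h2 s w. w \<in> space M ==> s \<in> {0<..T} ==>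
    (\<Phi> h1 h2 s w - H s w)^2 \<le> B * ((h1 s w - H1 s w)^2 + (h2 s w - H2 s w)^2)"
  and lip2: "\<And>J1 J2 t w. w \<in> space M ==> t \<in> {0..T} ==> (\<forall>w. J1 0 w = 0 \<and> J2 0 w = 0) ==>
    \<exists>u\<in>{0..T}. \<exists>v\<in>{0..T}. \<bar>\<Psi> J1 J2 t w - I t w\<bar> \<le> B * (\<bar>J1 u w - I1 u w\<bar> + \<bar>J1 v w - I1 v w\<bar> + \<bar>J2 u w - I2 u w\<bar> + \<bar>J2 v w - I2 v w\<bar>)"
 shows "approximable H I"
proof -
 obtain h1 J1 where el1: "\<And>k::nat. elementary F T W uniformly_bounded (h1 k) (J1 k)"
  and a1: "null_in_probability M (%k w. (TI {0..T} (%s. ennreal ((h1 k s w - H1 s w)^2))))"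
  and b1: "null_in_probability M (%k w. SUP t\<in>{0..T}. ennreal \<bar>J1 k t w - I1 t w\<bar>)"
  and m1: "AE w in M. (%s. indicator {0..T} s * H1 s w) \<in> borel_measurable lborel"
  using 1 unfolding approximable_def by blast
 obtain h2 J2 where el2: "\<And>k::nat. elementary F T W uniformly_bounded (h2 k) (J2 k)"
  and a2: "null_in_probability M (%k w. (TI {0..T} (%s. ennreal ((h2 k s w - H2 s w)^2))))"
  and b2: "null_in_probability M (%k w. SUP t\<in>{0..T}. ennreal \<bar>J2 k t w - I2 t w\<bar>)"
  and m2: "AE w in M. (%s. indicator {0..T} s * H2 s w) \<in> borel_measurable lborel"
  using 2 unfolding approximable_def by blast
 have "AE w in M. (%s. indicator {0..T} s * H1 s w) \<in> borel_measurable lborel \<and> (%s. indicator {0..T} s * H2 s w) \<in> borel_measurable lborel"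
  using m1 m2 by eventually_elim simp
 then obtain N where N: "N \<in> null_sets M" "\<And>w. w \<in> space M - N ==> (%s. indicator {0..T} s * H1 s w) \<in> borel_measurable lborel"
   "\<And>w. w \<in> space M - N ==> (%s. indicator {0..T} s * H2 s w) \<in> borel_measurable lborel"
  by (elim AE_E3) blast
 have z: "J1 k 0 w = 0 \<and> J2 k 0 w = 0" for k w
 proof -
  have "J 0 w = 0" if e: "elementary F T W uniformly_bounded h J" for h J
  proof -
   obtain n p \<xi> where "grid T n p" "elementary_on F W uniformly_bounded n p \<xi> h J" using e unfolding elementary_def by blast
   from elementary_on_integral_at_grid[OF this, of 0] this(1) show ?thesis unfolding grid_def by simp
  qed
  then show ?thesis using el1 el2 by blast
 qed
 show ?thesis
 proof (rule approximableI[where h="%k. \<Phi> (h1 k) (h2 k)" and J="%k. \<Psi> (J1 k) (J2 k)"])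
  show "AE w in M. (%s. indicator {0..T} s * H s w) \<in> borel_measurable lborel"
   using meas m1 m2 by eventually_elim blast
  show "elementary F T W uniformly_bounded (\<Phi> (h1 k) (h2 k)) (\<Psi> (J1 k) (J2 k))" for k using el el1 el2 by blast
  show "null_in_probability M (%k w. (TI {0..T} (%s. ennreal ((\<Phi> (h1 k) (h2 k) s w - H s w)^2))))"
  proof (rule null_in_probability_le[OF null_in_probability_add[OF a1 a2] N(1) B])
   fix k w assume w: "w \<in> space M - N"
   show "(TI {0..T} (%s. ennreal ((\<Phi> (h1 k) (h2 k) s w - H s w)^2)))
    \<le> ennreal B * ((TI {0..T} (%s. ennreal ((h1 k s w - H1 s w)^2))) + (TI {0..T} (%s. ennreal ((h2 k s w - H2 s w)^2))))"
   proof (rule nn_integral_square_diff_le[OF _ N(2)[OF w] _ N(3)[OF w] B])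
    show "(%s. indicator {0..T} s * h1 k s w) \<in> borel_measurable lborel" "(%s. indicator {0..T} s * h2 k s w) \<in> borel_measurable lborel"
     using elementary_path_measurable[OF el1[of k]] elementary_path_measurable[OF el2[of k]] by simp_all
    have "AE s in lborel. s \<noteq> (0::real)" by (rule AE_lborel_singleton)
    then show "AE s in lborel. s \<in> {0..T} --> (\<Phi> (h1 k) (h2 k) s w - H s w)^2 \<le> B * ((h1 k s w - H1 s w)^2 + (h2 k s w - H2 s w)^2)"
     by eventually_elim (use lip1 w in auto)
   qed
  qed
  show "null_in_probability M (%k w. SUP t\<in>{0..T}. ennreal \<bar>\<Psi> (J1 k) (J2 k) t w - I t w\<bar>)"
  proof (rule null_in_probability_le[OF null_in_probability_add[OF b1 b2] N(1), of "2 * B"])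
   fix k w assume w: "w \<in> space M - N"
   let ?S1 = "SUP t\<in>{0..T}. ennreal \<bar>J1 k t w - I1 t w\<bar>" and ?S2 = "SUP t\<in>{0..T}. ennreal \<bar>J2 k t w - I2 t w\<bar>"
   show "(SUP t\<in>{0..T}. ennreal \<bar>\<Psi> (J1 k) (J2 k) t w - I t w\<bar>) \<le> ennreal (2 * B) * (?S1 + ?S2)"
   proof (rule SUP_least)
    fix t assume t: "t \<in> {0..T}"
    obtain u v where uv: "u \<in> {0..T}" "v \<in> {0..T}" "\<bar>\<Psi> (J1 k) (J2 k) t w - I t w\<bar> \<le>
      B * (\<bar>J1 k u w - I1 u w\<bar> + \<bar>J1 k v w - I1 v w\<bar> + \<bar>J2 k u w - I2 u w\<bar> + \<bar>J2 k v w - I2 v w\<bar>)"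
     using lip2[of w t "J1 k" "J2 k"] w t z by blast
    have "ennreal \<bar>\<Psi> (J1 k) (J2 k) t w - I t w\<bar> \<le> ennreal (B * (\<bar>J1 k u w - I1 u w\<bar> + \<bar>J1 k v w - I1 v w\<bar> + \<bar>J2 k u w - I2 u w\<bar> + \<bar>J2 k v w - I2 v w\<bar>))"
     using uv(3) by (rule ennreal_leI)
    also have "... = ennreal B * (ennreal \<bar>J1 k u w - I1 u w\<bar> + ennreal \<bar>J1 k v w - I1 v w\<bar> + ennreal \<bar>J2 k u w - I2 u w\<bar> + ennreal \<bar>J2 k v w - I2 v w\<bar>)"
     using B by (simp add: ennreal_mult ennreal_plus)
    also have "... \<le> ennreal B * (?S1 + ?S1 + ?S2 + ?S2)"
     using uv by (intro mult_left_mono add_mono SUP_upper) auto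
    also have "... = ennreal (2 * B) * (?S1 + ?S2)"
     using B by (simp add: ennreal_mult mult_2 distrib_left distrib_right ac_simps)
    finally show "ennreal \<bar>\<Psi> (J1 k) (J2 k) t w - I t w\<bar> \<le> ennreal (2 * B) * (?S1 + ?S2)" .
   qed
  qed (use B in simp)
 qed
qed

lemma approximable_diff:
 assumes "approximable H1 I1" "approximable H2 I2"
 shows "approximable (%s w. H1 s w - H2 s w) (%t w. I1 t w - I2 t w)"
proof (rule approximable_transfer[OF assms, where B=2 and \<Phi>="%h1 h2 s w. h1 s w - h2 s w" and \<Psi>="%h1 h2 s w. h1 s w - h2 s w"])
 show "elementary F T W uniformly_bounded (%s w. h1 s w - h2 s w) (%s w. J1 s w - J2 s w)"
  if "elementary F T W uniformly_bounded h1 J1" "elementary F T W uniformly_bounded h2 J2" for h1 J1 h2 J2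
  by (rule elementary_diff[OF that]) (rule uniformly_bounded_diff)
 show "AE w in M. (%s. indicator {0..T} s * H1 s w) \<in> borel_measurable lborel -->
    (%s. indicator {0..T} s * H2 s w) \<in> borel_measurable lborel --> (%s. indicator {0..T} s * (H1 s w - H2 s w)) \<in> borel_measurable lborel"
  by (auto simp: right_diff_distrib)
 show "(h1 s w - h2 s w - (H1 s w - H2 s w))^2 \<le> 2 * ((h1 s w - H1 s w)^2 + (h2 s w - H2 s w)^2)" for h1 h2 s w
 proof -
  have "(a - c - (b - d))^2 \<le> 2 * ((a - b)^2 + (c - d)^2)" for a b c d :: real
  proof -
   have "0 \<le> ((a - b) + (c - d))^2" by simp
   then show ?thesis by (simp add: power2_eq_square algebra_simps)
  qed
  then show ?thesis .
 qed
 show "\<exists>u\<in>{0..T}. \<exists>v\<in>{0..T}. \<bar>J1 t w - J2 t w - (I1 t w - I2 t w)\<bar> \<le> 2 * (\<bar>J1 u w - I1 u w\<bar> + \<bar>J1 v w - I1 v w\<bar> + \<bar>J2 u w - I2 u w\<bar> + \<bar>J2 v w - I2 v w\<bar>)"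
  if "t \<in> {0..T}" for J1 J2 t w
 proof (intro bexI[OF _ that])
  have "\<bar>a - c - (b - d)\<bar> \<le> \<bar>a - b\<bar> + \<bar>c - d\<bar>" for a b c d :: real by linarith
  then have "\<bar>J1 t w - J2 t w - (I1 t w - I2 t w)\<bar> \<le> \<bar>J1 t w - I1 t w\<bar> + \<bar>J2 t w - I2 t w\<bar>" .
  then show "\<bar>J1 t w - J2 t w - (I1 t w - I2 t w)\<bar> \<le> 2 * (\<bar>J1 t w - I1 t w\<bar> + \<bar>J1 t w - I1 t w\<bar> + \<bar>J2 t w - I2 t w\<bar> + \<bar>J2 t w - I2 t w\<bar>)"
   using abs_ge_zero[of "J1 t w - I1 t w"] abs_ge_zero[of "J2 t w - I2 t w"] by argo
 qed
qed simp

lemma approximable_restart: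
 assumes H: "approximable H I" and a: "a \<in> {0..T}" and G: "G \<in> borel_measurable (F a)" "uniformly_bounded G"
 shows "approximable (%s w. if a < s then G w * H s w else 0) (%t w. G w * (I t w - I (min t a) w))"
proof -
 obtain B where B: "\<And>w. w \<in> space M ==> \<bar>G w\<bar> \<le> B" using G(2) by blast
 define C where "C = 1 + \<bar>B\<bar> + B^2"
 have C: "0 \<le> C" "\<bar>B\<bar> \<le> C" "B^2 \<le> C" by (auto simp: C_def)
 have GC: "\<bar>G w\<bar> \<le> C" "(G w)^2 \<le> C" if "w \<in> space M" for w
 proof -
  have *: "\<bar>G w\<bar> \<le> \<bar>B\<bar>" using B[OF that] by linarith
  then show "\<bar>G w\<bar> \<le> C" using C by linarith
  show "(G w)^2 \<le> C" using *[unfolded abs_le_square_iff] C by linarith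
 qed
 show ?thesis
 proof (rule approximable_transfer[OF H H C(1), where \<Phi>="%h _ s w. if a < s then G w * h s w else 0" and \<Psi>="%I _ t w. G w * (I t w - I (min t a) w)"])
  show "elementary F T W uniformly_bounded (%s w. if a < s then G w * h1 s w else 0) (%t w. G w * (J1 t w - J1 (min t a) w))"
   if "elementary F T W uniformly_bounded h1 J1" for h1 J1
   by (rule elementary_restart[OF that a G(1)]) (use uniformly_bounded_mult[OF G(2)] in \<open>auto intro: exI[of _ 0]\<close>)
  show "AE w in M. (%s. indicator {0..T} s * H s w) \<in> borel_measurable lborel --> (%s. indicator {0..T} s * H s w) \<in> borel_measurable lborel -->
    (%s. indicator {0..T} s * (if a < s then G w * H s w else 0)) \<in> borel_measurable lborel"
  proof (intro AE_I2 impI)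
   fix w assume [measurable]: "(%s. indicator {0..T} s * H s w) \<in> borel_measurable lborel"
   have "(%s. if a < s then G w * (indicator {0..T} s * H s w) else 0) \<in> borel_measurable lborel" by measurable
   moreover have "(%s. if a < s then G w * (indicator {0..T} s * H s w) else 0) = (%s. indicator {0..T} s * (if a < s then G w * H s w else 0))"
    by (auto simp: fun_eq_iff)
   ultimately show "(%s. indicator {0..T} s * (if a < s then G w * H s w else 0)) \<in> borel_measurable lborel" by simp
  qed
  fix h1 h2 :: "real => 'a => real" and s t w assume w: "w \<in> space M"
  have "(G w * h1 s w - G w * H s w)^2 \<le> C * ((h1 s w - H s w)^2 + (h2 s w - H s w)^2)"
  proof -
   have "(G w * h1 s w - G w * H s w)^2 = (G w)^2 * (h1 s w - H s w)^2"
    by (simp add: right_diff_distrib[symmetric] power_mult_distrib)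
   also have "... \<le> C * ((h1 s w - H s w)^2 + (h2 s w - H s w)^2)"
    using GC(2)[OF w] C by (intro mult_mono) auto
   finally show ?thesis .
  qed
  then show "((if a < s then G w * h1 s w else 0) - (if a < s then G w * H s w else 0))^2 \<le> C * ((h1 s w - H s w)^2 + (h2 s w - H s w)^2)"
   using C by simp
  fix J1 J2 :: "real => 'a => real"
  assume t: "t \<in> {0..T}"
  have "\<bar>G w * (J1 t w - J1 (min t a) w) - G w * (I t w - I (min t a) w)\<bar> = \<bar>G w\<bar> * \<bar>(J1 t w - I t w) - (J1 (min t a) w - I (min t a) w)\<bar>"
  proof -
   have "\<bar>g * (x - y) - g * (u - v)\<bar> = \<bar>g\<bar> * \<bar>(x - u) - (y - v)\<bar>" for g x y u v :: real
   proof -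
    have "g * (x - y) - g * (u - v) = g * ((x - u) - (y - v))" by (simp add: algebra_simps)
    then show ?thesis by (simp only: abs_mult)
   qed
   then show ?thesis .
  qed
  also have "... \<le> C * (\<bar>J1 t w - I t w\<bar> + \<bar>J1 (min t a) w - I (min t a) w\<bar> + \<bar>J2 t w - I t w\<bar> + \<bar>J2 (min t a) w - I (min t a) w\<bar>)"
  proof (intro mult_mono GC(1)[OF w] C(1) abs_ge_zero)
   have "\<bar>x - y\<bar> \<le> \<bar>x\<bar> + \<bar>y\<bar> + \<bar>z\<bar> + \<bar>q\<bar>" for x y z q :: real by linarith
   then show "\<bar>(J1 t w - I t w) - (J1 (min t a) w - I (min t a) w)\<bar> \<le> \<bar>J1 t w - I t w\<bar> + \<bar>J1 (min t a) w - I (min t a) w\<bar> + \<bar>J2 t w - I t w\<bar> + \<bar>J2 (min t a) w - I (min t a) w\<bar>" .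
  qed
  finally have fin: "\<bar>G w * (J1 t w - J1 (min t a) w) - G w * (I t w - I (min t a) w)\<bar>
    \<le> C * (\<bar>J1 t w - I t w\<bar> + \<bar>J1 (min t a) w - I (min t a) w\<bar> + \<bar>J2 t w - I t w\<bar> + \<bar>J2 (min t a) w - I (min t a) w\<bar>)" .
  have m: "min t a \<in> {0..T}" using t a by (simp add: min_def)
  show "\<exists>u\<in>{0..T}. \<exists>v\<in>{0..T}. \<bar>G w * (J1 t w - J1 (min t a) w) - G w * (I t w - I (min t a) w)\<bar>
    \<le> C * (\<bar>J1 u w - I u w\<bar> + \<bar>J1 v w - I v w\<bar> + \<bar>J2 u w - I u w\<bar> + \<bar>J2 v w - I v w\<bar>)"
   by (rule bexI[OF _ t], rule bexI[OF _ m], rule fin)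
 qed
qed

lemma approximable_stop:
 assumes H: "approximable H I" and a: "a \<in> {0..T}"
 shows "approximable (%s w. if s \<le> a then H s w else 0) (%t w. I (min t a) w)"
proof -
 have "approximable (%s w. if a < s then 1 * H s w else 0) (%t w. 1 * (I t w - I (min t a) w))"
  by (rule approximable_restart[OF H a]) auto
 from approximable_diff[OF H this]
 have "approximable (%s w. H s w - (if a < s then 1 * H s w else 0)) (%t w. I t w - 1 * (I t w - I (min t a) w))" .
 moreover have "(%s w. H s w - (if a < s then 1 * H s w else 0)) = (%s w. if s \<le> a then H s w else 0)"
  by (auto simp: fun_eq_iff)
 ultimately show ?thesis by simp
qed

lemma approximable_AE_subseq:
 assumes "approximable H I"
 shows "\<exists>h J. (\<forall>k::nat. elementary F T W uniformly_bounded (h k) (J k)) \<and>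
  (AE w in M. (%k. (TI {0..T} (%s. ennreal ((h k s w - H s w)^2)))) \<longlonglongrightarrow> 0) \<and>
  (AE w in M. \<forall>t\<in>{0..T}. (%k. J k t w) \<longlonglongrightarrow> I t w)"
proof -
 obtain h J where el: "\<And>k::nat. elementary F T W uniformly_bounded (h k) (J k)"
  and a: "null_in_probability M (%k w. (TI {0..T} (%s. ennreal ((h k s w - H s w)^2))))"
  and b: "null_in_probability M (%k w. SUP t\<in>{0..T}. ennreal \<bar>J k t w - I t w\<bar>)"
  using assms unfolding approximable_def by blast
 obtain r :: "nat => nat" where r: "AE w in M. (%k. (TI {0..T} (%s. ennreal ((h (r k) s w - H s w)^2))) + (SUP t\<in>{0..T}. ennreal \<bar>J (r k) t w - I t w\<bar>)) \<longlonglongrightarrow> 0"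
  using null_in_probability_AE_subseq[OF null_in_probability_add[OF a b]] by blast
 have "AE w in M. (%k. (TI {0..T} (%s. ennreal ((h (r k) s w - H s w)^2)))) \<longlonglongrightarrow> 0"
  using r
 proof eventually_elim
  case (elim w)
  show ?case by (rule tendsto_sandwich[OF _ _ tendsto_const elim]) auto
 qed
 moreover have "AE w in M. \<forall>t\<in>{0..T}. (%k. J (r k) t w) \<longlonglongrightarrow> I t w"
  using r
 proof eventually_elim
  case (elim w)
  show ?case
  proof
   fix t assume "t \<in> {0..T}"
   then have "ennreal \<bar>J (r k) t w - I t w\<bar> \<le> (TI {0..T} (%s. ennreal ((h (r k) s w - H s w)^2))) + (SUP t\<in>{0..T}. ennreal \<bar>J (r k) t w - I t w\<bar>)" for k
    by (intro add_increasing SUP_upper) auto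
   then show "(%k. J (r k) t w) \<longlonglongrightarrow> I t w" by (rule tendsto_of_ennreal_abs_diff[OF elim])
  qed
 qed
 ultimately show ?thesis using el by (intro exI[of _ "%k. h (r k)"] exI[of _ "%k. J (r k)"]) blast
qed

lemma approximable_zero:
 assumes "approximable H I"
 shows "AE w in M. I 0 w = 0"
proof -
 obtain h J where el: "\<And>k::nat. elementary F T W uniformly_bounded (h k) (J k)"
  and lim: "AE w in M. \<forall>t\<in>{0..T}. (%k. J k t w) \<longlonglongrightarrow> I t w"
  using approximable_AE_subseq[OF assms] by blast
 have z: "J k 0 w = 0" for k w
 proof -
  obtain n p \<xi> where "grid T n p" "elementary_on F W uniformly_bounded n p \<xi> (h k) (J k)" using el[of k] unfolding elementary_def by blast
  from elementary_on_integral_at_grid[OF this, of 0] this(1) show ?thesis unfolding grid_def by simp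
 qed
 show ?thesis using lim
 proof eventually_elim
  case (elim w)
  then have "(%k. 0) \<longlonglongrightarrow> I 0 w" using T_pos by (auto simp: z dest!: bspec[of _ _ 0])
  then show ?case by (rule LIMSEQ_unique[OF _ tendsto_const])
 qed
qed

text \<open>
 Only convergence in probability is known, so no energy identity can be expected. But an
 approximating integral whose energy is cut off at level \<open>C\<close> agrees with the limit where the energy
 is below \<open>C\<close>, and Fatou's lemma on the left and dominated convergence on the right give the
 inequality.
\<close>

lemma ito_inequality_gated:
 assumes H: "approximable H I" and Em: "(%w. (TI {0..T} (%s. ennreal ((H s w)^2)))) \<in> borel_measurable M" and C: "0 \<le> C"
 shows "(EE w. (if (TI {0..T} (%s. ennreal ((H s w)^2))) < ennreal C then ennreal ((I T w)^2) else 0))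
  \<le> (EE w. min (ennreal C) (TI {0..T} (%s. ennreal ((H s w)^2))))"
proof -
 let ?E = "%w. (TI {0..T} (%s. ennreal ((H s w)^2)))"
 have Hm: "AE w in M. (%s. indicator {0..T} s * H s w) \<in> borel_measurable lborel" using H unfolding approximable_def by blast
 obtain h J where el: "\<And>k::nat. elementary F T W uniformly_bounded (h k) (J k)"
  and l1: "AE w in M. (%k. (TI {0..T} (%s. ennreal ((h k s w - H s w)^2)))) \<longlonglongrightarrow> 0"
  and l2: "AE w in M. \<forall>t\<in>{0..T}. (%k. J k t w) \<longlonglongrightarrow> I t w"
  using approximable_AE_subseq[OF H] by blast
 define e where "e k w = (TI {0..T} (%s. ennreal ((h k s w)^2)))" for k w
 have "\<forall>k. \<exists>x. elementary F T W uniformly_bounded (fst x) (snd x) \<and>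
   (\<forall>w. (TI {0..T} (%s. ennreal ((fst x s w)^2))) \<le> min (ennreal C) (e k w)) \<and>
   (\<forall>w. e k w \<le> ennreal C --> snd x T w = J k T w)"
 proof
  fix k
  obtain h' J' where "elementary F T W uniformly_bounded h' J'"
   "\<forall>w. (TI {0..T} (%s. ennreal ((h' s w)^2))) \<le> min (ennreal C) (e k w)"
   "\<forall>w. e k w \<le> ennreal C --> J' T w = J k T w"
   using energy_gate[OF el[of k] C] unfolding e_def by blast
  then show "\<exists>x. elementary F T W uniformly_bounded (fst x) (snd x) \<and>
   (\<forall>w. (TI {0..T} (%s. ennreal ((fst x s w)^2))) \<le> min (ennreal C) (e k w)) \<and>
   (\<forall>w. e k w \<le> ennreal C --> snd x T w = J k T w)"
   by (intro exI[of _ "(h', J')"] conjI) (simp_all only: fst_conv snd_conv simp_thms)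
 qed
 from choice[OF this] obtain x where x: "\<And>k. elementary F T W uniformly_bounded (fst (x k)) (snd (x k))"
   "\<And>k w. (TI {0..T} (%s. ennreal ((fst (x k) s w)^2))) \<le> min (ennreal C) (e k w)"
   "\<And>k w. e k w \<le> ennreal C ==> snd (x k) T w = J k T w" by blast
 define h' where "h' k = fst (x k)" for k
 define J' where "J' k = snd (x k)" for k
 note el' = x(1)[folded h'_def J'_def] and g1 = x(2)[folded h'_def] and g2 = x(3)[folded J'_def]
 have em: "e k \<in> borel_measurable M" for k
 proof -
  have [measurable]: "(%(w, s). h k s w) \<in> borel_measurable (M \<Otimes>\<^sub>M lborel)" by (rule elementary_measurable[OF el])
  show ?thesis unfolding e_def by measurable
 qed
 have Tin: "T \<in> {0..T}" using T_pos by simp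
 have J'm: "J' k T \<in> borel_measurable M" for k
  using F_measurable_M[OF Tin elementary_adapted[OF el' Tin]] .
 have up: "AE w in M. \<forall>y. ?E w < y --> (\<forall>\<^sub>F k in sequentially. e k w < y)"
  using Hm l1
 proof eventually_elim
  case (elim w)
  show ?case unfolding e_def
   by (intro allI impI energy_eventually_less[OF _ elim]) (use elementary_path_measurable[OF el] in simp)
 qed
 have "(EE w. (if ?E w < ennreal C then ennreal ((I T w)^2) else 0))
   \<le> (EE w. liminf (%k. ennreal ((J' k T w)^2)))"
 proof (rule nn_integral_mono_AE)
  show "AE w in M. (if ?E w < ennreal C then ennreal ((I T w)^2) else 0) \<le> liminf (%k. ennreal ((J' k T w)^2))"
   using up l2
  proof eventually_elim
   case (elim w)
   show ?case
   proof (cases "?E w < ennreal C")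
    case True
    then have "\<forall>\<^sub>F k in sequentially. e k w < ennreal C" using elim(1) by blast
    then have ev: "\<forall>\<^sub>F k in sequentially. J k T w = J' k T w"
     by eventually_elim (simp add: g2 less_imp_le)
    have "(%k. J k T w) \<longlonglongrightarrow> I T w" using elim(2) Tin by blast
    then have "(%k. J' k T w) \<longlonglongrightarrow> I T w" by (rule Lim_transform_eventually[OF _ ev])
    then have "(%k. ennreal ((J' k T w)^2)) \<longlonglongrightarrow> ennreal ((I T w)^2)" by (intro tendsto_ennrealI tendsto_power)
    from lim_imp_Liminf[OF trivial_limit_sequentially this]
    show ?thesis by (simp only: True if_True order_refl)
   qed simp
  qed
 qed
 also have "... \<le> liminf (%k. (EE w. ennreal ((J' k T w)^2)))"
  by (rule nn_integral_liminf) (use J'm in measurable)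
 also have "... \<le> liminf (%k. (EE w. min (ennreal C) (e k w)))"
 proof (intro Liminf_mono always_eventually allI)
  fix k
  show "(EE w. ennreal ((J' k T w)^2)) \<le> (EE w. min (ennreal C) (e k w))"
   unfolding ito_isometry(1)[OF elementary_bounded_imp_square[OF el']] by (intro nn_integral_mono g1)
 qed
 also have "... \<le> limsup (%k. (EE w. min (ennreal C) (e k w)))" by (rule Liminf_le_Limsup) simp
 also have "... \<le> (EE w. limsup (%k. min (ennreal C) (e k w)))"
 proof (rule nn_integral_limsup[where w="%_. ennreal C"])
  show "(%w. min (ennreal C) (e k w)) \<in> borel_measurable M" for k using em by measurable
 qed (auto simp: emeasure_space_1)
 also have "... \<le> (EE w. min (ennreal C) (?E w))"
 proof (rule nn_integral_mono_AE)
  show "AE w in M. limsup (%k. min (ennreal C) (e k w)) \<le> min (ennreal C) (?E w)"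
   using up
  proof eventually_elim
   case (elim w)
   have "limsup (%k. min (ennreal C) (e k w)) \<le> ennreal C" by (intro Limsup_bounded always_eventually) auto
   moreover have "limsup (%k. min (ennreal C) (e k w)) \<le> ?E w"
   proof (rule dense_ge)
    fix y assume "?E w < y"
    then have "\<forall>\<^sub>F k in sequentially. e k w < y" using elim by blast
    then have "\<forall>\<^sub>F k in sequentially. min (ennreal C) (e k w) \<le> y" by eventually_elim (auto simp: min_le_iff_disj)
    then show "limsup (%k. min (ennreal C) (e k w)) \<le> y" by (rule Limsup_bounded)
   qed
   ultimately show ?case by simp
  qed
 qed
 finally show ?thesis .
qed

lemma ito_inequality:
 assumes H: "approximable H I" and Em: "(%w. (TI {0..T} (%s. ennreal ((H s w)^2)))) \<in> borel_measurable M"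
  and Im: "I T \<in> borel_measurable M"
 shows "(EE w. ennreal ((I T w)^2)) \<le> (EE w. (TI {0..T} (%s. ennreal ((H s w)^2))))"
proof (cases "(EE w. (TI {0..T} (%s. ennreal ((H s w)^2)))) = \<infinity>")
 case False
 show ?thesis
 proof (rule nn_integral_le_of_level_sets[OF _ Em])
  show "AE w in M. (TI {0..T} (%s. ennreal ((H s w)^2))) < \<infinity>"
   using nn_integral_PInf_AE[OF Em False] by eventually_elim (simp add: less_top)
  show "(%w. ennreal ((I T w)^2)) \<in> borel_measurable M" using Im by measurable
  fix n :: nat
  have "(EE w. (if (TI {0..T} (%s. ennreal ((H s w)^2))) < ennreal (real n) then ennreal ((I T w)^2) else 0))
    \<le> (EE w. min (ennreal (real n)) (TI {0..T} (%s. ennreal ((H s w)^2))))"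
   by (rule ito_inequality_gated[OF H Em]) simp
  also have "... \<le> (EE w. (TI {0..T} (%s. ennreal ((H s w)^2))))" by (intro nn_integral_mono) simp
  finally show "(EE w. (if (TI {0..T} (%s. ennreal ((H s w)^2))) < of_nat n then ennreal ((I T w)^2) else 0))
   \<le> (EE w. (TI {0..T} (%s. ennreal ((H s w)^2))))"
   by (simp only: ennreal_of_nat_eq_real_of_nat)
 qed
qed simp

end

section \<open>Moment bounds for solutions with integrable initial value\<close>

lemma jointly_measurable_of_continuous:
 fixes X :: "real => 'a => real"
 assumes m: "\<And>t. X t \<in> borel_measurable M" and c: "\<And>w. continuous_on UNIV (%t. X t w)"
 shows "(%(w, s). X s w) \<in> borel_measurable (M \<Otimes>\<^sub>M lborel)"
proof (rule borel_measurable_LIMSEQ_real)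
 define r where "r n s = real_of_int \<lfloor>real (Suc n) * s\<rfloor> / real (Suc n)" for n and s :: real
 show "(%n. (%z. X (r n (snd z)) (fst z)) z) \<longlonglongrightarrow> (case z of (w, s) => X s w)" for z
 proof -
  obtain w s where z: "z = (w, s)" by (cases z)
  have "\<bar>r n s - s\<bar> \<le> inverse (real (Suc n))" for n
  proof -
   have "r n s - s = (real_of_int \<lfloor>real (Suc n) * s\<rfloor> - real (Suc n) * s) / real (Suc n)"
    unfolding r_def by (simp add: diff_divide_distrib del: of_nat_Suc)
   moreover have "\<bar>real_of_int \<lfloor>real (Suc n) * s\<rfloor> - real (Suc n) * s\<bar> \<le> 1" by linarith
   moreover have "\<bar>x / N\<bar> \<le> inverse N" if "\<bar>x\<bar> \<le> 1" "0 < N" for x N :: real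
    using divide_right_mono[of "\<bar>x\<bar>" 1 N] that by (simp add: inverse_eq_divide)
   ultimately show ?thesis by (metis of_nat_0_less_iff zero_less_Suc)
  qed
  then have "(%n. r n s - s) \<longlonglongrightarrow> 0"
   by (intro Lim_null_comparison[OF _ LIMSEQ_inverse_real_of_nat] always_eventually) simp
  then have "(%n. r n s) \<longlonglongrightarrow> s" by (simp add: LIM_zero_iff)
  then have "(%n. X (r n s) w) \<longlonglongrightarrow> X s w" by (intro continuous_on_tendsto_compose[OF c]) auto
  then show ?thesis by (simp add: z)
 qed
 fix n
 have "(%z. (%k z. X (real_of_int k / real (Suc n)) (fst z)) \<lfloor>real (Suc n) * snd z\<rfloor> z) \<in> borel_measurable (M \<Otimes>\<^sub>M lborel)"
 proof (rule measurable_compose_countable[where f="%k z. X (real_of_int k / real (Suc n)) (fst z)" and g="%z. \<lfloor>real (Suc n) * snd z\<rfloor>"])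
  show "(%z. X (real_of_int k / real (Suc n)) (fst z)) \<in> borel_measurable (M \<Otimes>\<^sub>M lborel)" for k :: int
   by (rule measurable_compose[OF measurable_fst m])
  show "(%z. \<lfloor>real (Suc n) * snd z\<rfloor>) \<in> measurable (M \<Otimes>\<^sub>M lborel) (count_space UNIV)"
   by measurable
 qed
 then show "(%z. X (r n (snd z)) (fst z)) \<in> borel_measurable (M \<Otimes>\<^sub>M lborel)" unfolding r_def .
qed

lemma nn_integral_Icc_continuous:
 fixes g :: "real => real"
 assumes c: "continuous_on {a..b} g" and nn: "\<And>s. s \<in> {a..b} ==> 0 \<le> g s"
 shows "(TI {a..b} (%s. ennreal (g s))) = ennreal (integral {a..b} g)"
proof -
 have i: "set_integrable lborel {a..b} g" by (rule borel_integrable_atLeastAtMost'[OF c])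
 have "(TI {a..b} (%s. ennreal (g s))) = (\<integral>\<^sup>+s. ennreal (indicator {a..b} s *\<^sub>R g s) \<partial>lborel)"
  by (intro nn_integral_cong) (auto simp: indicator_def)
 also have "... = ennreal (\<integral>s. indicator {a..b} s *\<^sub>R g s \<partial>lborel)"
  using i nn unfolding set_integrable_def by (intro nn_integral_eq_integral) (auto simp: indicator_def intro!: AE_I2)
 also have "(\<integral>s. indicator {a..b} s *\<^sub>R g s \<partial>lborel) = integral {a..b} g"
  using set_borel_integral_eq_integral(2)[OF i] by (simp add: set_lebesgue_integral_def)
 finally show ?thesis .
qed

lemma square_set_integral_le:
 fixes f :: "real => real"
 assumes f: "set_integrable lborel {a..b} f" and ab: "a \<le> b"
 shows "ennreal ((LINT s:{a..b}|lborel. f s)^2) \<le> ennreal (b - a) * (TI {a..b} (%s. ennreal ((f s)^2)))"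
proof -
 have i: "integrable lborel (%s. indicator {a..b} s *\<^sub>R f s)"
  using f unfolding set_integrable_def .
 then have m: "(%s. indicator {a..b} s *\<^sub>R f s) \<in> borel_measurable lborel" by simp
 let ?L = "LINT s:{a..b}|lborel. f s"
 have "ennreal \<bar>?L\<bar> \<le> (\<integral>\<^sup>+s. ennreal \<bar>indicator {a..b} s *\<^sub>R f s\<bar> \<partial>lborel)"
  using integral_norm_bound_ennreal[OF i] unfolding set_lebesgue_integral_def by simp
 also have "... = (\<integral>\<^sup>+s. ennreal \<bar>indicator {a..b} s *\<^sub>R f s\<bar> * indicator {a..b} s \<partial>lborel)"
  by (intro nn_integral_cong) (auto simp: indicator_def)
 finally have 1: "ennreal \<bar>?L\<bar> \<le> (\<integral>\<^sup>+s. ennreal \<bar>indicator {a..b} s *\<^sub>R f s\<bar> * indicator {a..b} s \<partial>lborel)" .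
 have "ennreal (?L^2) = (ennreal \<bar>?L\<bar>)^2" by (simp add: ennreal_power)
 also have "... \<le> (\<integral>\<^sup>+s. ennreal \<bar>indicator {a..b} s *\<^sub>R f s\<bar> * indicator {a..b} s \<partial>lborel)^2"
  by (rule power_mono[OF 1]) simp
 also have "... \<le> (\<integral>\<^sup>+s. (ennreal \<bar>indicator {a..b} s *\<^sub>R f s\<bar>)^2 \<partial>lborel) * (\<integral>\<^sup>+s. (indicator {a..b} s)^2 \<partial>lborel)"
  by (rule Cauchy_Schwarz_nn_integral) (use m in measurable)
 also have "(\<integral>\<^sup>+s. (ennreal \<bar>indicator {a..b} s *\<^sub>R f s\<bar>)^2 \<partial>lborel) = (TI {a..b} (%s. ennreal ((f s)^2)))"
  by (intro nn_integral_cong) (auto simp: indicator_def ennreal_power)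
 also have "(\<integral>\<^sup>+s. (indicator {a..b} s)^2 \<partial>lborel) = (\<integral>\<^sup>+s. indicator {a..b} s \<partial>lborel)"
  by (intro nn_integral_cong) (auto simp: indicator_def)
 also have "... = ennreal (b - a)" using ab by simp
 finally show ?thesis by (simp add: mult.commute)
qed

text \<open>
 The energy accumulated before it reaches the level \<open>C\<close> amounts to \<open>C\<close>, unless the whole energy
 stays below \<open>C\<close>; the point is that the energy of a continuous path grows continuously.
\<close>

lemma truncated_energy_le:
 fixes g :: "real => real"
 assumes c: "continuous_on UNIV g" and nn: "\<And>s. 0 \<le> g s" and t: "0 \<le> t" and C: "0 \<le> C"
 shows "min (ennreal C) (TI {0..t} (%s. ennreal (g s)))
  \<le> (TI {0..t} (%s. (if (TI {0..s} (%r. ennreal (g r))) < ennreal C then ennreal (g s) else 0)))"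
proof -
 define A where "A s = (TI {0..s} (%r. ennreal (g r)))" for s
 define \<Phi> where "\<Phi> s = integral {0..s} g" for s
 have c': "continuous_on S g" for S using c continuous_on_subset by blast
 have A: "A s = ennreal (\<Phi> s)" for s unfolding A_def \<Phi>_def by (rule nn_integral_Icc_continuous[OF c' nn])
 have Amono: "A s \<le> A s'" if "s \<le> s'" for s s'
  unfolding A_def using that by (intro nn_integral_mono) (auto simp: indicator_def)
 have \<Phi>c: "continuous_on {0..t} \<Phi>" unfolding \<Phi>_def by (intro indefinite_integral_continuous_1 integrable_continuous_real c')
 have "min (ennreal C) (A t) \<le> (TI {0..t} (%s. (if A s < ennreal C then ennreal (g s) else 0)))"
 proof (cases "A t < ennreal C")
  case True
  have "A t \<le> (TI {0..t} (%s. (if A s < ennreal C then ennreal (g s) else 0)))"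
   unfolding A_def[of t]
  proof (rule nn_integral_mono)
   fix s show "ennreal (g s) * indicator {0..t} s \<le> (if A s < ennreal C then ennreal (g s) else 0) * indicator {0..t} s"
    using Amono[of s t] True by (cases "s \<in> {0..t}") (auto dest: le_less_trans)
  qed
  then show ?thesis by (rule min.coboundedI2)
 next
  case False
  define S where "S = {s\<in>{0..t}. C \<le> \<Phi> s}"
  define \<tau> where "\<tau> = Inf S"
  have "ennreal C \<le> ennreal (\<Phi> t)" using False by (simp add: A)
  moreover have "0 \<le> \<Phi> t" unfolding \<Phi>_def by (intro integral_nonneg integrable_continuous_real c' nn)
  ultimately have "C \<le> \<Phi> t" by simp
  then have "S \<noteq> {}" using t unfolding S_def by auto
  moreover have "closed S"
  proof -
   have "S = {0..t} \<inter> \<Phi> -` {C..}" unfolding S_def by auto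
   then show ?thesis using continuous_closed_preimage[OF \<Phi>c closed_atLeastAtMost closed_atLeast[of C]] by simp
  qed
  moreover have bb: "bdd_below S" unfolding S_def by (intro bdd_belowI[of _ 0]) auto
  ultimately have "\<tau> \<in> S" unfolding \<tau>_def by (intro closed_contains_Inf)
  then have \<tau>: "0 \<le> \<tau>" "\<tau> \<le> t" "C \<le> \<Phi> \<tau>" unfolding S_def by auto
  have less: "A s < ennreal C" if "0 \<le> s" "s < \<tau>" for s
  proof -
   have "s \<notin> S" using that(2) cInf_lower[OF _ bb, of s] unfolding \<tau>_def by (metis leD)
   then have "\<Phi> s < C" using that \<tau> unfolding S_def by auto
   moreover have "0 \<le> \<Phi> s" unfolding \<Phi>_def by (intro integral_nonneg integrable_continuous_real c' nn)
   ultimately show ?thesis unfolding A by (intro ennreal_lessI) auto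
  qed
  have "min (ennreal C) (A t) \<le> ennreal C" by simp
  also have "... \<le> A \<tau>" unfolding A using \<tau> by (intro ennreal_leI)
  also have "... \<le> (TI {0..t} (%s. (if A s < ennreal C then ennreal (g s) else 0)))"
   unfolding A_def[of \<tau>]
  proof (rule nn_integral_mono_AE)
   have "AE s in lborel. s \<noteq> \<tau>" by (rule AE_lborel_singleton)
   then show "AE s in lborel. ennreal (g s) * indicator {0..\<tau>} s \<le> (if A s < ennreal C then ennreal (g s) else 0) * indicator {0..t} s"
   proof eventually_elim
    case (elim s)
    show ?case
    proof (cases "s \<in> {0..\<tau>}")
     case True
     then have "A s < ennreal C" "s \<in> {0..t}" using elim \<tau> by (auto intro!: less)
     then show ?thesis using True by simp
    qed simp
   qed
  qed
  finally show ?thesis .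
 qed
 then show ?thesis unfolding A_def .
qed

context prob_space
begin

lemma nn_integral_swap_set:
 assumes f: "(%(w, s). f s w) \<in> borel_measurable (M \<Otimes>\<^sub>M lborel)" and S: "S \<in> sets lborel"
 shows "(EE w. (TI S (%s. f s w))) = (\<integral>\<^sup>+s\<in>S. (EE w. f s w) \<partial>(lborel :: real measure))"
proof -
 interpret L: pair_sigma_finite M "lborel :: real measure" ..
 have fs: "(%w. f s w) \<in> borel_measurable M" for s
  using measurable_compose[OF measurable_Pair2'[of s lborel M] f] by simp
 have f': "(%(w, s). f s w * indicator S s) \<in> borel_measurable (M \<Otimes>\<^sub>M lborel)"
 proof -
  have "(%z. (case z of (w, s) => f s w) * indicator S (snd z)) \<in> borel_measurable (M \<Otimes>\<^sub>M lborel)"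
   using f S by measurable
  then show ?thesis by (simp add: case_prod_beta')
 qed
 have "(EE w. (TI S (%s. f s w))) = (\<integral>\<^sup>+s. (EE w. f s w * indicator S s) \<partial>lborel)"
  using L.Fubini'[OF f'] by simp
 also have "... = (TI S (%s. (EE w. f s w)))"
  by (intro nn_integral_cong nn_integral_multc fs)
 finally show ?thesis .
qed

end

text \<open>
 A solution after modification on a null set and constant continuation outside \<open>[0, T]\<close>: all
 paths are continuous on the whole line, and the coefficients satisfy global bounds.
\<close>

locale regular_solution = brownian_filtration +
 fixes X0 :: "'a => real" and X I :: "real => 'a => real" and b \<sigma> :: "real => real => real" and K :: real
 assumes X0_F: "X0 \<in> borel_measurable (F 0)" and X0_int: "integrable M X0"
  and X_cont: "\<And>w. continuous_on UNIV (%t. X t w)" and X_meas: "\<And>t. X t \<in> borel_measurable M"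
  and X_F: "\<And>t. t \<in> {0..T} ==> X t \<in> borel_measurable (F t)"
  and I_cont: "\<And>w. continuous_on UNIV (%t. I t w)" and I_meas: "\<And>t. I t \<in> borel_measurable M"
  and \<sigma>_cont: "continuous_on UNIV (%(t, x). \<sigma> t x)" and b_cont: "continuous_on UNIV (%(t, x). b t x)"
  and K_nonneg: "0 \<le> K" and \<sigma>_growth: "\<And>t x. \<bar>\<sigma> t x\<bar> \<le> K * (1 + \<bar>x\<bar>)" and b_growth: "\<And>t x. \<bar>b t x\<bar> \<le> K * (1 + \<bar>x\<bar>)"
  and \<sigma>_lipschitz: "\<And>t x y. \<bar>\<sigma> t x - \<sigma> t y\<bar> \<le> K * \<bar>x - y\<bar>"
  and X_approx: "approximable (%s w. \<sigma> s (X s w)) I"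
  and X_eq: "AE w in M. \<forall>t\<in>{0..T}. X t w = X0 w + (LINT s:{0..t}|lborel. b s (X s w)) + I t w"
begin

lemma X0_meas [measurable]: "X0 \<in> borel_measurable M"
 using X0_int by simp

abbreviation H :: "real => 'a => real" where "H s w \<equiv> \<sigma> s (X s w)"
abbreviation B :: "real => 'a => real" where "B s w \<equiv> b s (X s w)"

text \<open>The weight that turns the merely integrable initial value into a square integrable one.\<close>

definition wt :: "'a => real" where "wt w = 1 / sqrt (1 + \<bar>X0 w\<bar>)"

lemma wt_props: "0 < wt w" "wt w \<le> 1" "(wt w)^2 = 1 / (1 + \<bar>X0 w\<bar>)" "(wt w)^2 \<le> 1" "(wt w)^2 * (X0 w)^2 \<le> \<bar>X0 w\<bar>"
proof -
 have p: "0 < 1 + \<bar>X0 w\<bar>" by (rule add_pos_nonneg) auto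
 show "0 < wt w" unfolding wt_def using p by simp
 show "wt w \<le> 1" unfolding wt_def by simp
 show sq: "(wt w)^2 = 1 / (1 + \<bar>X0 w\<bar>)" unfolding wt_def using p by (simp add: power_divide)
 show "(wt w)^2 \<le> 1" unfolding sq by simp
 have "(X0 w)^2 \<le> \<bar>X0 w\<bar> * (1 + \<bar>X0 w\<bar>)"
  by (simp add: distrib_left power2_eq_square flip: abs_mult)
 then show "(wt w)^2 * (X0 w)^2 \<le> \<bar>X0 w\<bar>" unfolding sq using p by (simp add: pos_divide_le_eq)
qed

lemma wt_F: "a \<in> {0..T} ==> wt \<in> borel_measurable (F a)"
proof -
 assume a: "a \<in> {0..T}"
 have "X0 \<in> borel_measurable (F a)" by (rule F_measurable_mono[OF _ _ _ X0_F]) (use a in auto)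
 then show ?thesis unfolding wt_def by measurable
qed

lemma wt_meas [measurable]: "wt \<in> borel_measurable M"
 unfolding wt_def by measurable

lemma wt_bounded: "uniformly_bounded wt"
 using wt_props(1,2) by (intro exI[of _ 1]) (auto simp: abs_of_pos)

lemma H_path_cont: "continuous_on S (%s. H s w)" and B_path_cont: "continuous_on S (%s. B s w)"
 and X_path_cont: "continuous_on S (%s. X s w)" and I_path_cont: "continuous_on S (%s. I s w)"
proof -
 have p: "continuous_on UNIV (%s. (s, X s w))" by (intro continuous_intros X_cont)
 have "continuous_on UNIV (%s. H s w)" "continuous_on UNIV (%s. B s w)"
  using continuous_on_compose2[OF \<sigma>_cont p] continuous_on_compose2[OF b_cont p] by auto
 then show "continuous_on S (%s. H s w)" "continuous_on S (%s. B s w)" "continuous_on S (%s. X s w)" "continuous_on S (%s. I s w)"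
  using X_cont I_cont by (blast intro: continuous_on_subset)+
qed

lemma \<sigma>_borel: "\<sigma> t \<in> borel_measurable borel" and b_borel: "b t \<in> borel_measurable borel"
proof -
 have p: "continuous_on UNIV (%x::real. (t, x))" by (intro continuous_intros)
 show "\<sigma> t \<in> borel_measurable borel" "b t \<in> borel_measurable borel"
  using continuous_on_compose2[OF \<sigma>_cont p] continuous_on_compose2[OF b_cont p]
  by (auto intro!: borel_measurable_continuous_onI)
qed

lemma H_meas: "H t \<in> borel_measurable M" and B_meas: "B t \<in> borel_measurable M"
 using measurable_compose[OF X_meas \<sigma>_borel] measurable_compose[OF X_meas b_borel] by auto

lemma joint_measurable [measurable]:
 "(%(w, s). X s w) \<in> borel_measurable (M \<Otimes>\<^sub>M lborel)" "(%(w, s). I s w) \<in> borel_measurable (M \<Otimes>\<^sub>M lborel)"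
 "(%(w, s). H s w) \<in> borel_measurable (M \<Otimes>\<^sub>M lborel)" "(%(w, s). B s w) \<in> borel_measurable (M \<Otimes>\<^sub>M lborel)"
 using jointly_measurable_of_continuous[OF X_meas X_path_cont] jointly_measurable_of_continuous[OF I_meas I_path_cont]
  jointly_measurable_of_continuous[OF H_meas H_path_cont] jointly_measurable_of_continuous[OF B_meas B_path_cont] by auto

lemma square_growth: "(\<sigma> t x)^2 \<le> 2 * K^2 * (1 + x^2)" "(b t x)^2 \<le> 2 * K^2 * (1 + x^2)"
proof -
 have "y^2 \<le> 2 * K^2 * (1 + x^2)" if "\<bar>y\<bar> \<le> K * (1 + \<bar>x\<bar>)" for y
 proof -
  have "y^2 \<le> (K * (1 + \<bar>x\<bar>))^2" using power_mono[OF that abs_ge_zero, of 2] by simp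
  also have "... = K^2 * (1 + \<bar>x\<bar>)^2" by (simp add: power_mult_distrib)
  also have "... \<le> K^2 * (2 * (1 + x^2))"
  proof (rule mult_left_mono)
   have "0 \<le> (1 - \<bar>x\<bar>)^2" by simp
   then show "(1 + \<bar>x\<bar>)^2 \<le> 2 * (1 + x^2)" by (simp add: power2_sum power2_diff)
  qed simp
  finally show ?thesis by (simp add: algebra_simps)
 qed
 then show "(\<sigma> t x)^2 \<le> 2 * K^2 * (1 + x^2)" "(b t x)^2 \<le> 2 * K^2 * (1 + x^2)" using \<sigma>_growth b_growth by auto
qed

lemma weighted_growth:
 assumes "y^2 \<le> 2 * K^2 * (1 + x^2)"
 shows "ennreal ((wt w)^2 * y^2) \<le> ennreal (2 * K^2) * (1 + ennreal ((wt w)^2 * x^2))"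
proof -
 have "(wt w)^2 * y^2 \<le> (wt w)^2 * (2 * K^2 * (1 + x^2))" using assms by (intro mult_left_mono) auto
 also have "... = 2 * K^2 * ((wt w)^2 + (wt w)^2 * x^2)" by (simp add: algebra_simps)
 also have "... \<le> 2 * K^2 * (1 + (wt w)^2 * x^2)" using wt_props(4)[of w] by (intro mult_left_mono add_right_mono) auto
 finally have "ennreal ((wt w)^2 * y^2) \<le> ennreal (2 * K^2 * (1 + (wt w)^2 * x^2))" by (rule ennreal_leI)
 also have "... = ennreal (2 * K^2) * (ennreal 1 + ennreal ((wt w)^2 * x^2))"
  using ennreal_mult[of "2 * K^2" "1 + (wt w)^2 * x^2"] ennreal_plus[of 1 "(wt w)^2 * x^2"] by simp
 finally show ?thesis by simp
qed

lemma I_zero: "AE w in M. I 0 w = 0"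
 by (rule approximable_zero[OF X_approx])

lemma ito_inequality_between:
 assumes at: "0 \<le> a" "a \<le> t" "t \<le> T" and G: "G \<in> borel_measurable (F a)" "uniformly_bounded G"
  and S: "S \<in> borel_measurable (F a)" "uniformly_bounded (%w. G w * S w)"
 shows "(EE w. ennreal ((G w)^2 * (I t w - I a w - S w * (W t w - W a w))^2))
  \<le> (EE w. (TI {a..t} (%s. ennreal ((G w)^2 * (H s w - S w)^2))))"
proof -
 have in_T: "a \<in> {0..T}" "t \<in> {0..T}" using at by auto
 have GM [measurable]: "G \<in> borel_measurable M" "S \<in> borel_measurable M"
  using F_measurable_M[OF in_T(1)] G S by auto
 let ?one = "simple_process 1 (%i. if i = 0 then 0 else T) (%_ _. 1) :: real => 'a => real"
 let ?Jone = "simple_ito W 1 (%i. if i = 0 then 0 else T) (%_ _. 1)"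
 have g: "grid T 1 (%i. if i = 0 then 0 else T)" using T_pos by (simp add: grid_def)
 have "elementary_on F W uniformly_bounded 1 (%i. if i = 0 then 0 else T) (%_ _. 1) ?one ?Jone"
  by (rule elementary_on_simple[OF g]) auto
 then have "elementary F T W uniformly_bounded ?one ?Jone" using g unfolding elementary_def by blast
 then have "elementary F T W uniformly_bounded (%s w. if a < s then (G w * S w) * ?one s w else 0) (%t w. (G w * S w) * (?Jone t w - ?Jone (min t a) w))"
 proof (rule elementary_restart[OF _ in_T(1)])
  show "(%w. G w * S w) \<in> borel_measurable (F a)" using G S by measurable
  show "uniformly_bounded (%w. G w * S w * \<xi> w)" if "uniformly_bounded \<xi>" for \<xi>
   by (rule uniformly_bounded_mult[OF S(2) that])
 qed (auto intro: exI[of _ 0])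
 from approximable_stop[OF approximable_diff[OF approximable_restart[OF X_approx in_T(1) G] approximable_elementary[OF this]] in_T(2)]
 have ap: "approximable (%s w. if s \<le> t then (if a < s then G w * H s w else 0) - (if a < s then (G w * S w) * ?one s w else 0) else 0)
  (%u w. G w * (I (min u t) w - I (min (min u t) a) w) - (G w * S w) * (?Jone (min u t) w - ?Jone (min (min u t) a) w))"
  (is "approximable ?H ?I") .
 have one: "?one s w = 1" if "0 < s" "s \<le> T" for s w
  using that by (simp add: simple_process_def)
 have HE: "(?H s w)^2 * indicator {0..T} s = ((G w)^2 * (H s w - S w)^2) * indicator {a..t} s" if "s \<noteq> a" for s w
 proof (cases "a < s \<and> s \<le> t")
  case True
  then have "?H s w = G w * (H s w - S w)" using one[of s w] at by (simp add: right_diff_distrib)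
  moreover have "indicator {0..T} s = (1::real)" "indicator {a..t} s = (1::real)" using True at by auto
  ultimately show ?thesis by (simp only: power_mult_distrib mult_1_right)
 next
  case False
  then have "?H s w = 0" by auto
  moreover have "indicator {a..t} s = (0::real)" using False that by (auto simp: indicator_def)
  ultimately show ?thesis by (simp only: mult_zero_right) simp
 qed
 have E: "(TI {0..T} (%s. ennreal ((?H s w)^2))) = (TI {a..t} (%s. ennreal ((G w)^2 * (H s w - S w)^2)))" for w
 proof (rule nn_integral_cong_AE)
  have i: "ennreal x * indicator A s = ennreal (x * indicator A s)" for x and A :: "real set" and s by (simp add: indicator_def)
  have "AE s in lborel. s \<noteq> a" by (rule AE_lborel_singleton)
  then show "AE s in lborel. ennreal ((?H s w)^2) * indicator {0..T} s = ennreal ((G w)^2 * (H s w - S w)^2) * indicator {a..t} s"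
  proof eventually_elim
   case (elim s)
   show ?case unfolding i using HE[OF elim, of w] by (rule arg_cong)
  qed
 qed
 have IT: "?I T w = G w * (I t w - I a w - S w * (W t w - W a w))" for w
 proof -
  have "min T t = t" "min t a = a" "min t T = t" "min a T = a" "min t 0 = 0" "min a 0 = 0" using at by auto
  then show ?thesis by (simp add: simple_ito_def algebra_simps)
 qed
 have Wm [measurable]: "W t \<in> borel_measurable M" "W a \<in> borel_measurable M" using W_measurable in_T by auto
 have "(EE w. ennreal ((?I T w)^2)) \<le> (EE w. (TI {0..T} (%s. ennreal ((?H s w)^2))))"
 proof (rule ito_inequality[OF ap])
  show "(%w. (TI {0..T} (%s. ennreal ((?H s w)^2)))) \<in> borel_measurable M"
   unfolding E by measurable
  show "?I T \<in> borel_measurable M" unfolding IT using I_meas by measurable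
 qed
 then show ?thesis unfolding E IT by (simp only: power_mult_distrib)
qed

definition energy :: "real => 'a => ennreal" where
 "energy t w = (TI {0..t} (%s. ennreal ((wt w)^2 * (H s w)^2)))"

lemma energy_measurable [measurable]: "(%(w, t). energy t w) \<in> borel_measurable (M \<Otimes>\<^sub>M lborel)"
proof -
 have "(%z. \<integral>\<^sup>+s. (if 0 \<le> s \<and> s \<le> snd z then ennreal ((wt (fst z))^2 * (H s (fst z))^2) else 0) \<partial>lborel) \<in> borel_measurable (M \<Otimes>\<^sub>M lborel)"
 proof -
  have "(%(z, s). if 0 \<le> s \<and> s \<le> snd z then ennreal ((wt (fst z))^2 * (H s (fst z))^2) else 0) \<in> borel_measurable ((M \<Otimes>\<^sub>M lborel) \<Otimes>\<^sub>M lborel)"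
  proof -
   have "(%y. (fst (fst y), snd y)) \<in> measurable ((M \<Otimes>\<^sub>M lborel) \<Otimes>\<^sub>M (lborel :: real measure)) (M \<Otimes>\<^sub>M (lborel :: real measure))" by measurable
   from measurable_compose[OF this joint_measurable(3)]
   have [measurable]: "(%y. H (snd y) (fst (fst y))) \<in> borel_measurable ((M \<Otimes>\<^sub>M (lborel :: real measure)) \<Otimes>\<^sub>M lborel)" by simp
   have "(%y. if 0 \<le> snd y \<and> snd y \<le> snd (fst y) then ennreal ((wt (fst (fst y)))^2 * (H (snd y) (fst (fst y)))^2) else 0) \<in> borel_measurable ((M \<Otimes>\<^sub>M lborel) \<Otimes>\<^sub>M lborel)"
    by measurable
   then show ?thesis by (simp add: case_prod_beta')
  qed
  then show ?thesis by (rule lborel.borel_measurable_nn_integral)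
 qed
 moreover have "(%(w, t). energy t w) = (%z. \<integral>\<^sup>+s. (if 0 \<le> s \<and> s \<le> snd z then ennreal ((wt (fst z))^2 * (H s (fst z))^2) else 0) \<partial>lborel)"
  unfolding energy_def by (auto simp: fun_eq_iff indicator_def intro!: nn_integral_cong)
 ultimately show ?thesis by simp
qed

end

context regular_solution
begin

lemma ito_inequality_truncated:
 assumes t: "t \<in> {0..T}" and C: "0 \<le> C"
 shows "(EE w. (if energy t w < ennreal C then ennreal ((wt w)^2 * (I t w)^2) else 0))
  \<le> (EE w. min (ennreal C) (energy t w))"
proof -
 have in0: "0 \<in> {0..T}" using T_pos by simp
 from approximable_stop[OF approximable_restart[OF X_approx in0 wt_F[OF in0] wt_bounded] t]
 have ap: "approximable (%s w. if s \<le> t then if 0 < s then wt w * H s w else 0 else 0)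
  (%u w. wt w * (I (min u t) w - I (min (min u t) 0) w))" (is "approximable ?H ?I") .
 have E: "(TI {0..T} (%s. ennreal ((?H s w)^2))) = energy t w" for w
  unfolding energy_def
 proof (rule nn_integral_cong_AE)
  have "AE s in lborel. s \<noteq> (0::real)" by (rule AE_lborel_singleton)
  then show "AE s in lborel. ennreal ((?H s w)^2) * indicator {0..T} s = ennreal ((wt w)^2 * (H s w)^2) * indicator {0..t} s"
  proof eventually_elim
   case (elim s)
   show ?case
   proof (cases "0 < s \<and> s \<le> t")
    case True
    then show ?thesis using t by (simp add: power_mult_distrib)
   next
    case False
    then have "s \<notin> {0..t}" using elim by auto
    then show ?thesis using False by auto
   qed
  qed
 qed
 have IT: "?I T w = wt w * (I t w - I 0 w)" for w
 proof -
  have "min T t = t" "min t 0 = 0" using t by auto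
  then show ?thesis by simp
 qed
 have em: "energy t \<in> borel_measurable M" using measurable_compose[OF measurable_Pair2'[of t lborel M] energy_measurable] by simp
 have "(EE w. (if energy t w < ennreal C then ennreal ((?I T w)^2) else 0)) \<le> (EE w. min (ennreal C) (energy t w))"
  using ito_inequality_gated[OF ap _ C] em unfolding E by simp
 moreover have "(EE w. (if energy t w < ennreal C then ennreal ((?I T w)^2) else 0))
   = (EE w. (if energy t w < ennreal C then ennreal ((wt w)^2 * (I t w)^2) else 0))"
 proof (rule nn_integral_cong_AE)
  show "AE w in M. (if energy t w < ennreal C then ennreal ((?I T w)^2) else 0) = (if energy t w < ennreal C then ennreal ((wt w)^2 * (I t w)^2) else 0)"
   using I_zero unfolding IT by eventually_elim (simp add: power_mult_distrib)
 qed
 ultimately show ?thesis by simp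
qed

lemma energy_mono: "s \<le> t ==> energy s w \<le> energy t w"
 unfolding energy_def by (intro nn_integral_mono) (auto simp: indicator_def)

lemma energy_finite: "energy t w < \<infinity>"
proof -
 have "energy t w = ennreal (integral {0..t} (%s. (wt w)^2 * (H s w)^2))"
  unfolding energy_def by (intro nn_integral_Icc_continuous continuous_on_mult continuous_on_power continuous_on_const H_path_cont) auto
 then show ?thesis by simp
qed

lemma energy_meas: "energy t \<in> borel_measurable M"
 using measurable_compose[OF measurable_Pair2'[of t lborel M] energy_measurable] by simp

lemma square_sum3_le: "((x::real) + y + z)^2 \<le> 3 * x^2 + 3 * y^2 + 3 * z^2"
proof -
 have "0 \<le> (x - y)^2 + (y - z)^2 + (x - z)^2" by simp
 then show ?thesis by (simp add: power2_eq_square algebra_simps)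
qed

lemma weighted_drift_le:
 assumes "a \<le> t"
 shows "ennreal ((wt w)^2 * (LINT s:{a..t}|lborel. B s w)^2)
  \<le> ennreal (t - a) * (TI {a..t} (%s. ennreal (2 * K^2) * (1 + ennreal ((wt w)^2 * (X s w)^2))))"
proof -
 have Bm: "(%s. B s w) \<in> borel_measurable lborel"
  using borel_measurable_continuous_onI[OF B_path_cont] by simp
 have "ennreal ((wt w)^2 * (LINT s:{a..t}|lborel. B s w)^2) = ennreal ((wt w)^2) * ennreal ((LINT s:{a..t}|lborel. B s w)^2)"
  by (simp add: ennreal_mult)
 also have "... \<le> ennreal ((wt w)^2) * (ennreal (t - a) * (TI {a..t} (%s. ennreal ((B s w)^2))))"
  by (intro mult_left_mono square_set_integral_le borel_integrable_atLeastAtMost' B_path_cont assms) simp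
 also have "... = ennreal (t - a) * (ennreal ((wt w)^2) * (TI {a..t} (%s. ennreal ((B s w)^2))))"
  by (simp only: mult.left_commute)
 also have "ennreal ((wt w)^2) * (TI {a..t} (%s. ennreal ((B s w)^2))) = (\<integral>\<^sup>+s. ennreal ((wt w)^2) * (ennreal ((B s w)^2) * indicator {a..t} s) \<partial>lborel)"
 proof (rule nn_integral_cmult[symmetric])
  have "(%s. ennreal ((f s)^2) * indicator {a..t} s) \<in> borel_measurable lborel" if [measurable]: "f \<in> borel_measurable lborel" for f :: "real => real"
   by measurable
  from this[OF Bm] show "(%s. ennreal ((B s w)^2) * indicator {a..t} s) \<in> borel_measurable lborel" .
 qed
 also have "... \<le> (TI {a..t} (%s. ennreal (2 * K^2) * (1 + ennreal ((wt w)^2 * (X s w)^2))))"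
 proof (rule nn_integral_mono)
  fix s
  have "ennreal ((wt w)^2) * ennreal ((B s w)^2) \<le> ennreal (2 * K^2) * (1 + ennreal ((wt w)^2 * (X s w)^2))"
   using weighted_growth[OF square_growth(2)[of s "X s w"], of w] by (simp add: ennreal_mult)
  then show "ennreal ((wt w)^2) * (ennreal ((B s w)^2) * indicator {a..t} s) \<le> ennreal (2 * K^2) * (1 + ennreal ((wt w)^2 * (X s w)^2)) * indicator {a..t} s"
   by (cases "s \<in> {a..t}") simp_all
 qed
 finally show ?thesis by (simp add: mult_left_mono)
qed

text \<open>
 Stopping at the energy level \<open>C\<close> closes the usual estimate: the truncated second moment obeys an
 integral inequality with constants that do not depend on \<open>C\<close>. Gronwall's inequality needs to know
 that the moment is finite; this is read off the same inequality path by path, where the path is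
 bounded, using that the truncated integral has second moment at most \<open>C\<close>.
\<close>

lemma truncated_moment_bound:
 defines "c1 \<equiv> 6 * T * K^2"
 defines "a \<equiv> 3 * expectation (%w. \<bar>X0 w\<bar>) + c1 * T + 6 * K^2 * T"
 assumes C: "0 \<le> C" and t: "t \<in> {0..T}"
 shows "(EE w. (if energy t w < ennreal C then ennreal ((wt w)^2 * (X t w)^2) else 0)) \<le> ennreal (a * exp ((c1 + 6 * K^2) * t))"
proof -
 define \<phi> where "\<phi> s w = (if energy s w < ennreal C then ennreal ((wt w)^2 * (X s w)^2) else 0)" for s w
 define \<psi> where "\<psi> s w = (if energy s w < ennreal C then ennreal ((wt w)^2 * (I s w)^2) else 0)" for s w
 have c1: "0 \<le> c1" unfolding c1_def using T_pos by simp
 have k2: "0 \<le> K^2" by simp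
 have E0: "0 \<le> expectation (%w. \<bar>X0 w\<bar>)" by simp
 have a: "0 \<le> a" unfolding a_def using c1 k2 E0 T_pos by (intro add_nonneg_nonneg mult_nonneg_nonneg) auto
 have jm: "(%(w, s). \<phi> s w) \<in> borel_measurable (M \<Otimes>\<^sub>M lborel)" "(%(w, s). \<psi> s w) \<in> borel_measurable (M \<Otimes>\<^sub>M lborel)"
 proof -
  have [measurable]: "(%z. energy (snd z) (fst z)) \<in> borel_measurable (M \<Otimes>\<^sub>M lborel)" "(%z. X (snd z) (fst z)) \<in> borel_measurable (M \<Otimes>\<^sub>M lborel)"
   "(%z. I (snd z) (fst z)) \<in> borel_measurable (M \<Otimes>\<^sub>M lborel)"
   using energy_measurable joint_measurable(1,2) by (simp_all add: case_prod_beta')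
  have "(%z. if energy (snd z) (fst z) < ennreal C then ennreal ((wt (fst z))^2 * (X (snd z) (fst z))^2) else 0) \<in> borel_measurable (M \<Otimes>\<^sub>M lborel)"
   "(%z. if energy (snd z) (fst z) < ennreal C then ennreal ((wt (fst z))^2 * (I (snd z) (fst z))^2) else 0) \<in> borel_measurable (M \<Otimes>\<^sub>M lborel)"
   by measurable
  then show "(%(w, s). \<phi> s w) \<in> borel_measurable (M \<Otimes>\<^sub>M lborel)" "(%(w, s). \<psi> s w) \<in> borel_measurable (M \<Otimes>\<^sub>M lborel)"
   unfolding \<phi>_def \<psi>_def by (simp_all add: case_prod_beta')
 qed
 have sm: "\<phi> s \<in> borel_measurable M" "\<psi> s \<in> borel_measurable M" for s
  using measurable_compose[OF measurable_Pair2'[of s lborel M] jm(1)] measurable_compose[OF measurable_Pair2'[of s lborel M] jm(2)] by simp_all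
 have pm: "(%s. \<phi> s w) \<in> borel_measurable lborel" "(%s. \<psi> s w) \<in> borel_measurable lborel" if "w \<in> space M" for w
  using measurable_compose[OF measurable_Pair1'[OF that] jm(1)] measurable_compose[OF measurable_Pair1'[OF that] jm(2)] by simp_all
 have im: "(%w. (TI {0..r} (%s. \<phi> s w))) \<in> borel_measurable M" "(%w. (TI {0..r} (%s. \<psi> s w))) \<in> borel_measurable M" for r
 proof -
  have [measurable]: "(%z. \<phi> (snd z) (fst z)) \<in> borel_measurable (M \<Otimes>\<^sub>M lborel)" "(%z. \<psi> (snd z) (fst z)) \<in> borel_measurable (M \<Otimes>\<^sub>M lborel)"
   using jm by (simp_all add: case_prod_beta')
  have 1: "(%z. \<phi> (snd z) (fst z) * indicator {0..r} (snd z)) \<in> borel_measurable (M \<Otimes>\<^sub>M lborel)"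
   "(%z. \<psi> (snd z) (fst z) * indicator {0..r} (snd z)) \<in> borel_measurable (M \<Otimes>\<^sub>M lborel)" by measurable
  show "(%w. (TI {0..r} (%s. \<phi> s w))) \<in> borel_measurable M" "(%w. (TI {0..r} (%s. \<psi> s w))) \<in> borel_measurable M"
   using 1 by (auto intro!: lborel.borel_measurable_nn_integral simp: case_prod_beta')
 qed
 have psiC: "(EE w. \<psi> s w) \<le> (EE w. min (ennreal C) (energy s w))" if "s \<in> {0..T}" for s
  unfolding \<psi>_def by (rule ito_inequality_truncated[OF that C])
 have k6: "3 * ennreal (2 * K^2) = ennreal (6 * K^2)"
  by (simp add: ennreal_mult''[symmetric] flip: ennreal_numeral)
 have path: "AE w in M. \<forall>s\<in>{0..T}. \<phi> s w \<le> ennreal (3 * \<bar>X0 w\<bar> + c1 * T) + ennreal c1 * (TI {0..s} (%r. \<phi> r w)) + 3 * \<psi> s w"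
  using X_eq AE_space
 proof eventually_elim
  case (elim w)
  show ?case
  proof
   fix s assume s: "s \<in> {0..T}"
   show "\<phi> s w \<le> ennreal (3 * \<bar>X0 w\<bar> + c1 * T) + ennreal c1 * (TI {0..s} (%r. \<phi> r w)) + 3 * \<psi> s w"
   proof (cases "energy s w < ennreal C")
    case True
    let ?D = "LINT r:{0..s}|lborel. B r w"
    have "(wt w)^2 * (X s w)^2 \<le> (wt w)^2 * (3 * (X0 w)^2 + 3 * ?D^2 + 3 * (I s w)^2)"
     using elim(1) s square_sum3_le[of "X0 w" ?D "I s w"] by (intro mult_left_mono) auto
    also have "... = 3 * ((wt w)^2 * (X0 w)^2) + 3 * ((wt w)^2 * ?D^2) + 3 * ((wt w)^2 * (I s w)^2)" by (simp add: algebra_simps)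
    also have "... \<le> 3 * \<bar>X0 w\<bar> + 3 * ((wt w)^2 * ?D^2) + 3 * ((wt w)^2 * (I s w)^2)" using wt_props(5)[of w] by simp
    finally have "ennreal ((wt w)^2 * (X s w)^2) \<le> ennreal (3 * \<bar>X0 w\<bar> + 3 * ((wt w)^2 * ?D^2) + 3 * ((wt w)^2 * (I s w)^2))"
     by (rule ennreal_leI)
    then have "\<phi> s w \<le> ennreal (3 * \<bar>X0 w\<bar> + 3 * ((wt w)^2 * ?D^2) + 3 * ((wt w)^2 * (I s w)^2))"
     unfolding \<phi>_def by (simp only: True if_True)
    also have "... = ennreal (3 * \<bar>X0 w\<bar>) + 3 * ennreal ((wt w)^2 * ?D^2) + 3 * \<psi> s w"
     unfolding \<psi>_def using True by (simp add: ennreal_plus ennreal_mult''[of _ 3] ennreal_mult')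
    also have "... \<le> ennreal (3 * \<bar>X0 w\<bar>) + 3 * (ennreal T * (TI {0..s} (%r. ennreal (2 * K^2) * (1 + \<phi> r w)))) + 3 * \<psi> s w"
    proof -
     have "ennreal ((wt w)^2 * ?D^2) \<le> ennreal (s - 0) * (TI {0..s} (%r. ennreal (2 * K^2) * (1 + ennreal ((wt w)^2 * (X r w)^2))))"
      using s by (intro weighted_drift_le) simp
     also have "... \<le> ennreal T * (TI {0..s} (%r. ennreal (2 * K^2) * (1 + \<phi> r w)))"
     proof (rule mult_mono[OF _ nn_integral_mono])
      show "ennreal (s - 0) \<le> ennreal T" using s by (intro ennreal_leI) simp
      fix r
      show "ennreal (2 * K^2) * (1 + ennreal ((wt w)^2 * (X r w)^2)) * indicator {0..s} r \<le> ennreal (2 * K^2) * (1 + \<phi> r w) * indicator {0..s} r"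
      proof (cases "r \<in> {0..s}")
       case r: True
       then have "energy r w < ennreal C" using energy_mono[of r s w] True by (auto intro: le_less_trans)
       then show ?thesis unfolding \<phi>_def by simp
      qed simp
     qed auto
     finally have le: "ennreal ((wt w)^2 * ?D^2) \<le> ennreal T * (TI {0..s} (%r. ennreal (2 * K^2) * (1 + \<phi> r w)))" .
     show ?thesis by (rule add_mono[OF add_mono[OF order_refl mult_left_mono[OF le]] order_refl]) simp
    qed
    also have "(TI {0..s} (%r. ennreal (2 * K^2) * (1 + \<phi> r w))) = ennreal (2 * K^2) * (ennreal s + (TI {0..s} (%r. \<phi> r w)))"
    proof -
     have "(TI {0..s} (%r. ennreal (2 * K^2) * (1 + \<phi> r w))) = (\<integral>\<^sup>+r. ennreal (2 * K^2) * (indicator {0..s} r + \<phi> r w * indicator {0..s} r) \<partial>lborel)"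
      by (intro nn_integral_cong) (auto simp: indicator_def)
     also have "... = ennreal (2 * K^2) * ((\<integral>\<^sup>+r. indicator {0..s} r \<partial>lborel) + (TI {0..s} (%r. \<phi> r w)))"
      using pm(1)[OF elim(2)] by (subst nn_integral_cmult) (simp_all add: nn_integral_add)
     also have "(\<integral>\<^sup>+r. indicator {0..s} r \<partial>lborel) = ennreal s" using s by simp
     finally show ?thesis .
    qed
    also have "ennreal (3 * \<bar>X0 w\<bar>) + 3 * (ennreal T * (ennreal (2 * K^2) * (ennreal s + (TI {0..s} (%r. \<phi> r w))))) + 3 * \<psi> s w
     = ennreal (3 * \<bar>X0 w\<bar>) + ennreal c1 * (ennreal s + (TI {0..s} (%r. \<phi> r w))) + 3 * \<psi> s w"
    proof -
     have "3 * (ennreal T * (ennreal (2 * K^2) * y)) = ennreal T * (3 * ennreal (2 * K^2)) * y" for y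
      by (simp only: ac_simps)
     also have "ennreal T * (3 * ennreal (2 * K^2)) * y = ennreal c1 * y" for y
      unfolding k6 c1_def using T_pos by (simp add: ennreal_mult''[symmetric] mult.commute mult.left_commute)
     finally show ?thesis by simp
    qed
    also have "... \<le> ennreal (3 * \<bar>X0 w\<bar>) + ennreal c1 * (ennreal T + (TI {0..s} (%r. \<phi> r w))) + 3 * \<psi> s w"
     using s by (intro add_mono mult_left_mono order_refl ennreal_leI) auto
    also have "... = ennreal (3 * \<bar>X0 w\<bar> + c1 * T) + ennreal c1 * (TI {0..s} (%r. \<phi> r w)) + 3 * \<psi> s w"
     using c1 T_pos by (simp add: distrib_left ennreal_plus ennreal_mult add.assoc)
    finally show ?thesis .
   qed (simp add: \<phi>_def)
  qed
 qed
 \<comment> \<open>finiteness of the truncated moment, from Gronwall's inequality along each path\<close>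
 have "(EE w. (TI {0..T} (%s. \<phi> s w))) \<le> (EE w. (ennreal (T * (3 * \<bar>X0 w\<bar> + c1 * T)) + 3 * (TI {0..T} (%s. \<psi> s w))) * ennreal (exp (c1 * T)))"
 proof (rule nn_integral_mono_AE)
  show "AE w in M. (TI {0..T} (%s. \<phi> s w)) \<le> (ennreal (T * (3 * \<bar>X0 w\<bar> + c1 * T)) + 3 * (TI {0..T} (%s. \<psi> s w))) * ennreal (exp (c1 * T))"
   using path AE_space
  proof eventually_elim
   case (elim w)
   define \<Phi> where "\<Phi> s = (TI {0..s} (%r. \<phi> r w))" for s
   define G where "G = ennreal (T * (3 * \<bar>X0 w\<bar> + c1 * T)) + 3 * (TI {0..T} (%s. \<psi> s w))"
   have \<Phi>m: "\<Phi> \<in> borel_measurable lborel"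
   proof -
    have [measurable]: "(%s. \<phi> s w) \<in> borel_measurable lborel" by (rule pm(1)[OF elim(2)])
    have "(%(s, r). if 0 \<le> r \<and> r \<le> s then \<phi> r w else 0) \<in> borel_measurable (lborel \<Otimes>\<^sub>M lborel)"
    proof -
     have "(%z. if 0 \<le> snd z \<and> snd z \<le> fst z then (%s. \<phi> s w) (snd z) else 0) \<in> borel_measurable (lborel \<Otimes>\<^sub>M lborel)"
      by measurable
     then show ?thesis by (simp add: case_prod_beta')
    qed
    then have "(%s. \<integral>\<^sup>+r. (if 0 \<le> r \<and> r \<le> s then \<phi> r w else 0) \<partial>lborel) \<in> borel_measurable lborel"
     by (rule lborel.borel_measurable_nn_integral)
    moreover have "\<Phi> = (%s. \<integral>\<^sup>+r. (if 0 \<le> r \<and> r \<le> s then \<phi> r w else 0) \<partial>lborel)"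
     unfolding \<Phi>_def by (auto simp: fun_eq_iff indicator_def intro!: nn_integral_cong)
    ultimately show ?thesis by simp
   qed
   show ?case
   proof (cases "G = \<infinity>")
    case True
    then show ?thesis unfolding G_def[symmetric] by (simp add: ennreal_top_mult)
   next
    case False
    then obtain g where g: "G = ennreal g" "0 \<le> g" by (cases G) auto
    obtain M0 where M0: "(TI {0..T} (%s. ennreal ((wt w)^2 * (X s w)^2))) = ennreal M0" "0 \<le> M0"
    proof -
     have c: "continuous_on {0..T} (%s. (wt w)^2 * (X s w)^2)"
      by (intro continuous_on_mult continuous_on_power continuous_on_const X_path_cont)
     have "0 \<le> integral {0..T} (%s. (wt w)^2 * (X s w)^2)"
      by (intro integral_nonneg integrable_continuous_real c) simp
     then show ?thesis using nn_integral_Icc_continuous[OF c] that by simp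
    qed
    have bound: "\<Phi> s \<le> ennreal M0" if "s \<in> {0..T}" for s
     unfolding \<Phi>_def M0(1)[symmetric] \<phi>_def using that by (intro nn_integral_mono) (auto simp: indicator_def)
    have "\<Phi> T \<le> ennreal (g * exp (c1 * T))"
    proof (rule gronwall_bounded[OF g(2) c1 M0(2) bound])
     fix s assume s: "s \<in> {0..T}"
     have "\<Phi> s \<le> (TI {0..s} (%r. ennreal (3 * \<bar>X0 w\<bar> + c1 * T) + ennreal c1 * \<Phi> r + 3 * \<psi> r w))"
      unfolding \<Phi>_def[of s]
     proof (rule nn_integral_mono)
      fix r show "\<phi> r w * indicator {0..s} r \<le> (ennreal (3 * \<bar>X0 w\<bar> + c1 * T) + ennreal c1 * \<Phi> r + 3 * \<psi> r w) * indicator {0..s} r"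
       using elim(1) s unfolding \<Phi>_def by (cases "r \<in> {0..s}") auto
     qed
     also have "... = (\<integral>\<^sup>+r. ennreal (3 * \<bar>X0 w\<bar> + c1 * T) * indicator {0..s} r + ennreal c1 * (\<Phi> r * indicator {0..s} r) + 3 * (\<psi> r w * indicator {0..s} r) \<partial>lborel)"
      by (intro nn_integral_cong) (auto simp: indicator_def)
     also have "... = ennreal (3 * \<bar>X0 w\<bar> + c1 * T) * ennreal s + ennreal c1 * (TI {0..s} \<Phi>) + 3 * (TI {0..s} (%r. \<psi> r w))"
      using \<Phi>m pm(2)[OF elim(2)] s by (simp add: nn_integral_add nn_integral_cmult)
     also have "... \<le> ennreal (3 * \<bar>X0 w\<bar> + c1 * T) * ennreal T + ennreal c1 * (TI {0..s} \<Phi>) + 3 * (TI {0..T} (%r. \<psi> r w))"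
      using s by (intro add_mono mult_left_mono order_refl ennreal_leI nn_integral_mono) (auto simp: indicator_def)
     also have "... = G + ennreal c1 * (TI {0..s} \<Phi>)"
     proof -
      have "ennreal (3 * \<bar>X0 w\<bar> + c1 * T) * ennreal T = ennreal (T * (3 * \<bar>X0 w\<bar> + c1 * T))"
       using c1 T_pos by (subst ennreal_mult[symmetric]) (auto simp: mult.commute)
      then show ?thesis unfolding G_def by (simp only: ac_simps)
     qed
     finally show "\<Phi> s \<le> ennreal g + ennreal c1 * (TI {0..s} \<Phi>)" unfolding g .
    next
     show "T \<in> {0..T}" using T_pos by (simp add: less_imp_le)
    qed
    also have "... = G * ennreal (exp (c1 * T))" unfolding g using g by (simp add: ennreal_mult)
    finally show ?thesis unfolding G_def \<Phi>_def .
   qed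
  qed
 qed
 also have "... < \<infinity>"
 proof -
  have "(EE w. (TI {0..T} (%s. \<psi> s w))) = (TI {0..T} (%s. (EE w. \<psi> s w)))"
   by (rule nn_integral_swap_set[OF jm(2)]) simp
  also have "... \<le> (\<integral>\<^sup>+s. ennreal C * indicator {0..T} s \<partial>lborel)"
  proof (rule nn_integral_mono)
   fix s
   have "(EE w. \<psi> s w) \<le> ennreal C" if "s \<in> {0..T}"
   proof -
    have "(EE w. min (ennreal C) (energy s w)) \<le> (EE w. ennreal C)" by (intro nn_integral_mono) simp
    also have "... = ennreal C" by (simp add: emeasure_space_1)
    finally show ?thesis using psiC[OF that] by (rule order_trans[rotated])
   qed
   then show "(EE w. \<psi> s w) * indicator {0..T} s \<le> ennreal C * indicator {0..T} s" by (cases "s \<in> {0..T}") auto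
  qed
  also have "... < \<infinity>" using T_pos by (simp add: nn_integral_cmult_indicator ennreal_mult_less_top)
  finally have psi: "(EE w. (TI {0..T} (%s. \<psi> s w))) < \<infinity>" .
  have "(EE w. ennreal (T * (3 * \<bar>X0 w\<bar> + c1 * T))) < \<infinity>"
  proof -
   have "integrable M (%w. T * (3 * \<bar>X0 w\<bar> + c1 * T))" using X0_int by simp
   then have "(EE w. ennreal (T * (3 * \<bar>X0 w\<bar> + c1 * T))) = ennreal (expectation (%w. T * (3 * \<bar>X0 w\<bar> + c1 * T)))"
    using T_pos c1 by (intro nn_integral_eq_integral) auto
   then show ?thesis by simp
  qed
  then have "((EE w. ennreal (T * (3 * \<bar>X0 w\<bar> + c1 * T))) + 3 * (EE w. (TI {0..T} (%s. \<psi> s w)))) * ennreal (exp (c1 * T)) < \<infinity>"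
   using psi by (simp add: ennreal_mult_less_top)
  moreover have "(EE w. (ennreal (T * (3 * \<bar>X0 w\<bar> + c1 * T)) + 3 * (TI {0..T} (%s. \<psi> s w))) * ennreal (exp (c1 * T)))
    = ((EE w. ennreal (T * (3 * \<bar>X0 w\<bar> + c1 * T))) + 3 * (EE w. (TI {0..T} (%s. \<psi> s w)))) * ennreal (exp (c1 * T))"
  proof -
   have [measurable]: "(%w. ennreal (T * (3 * \<bar>X0 w\<bar> + c1 * T))) \<in> borel_measurable M" "(%w. (TI {0..T} (%s. \<psi> s w))) \<in> borel_measurable M"
    using im(2) by simp_all
   show ?thesis by (simp add: nn_integral_multc nn_integral_add nn_integral_cmult)
  qed
  ultimately show ?thesis by simp
 qed
 finally have fin: "(TI {0..T} (%s. (EE w. \<phi> s w))) < \<infinity>"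
  using nn_integral_swap_set[OF jm(1), of "{0..T}"] by simp
 have ineq: "(EE w. \<phi> s w) \<le> ennreal a + ennreal (c1 + 6 * K^2) * (TI {0..s} (%r. (EE w. \<phi> r w)))" if s: "s \<in> {0..T}" for s
 proof -
  have "(EE w. \<psi> s w) \<le> (EE w. min (ennreal C) (energy s w))" by (rule psiC[OF s])
  also have "... \<le> (EE w. (TI {0..s} (%r. (if energy r w < ennreal C then ennreal ((wt w)^2 * (H r w)^2) else 0))))"
   unfolding energy_def using s
   by (intro nn_integral_mono truncated_energy_le continuous_on_mult continuous_on_power continuous_on_const H_path_cont C) auto
  also have "... \<le> (EE w. ennreal (2 * K^2) * (ennreal T + (TI {0..s} (%r. \<phi> r w))))"
  proof (rule nn_integral_mono)
   fix w assume w: "w \<in> space M"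
   have "(TI {0..s} (%r. (if energy r w < ennreal C then ennreal ((wt w)^2 * (H r w)^2) else 0)))
    \<le> (\<integral>\<^sup>+r. ennreal (2 * K^2) * (indicator {0..s} r + \<phi> r w * indicator {0..s} r) \<partial>lborel)"
   proof (rule nn_integral_mono)
    fix r
    show "(if energy r w < ennreal C then ennreal ((wt w)^2 * (H r w)^2) else 0) * indicator {0..s} r \<le> ennreal (2 * K^2) * (indicator {0..s} r + \<phi> r w * indicator {0..s} r)"
     using weighted_growth[OF square_growth(1)[of r "X r w"], of w] unfolding \<phi>_def by (cases "r \<in> {0..s}") auto
   qed
   also have "... = ennreal (2 * K^2) * ((\<integral>\<^sup>+r. indicator {0..s} r \<partial>lborel) + (TI {0..s} (%r. \<phi> r w)))"
    using pm(1)[OF w] by (subst nn_integral_cmult) (simp_all add: nn_integral_add)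
   also have "... \<le> ennreal (2 * K^2) * (ennreal T + (TI {0..s} (%r. \<phi> r w)))"
    using s by (intro mult_left_mono add_mono order_refl) (auto intro!: ennreal_leI)
   finally show "(TI {0..s} (%r. (if energy r w < ennreal C then ennreal ((wt w)^2 * (H r w)^2) else 0)))
     \<le> ennreal (2 * K^2) * (ennreal T + (TI {0..s} (%r. \<phi> r w)))" .
  qed
  also have "... = ennreal (2 * K^2) * (ennreal T + (EE w. (TI {0..s} (%r. \<phi> r w))))"
   using im(1)[of s] by (simp add: nn_integral_cmult nn_integral_add emeasure_space_1)
  also have "(EE w. (TI {0..s} (%r. \<phi> r w))) = (TI {0..s} (%r. (EE w. \<phi> r w)))"
   by (rule nn_integral_swap_set[OF jm(1)]) simp
  finally have psi: "(EE w. \<psi> s w) \<le> ennreal (2 * K^2) * (ennreal T + (TI {0..s} (%r. (EE w. \<phi> r w))))" .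
  let ?V = "TI {0..s} (%r. (EE w. \<phi> r w))"
  have "(EE w. \<phi> s w) \<le> (EE w. ennreal (3 * \<bar>X0 w\<bar> + c1 * T) + ennreal c1 * (TI {0..s} (%r. \<phi> r w)) + 3 * \<psi> s w)"
  proof (rule nn_integral_mono_AE)
   show "AE w in M. \<phi> s w \<le> ennreal (3 * \<bar>X0 w\<bar> + c1 * T) + ennreal c1 * (TI {0..s} (%r. \<phi> r w)) + 3 * \<psi> s w"
    using path by eventually_elim (use s in blast)
  qed
  also have "... = (EE w. ennreal (3 * \<bar>X0 w\<bar> + c1 * T)) + ennreal c1 * ?V + 3 * (EE w. \<psi> s w)"
   using im(1)[of s] sm(2)[of s] nn_integral_swap_set[OF jm(1), of "{0..s}"]
   by (simp add: nn_integral_cmult nn_integral_add)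
  also have "(EE w. ennreal (3 * \<bar>X0 w\<bar> + c1 * T)) = ennreal (3 * expectation (%w. \<bar>X0 w\<bar>) + c1 * T)"
   using X0_int c1 T_pos by (subst nn_integral_eq_integral) (auto simp: prob_space)
  also have "ennreal (3 * expectation (%w. \<bar>X0 w\<bar>) + c1 * T) + ennreal c1 * ?V + 3 * (EE w. \<psi> s w)
    \<le> ennreal (3 * expectation (%w. \<bar>X0 w\<bar>) + c1 * T) + ennreal c1 * ?V + 3 * (ennreal (2 * K^2) * (ennreal T + ?V))"
   using psi by (intro add_mono mult_left_mono order_refl) auto
  also have "... = ennreal (3 * expectation (%w. \<bar>X0 w\<bar>) + c1 * T) + ennreal c1 * ?V + ennreal (6 * K^2) * (ennreal T + ?V)"
   by (simp only: mult.assoc[symmetric] k6)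
  also have "... = (ennreal (3 * expectation (%w. \<bar>X0 w\<bar>) + c1 * T) + ennreal (6 * K^2) * ennreal T) + (ennreal c1 + ennreal (6 * K^2)) * ?V"
   by (simp only: distrib_left distrib_right ac_simps)
  also have "ennreal (3 * expectation (%w. \<bar>X0 w\<bar>) + c1 * T) + ennreal (6 * K^2) * ennreal T = ennreal a"
   unfolding a_def using c1 T_pos E0 by (simp add: ennreal_mult''[symmetric] ennreal_plus[symmetric] del: ennreal_plus)
  also have "ennreal c1 + ennreal (6 * K^2) = ennreal (c1 + 6 * K^2)"
   using c1 by (simp add: ennreal_plus)
  finally show ?thesis .
 qed
 from gronwall_integrable[OF a _ fin ineq t] c1 show ?thesis unfolding \<phi>_def by simp
qed

lemma moment_bound: "\<exists>K1\<ge>0. \<forall>t\<in>{0..T}. (EE w. ennreal ((wt w)^2 * (X t w)^2)) \<le> ennreal K1"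
proof -
 define c where "c = 6 * T * K^2 + 6 * K^2"
 define a where "a = 3 * expectation (%w. \<bar>X0 w\<bar>) + 6 * T * K^2 * T + 6 * K^2 * T"
 have c: "0 \<le> c" unfolding c_def using T_pos by simp
 have a: "0 \<le> a" unfolding a_def using T_pos by simp
 have "(EE w. ennreal ((wt w)^2 * (X t w)^2)) \<le> ennreal (a * exp (c * T))" if t: "t \<in> {0..T}" for t
 proof (rule nn_integral_le_of_level_sets[OF _ energy_meas[of t]])
  show "(%w. ennreal ((wt w)^2 * (X t w)^2)) \<in> borel_measurable M" using X_meas[of t] by measurable
  show "AE w in M. energy t w < \<infinity>" using energy_finite by simp
  fix n :: nat
  have "(EE w. (if energy t w < ennreal (real n) then ennreal ((wt w)^2 * (X t w)^2) else 0)) \<le> ennreal (a * exp (c * t))"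
   using truncated_moment_bound[OF _ t, of "real n"] unfolding a_def c_def by simp
  also have "... \<le> ennreal (a * exp (c * T))" using t a c by (intro ennreal_leI mult_left_mono) (auto intro: mult_left_mono)
  finally show "(EE w. (if energy t w < of_nat n then ennreal ((wt w)^2 * (X t w)^2) else 0)) \<le> ennreal (a * exp (c * T))"
   by (simp only: ennreal_of_nat_eq_real_of_nat)
 qed
 moreover have "0 \<le> a * exp (c * T)" using a by simp
 ultimately show ?thesis by blast
qed

end

section \<open>Small-time behaviour of the increments\<close>

context regular_solution
begin

lemma LINT_B_split:
 assumes "0 \<le> s" "s \<le> t"
 shows "(LINT r:{0..t}|lborel. B r w) = (LINT r:{0..s}|lborel. B r w) + (LINT r:{s..t}|lborel. B r w)"
proof -
 have i: "(LINT r:{u..v}|lborel. B r w) = integral {u..v} (%r. B r w)" for u v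
  by (rule set_borel_integral_eq_integral(2)[OF borel_integrable_atLeastAtMost'[OF B_path_cont]])
 show ?thesis unfolding i
  by (rule Henstock_Kurzweil_Integration.integral_combine[OF assms integrable_continuous_real[OF B_path_cont], symmetric])
qed

lemma X_joint': "(%z. X (snd z) (fst z)) \<in> borel_measurable (M \<Otimes>\<^sub>M lborel)" "(%z. H (snd z) (fst z)) \<in> borel_measurable (M \<Otimes>\<^sub>M lborel)"
 using joint_measurable(1,3) by (simp_all add: case_prod_beta')

lemma growth_integral_le:
 assumes K1: "\<And>t. t \<in> {0..T} ==> (EE w. ennreal ((wt w)^2 * (X t w)^2)) \<le> ennreal K1" and K1n: "0 \<le> K1"
  and st: "0 \<le> s" "s \<le> t" "t \<le> T"
 shows "(EE w. (TI {s..t} (%r. ennreal (2 * K^2) * (1 + ennreal ((wt w)^2 * (X r w)^2))))) \<le> ennreal (2 * K^2 * (1 + K1) * (t - s))"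
proof -
 have jm: "(%(w, r). ennreal (2 * K^2) * (1 + ennreal ((wt w)^2 * (X r w)^2))) \<in> borel_measurable (M \<Otimes>\<^sub>M lborel)"
 proof -
  note [measurable] = X_joint'
  have "(%z. ennreal (2 * K^2) * (1 + ennreal ((wt (fst z))^2 * (X (snd z) (fst z))^2))) \<in> borel_measurable (M \<Otimes>\<^sub>M lborel)" by measurable
  then show ?thesis by (simp add: case_prod_beta')
 qed
 have "(EE w. (TI {s..t} (%r. ennreal (2 * K^2) * (1 + ennreal ((wt w)^2 * (X r w)^2)))))
   = (TI {s..t} (%r. (EE w. ennreal (2 * K^2) * (1 + ennreal ((wt w)^2 * (X r w)^2)))))"
  by (rule nn_integral_swap_set[OF jm]) simp
 also have "... \<le> (\<integral>\<^sup>+r. ennreal (2 * K^2 * (1 + K1)) * indicator {s..t} r \<partial>lborel)"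
 proof (rule nn_integral_mono)
  fix r
  have "(EE w. ennreal (2 * K^2) * (1 + ennreal ((wt w)^2 * (X r w)^2))) \<le> ennreal (2 * K^2 * (1 + K1))" if r: "r \<in> {s..t}"
  proof -
   have [measurable]: "X r \<in> borel_measurable M" by (rule X_meas)
   have "(EE w. ennreal (2 * K^2) * (1 + ennreal ((wt w)^2 * (X r w)^2))) = ennreal (2 * K^2) * (1 + (EE w. ennreal ((wt w)^2 * (X r w)^2)))"
    by (simp add: nn_integral_cmult nn_integral_add emeasure_space_1)
   also have "... \<le> ennreal (2 * K^2) * (1 + ennreal K1)"
    using K1[of r] r st by (intro mult_left_mono add_mono) auto
   also have "... = ennreal (2 * K^2 * (1 + K1))"
    using ennreal_mult[of "2 * K^2" "1 + K1"] ennreal_plus[of 1 K1] K1n by simp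
   finally show ?thesis .
  qed
  then show "(EE w. ennreal (2 * K^2) * (1 + ennreal ((wt w)^2 * (X r w)^2))) * indicator {s..t} r \<le> ennreal (2 * K^2 * (1 + K1)) * indicator {s..t} r"
   by (cases "r \<in> {s..t}") auto
 qed
 also have "... = ennreal (2 * K^2 * (1 + K1) * (t - s))"
  using st K1n by (simp add: nn_integral_cmult_indicator ennreal_mult[symmetric])
 finally show ?thesis .
qed

lemma drift_bound: "\<exists>Kd\<ge>0. \<forall>s t. 0 \<le> s --> s \<le> t --> t \<le> T -->
  (EE w. ennreal ((wt w)^2 * (LINT r:{s..t}|lborel. B r w)^2)) \<le> ennreal (Kd * (t - s)^2) \<and>
  (EE w. ennreal ((wt w)^2 * (I t w - I s w)^2)) \<le> ennreal (Kd * (t - s))"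
proof -
 obtain K1 where K1: "0 \<le> K1" "\<And>t. t \<in> {0..T} ==> (EE w. ennreal ((wt w)^2 * (X t w)^2)) \<le> ennreal K1"
  using moment_bound by blast
 define Kd where "Kd = 2 * K^2 * (1 + K1)"
 have Kd: "0 \<le> Kd" using K1 by (simp add: Kd_def)
 have "(EE w. ennreal ((wt w)^2 * (LINT r:{s..t}|lborel. B r w)^2)) \<le> ennreal (Kd * (t - s)^2) \<and>
  (EE w. ennreal ((wt w)^2 * (I t w - I s w)^2)) \<le> ennreal (Kd * (t - s))" if st: "0 \<le> s" "s \<le> t" "t \<le> T" for s t
 proof
  note Q = growth_integral_le[OF K1(2,1) st]
  have qm: "(%w. (TI {s..t} (%r. ennreal (2 * K^2) * (1 + ennreal ((wt w)^2 * (X r w)^2))))) \<in> borel_measurable M"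
  proof -
   note [measurable] = X_joint'
   have "(%z. ennreal (2 * K^2) * (1 + ennreal ((wt (fst z))^2 * (X (snd z) (fst z))^2)) * indicator {s..t} (snd z)) \<in> borel_measurable (M \<Otimes>\<^sub>M lborel)" by measurable
   then show ?thesis by (intro lborel.borel_measurable_nn_integral) (simp add: case_prod_beta')
  qed
  have "(EE w. ennreal ((wt w)^2 * (LINT r:{s..t}|lborel. B r w)^2))
    \<le> (EE w. ennreal (t - s) * (TI {s..t} (%r. ennreal (2 * K^2) * (1 + ennreal ((wt w)^2 * (X r w)^2)))))"
   by (intro nn_integral_mono weighted_drift_le st)
  also have "... = ennreal (t - s) * (EE w. (TI {s..t} (%r. ennreal (2 * K^2) * (1 + ennreal ((wt w)^2 * (X r w)^2)))))"
   by (rule nn_integral_cmult[OF qm])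
  also have "... \<le> ennreal (t - s) * ennreal (Kd * (t - s))" unfolding Kd_def by (rule mult_left_mono[OF Q zero_le])
  also have "... = ennreal (Kd * (t - s)^2)"
   using st Kd by (subst ennreal_mult[symmetric]) (auto simp: power2_eq_square mult.commute mult.left_commute)
  finally show "(EE w. ennreal ((wt w)^2 * (LINT r:{s..t}|lborel. B r w)^2)) \<le> ennreal (Kd * (t - s)^2)" .
  have s: "s \<in> {0..T}" using st by auto
  have "(EE w. ennreal ((wt w)^2 * (I t w - I s w - 0 * (W t w - W s w))^2))
   \<le> (EE w. (TI {s..t} (%r. ennreal ((wt w)^2 * (H r w - 0)^2))))"
   by (rule ito_inequality_between[OF st wt_F[OF s] wt_bounded]) auto
  also have "... \<le> (EE w. (TI {s..t} (%r. ennreal (2 * K^2) * (1 + ennreal ((wt w)^2 * (X r w)^2)))))"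
  proof (intro nn_integral_mono)
   fix w r
   show "ennreal ((wt w)^2 * (H r w - 0)^2) * indicator {s..t} r \<le> ennreal (2 * K^2) * (1 + ennreal ((wt w)^2 * (X r w)^2)) * indicator {s..t} r"
    using weighted_growth[OF square_growth(1)[of r "X r w"], of w] by (cases "r \<in> {s..t}") auto
  qed
  also have "... \<le> ennreal (Kd * (t - s))" unfolding Kd_def by (rule Q)
  finally show "(EE w. ennreal ((wt w)^2 * (I t w - I s w)^2)) \<le> ennreal (Kd * (t - s))" by simp
 qed
 then show ?thesis using Kd by blast
qed

lemma square_sum2_le: "((x::real) + y)^2 \<le> 2 * x^2 + 2 * y^2"
proof -
 have "0 \<le> (x - y)^2" by simp
 then show ?thesis by (simp add: power2_eq_square algebra_simps)
qed

lemma nn_integral_weighted_sum_le: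
 assumes [measurable]: "f \<in> borel_measurable M" "g \<in> borel_measurable M"
  and le: "AE w in M. (h w)^2 \<le> 2 * (f w)^2 + 2 * (g w)^2"
 shows "(EE w. ennreal ((wt w)^2 * (h w)^2)) \<le> 2 * (EE w. ennreal ((wt w)^2 * (f w)^2)) + 2 * (EE w. ennreal ((wt w)^2 * (g w)^2))"
proof -
 have "(EE w. ennreal ((wt w)^2 * (h w)^2)) \<le> (EE w. 2 * ennreal ((wt w)^2 * (f w)^2) + 2 * ennreal ((wt w)^2 * (g w)^2))"
 proof (rule nn_integral_mono_AE)
  show "AE w in M. ennreal ((wt w)^2 * (h w)^2) \<le> 2 * ennreal ((wt w)^2 * (f w)^2) + 2 * ennreal ((wt w)^2 * (g w)^2)"
   using le
  proof eventually_elim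
   case (elim w)
   have "ennreal ((wt w)^2 * (h w)^2) \<le> ennreal ((wt w)^2 * (2 * (f w)^2 + 2 * (g w)^2))"
    using elim by (intro ennreal_leI mult_left_mono) auto
   also have "(wt w)^2 * (2 * (f w)^2 + 2 * (g w)^2) = 2 * ((wt w)^2 * (f w)^2) + 2 * ((wt w)^2 * (g w)^2)" by (simp add: algebra_simps)
   also have "ennreal ... = 2 * ennreal ((wt w)^2 * (f w)^2) + 2 * ennreal ((wt w)^2 * (g w)^2)"
    by (simp add: ennreal_plus ennreal_mult'[of 2])
   finally show ?case .
  qed
 qed
 also have "... = 2 * (EE w. ennreal ((wt w)^2 * (f w)^2)) + 2 * (EE w. ennreal ((wt w)^2 * (g w)^2))"
  by (simp add: nn_integral_add nn_integral_cmult)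
 finally show ?thesis .
qed

lemma LINT_B_measurable: "(%w. LINT r:{s..t}|lborel. B r w) \<in> borel_measurable M"
proof -
 have [measurable]: "(%z. B (snd z) (fst z)) \<in> borel_measurable (M \<Otimes>\<^sub>M lborel)" using joint_measurable(4) by (simp add: case_prod_beta')
 have "(%z. indicator {s..t} (snd z) *\<^sub>R B (snd z) (fst z)) \<in> borel_measurable (M \<Otimes>\<^sub>M lborel)" by measurable
 then show ?thesis unfolding set_lebesgue_integral_def
  by (intro lborel.borel_measurable_lebesgue_integral) (simp add: case_prod_beta')
qed

lemma X_increment:
 assumes "0 \<le> s" "s \<le> t" "t \<le> T"
 shows "AE w in M. X t w - X s w = (LINT r:{s..t}|lborel. B r w) + (I t w - I s w)"
 using X_eq
proof eventually_elim
 case (elim w)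
 have "s \<in> {0..T}" "t \<in> {0..T}" using assms by auto
 then show ?case using elim LINT_B_split[OF assms(1,2), of w] by simp
qed

lemma increment_bound: "\<exists>K2\<ge>0. \<forall>s t. 0 \<le> s --> s \<le> t --> t \<le> T -->
  (EE w. ennreal ((wt w)^2 * (X t w - X s w)^2)) \<le> ennreal (K2 * (t - s))"
proof -
 obtain Kd where Kd: "0 \<le> Kd" "\<And>s t. 0 \<le> s ==> s \<le> t ==> t \<le> T ==>
  (EE w. ennreal ((wt w)^2 * (LINT r:{s..t}|lborel. B r w)^2)) \<le> ennreal (Kd * (t - s)^2)"
  "\<And>s t. 0 \<le> s ==> s \<le> t ==> t \<le> T ==> (EE w. ennreal ((wt w)^2 * (I t w - I s w)^2)) \<le> ennreal (Kd * (t - s))"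
  using drift_bound by blast
 have "(EE w. ennreal ((wt w)^2 * (X t w - X s w)^2)) \<le> ennreal (2 * Kd * (T + 1) * (t - s))" if st: "0 \<le> s" "s \<le> t" "t \<le> T" for s t
 proof -
  have "(EE w. ennreal ((wt w)^2 * (X t w - X s w)^2))
    \<le> 2 * (EE w. ennreal ((wt w)^2 * (LINT r:{s..t}|lborel. B r w)^2)) + 2 * (EE w. ennreal ((wt w)^2 * (I t w - I s w)^2))"
  proof (rule nn_integral_weighted_sum_le)
   show "AE w in M. (X t w - X s w)^2 \<le> 2 * (LINT r:{s..t}|lborel. B r w)^2 + 2 * (I t w - I s w)^2"
    using X_increment[OF st]
   proof eventually_elim
    case (elim w) show ?case unfolding elim by (rule square_sum2_le)
   qed
   show "(%w. I t w - I s w) \<in> borel_measurable M" by (intro borel_measurable_diff I_meas)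
  qed (rule LINT_B_measurable)
  also have "... \<le> 2 * ennreal (Kd * (t - s)^2) + 2 * ennreal (Kd * (t - s))"
   by (intro add_mono mult_left_mono Kd(2,3) st) auto
  also have "... = ennreal (2 * (Kd * (t - s)^2) + 2 * (Kd * (t - s)))"
   using Kd(1) st by (simp add: ennreal_plus ennreal_mult'[of 2])
  also have "... \<le> ennreal (2 * Kd * (T + 1) * (t - s))"
  proof (rule ennreal_leI)
   have "Kd * (t - s)^2 \<le> Kd * (T * (t - s))"
    unfolding power2_eq_square using st Kd(1) by (intro mult_left_mono mult_right_mono) auto
   then show "2 * (Kd * (t - s)^2) + 2 * (Kd * (t - s)) \<le> 2 * Kd * (T + 1) * (t - s)" by (simp add: algebra_simps)
  qed
  finally show ?thesis .
 qed
 moreover have "0 \<le> 2 * Kd * (T + 1)" using Kd(1) T_pos by simp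
 ultimately show ?thesis by blast
qed

text \<open>A weighted second moment controls the first moment, by the arithmetic-geometric mean inequality.\<close>

lemma first_moment_le:
 assumes [measurable]: "D \<in> borel_measurable M" and e: "0 < e"
  and le: "(EE w. ennreal ((wt w)^2 * (D w)^2)) \<le> ennreal (e^2)"
 shows "integrable M D" "expectation (%w. \<bar>D w\<bar>) \<le> e * (1 + expectation (%w. \<bar>X0 w\<bar>))"
proof -
 have ig: "integrable M (%w. (wt w)^2 * (D w)^2)"
  using le by (intro integrableI_nonneg) (auto intro: le_less_trans)
 have Eg: "expectation (%w. (wt w)^2 * (D w)^2) \<le> e^2"
  using le ig by (subst (asm) nn_integral_eq_integral) (auto simp: ennreal_le_iff)
 have pt: "\<bar>D w\<bar> \<le> (wt w)^2 * (D w)^2 / (2 * e) + e / 2 * (1 + \<bar>X0 w\<bar>)" for w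
 proof -
  let ?q = "1 + \<bar>X0 w\<bar>"
  have q: "0 < ?q" by (rule add_pos_nonneg) auto
  have "0 \<le> (\<bar>D w\<bar> - e * ?q)^2" by simp
  then have "2 * (\<bar>D w\<bar> * (e * ?q)) \<le> (D w)^2 + (e * ?q)^2" by (simp add: power2_diff mult.assoc)
  then have "\<bar>D w\<bar> * (2 * e * ?q) / (2 * e * ?q) \<le> ((D w)^2 + (e * ?q)^2) / (2 * e * ?q)"
   using e q by (intro divide_right_mono) (auto simp: mult_ac)
  moreover have "\<bar>D w\<bar> * (2 * e * ?q) / (2 * e * ?q) = \<bar>D w\<bar>" using e q by simp
  moreover have "((D w)^2 + (e * ?q)^2) / (2 * e * ?q) = (D w)^2 / ?q / (2 * e) + e / 2 * ?q"
  proof -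
   have "(x^2 + (e * y)^2) / (2 * e * y) = x^2 / y / (2 * e) + e / 2 * y" if "0 < y" for x y
    using e that by (simp add: field_simps power2_eq_square)
   from this[OF q] show ?thesis .
  qed
  ultimately show ?thesis unfolding wt_props(3) by simp
 qed
 have ib: "integrable M (%w. (wt w)^2 * (D w)^2 / (2 * e) + e / 2 * (1 + \<bar>X0 w\<bar>))"
  using ig X0_int by simp
 show iD: "integrable M D"
 proof (rule Bochner_Integration.integrable_bound[OF ib])
  show "AE w in M. norm (D w) \<le> norm ((wt w)^2 * (D w)^2 / (2 * e) + e / 2 * (1 + \<bar>X0 w\<bar>))"
   using pt by (intro AE_I2) (metis abs_ge_self order_trans real_norm_def)
 qed simp
 have "expectation (%w. \<bar>D w\<bar>) \<le> expectation (%w. (wt w)^2 * (D w)^2 / (2 * e) + e / 2 * (1 + \<bar>X0 w\<bar>))"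
  using iD ib pt by (intro integral_mono) auto
 also have "... = expectation (%w. (wt w)^2 * (D w)^2) / (2 * e) + e / 2 * (1 + expectation (%w. \<bar>X0 w\<bar>))"
  using ig X0_int by (simp add: prob_space)
 also have "... \<le> e^2 / (2 * e) + e / 2 * (1 + expectation (%w. \<bar>X0 w\<bar>))"
  using Eg e by (intro add_right_mono divide_right_mono) auto
 also have "... = e / 2 + e / 2 * (1 + expectation (%w. \<bar>X0 w\<bar>))" using e by (simp add: power2_eq_square)
 also have "... \<le> e * (1 + expectation (%w. \<bar>X0 w\<bar>))"
 proof -
  have "0 \<le> e * expectation (%w. \<bar>X0 w\<bar>)" using e by (intro mult_nonneg_nonneg) auto
  then show ?thesis by (simp add: distrib_left)
 qed
 finally show "expectation (%w. \<bar>D w\<bar>) \<le> e * (1 + expectation (%w. \<bar>X0 w\<bar>))" .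
qed

lemma X_integrable: "t \<in> {0..T} ==> integrable M (X t)"
proof -
 assume t: "t \<in> {0..T}"
 obtain K1 where K1: "0 \<le> K1" "\<And>t. t \<in> {0..T} ==> (EE w. ennreal ((wt w)^2 * (X t w)^2)) \<le> ennreal K1"
  using moment_bound by blast
 have "(EE w. ennreal ((wt w)^2 * (X t w)^2)) \<le> ennreal ((sqrt (K1 + 1))^2)"
  using K1(1) by (intro order_trans[OF K1(2)[OF t]] ennreal_leI) simp
 then show ?thesis by (rule first_moment_le(1)[OF X_meas, rotated]) (use K1 in simp)
qed

lemma H_integrable: "t \<in> {0..T} ==> integrable M (H t)"
proof (rule Bochner_Integration.integrable_bound)
 assume "t \<in> {0..T}"
 then show "integrable M (%w. K * (1 + \<bar>X t w\<bar>))" using X_integrable by simp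
 show "AE w in M. norm (H t w) \<le> norm (K * (1 + \<bar>X t w\<bar>))"
  using \<sigma>_growth by (intro AE_I2) (metis abs_ge_self order_trans real_norm_def)
qed (rule H_meas)

text \<open>The weighted mean square modulus of continuity of the integrand at time \<open>s\<close>.\<close>

definition \<rho> :: "real => real => ennreal" where "\<rho> s r = (EE w. ennreal ((wt w)^2 * (H r w - H s w)^2))"

lemma \<rho>_tendsto:
 assumes s: "s \<in> {0..T}" and r: "\<And>n. r n \<in> {0..T}" and lim: "r \<longlonglongrightarrow> s"
 shows "(%n. \<rho> s (r n)) \<longlonglongrightarrow> 0"
proof -
 obtain K2 where K2: "0 \<le> K2" "\<And>s t. 0 \<le> s ==> s \<le> t ==> t \<le> T ==>
  (EE w. ennreal ((wt w)^2 * (X t w - X s w)^2)) \<le> ennreal (K2 * (t - s))"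
  using increment_bound by blast
 obtain K1 where K1: "0 \<le> K1" "\<And>t. t \<in> {0..T} ==> (EE w. ennreal ((wt w)^2 * (X t w)^2)) \<le> ennreal K1"
  using moment_bound by blast
 have Xm [measurable]: "X t \<in> borel_measurable M" for t by (rule X_meas)
 have inc: "(EE w. ennreal ((wt w)^2 * (X t w - X s w)^2)) \<le> ennreal (K2 * \<bar>t - s\<bar>)" if t: "t \<in> {0..T}" for t
 proof (cases "s \<le> t")
  case True then show ?thesis using K2(2)[of s t] s t by simp
 next
  case False then show ?thesis using K2(2)[of t s] s t by (simp add: power2_commute)
 qed
 define u where "u n = (EE w. ennreal ((wt w)^2 * (\<sigma> (r n) (X s w) - \<sigma> s (X s w))^2))" for n
 have sm [measurable]: "(%w. \<sigma> t (X s w)) \<in> borel_measurable M" for t by (rule measurable_compose[OF X_meas \<sigma>_borel])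
 have "u \<longlonglongrightarrow> (EE w. 0)" unfolding u_def
 proof (rule nn_integral_dominated_convergence[where w="%w. 4 * (ennreal (2 * K^2) * (1 + ennreal ((wt w)^2 * (X s w)^2)))"])
  show "(EE w. 4 * (ennreal (2 * K^2) * (1 + ennreal ((wt w)^2 * (X s w)^2)))) < \<infinity>"
  proof -
   have "(EE w. ennreal ((wt w)^2 * (X s w)^2)) < \<infinity>" using K1(2)[OF s] by (auto intro: le_less_trans)
   then show ?thesis by (simp add: nn_integral_cmult nn_integral_add emeasure_space_1 ennreal_mult_less_top)
  qed
  show "AE w in M. ennreal ((wt w)^2 * (\<sigma> (r n) (X s w) - \<sigma> s (X s w))^2) \<le> 4 * (ennreal (2 * K^2) * (1 + ennreal ((wt w)^2 * (X s w)^2)))" for n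
  proof (rule AE_I2)
   fix w
   have "(wt w)^2 * (\<sigma> (r n) (X s w) - \<sigma> s (X s w))^2 \<le> (wt w)^2 * (2 * (\<sigma> (r n) (X s w))^2 + 2 * (\<sigma> s (X s w))^2)"
    using square_sum2_le[of "\<sigma> (r n) (X s w)" "- \<sigma> s (X s w)"] by (intro mult_left_mono) auto
   also have "... = 2 * ((wt w)^2 * (\<sigma> (r n) (X s w))^2) + 2 * ((wt w)^2 * (\<sigma> s (X s w))^2)" by (simp add: algebra_simps)
   finally have "ennreal ((wt w)^2 * (\<sigma> (r n) (X s w) - \<sigma> s (X s w))^2) \<le> ennreal (2 * ((wt w)^2 * (\<sigma> (r n) (X s w))^2) + 2 * ((wt w)^2 * (\<sigma> s (X s w))^2))"
    by (rule ennreal_leI)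
   also have "... = 2 * ennreal ((wt w)^2 * (\<sigma> (r n) (X s w))^2) + 2 * ennreal ((wt w)^2 * (\<sigma> s (X s w))^2)"
    by (simp add: ennreal_plus ennreal_mult'[of 2])
   also have "... \<le> 2 * (ennreal (2 * K^2) * (1 + ennreal ((wt w)^2 * (X s w)^2))) + 2 * (ennreal (2 * K^2) * (1 + ennreal ((wt w)^2 * (X s w)^2)))"
    by (intro add_mono mult_left_mono weighted_growth square_growth) auto
   also have "... = 4 * (ennreal (2 * K^2) * (1 + ennreal ((wt w)^2 * (X s w)^2)))"
    by (simp only: distrib_right[symmetric]) simp
   finally show "ennreal ((wt w)^2 * (\<sigma> (r n) (X s w) - \<sigma> s (X s w))^2) \<le> 4 * (ennreal (2 * K^2) * (1 + ennreal ((wt w)^2 * (X s w)^2)))" .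
  qed
  show "AE w in M. (%n. ennreal ((wt w)^2 * (\<sigma> (r n) (X s w) - \<sigma> s (X s w))^2)) \<longlonglongrightarrow> 0"
  proof (rule AE_I2)
   fix w
   have "(%n. (%(t, x). \<sigma> t x) (r n, X s w)) \<longlonglongrightarrow> (%(t, x). \<sigma> t x) (s, X s w)"
    by (rule continuous_on_tendsto_compose[OF \<sigma>_cont]) (auto intro!: tendsto_Pair lim)
   then have "(%n. \<sigma> (r n) (X s w)) \<longlonglongrightarrow> \<sigma> s (X s w)" by simp
   then have "(%n. ennreal ((wt w)^2 * (\<sigma> (r n) (X s w) - \<sigma> s (X s w))^2)) \<longlonglongrightarrow> ennreal ((wt w)^2 * (\<sigma> s (X s w) - \<sigma> s (X s w))^2)"
    by (intro tendsto_intros tendsto_ennrealI)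
   then show "(%n. ennreal ((wt w)^2 * (\<sigma> (r n) (X s w) - \<sigma> s (X s w))^2)) \<longlonglongrightarrow> 0" by simp
  qed
 qed measurable
 then have u0: "u \<longlonglongrightarrow> 0" by simp
 have le: "\<rho> s (r n) \<le> 2 * ennreal (K^2 * K2 * \<bar>r n - s\<bar>) + 2 * u n" for n
 proof -
  have "\<rho> s (r n) \<le> 2 * (EE w. ennreal ((wt w)^2 * (K * (X (r n) w - X s w))^2)) + 2 * u n"
   unfolding \<rho>_def u_def
  proof (rule nn_integral_weighted_sum_le)
   show "AE w in M. (H (r n) w - H s w)^2 \<le> 2 * (K * (X (r n) w - X s w))^2 + 2 * (\<sigma> (r n) (X s w) - \<sigma> s (X s w))^2"
   proof (rule AE_I2)
    fix w
    have "(H (r n) w - H s w)^2 = ((H (r n) w - \<sigma> (r n) (X s w)) + (\<sigma> (r n) (X s w) - H s w))^2" by simp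
    also have "... \<le> 2 * (H (r n) w - \<sigma> (r n) (X s w))^2 + 2 * (\<sigma> (r n) (X s w) - H s w)^2" by (rule square_sum2_le)
    also have "(H (r n) w - \<sigma> (r n) (X s w))^2 \<le> (K * (X (r n) w - X s w))^2"
    proof -
     have "\<bar>H (r n) w - \<sigma> (r n) (X s w)\<bar> \<le> \<bar>K * (X (r n) w - X s w)\<bar>"
      using \<sigma>_lipschitz[of "r n" "X (r n) w" "X s w"] K_nonneg by (simp add: abs_mult)
     then show ?thesis by (simp only: abs_le_square_iff)
    qed
    finally show "(H (r n) w - H s w)^2 \<le> 2 * (K * (X (r n) w - X s w))^2 + 2 * (\<sigma> (r n) (X s w) - \<sigma> s (X s w))^2" by simp
   qed
  qed measurable
  also have "(EE w. ennreal ((wt w)^2 * (K * (X (r n) w - X s w))^2)) = (EE w. ennreal (K^2) * ennreal ((wt w)^2 * (X (r n) w - X s w)^2))"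
   by (intro nn_integral_cong) (simp add: ennreal_mult[symmetric] power_mult_distrib mult.left_commute)
  also have "... = ennreal (K^2) * (EE w. ennreal ((wt w)^2 * (X (r n) w - X s w)^2))" by (rule nn_integral_cmult) measurable
  also have "2 * ... + 2 * u n \<le> 2 * (ennreal (K^2) * ennreal (K2 * \<bar>r n - s\<bar>)) + 2 * u n"
   by (intro add_mono mult_left_mono inc r order_refl) auto
  also have "ennreal (K^2) * ennreal (K2 * \<bar>r n - s\<bar>) = ennreal (K^2 * K2 * \<bar>r n - s\<bar>)"
   using K2(1) by (simp add: ennreal_mult[symmetric] mult.assoc)
  finally show ?thesis .
 qed
 have "(%n. 2 * ennreal (K^2 * K2 * \<bar>r n - s\<bar>) + 2 * u n) \<longlonglongrightarrow> 2 * ennreal (K^2 * K2 * \<bar>s - s\<bar>) + 2 * 0"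
  by (intro tendsto_add tendsto_mult_ennreal tendsto_const tendsto_ennrealI tendsto_mult tendsto_rabs tendsto_diff lim u0) auto
 then have up: "(%n. 2 * ennreal (K^2 * K2 * \<bar>r n - s\<bar>) + 2 * u n) \<longlonglongrightarrow> 0" by simp
 show ?thesis
  by (rule tendsto_sandwich[OF _ _ tendsto_const up]) (auto intro!: always_eventually le)
qed

lemma \<rho>_small:
 assumes s: "s \<in> {0..T}" and e: "0 < e"
 shows "\<exists>\<delta>>0. \<forall>r\<in>{0..T}. \<bar>r - s\<bar> < \<delta> --> \<rho> s r \<le> ennreal e"
proof (rule ccontr)
 assume "\<not> ?thesis"
 then have "\<exists>r\<in>{0..T}. \<bar>r - s\<bar> < \<delta> \<and> \<not> \<rho> s r \<le> ennreal e" if "0 < \<delta>" for \<delta> using that by blast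
 then have "\<forall>n. \<exists>r\<in>{0..T}. \<bar>r - s\<bar> < inverse (real (Suc n)) \<and> \<not> \<rho> s r \<le> ennreal e" by simp
 then obtain r where r: "\<And>n. r n \<in> {0..T}" "\<And>n. \<bar>r n - s\<bar> < inverse (real (Suc n))" "\<And>n. \<not> \<rho> s (r n) \<le> ennreal e" by metis
 have "(%n. r n - s) \<longlonglongrightarrow> 0"
  by (rule Lim_null_comparison[OF _ LIMSEQ_inverse_real_of_nat], intro always_eventually allI)
   (simp only: real_norm_def less_imp_le[OF r(2)])
 then have "r \<longlonglongrightarrow> s" by (simp add: LIM_zero_iff)
 from \<rho>_tendsto[OF s r(1) this] have "\<forall>\<^sub>F n in sequentially. \<rho> s (r n) < ennreal e"
  using e by (intro order_tendstoD(2)) auto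
 then obtain N where "\<forall>n\<ge>N. \<rho> s (r n) < ennreal e" unfolding eventually_sequentially by blast
 then have "\<rho> s (r N) < ennreal e" by blast
 then show False using r(3)[of N] by (simp only: less_imp_le not_True_eq_False)
qed

lemma expectation_H_diff:
 assumes s: "s \<in> {0..T}" and e: "0 < e"
 shows "\<exists>\<delta>>0. \<forall>r\<in>{0..T}. \<bar>r - s\<bar> < \<delta> --> \<bar>expectation (%w. \<bar>H r w\<bar>) - expectation (%w. \<bar>H s w\<bar>)\<bar> \<le> e * (1 + expectation (%w. \<bar>X0 w\<bar>))"
proof -
 obtain \<delta> where \<delta>: "0 < \<delta>" "\<And>r. r \<in> {0..T} ==> \<bar>r - s\<bar> < \<delta> ==> \<rho> s r \<le> ennreal (e^2)" using \<rho>_small[OF s, of "e^2"] e by auto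
 have "\<bar>expectation (%w. \<bar>H r w\<bar>) - expectation (%w. \<bar>H s w\<bar>)\<bar> \<le> e * (1 + expectation (%w. \<bar>X0 w\<bar>))" if r: "r \<in> {0..T}" "\<bar>r - s\<bar> < \<delta>" for r
 proof -
  have "(%w. H r w - H s w) \<in> borel_measurable M" by (intro borel_measurable_diff H_meas)
  note fm = first_moment_le[OF this e \<delta>(2)[OF r, unfolded \<rho>_def]]
  have "\<bar>expectation (%w. \<bar>H r w\<bar>) - expectation (%w. \<bar>H s w\<bar>)\<bar> = \<bar>expectation (%w. \<bar>H r w\<bar> - \<bar>H s w\<bar>)\<bar>"
   using H_integrable r s by simp
  also have "... \<le> expectation (%w. \<bar>\<bar>H r w\<bar> - \<bar>H s w\<bar>\<bar>)" by (rule integral_abs_bound)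
  also have "... \<le> expectation (%w. \<bar>H r w - H s w\<bar>)"
   using H_integrable[OF r(1)] H_integrable[OF s] fm(1) by (intro integral_mono) auto
  also have "... \<le> e * (1 + expectation (%w. \<bar>X0 w\<bar>))" by (rule fm(2))
  finally show ?thesis .
 qed
 then show ?thesis using \<delta>(1) by blast
qed

text \<open>
 The frozen-coefficient approximation. Freezing \<open>H\<close> at time \<open>s\<close> requires a bounded frozen
 coefficient, so the estimate is made on \<open>{\<bar>X s\<bar> < n}\<close>, with a bound uniform in \<open>n\<close>.
\<close>

lemma frozen_increment_le:
 assumes st: "0 \<le> s" "s \<le> t" "t \<le> T" and e: "0 \<le> e"
  and le: "\<And>r. r \<in> {s..t} ==> \<rho> s r \<le> ennreal e"
 shows "(EE w. ennreal ((wt w)^2 * (I t w - I s w - H s w * (W t w - W s w))^2)) \<le> ennreal (e * (t - s))"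
proof (rule nn_integral_le_of_level_sets[where E="%w. ennreal \<bar>X s w\<bar>"])
 have s: "s \<in> {0..T}" "t \<in> {0..T}" using st by auto
 have [measurable]: "X s \<in> borel_measurable M" "I s \<in> borel_measurable M" "I t \<in> borel_measurable M" "H s \<in> borel_measurable M"
  "W s \<in> borel_measurable M" "W t \<in> borel_measurable M"
  using X_meas I_meas H_meas W_measurable s by auto
 show "(%w. ennreal ((wt w)^2 * (I t w - I s w - H s w * (W t w - W s w))^2)) \<in> borel_measurable M" by measurable
 show "(%w. ennreal \<bar>X s w\<bar>) \<in> borel_measurable M" by measurable
 show "AE w in M. ennreal \<bar>X s w\<bar> < \<infinity>" by simp
 fix n :: nat
 define G where "G w = (if \<bar>X s w\<bar> < real n then wt w else 0)" for w
 have XF: "X s \<in> borel_measurable (F s)" by (rule X_F[OF s(1)])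
 have HF: "H s \<in> borel_measurable (F s)" by (rule measurable_compose[OF XF \<sigma>_borel])
 have GF: "G \<in> borel_measurable (F s)" unfolding G_def using XF wt_F[OF s(1)] by measurable
 have Gb: "uniformly_bounded G" using wt_props(1,2) unfolding G_def by (intro exI[of _ 1]) (auto simp: abs_of_pos)
 have GHb: "uniformly_bounded (%w. G w * H s w)"
 proof (intro exI[of _ "K * (1 + real n)"] ballI)
  fix w
  show "\<bar>G w * H s w\<bar> \<le> K * (1 + real n)"
  proof (cases "\<bar>X s w\<bar> < real n")
   case True
   have "\<bar>G w * H s w\<bar> \<le> 1 * \<bar>H s w\<bar>" unfolding abs_mult G_def using wt_props(1,2)[of w] by (intro mult_right_mono) auto
   also have "... \<le> K * (1 + \<bar>X s w\<bar>)" using \<sigma>_growth by simp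
   also have "... \<le> K * (1 + real n)" using True K_nonneg by (intro mult_left_mono) auto
   finally show ?thesis .
  qed (use K_nonneg in \<open>simp add: G_def\<close>)
 qed
 have "(EE w. (if ennreal \<bar>X s w\<bar> < of_nat n then ennreal ((wt w)^2 * (I t w - I s w - H s w * (W t w - W s w))^2) else 0))
   = (EE w. ennreal ((G w)^2 * (I t w - I s w - H s w * (W t w - W s w))^2))"
  by (intro nn_integral_cong) (simp add: G_def ennreal_of_nat_eq_real_of_nat ennreal_less_iff)
 also have "... \<le> (EE w. (TI {s..t} (%r. ennreal ((G w)^2 * (H r w - H s w)^2))))"
  by (rule ito_inequality_between[OF st GF Gb HF GHb])
 also have "... \<le> (EE w. (TI {s..t} (%r. ennreal ((wt w)^2 * (H r w - H s w)^2))))"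
  unfolding G_def by (intro nn_integral_mono mult_right_mono ennreal_leI) auto
 also have "... = (TI {s..t} (%r. \<rho> s r))"
  unfolding \<rho>_def
 proof (rule nn_integral_swap_set)
  note [measurable] = X_joint'
  have "(%z. ennreal ((wt (fst z))^2 * (H (snd z) (fst z) - H s (fst z))^2)) \<in> borel_measurable (M \<Otimes>\<^sub>M lborel)" by measurable
  then show "(%(w, r). ennreal ((wt w)^2 * (H r w - H s w)^2)) \<in> borel_measurable (M \<Otimes>\<^sub>M lborel)" by (simp add: case_prod_beta')
 qed simp
 also have "... \<le> (\<integral>\<^sup>+r. ennreal e * indicator {s..t} r \<partial>lborel)"
  using le by (intro nn_integral_mono) (auto simp: indicator_def)
 also have "... = ennreal (e * (t - s))" using st e by (simp add: nn_integral_cmult_indicator ennreal_mult)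
 finally show "(EE w. (if ennreal \<bar>X s w\<bar> < of_nat n then ennreal ((wt w)^2 * (I t w - I s w - H s w * (W t w - W s w))^2) else 0)) \<le> ennreal (e * (t - s))" .
qed

lemma expectation_H_increment:
 assumes st: "0 \<le> s" "s < t" "t \<le> T"
 shows "integrable M (%w. H s w * (W t w - W s w))"
  "expectation (%w. \<bar>H s w * (W t w - W s w)\<bar>) = expectation (%w. \<bar>H s w\<bar>) * (sqrt (2 / pi) * sqrt (t - s))"
proof -
 have s: "s \<in> {0..T}" using st by auto
 have HF: "H s \<in> borel_measurable (F s)" by (rule measurable_compose[OF X_F[OF s] \<sigma>_borel])
 note ind = increment_indep[OF st HF]
 have "indep_var borel (abs \<circ> H s) borel (abs \<circ> (%w. W t w - W s w))"
  by (rule indep_var_compose[OF ind]) auto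
 then have ind': "indep_var borel (%w. \<bar>H s w\<bar>) borel (%w. \<bar>W t w - W s w\<bar>)" by (simp add: comp_def)
 have i: "integrable M (%w. \<bar>H s w\<bar>)" "integrable M (%w. \<bar>W t w - W s w\<bar>)"
  using H_integrable[OF s] increment_moments(1)[OF st] by auto
 show "integrable M (%w. H s w * (W t w - W s w))"
  by (rule indep_var_integrable[OF ind H_integrable[OF s] increment_moments(1)[OF st]])
 show "expectation (%w. \<bar>H s w * (W t w - W s w)\<bar>) = expectation (%w. \<bar>H s w\<bar>) * (sqrt (2 / pi) * sqrt (t - s))"
  using indep_var_lebesgue_integral[OF ind' i] increment_moments(5)[OF st] by (simp only: abs_mult)
qed

text \<open>
 Over a short time the drift contributes \<open>O(t - s)\<close> and the stochastic integral behaves like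
 \<open>H\<^sub>s (W\<^sub>t - W\<^sub>s)\<close>, whose factors are independent: first absolute moments of increments detect
 \<open>E \<bar>H\<^sub>s\<bar>\<close>.
\<close>

lemma small_time_limit:
 assumes s: "0 \<le> s" "s < T"
 shows "((%t. expectation (%w. \<bar>X t w - X s w\<bar>) / sqrt (t - s)) \<longlongrightarrow> sqrt (2 / pi) * expectation (%w. \<bar>H s w\<bar>)) (at_right s)"
proof (rule tendstoI)
 fix \<eta> :: real assume \<eta>: "0 < \<eta>"
 have s': "s \<in> {0..T}" using s by auto
 define \<kappa> where "\<kappa> = 1 + expectation (%w. \<bar>X0 w\<bar>)"
 have \<kappa>: "0 < \<kappa>" unfolding \<kappa>_def by (intro add_pos_nonneg) auto
 obtain Kd where Kd: "0 \<le> Kd" "\<And>s t. 0 \<le> s ==> s \<le> t ==> t \<le> T ==>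
  (EE w. ennreal ((wt w)^2 * (LINT r:{s..t}|lborel. B r w)^2)) \<le> ennreal (Kd * (t - s)^2)"
  using drift_bound by blast
 define e where "e = \<eta> / (3 * \<kappa>)"
 have e: "0 < e" using \<eta> \<kappa> by (simp add: e_def)
 define c where "c = sqrt (Kd + 1)"
 have c: "0 < c" "Kd \<le> c^2" using Kd(1) by (simp_all add: c_def)
 obtain \<delta> where \<delta>: "0 < \<delta>" "\<And>r. r \<in> {0..T} ==> \<bar>r - s\<bar> < \<delta> ==> \<rho> s r \<le> ennreal (e^2)" using \<rho>_small[OF s', of "e^2"] e by auto
 define d where "d = min (T - s) (min \<delta> ((e / c)^2))"
 have d: "0 < d" using s \<delta> e c by (simp add: d_def)
 have "dist (expectation (%w. \<bar>X t w - X s w\<bar>) / sqrt (t - s)) (sqrt (2 / pi) * expectation (%w. \<bar>H s w\<bar>)) < \<eta>"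
  if t: "s < t" "t < s + d" for t
 proof -
  have st: "0 \<le> s" "s < t" "t \<le> T" "t \<in> {0..T}" using s t by (auto simp: d_def)
  have st': "s \<le> t" using st by simp
  let ?q = "sqrt (t - s)"
  have q: "0 < ?q" using st by simp
  have qq: "?q * ?q = t - s" using st by simp
  have cq: "c * ?q < e"
  proof -
   have "t - s < (e / c)^2" using t unfolding d_def by linarith
   then have "?q < sqrt ((e / c)^2)" by (rule real_sqrt_less_mono)
   also have "... = e / c" using e c by simp
   finally show ?thesis using c by (simp add: pos_less_divide_eq mult.commute)
  qed
  let ?D = "%w. LINT r:{s..t}|lborel. B r w" and ?R = "%w. I t w - I s w - H s w * (W t w - W s w)"
  have Rm: "?R \<in> borel_measurable M"
   using I_meas H_meas[of s] W_measurable s' st(4) by (intro borel_measurable_diff borel_measurable_times) auto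
  have "(EE w. ennreal ((wt w)^2 * (?D w)^2)) \<le> ennreal ((c * (t - s))^2)"
   using c by (intro order_trans[OF Kd(2)[OF st(1) st' st(3)]] ennreal_leI) (simp add: power_mult_distrib mult_right_mono)
  note D = first_moment_le[OF LINT_B_measurable _ this, folded \<kappa>_def]
  have "(EE w. ennreal ((wt w)^2 * (?R w)^2)) \<le> ennreal (e^2 * (t - s))"
  proof (rule frozen_increment_le[OF st(1) st' st(3)])
   show "\<rho> s r \<le> ennreal (e^2)" if "r \<in> {s..t}" for r
    using that t st by (intro \<delta>(2)) (auto simp: d_def)
  qed simp
  also have "e^2 * (t - s) = (e * ?q)^2" using st by (simp add: power_mult_distrib)
  finally have "(EE w. ennreal ((wt w)^2 * (?R w)^2)) \<le> ennreal ((e * ?q)^2)" .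
  note R = first_moment_le[OF Rm _ this, folded \<kappa>_def]
  have ctp: "0 < c * (t - s)" and eqp: "0 < e * ?q" using c e st by simp_all
  note D' = D[OF ctp] and R' = R[OF eqp]
  have iX: "integrable M (%w. X t w - X s w)" using X_integrable s' st(4) by simp
  note Hi = expectation_H_increment[OF st(1-3)]
  have "\<bar>expectation (%w. \<bar>X t w - X s w\<bar>) - expectation (%w. \<bar>H s w * (W t w - W s w)\<bar>)\<bar>
    = \<bar>expectation (%w. \<bar>X t w - X s w\<bar> - \<bar>H s w * (W t w - W s w)\<bar>)\<bar>"
   using iX Hi(1) by simp
  also have "... \<le> expectation (%w. \<bar>\<bar>X t w - X s w\<bar> - \<bar>H s w * (W t w - W s w)\<bar>\<bar>)"
   by (rule integral_abs_bound)
  also have "... \<le> expectation (%w. \<bar>?D w\<bar> + \<bar>?R w\<bar>)"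
  proof (rule integral_mono_AE)
   show "AE w in M. \<bar>\<bar>X t w - X s w\<bar> - \<bar>H s w * (W t w - W s w)\<bar>\<bar> \<le> \<bar>?D w\<bar> + \<bar>?R w\<bar>"
    using X_increment[OF st(1) st' st(3)]
   proof eventually_elim
    case (elim w)
    have "\<bar>\<bar>x\<bar> - \<bar>h\<bar>\<bar> \<le> \<bar>u\<bar> + \<bar>i - h\<bar>" if "x = u + i" for x h u i :: real using that by linarith
    from this[OF elim] show ?case .
   qed
  qed (use iX Hi(1) D'(1) R'(1) in auto)
  also have "... = expectation (%w. \<bar>?D w\<bar>) + expectation (%w. \<bar>?R w\<bar>)" using D'(1) R'(1) by simp
  also have "... \<le> c * (t - s) * \<kappa> + e * ?q * \<kappa>" using D'(2) R'(2) by (rule add_mono)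
  also have "... = (c * ?q + e) * \<kappa> * ?q" 
  proof -
   have "c * (y * y) * \<kappa> + e * y * \<kappa> = (c * y + e) * \<kappa> * y" for y by (simp add: algebra_simps)
   from this[of ?q] show ?thesis unfolding qq .
  qed
  finally have b: "\<bar>expectation (%w. \<bar>X t w - X s w\<bar>) - expectation (%w. \<bar>H s w\<bar>) * (sqrt (2 / pi) * ?q)\<bar> \<le> (c * ?q + e) * \<kappa> * ?q"
   unfolding Hi(2) .
  have "dist (expectation (%w. \<bar>X t w - X s w\<bar>) / ?q) (sqrt (2 / pi) * expectation (%w. \<bar>H s w\<bar>))
   = \<bar>(expectation (%w. \<bar>X t w - X s w\<bar>) - expectation (%w. \<bar>H s w\<bar>) * (sqrt (2 / pi) * ?q)) / ?q\<bar>"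
   using q by (simp add: dist_real_def diff_divide_distrib mult.commute)
  also have "... \<le> (c * ?q + e) * \<kappa> * ?q / ?q" using b q by (simp only: abs_divide abs_of_pos[OF q] divide_right_mono less_imp_le)
  also have "... = (c * ?q + e) * \<kappa>" using q by simp
  also have "... < (e + 2 * e) * \<kappa>" using cq e \<kappa> by (intro mult_strict_right_mono) auto
  also have "... = \<eta>" using \<kappa> by (simp add: e_def)
  finally show ?thesis .
 qed
 then show "\<forall>\<^sub>F t in at_right s. dist (expectation (%w. \<bar>X t w - X s w\<bar>) / sqrt (t - s)) (sqrt (2 / pi) * expectation (%w. \<bar>H s w\<bar>)) < \<eta>"
  using d by (subst eventually_at_right[of s "s + d"]) (auto intro!: exI[of _ "s + d"])
qed

end

section \<open>Comparison of the diffusion coefficients\<close>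

context brownian_filtration
begin

lemma approximable_cong:
 assumes H: "approximable H I" and N: "N \<in> null_sets M"
  and eq: "\<And>w s. w \<in> space M - N ==> s \<in> {0..T} ==> H' s w = H s w \<and> I' s w = I s w"
 shows "approximable H' I'"
proof -
 obtain h J where el: "\<And>k::nat. elementary F T W uniformly_bounded (h k) (J k)"
  and a: "null_in_probability M (%k w. (TI {0..T} (%s. ennreal ((h k s w - H s w)^2))))"
  and b: "null_in_probability M (%k w. SUP t\<in>{0..T}. ennreal \<bar>J k t w - I t w\<bar>)"
  and m: "AE w in M. (%s. indicator {0..T} s * H s w) \<in> borel_measurable lborel"
  using H unfolding approximable_def by blast
 show ?thesis
 proof (rule approximableI[OF _ el])
  have "AE w in M. w \<in> space M - N" using AE_not_in[OF N] AE_space by eventually_elim simp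
  with m show "AE w in M. (%s. indicator {0..T} s * H' s w) \<in> borel_measurable lborel"
  proof eventually_elim
   case (elim w)
   have "(%s. indicator {0..T} s * H' s w) = (%s. indicator {0..T} s * H s w)"
    using eq[OF elim(2)] by (auto simp: fun_eq_iff indicator_def)
   then show ?case using elim(1) by simp
  qed
  show "null_in_probability M (%k w. (TI {0..T} (%s. ennreal ((h k s w - H' s w)^2))))"
  proof (rule null_in_probability_le[OF a N, of 1])
   fix k w assume w: "w \<in> space M - N"
   have "(TI {0..T} (%s. ennreal ((h k s w - H' s w)^2))) = (TI {0..T} (%s. ennreal ((h k s w - H s w)^2)))"
    by (intro nn_integral_cong) (simp add: indicator_def eq[OF w])
   then show "(TI {0..T} (%s. ennreal ((h k s w - H' s w)^2))) \<le> ennreal 1 * (TI {0..T} (%s. ennreal ((h k s w - H s w)^2)))"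
    by simp
  qed simp
  show "null_in_probability M (%k w. SUP t\<in>{0..T}. ennreal \<bar>J k t w - I' t w\<bar>)"
  proof (rule null_in_probability_le[OF b N, of 1])
   fix k w assume w: "w \<in> space M - N"
   have "(SUP t\<in>{0..T}. ennreal \<bar>J k t w - I' t w\<bar>) = (SUP t\<in>{0..T}. ennreal \<bar>J k t w - I t w\<bar>)"
    by (intro SUP_cong refl) (simp add: eq[OF w])
   then show "(SUP t\<in>{0..T}. ennreal \<bar>J k t w - I' t w\<bar>) \<le> ennreal 1 * (SUP t\<in>{0..T}. ennreal \<bar>J k t w - I t w\<bar>)" by simp
  qed simp
 qed
qed

end

lemma admissible_coefficient_bounds:
 assumes "admissible_coefficient T g"
 shows "\<exists>L\<ge>0. (\<forall>t\<in>{0..T}. \<forall>x y. \<bar>g t x - g t y\<bar> \<le> L * \<bar>x - y\<bar>) \<and> (\<forall>t\<in>{0..T}. \<forall>x. \<bar>g t x\<bar> \<le> L * (1 + \<bar>x\<bar>))"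
proof -
 let ?A = "{\<bar>g t x - g t y\<bar> / \<bar>x - y\<bar> | t x y. t \<in> {0..T} \<and> x \<noteq> y}" and ?B = "{\<bar>g t 0\<bar> | t. t \<in> {0..T}}"
 have bdd: "bdd_above ?A" "bdd_above ?B" using assms unfolding admissible_coefficient_def by simp_all
 obtain A where A': "\<And>v. v \<in> ?A ==> v \<le> A" using bdd(1) unfolding bdd_above_def by blast
 obtain B where B': "\<And>v. v \<in> ?B ==> v \<le> B" using bdd(2) unfolding bdd_above_def by blast
 have A: "\<bar>g t x - g t y\<bar> / \<bar>x - y\<bar> \<le> A" if "t \<in> {0..T}" "x \<noteq> y" for t x y
  by (rule A', rule CollectI, intro exI conjI) (rule refl that)+
 have B: "\<bar>g t 0\<bar> \<le> B" if "t \<in> {0..T}" for t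
  by (rule B', rule CollectI, intro exI conjI) (rule refl that)+
 define L where "L = max 0 (max A B)"
 have L: "0 \<le> L" "A \<le> L" "B \<le> L" by (auto simp: L_def)
 have lip: "\<bar>g t x - g t y\<bar> \<le> L * \<bar>x - y\<bar>" if "t \<in> {0..T}" for t x y
 proof (cases "x = y")
  case False
  then have "\<bar>g t x - g t y\<bar> \<le> A * \<bar>x - y\<bar>" using A[OF that False] by (simp add: pos_divide_le_eq)
  also have "... \<le> L * \<bar>x - y\<bar>" using L by (intro mult_right_mono) auto
  finally show ?thesis .
 qed simp
 have "\<bar>g t x\<bar> \<le> L * (1 + \<bar>x\<bar>)" if "t \<in> {0..T}" for t x
 proof -
  have "\<bar>g t x\<bar> \<le> \<bar>g t 0\<bar> + \<bar>g t x - g t 0\<bar>" by linarith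
  also have "... \<le> L + L * \<bar>x - 0\<bar>" using B[OF that] L lip[OF that, of x 0] by linarith
  finally show ?thesis by (simp add: algebra_simps)
 qed
 then show ?thesis using L(1) lip by blast
qed

lemma initial_value_aug_measurable: "X0 \<in> borel_measurable (aug_filtration M W X0 t)"
proof (rule measurableI)
 fix A :: "real set" assume "A \<in> sets borel"
 then show "X0 -` A \<inter> space (aug_filtration M W X0 t) \<in> sets (aug_filtration M W X0 t)"
  unfolding sets_aug_filtration space_aug_filtration by (intro sigma_sets.Basic) blast
qed simp

lemma ext_expectation_integrable:
 assumes "integrable M g"
 shows "ext_expectation M g = ereal (integral\<^sup>L M g)"
proof -
 have f: "(\<integral>\<^sup>+w. ennreal (g w) \<partial>M) < \<top>" "(\<integral>\<^sup>+w. ennreal (- g w) \<partial>M) < \<top>"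
  using assms by (auto simp: real_integrable_def less_top)
 have "enn2ereal x = ereal (enn2real x)" if "x < \<top>" for x
  using that by (cases x) auto
 then show ?thesis unfolding ext_expectation_def real_lebesgue_integral_def[OF assms] using f by simp
qed

text \<open>The test function \<open>(x\<^sub>1, x\<^sub>2) \<mapsto> \<bar>x\<^sub>2 - x\<^sub>1\<bar>\<close> compares first absolute moments of increments.\<close>

lemma dominated_increment_le:
 assumes dom: "two_marginal_cvx_dominated M T X Y" and st: "s \<in> {0..T}" "t \<in> {0..T}" "s \<le> t"
 shows "(\<integral>w. \<bar>X t w - X s w\<bar> \<partial>M) \<le> (\<integral>w. \<bar>Y t w - Y s w\<bar> \<partial>M)"
proof -
 let ?f = "%z :: real \<times> real. \<bar>snd z - fst z\<bar>"
 have cvx: "convex_on UNIV ?f"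
 proof (rule convex_onI)
  fix u :: real and z v :: "real \<times> real" assume u: "0 < u" "u < 1"
  have "snd ((1 - u) *\<^sub>R z + u *\<^sub>R v) - fst ((1 - u) *\<^sub>R z + u *\<^sub>R v) = (1 - u) * (snd z - fst z) + u * (snd v - fst v)"
   by (simp add: algebra_simps)
  also have "\<bar>...\<bar> \<le> \<bar>(1 - u) * (snd z - fst z)\<bar> + \<bar>u * (snd v - fst v)\<bar>" by (rule abs_triangle_ineq)
  also have "... = (1 - u) * ?f z + u * ?f v" using u by (simp add: abs_mult)
  finally show "?f ((1 - u) *\<^sub>R z + u *\<^sub>R v) \<le> (1 - u) * ?f z + u * ?f v" .
 qed simp
 have i: "integrable M (X s)" "integrable M (X t)" "integrable M (Y s)" "integrable M (Y t)"
  using dom st unfolding two_marginal_cvx_dominated_def by auto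
 have "ext_expectation M (%w. ?f (X s w, X t w)) \<le> ext_expectation M (%w. ?f (Y s w, Y t w))"
  using dom st cvx unfolding two_marginal_cvx_dominated_def cvx_le_def by blast
 then show ?thesis
  using ext_expectation_integrable[of M "%w. \<bar>X t w - X s w\<bar>"] ext_expectation_integrable[of M "%w. \<bar>Y t w - Y s w\<bar>"] i
  by simp
qed

lemma tendsto_at_right_le:
 fixes f g :: "real => real"
 assumes "(f \<longlongrightarrow> a) (at_right s)" "(g \<longlongrightarrow> b) (at_right s)" "s < T" "\<And>t. s < t ==> t < T ==> f t \<le> g t"
 shows "a \<le> b"
proof (rule tendsto_le[OF _ assms(2,1)])
 show "\<forall>\<^sub>F t in at_right s. f t \<le> g t"
  unfolding eventually_at_right[OF assms(3)] using assms(3,4) by blast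
qed simp

text \<open>Everything that the equations of the statement have in common.\<close>

locale linear_drift_equation =
 fixes M :: "'a measure" and T :: real and W :: "real => 'a => real" and l m :: "real => real"
 assumes T_pos: "0 < T" and prob: "prob_space M" and BM: "brownian_motion M T W"
  and l_cont: "continuous_on {0..T} l" and m_cont: "continuous_on {0..T} m"
begin

sublocale prob_space M by (rule prob)

definition clamp_time :: "real => real" where "clamp_time t = max 0 (min T t)"

lemma clamp_time: "clamp_time t \<in> {0..T}" "t \<in> {0..T} ==> clamp_time t = t" "continuous_on S clamp_time"
 using T_pos unfolding clamp_time_def by (auto intro!: continuous_intros)

lemma continuous_on_clamp_time:
 "continuous_on {0..T} f ==> continuous_on UNIV (%t. f (clamp_time t))"
 by (rule continuous_on_compose2[OF _ clamp_time(3)]) (auto intro: clamp_time(1) simp del: atLeastAtMost_iff)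

lemma bounded_on_interval:
 fixes f :: "real => real" assumes "continuous_on {0..T} f"
 shows "\<exists>K\<ge>0. \<forall>t\<in>{0..T}. \<bar>f t\<bar> \<le> K"
proof -
 have "bounded (f ` {0..T})" using compact_continuous_image[OF assms compact_Icc] by (rule compact_imp_bounded)
 then obtain K where "\<forall>x\<in>f ` {0..T}. norm x \<le> K" unfolding bounded_iff by blast
 then have "\<forall>t\<in>{0..T}. \<bar>f t\<bar> \<le> max 0 K" by auto
 then show ?thesis by (intro exI[of _ "max 0 K"]) auto
qed

text \<open>
 Setting a solution to 0 on the null set of its irregular paths keeps it adapted, because the
 filtration contains the null sets, and changes neither the equation nor the approximations.
\<close>

lemma strong_solution_regular:
 assumes bb: "\<forall>t\<in>{0..T}. \<forall>x. b t x = l t + m t * x"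
  and adm: "admissible_coefficient T \<sigma>" and X0: "integrable M X0" "indep_of_process M T W X0"
  and sol: "strong_solution M T W b \<sigma> X0 X"
 shows "\<exists>X' I' K. regular_solution M T W (aug_filtration M W X0) X0 X' I' (%t. b (clamp_time t)) (%t. \<sigma> (clamp_time t)) K
  \<and> (AE w in M. \<forall>t\<in>{0..T}. X' t w = X t w)"
proof -
 have b: "b t x = l t + m t * x" if "t \<in> {0..T}" for t x using bb that by blast
 let ?F = "aug_filtration M W X0"
 interpret brownian_filtration M T W ?F by (rule brownian_filtration_aug[OF prob BM T_pos X0(2)])
 obtain I where XF: "\<And>t. t \<in> {0..T} ==> X t \<in> borel_measurable (?F t)"
  and Xc: "AE w in M. continuous_on {0..T} (%t. X t w)"
  and ito: "ito_integral M ?F T W (%s w. \<sigma> s (X s w)) I"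
  and eq: "AE w in M. \<forall>t\<in>{0..T}. X t w = X0 w + (LINT s:{0..t}|lborel. b s (X s w)) + I t w"
  using sol unfolding strong_solution_def by blast
 have ap: "approximable (%s w. \<sigma> s (X s w)) I" and IF: "\<And>t. t \<in> {0..T} ==> I t \<in> borel_measurable (?F t)"
  and Ic: "AE w in M. continuous_on {0..T} (%t. I t w)"
  using ito unfolding ito_integral_iff_approximable by auto
 have "AE w in M. continuous_on {0..T} (%t. X t w) \<and> continuous_on {0..T} (%t. I t w)" using Xc Ic by eventually_elim simp
 then obtain N where N: "N \<in> null_sets M" "\<And>w. w \<in> space M - N ==> continuous_on {0..T} (%t. X t w)"
  "\<And>w. w \<in> space M - N ==> continuous_on {0..T} (%t. I t w)" by (elim AE_E3) blast
 define reg where "reg Z t w = (if w \<in> space M - N then Z (clamp_time t) w else 0)" for Z :: "real => 'a => real" and t w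
 have reg_cont: "continuous_on UNIV (%t. reg Z t w)" if "\<And>w. w \<in> space M - N ==> continuous_on {0..T} (%t. Z t w)" for Z w
  using that[of w] continuous_on_clamp_time[of "%t. Z t w"] unfolding reg_def by (cases "w \<in> space M - N") auto
 have reg_F: "reg Z t \<in> borel_measurable (?F (clamp_time t))" if "\<And>t. t \<in> {0..T} ==> Z t \<in> borel_measurable (?F t)" for Z t
 proof -
  have "N \<in> sets (?F (clamp_time t))" using F_null[OF clamp_time(1) N(1)] .
  then have "space M - N \<in> sets (?F (clamp_time t))" using sets.compl_sets[of N "?F (clamp_time t)"] by simp
  then have "(%w. Z (clamp_time t) w * indicator (space M - N) w) \<in> borel_measurable (?F (clamp_time t))"
   using that[OF clamp_time(1)] by (intro borel_measurable_times borel_measurable_indicator)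
  moreover have "(%w. Z (clamp_time t) w * indicator (space M - N) w) = reg Z t" by (auto simp: reg_def fun_eq_iff)
  ultimately show ?thesis by simp
 qed
 have reg_M: "reg Z t \<in> borel_measurable M" if "\<And>t. t \<in> {0..T} ==> Z t \<in> borel_measurable (?F t)" for Z t
  by (rule F_measurable_M[OF clamp_time(1) reg_F[OF that]])
 have reg_eq: "reg Z t w = Z t w" if "w \<in> space M - N" "t \<in> {0..T}" for Z t w
  using that by (simp add: reg_def clamp_time(2))
 have AEN: "AE w in M. w \<in> space M - N" using AE_not_in[OF N(1)] AE_space by eventually_elim simp
 obtain L where L: "0 \<le> L" "\<And>t x y. t \<in> {0..T} ==> \<bar>\<sigma> t x - \<sigma> t y\<bar> \<le> L * \<bar>x - y\<bar>" "\<And>t x. t \<in> {0..T} ==> \<bar>\<sigma> t x\<bar> \<le> L * (1 + \<bar>x\<bar>)"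
  using admissible_coefficient_bounds[OF adm] by blast
 obtain Kl where Kl: "0 \<le> Kl" "\<And>t. t \<in> {0..T} ==> \<bar>l t\<bar> \<le> Kl" using bounded_on_interval[OF l_cont] by blast
 obtain Km where Km: "0 \<le> Km" "\<And>t. t \<in> {0..T} ==> \<bar>m t\<bar> \<le> Km" using bounded_on_interval[OF m_cont] by blast
 define K where "K = L + Kl + Km"
 have K: "0 \<le> K" "L \<le> K" "Kl + Km \<le> K" using L(1) Kl(1) Km(1) by (auto simp: K_def)
 have "regular_solution M T W ?F X0 (reg X) (reg I) (%t. b (clamp_time t)) (%t. \<sigma> (clamp_time t)) K"
 proof unfold_locales
  show "X0 \<in> borel_measurable (?F 0)" by (rule initial_value_aug_measurable)
  show "integrable M X0" by fact
  show "continuous_on UNIV (%t. reg X t w)" "continuous_on UNIV (%t. reg I t w)" for w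
   by (intro reg_cont N; assumption)+
  show "reg X t \<in> borel_measurable M" "reg I t \<in> borel_measurable M" for t
   by (intro reg_M XF IF; assumption)+
  show "reg X t \<in> borel_measurable (?F t)" if "t \<in> {0..T}" for t
   using reg_F[OF XF, of t] that by (simp add: clamp_time(2))
  have cp: "continuous_on UNIV (%z::real\<times>real. (clamp_time (fst z), snd z))"
   by (intro continuous_on_Pair continuous_on_compose2[OF clamp_time(3)[of UNIV]] continuous_intros) auto
  have "continuous_on UNIV (%z. (%(t, x). \<sigma> t x) (clamp_time (fst z), snd z))"
   using adm clamp_time(1) unfolding admissible_coefficient_def by (intro continuous_on_compose2[OF _ cp]) auto
  then show "continuous_on UNIV (%(t, x). \<sigma> (clamp_time t) x)" by (simp add: case_prod_beta')
  have "continuous_on UNIV (%z::real\<times>real. l (clamp_time (fst z)) + m (clamp_time (fst z)) * snd z)"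
  proof -
   have f: "continuous_on UNIV (fst :: real \<times> real => real)" by (rule continuous_on_fst[OF continuous_on_id])
   show ?thesis
    using continuous_on_compose2[OF continuous_on_clamp_time[OF l_cont] f] continuous_on_compose2[OF continuous_on_clamp_time[OF m_cont] f]
    by (intro continuous_on_add continuous_on_mult continuous_on_snd continuous_on_id) simp_all
  qed
  then show "continuous_on UNIV (%(t, x). b (clamp_time t) x)" by (simp add: case_prod_beta' b[OF clamp_time(1)])
  show "0 \<le> K" by (rule K)
  show "\<bar>\<sigma> (clamp_time t) x\<bar> \<le> K * (1 + \<bar>x\<bar>)" for t x
   using L(3)[OF clamp_time(1), of t x] mult_right_mono[OF K(2), of "1 + \<bar>x\<bar>"] by simp
  show "\<bar>\<sigma> (clamp_time t) x - \<sigma> (clamp_time t) y\<bar> \<le> K * \<bar>x - y\<bar>" for t x y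
   using L(2)[OF clamp_time(1), of t x y] mult_right_mono[OF K(2), of "\<bar>x - y\<bar>"] by simp
  show "\<bar>b (clamp_time t) x\<bar> \<le> K * (1 + \<bar>x\<bar>)" for t x
  proof -
   have "\<bar>b (clamp_time t) x\<bar> \<le> \<bar>l (clamp_time t)\<bar> + \<bar>m (clamp_time t)\<bar> * \<bar>x\<bar>"
    unfolding b[OF clamp_time(1)] abs_mult[symmetric] by (rule abs_triangle_ineq)
   also have "... \<le> Kl + Km * \<bar>x\<bar>" using Kl(2) Km(2) clamp_time(1) by (intro add_mono mult_right_mono) auto
   also have "... \<le> (Kl + Km) * (1 + \<bar>x\<bar>)"
   proof -
    have "0 \<le> Kl * \<bar>x\<bar>" using Kl(1) by simp
    then show ?thesis using Km(1) by (simp add: algebra_simps)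
   qed
   also have "... \<le> K * (1 + \<bar>x\<bar>)" using K(3) by (intro mult_right_mono) auto
   finally show ?thesis .
  qed
  show "approximable (%s w. \<sigma> (clamp_time s) (reg X s w)) (reg I)"
   by (rule approximable_cong[OF ap N(1)]) (simp add: reg_eq clamp_time(2))
  show "AE w in M. \<forall>t\<in>{0..T}. reg X t w = X0 w + (LINT s:{0..t}|lborel. b (clamp_time s) (reg X s w)) + reg I t w"
   using eq AEN
  proof eventually_elim
   case (elim w)
   show ?case
   proof
    fix t assume t: "t \<in> {0..T}"
    have "(LINT s:{0..t}|lborel. b (clamp_time s) (reg X s w)) = (LINT s:{0..t}|lborel. b s (X s w))"
     using t by (intro set_lebesgue_integral_cong) (auto simp: reg_eq[OF elim(2)] clamp_time(2))
    then show "reg X t w = X0 w + (LINT s:{0..t}|lborel. b (clamp_time s) (reg X s w)) + reg I t w"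
     using elim(1) t by (simp add: reg_eq[OF elim(2)])
   qed
  qed
 qed
 moreover have "AE w in M. \<forall>t\<in>{0..T}. reg X t w = X t w" using AEN by eventually_elim (simp add: reg_eq)
 ultimately show ?thesis by blast
qed

lemma strong_solution_measurable:
 assumes X0: "X0 \<in> borel_measurable M" and sol: "strong_solution M T W b \<sigma> X0 X" and t: "t \<in> {0..T}"
 shows "X t \<in> borel_measurable M"
proof (rule measurable_from_subalg)
 show "subalgebra M (aug_filtration M W X0 t)"
  using aug_filtration_subalgebra[OF prob BM X0] t by simp
 show "X t \<in> borel_measurable (aug_filtration M W X0 t)" using sol t unfolding strong_solution_def by blast
qed

lemma admissible_borel:
 assumes adm: "admissible_coefficient T \<sigma>" and t: "t \<in> {0..T}"
 shows "\<sigma> t \<in> borel_measurable borel"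
proof -
 have 1: "continuous_on ({0..T} \<times> UNIV) (%(t, x). \<sigma> t x)" using adm unfolding admissible_coefficient_def by blast
 have 2: "continuous_on UNIV (%x. (t, x))" by (intro continuous_on_Pair continuous_on_const continuous_on_id)
 have 3: "(%x. (t, x)) ` UNIV \<subseteq> {0..T} \<times> UNIV" using t by blast
 have "continuous_on UNIV (%x. (%(t, x). \<sigma> t x) (t, x))" by (rule continuous_on_compose2[OF 1 2 3])
 then show ?thesis by (intro borel_measurable_continuous_onI) simp
qed

lemma strong_solution_asymptotics:
 assumes bb: "\<forall>t\<in>{0..T}. \<forall>x. b t x = l t + m t * x"
  and adm: "admissible_coefficient T \<sigma>" and X0: "integrable M X0" "indep_of_process M T W X0"
  and sol: "strong_solution M T W b \<sigma> X0 X"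
 shows "\<And>t. t \<in> {0..T} ==> integrable M (%w. \<sigma> t (X t w))"
  and "\<And>s. 0 \<le> s ==> s < T ==> ((%t. expectation (%w. \<bar>X t w - X s w\<bar>) / sqrt (t - s)) \<longlongrightarrow> sqrt (2 / pi) * expectation (%w. \<bar>\<sigma> s (X s w)\<bar>)) (at_right s)"
  and "\<And>e. 0 < e ==> \<exists>\<delta>>0. \<forall>r\<in>{0..T}. T - r < \<delta> --> \<bar>expectation (%w. \<bar>\<sigma> r (X r w)\<bar>) - expectation (%w. \<bar>\<sigma> T (X T w)\<bar>)\<bar> \<le> e"
proof -
 obtain X' I' K where rs: "regular_solution M T W (aug_filtration M W X0) X0 X' I' (%t. b (clamp_time t)) (%t. \<sigma> (clamp_time t)) K"
  and eq: "AE w in M. \<forall>t\<in>{0..T}. X' t w = X t w"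
  using strong_solution_regular[OF bb adm X0 sol] by blast
 interpret R: regular_solution M T W "aug_filtration M W X0" X0 X' I' "%t. b (clamp_time t)" "%t. \<sigma> (clamp_time t)" K by (rule rs)
 have X0m: "X0 \<in> borel_measurable M" using X0 by simp
 note Xm = strong_solution_measurable[OF X0m sol]
 have Hm: "(%w. \<sigma> t (X t w)) \<in> borel_measurable M" if "t \<in> {0..T}" for t
  by (rule measurable_compose[OF Xm[OF that] admissible_borel[OF adm that]])
 have Heq: "AE w in M. \<sigma> (clamp_time t) (X' t w) = \<sigma> t (X t w)" if "t \<in> {0..T}" for t
  using eq by eventually_elim (use that in \<open>simp add: clamp_time(2)\<close>)
 show "integrable M (%w. \<sigma> t (X t w))" if t: "t \<in> {0..T}" for t
  using R.H_integrable[OF t] integrable_cong_AE[OF R.H_meas Hm[OF t] Heq[OF t]] by blast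
 have Eh: "expectation (%w. \<bar>\<sigma> (clamp_time t) (X' t w)\<bar>) = expectation (%w. \<bar>\<sigma> t (X t w)\<bar>)" if t: "t \<in> {0..T}" for t
 proof (rule integral_cong_AE)
  show "AE w in M. \<bar>\<sigma> (clamp_time t) (X' t w)\<bar> = \<bar>\<sigma> t (X t w)\<bar>" using Heq[OF t] by eventually_elim simp
 qed (use R.H_meas[of t] Hm[OF t] in simp_all)
 have Ex: "expectation (%w. \<bar>X' t w - X' s w\<bar>) = expectation (%w. \<bar>X t w - X s w\<bar>)" if t: "t \<in> {0..T}" and s: "s \<in> {0..T}" for s t
 proof (rule integral_cong_AE)
  show "AE w in M. \<bar>X' t w - X' s w\<bar> = \<bar>X t w - X s w\<bar>" using eq by eventually_elim (use s t in simp)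
 qed (use R.X_meas[of t] R.X_meas[of s] Xm[OF t] Xm[OF s] in simp_all)
 show "((%t. expectation (%w. \<bar>X t w - X s w\<bar>) / sqrt (t - s)) \<longlongrightarrow> sqrt (2 / pi) * expectation (%w. \<bar>\<sigma> s (X s w)\<bar>)) (at_right s)"
  if s: "0 \<le> s" "s < T" for s
 proof (rule Lim_transform_eventually)
  show "((%t. expectation (%w. \<bar>X' t w - X' s w\<bar>) / sqrt (t - s)) \<longlongrightarrow> sqrt (2 / pi) * expectation (%w. \<bar>\<sigma> s (X s w)\<bar>)) (at_right s)"
   using R.small_time_limit[OF s] Eh[of s] s by simp
  have "expectation (%w. \<bar>X' t w - X' s w\<bar>) / sqrt (t - s) = expectation (%w. \<bar>X t w - X s w\<bar>) / sqrt (t - s)" if "s < t" "t < T" for t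
   using Ex[of t s] that s by simp
  then show "\<forall>\<^sub>F t in at_right s. expectation (%w. \<bar>X' t w - X' s w\<bar>) / sqrt (t - s) = expectation (%w. \<bar>X t w - X s w\<bar>) / sqrt (t - s)"
   unfolding eventually_at_right[OF s(2)] using s(2) by blast
 qed
 fix e :: real assume e: "0 < e"
 let ?\<kappa> = "1 + expectation (%w. \<bar>X0 w\<bar>)"
 have k: "0 < ?\<kappa>" by (intro add_pos_nonneg) auto
 have TT: "T \<in> {0..T}" using T_pos by (simp add: less_imp_le)
 have ek: "0 < e / ?\<kappa>" using e k by simp
 obtain \<delta> where \<delta>: "0 < \<delta>" "\<forall>r\<in>{0..T}. \<bar>r - T\<bar> < \<delta> --> \<bar>expectation (%w. \<bar>\<sigma> (clamp_time r) (X' r w)\<bar>) - expectation (%w. \<bar>\<sigma> (clamp_time T) (X' T w)\<bar>)\<bar> \<le> e / ?\<kappa> * ?\<kappa>"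
  using R.expectation_H_diff[OF TT ek] by blast
 have "\<bar>expectation (%w. \<bar>\<sigma> r (X r w)\<bar>) - expectation (%w. \<bar>\<sigma> T (X T w)\<bar>)\<bar> \<le> e" if r: "r \<in> {0..T}" "T - r < \<delta>" for r
 proof -
  have "\<bar>r - T\<bar> < \<delta>" using r by auto
  then have "\<bar>expectation (%w. \<bar>\<sigma> (clamp_time r) (X' r w)\<bar>) - expectation (%w. \<bar>\<sigma> (clamp_time T) (X' T w)\<bar>)\<bar> \<le> e / ?\<kappa> * ?\<kappa>"
   using \<delta>(2) r(1) by blast
  then show ?thesis using k unfolding Eh[OF r(1)] Eh[OF TT] by simp
 qed
 then show "\<exists>\<delta>>0. \<forall>r\<in>{0..T}. T - r < \<delta> --> \<bar>expectation (%w. \<bar>\<sigma> r (X r w)\<bar>) - expectation (%w. \<bar>\<sigma> T (X T w)\<bar>)\<bar> \<le> e" using \<delta>(1) by blast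
qed

text \<open>
 Dividing the comparison of the increments by \<open>\<surd>(t - s)\<close> and letting \<open>t \<down> s\<close> settles \<open>s < T\<close>; continuity
 settles the end point.
\<close>

lemma dominated_diffusion_le:
 assumes b: "\<forall>t\<in>{0..T}. \<forall>x. b t x = l t + m t * x" and \<beta>: "\<forall>t\<in>{0..T}. \<forall>x. \<beta> t x = l t + m t * x"
  and adm: "admissible_coefficient T \<sigma>" "admissible_coefficient T \<theta>"
  and X0: "integrable M X0" "indep_of_process M T W X0" and Y0: "integrable M Y0" "indep_of_process M T W Y0"
  and sol: "strong_solution M T W b \<sigma> X0 X" "strong_solution M T W \<beta> \<theta> Y0 Y"
  and dom: "two_marginal_cvx_dominated M T X Y" and t: "t \<in> {0..T}"
 shows "expectation (%w. \<bar>\<sigma> t (X t w)\<bar>) \<le> expectation (%w. \<bar>\<theta> t (Y t w)\<bar>)"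
proof -
 note AX = strong_solution_asymptotics[OF b adm(1) X0 sol(1)]
 note AY = strong_solution_asymptotics[OF \<beta> adm(2) Y0 sol(2)]
 have lt: "expectation (%w. \<bar>\<sigma> s (X s w)\<bar>) \<le> expectation (%w. \<bar>\<theta> s (Y s w)\<bar>)" if s: "0 \<le> s" "s < T" for s
 proof -
  have "sqrt (2 / pi) * expectation (%w. \<bar>\<sigma> s (X s w)\<bar>) \<le> sqrt (2 / pi) * expectation (%w. \<bar>\<theta> s (Y s w)\<bar>)"
  proof (rule tendsto_at_right_le[OF AX(2)[OF s] AY(2)[OF s] s(2)])
   fix r assume r: "s < r" "r < T"
   show "expectation (%w. \<bar>X r w - X s w\<bar>) / sqrt (r - s) \<le> expectation (%w. \<bar>Y r w - Y s w\<bar>) / sqrt (r - s)"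
    using r s by (intro divide_right_mono dominated_increment_le[OF dom]) auto
  qed
  then show ?thesis by simp
 qed
 show ?thesis
 proof (cases "t < T")
  case True then show ?thesis using lt t by simp
 next
  case False
  then have tT: "t = T" using t by simp
  show ?thesis unfolding tT
  proof (rule field_le_epsilon)
   fix e :: real assume e: "0 < e"
   then have e2: "0 < e / 2" by simp
   obtain d1 where d1: "0 < d1" "\<forall>r\<in>{0..T}. T - r < d1 --> \<bar>expectation (%w. \<bar>\<sigma> r (X r w)\<bar>) - expectation (%w. \<bar>\<sigma> T (X T w)\<bar>)\<bar> \<le> e / 2"
    using AX(3)[OF e2] by blast
   obtain d2 where d2: "0 < d2" "\<forall>r\<in>{0..T}. T - r < d2 --> \<bar>expectation (%w. \<bar>\<theta> r (Y r w)\<bar>) - expectation (%w. \<bar>\<theta> T (Y T w)\<bar>)\<bar> \<le> e / 2"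
    using AY(3)[OF e2] by blast
   define r where "r = T - min T (min d1 d2) / 2"
   have r: "r \<in> {0..T}" "r < T" "T - r < d1" "T - r < d2" using T_pos d1(1) d2(1) by (auto simp: r_def)
   have "\<bar>expectation (%w. \<bar>\<sigma> r (X r w)\<bar>) - expectation (%w. \<bar>\<sigma> T (X T w)\<bar>)\<bar> \<le> e / 2"
    "\<bar>expectation (%w. \<bar>\<theta> r (Y r w)\<bar>) - expectation (%w. \<bar>\<theta> T (Y T w)\<bar>)\<bar> \<le> e / 2"
    "expectation (%w. \<bar>\<sigma> r (X r w)\<bar>) \<le> expectation (%w. \<bar>\<theta> r (Y r w)\<bar>)"
    using d1(2) d2(2) r lt[of r] by auto
   then show "expectation (%w. \<bar>\<sigma> T (X T w)\<bar>) \<le> expectation (%w. \<bar>\<theta> T (Y T w)\<bar>) + e" by linarith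
  qed
 qed
qed

end

section \<open>Mixing two deterministic initial values\<close>

context linear_drift_equation
begin

lemma aug_const_subalgebra: "subalgebra (aug_filtration M W Y0 t) (aug_filtration M W (%_. x) t)"
proof -
 have "sets (aug_filtration M W (%_. x) t) \<subseteq> sets (aug_filtration M W Y0 t)"
  unfolding sets_aug_filtration
 proof (intro sigma_sets_mono' Un_mono order_refl subsetI)
  fix a assume "a \<in> {(%_. x) -` B \<inter> space M |B. B \<in> sets borel}"
  then obtain B where a: "a = (%_. x) -` B \<inter> space M" by blast
  have "a = Y0 -` (if x \<in> B then UNIV else {}) \<inter> space M" unfolding a by auto
  then show "a \<in> {Y0 -` B \<inter> space M |B. B \<in> sets borel}"
   by (intro CollectI exI[of _ "if x \<in> B then UNIV else {}"]) auto
 qed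
 then show ?thesis by (simp add: subalgebra_def)
qed

lemma filtration: "indep_of_process M T W X0 ==> brownian_filtration M T W (aug_filtration M W X0)"
 for X0 :: "'a => real"
 by (rule brownian_filtration_aug[OF prob BM T_pos])

lemma indep_const: "indep_of_process M T W (%_. x :: real)"
 by (rule indep_of_process_const[OF prob BM])

text \<open>
 Enlarging the filtration by an independent initial variable leaves approximating integrands
 admissible, and the driving path is still a Brownian motion for the larger filtration.
\<close>

lemma approximable_const_to_random:
 assumes Y0: "indep_of_process M T W Y0"
  and ap: "brownian_filtration.approximable M T W (aug_filtration M W (%_. x)) H I"
 shows "brownian_filtration.approximable M T W (aug_filtration M W Y0) H I"
proof -
 interpret C: brownian_filtration M T W "aug_filtration M W (%_. x)" by (rule filtration[OF indep_const])
 interpret G: brownian_filtration M T W "aug_filtration M W Y0" by (rule filtration[OF Y0])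
 obtain h J where el: "\<And>k::nat. elementary (aug_filtration M W (%_. x)) T W C.uniformly_bounded (h k) (J k)"
  and a: "null_in_probability M (%k w. (TI {0..T} (%s. ennreal ((h k s w - H s w)^2))))"
  and b: "null_in_probability M (%k w. SUP t\<in>{0..T}. ennreal \<bar>J k t w - I t w\<bar>)"
  and m: "AE w in M. (%s. indicator {0..T} s * H s w) \<in> borel_measurable lborel"
  using ap unfolding C.approximable_def by blast
 show ?thesis
  by (rule G.approximableI[OF m elementary_change_filtration[OF el aug_const_subalgebra] a b])
qed

text \<open>
 On the event \<open>Y\<^sub>0 = x\<close>, known at time 0, the mixture follows one solution, elsewhere the other; the
 Ito integral of the mixture is the corresponding mixture because known factors pass through it.
\<close>

lemma mixed_strong_solution:
 assumes Y0: "indep_of_process M T W Y0"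
  and X: "strong_solution M T W b \<sigma> (%_. x) X" and X': "strong_solution M T W b \<sigma> (%_. x') X'"
  and val: "\<And>w. Y0 w \<noteq> x ==> Y0 w = x'"
 shows "strong_solution M T W b \<sigma> Y0 (%t w. if Y0 w = x then X t w else X' t w)"
proof -
 interpret C: brownian_filtration M T W "aug_filtration M W (%_. x)" by (rule filtration[OF indep_const])
 interpret C': brownian_filtration M T W "aug_filtration M W (%_. x')" by (rule filtration[OF indep_const])
 interpret G: brownian_filtration M T W "aug_filtration M W Y0" by (rule filtration[OF Y0])
 let ?F = "aug_filtration M W Y0"
 obtain I where XF: "\<And>t. t \<in> {0..T} ==> X t \<in> borel_measurable (aug_filtration M W (%_. x) t)"
  and Xc: "AE w in M. continuous_on {0..T} (%t. X t w)"
  and ito: "ito_integral M (aug_filtration M W (%_. x)) T W (%s w. \<sigma> s (X s w)) I"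
  and eq: "AE w in M. \<forall>t\<in>{0..T}. X t w = x + (LINT s:{0..t}|lborel. b s (X s w)) + I t w"
  using X unfolding strong_solution_def by blast
 obtain I' where XF': "\<And>t. t \<in> {0..T} ==> X' t \<in> borel_measurable (aug_filtration M W (%_. x') t)"
  and Xc': "AE w in M. continuous_on {0..T} (%t. X' t w)"
  and ito': "ito_integral M (aug_filtration M W (%_. x')) T W (%s w. \<sigma> s (X' s w)) I'"
  and eq': "AE w in M. \<forall>t\<in>{0..T}. X' t w = x' + (LINT s:{0..t}|lborel. b s (X' s w)) + I' t w"
  using X' unfolding strong_solution_def by blast
 note i = ito[unfolded C.ito_integral_iff_approximable] and i' = ito'[unfolded C'.ito_integral_iff_approximable]
 have ap: "G.approximable (%s w. \<sigma> s (X s w)) I" using i approximable_const_to_random[OF Y0] by blast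
 have ap': "G.approximable (%s w. \<sigma> s (X' s w)) I'" using i' approximable_const_to_random[OF Y0] by blast
 have Y0F: "Y0 \<in> borel_measurable (?F t)" for t by (rule initial_value_aug_measurable)
 have mix: "(%w. if Y0 w = x then f w else g w) \<in> borel_measurable (?F t)"
  if "f \<in> borel_measurable (aug_filtration M W (%_. x) t)" "g \<in> borel_measurable (aug_filtration M W (%_. x') t)" for f g :: "'a => real" and t
 proof -
  have [measurable]: "f \<in> borel_measurable (?F t)" "g \<in> borel_measurable (?F t)" "Y0 \<in> borel_measurable (?F t)"
   using measurable_from_subalg[OF aug_const_subalgebra that(1)] measurable_from_subalg[OF aug_const_subalgebra that(2)] Y0F by auto
  show ?thesis by measurable
 qed
 let ?Y = "%t w. if Y0 w = x then X t w else X' t w" and ?I = "%t w. if Y0 w = x then I t w else I' t w"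
 \<comment> \<open>negative in the second case, so that a difference of restarted integrals is the mixture\<close>
 define A A' where "A w = (if Y0 w = x then 1 else 0 :: real)" and "A' w = (if Y0 w = x then 0 else - 1 :: real)" for w
 have AF: "A \<in> borel_measurable (?F 0)" "A' \<in> borel_measurable (?F 0)" unfolding A_def A'_def using Y0F[of 0] by measurable
 have Ab: "G.uniformly_bounded A" "G.uniformly_bounded A'" unfolding A_def A'_def by (auto intro!: exI[of _ 1])
 have in0: "0 \<in> {0..T}" using T_pos by simp
 have "G.approximable (%s w. \<sigma> s (?Y s w)) ?I"
 proof (rule G.approximable_transfer[OF ap ap', where B=1
    and \<Phi>="%h h' s w. (if 0 < s then A w * h s w else 0) - (if 0 < s then A' w * h' s w else 0)"
    and \<Psi>="%J J' t w. A w * (J t w - J (min t 0) w) - A' w * (J' t w - J' (min t 0) w)"])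
  fix h J h' J'
  assume h: "elementary ?F T W G.uniformly_bounded h J" and h': "elementary ?F T W G.uniformly_bounded h' J'"
  have P0: "G.uniformly_bounded (%_. 0)" by (auto intro: exI[of _ 0])
  have 1: "elementary ?F T W G.uniformly_bounded (%s w. if 0 < s then A w * h s w else 0) (%t w. A w * (J t w - J (min t 0) w))"
   by (rule G.elementary_restart[OF h in0 AF(1) P0]) (rule G.uniformly_bounded_mult[OF Ab(1)])
  have 2: "elementary ?F T W G.uniformly_bounded (%s w. if 0 < s then A' w * h' s w else 0) (%t w. A' w * (J' t w - J' (min t 0) w))"
   by (rule G.elementary_restart[OF h' in0 AF(2) P0]) (rule G.uniformly_bounded_mult[OF Ab(2)])
  show "elementary ?F T W G.uniformly_bounded (%s w. (if 0 < s then A w * h s w else 0) - (if 0 < s then A' w * h' s w else 0))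
    (%t w. A w * (J t w - J (min t 0) w) - A' w * (J' t w - J' (min t 0) w))"
   by (rule G.elementary_diff[OF 1 2]) (rule G.uniformly_bounded_diff)
 next
  show "AE w in M. (%s. indicator {0..T} s * \<sigma> s (X s w)) \<in> borel_measurable lborel -->
    (%s. indicator {0..T} s * \<sigma> s (X' s w)) \<in> borel_measurable lborel --> (%s. indicator {0..T} s * \<sigma> s (?Y s w)) \<in> borel_measurable lborel"
   by (intro AE_I2 impI) (case_tac "Y0 w = x"; simp)
 next
  fix h h' :: "real => 'a => real" and s w assume "s \<in> {0<..T}"
  then show "((if 0 < s then A w * h s w else 0) - (if 0 < s then A' w * h' s w else 0) - \<sigma> s (?Y s w))^2
   \<le> 1 * ((h s w - \<sigma> s (X s w))^2 + (h' s w - \<sigma> s (X' s w))^2)"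
   unfolding A_def A'_def by (cases "Y0 w = x") simp_all
 next
  fix J J' :: "real => 'a => real" and t w assume t: "t \<in> {0..T}" and z: "\<forall>w. J 0 w = 0 \<and> J' 0 w = 0"
  have m: "min t 0 = 0" using t by simp
  have "\<bar>A w * (J t w - J (min t 0) w) - A' w * (J' t w - J' (min t 0) w) - ?I t w\<bar>
    \<le> 1 * (\<bar>J t w - I t w\<bar> + \<bar>J t w - I t w\<bar> + \<bar>J' t w - I' t w\<bar> + \<bar>J' t w - I' t w\<bar>)"
   unfolding m A_def A'_def using z by (cases "Y0 w = x") simp_all
  then show "\<exists>u\<in>{0..T}. \<exists>v\<in>{0..T}. \<bar>A w * (J t w - J (min t 0) w) - A' w * (J' t w - J' (min t 0) w) - ?I t w\<bar>
    \<le> 1 * (\<bar>J u w - I u w\<bar> + \<bar>J v w - I v w\<bar> + \<bar>J' u w - I' u w\<bar> + \<bar>J' v w - I' v w\<bar>)"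
   using t by blast
 qed simp
 moreover have "\<forall>t\<in>{0..T}. ?I t \<in> borel_measurable (?F t)" using i i' by (intro ballI mix) auto
 moreover have "AE w in M. continuous_on {0..T} (%t. I t w)" "AE w in M. continuous_on {0..T} (%t. I' t w)" using i i' by auto
 then have "AE w in M. continuous_on {0..T} (%t. ?I t w)"
  by eventually_elim (case_tac "Y0 w = x"; simp)
 ultimately have "ito_integral M ?F T W (%s w. \<sigma> s (?Y s w)) ?I"
  unfolding G.ito_integral_iff_approximable by blast
 moreover have "AE w in M. \<forall>t\<in>{0..T}. ?Y t w = Y0 w + (LINT s:{0..t}|lborel. b s (?Y s w)) + ?I t w"
  using eq eq'
 proof eventually_elim
  case (elim w)
  show ?case using elim val[of w] by (cases "Y0 w = x") simp_all
 qed
 moreover have "AE w in M. continuous_on {0..T} (%t. ?Y t w)"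
  using Xc Xc' by eventually_elim (case_tac "Y0 w = x"; simp)
 moreover have "\<forall>t\<in>{0..T}. ?Y t \<in> borel_measurable (?F t)" using XF XF' by (intro ballI mix) auto
 ultimately show ?thesis unfolding strong_solution_def by blast
qed

lemma expectation_initial_indep:
 assumes Y0: "indep_of_process M T W Y0" and t: "t \<in> {0..T}"
  and f: "f \<in> borel_measurable (aug_filtration M W (%_. x) t)" "integrable M f"
  and h: "h \<in> borel_measurable borel" "integrable M (%w. h (Y0 w))"
 shows "integrable M (%w. f w * h (Y0 w))" "expectation (%w. f w * h (Y0 w)) = expectation f * expectation (%w. h (Y0 w :: real) :: real)"
proof -
 let ?F = "aug_filtration M W (%_. x) t" and ?V = "vimage_algebra (space M) Y0 borel"
 have ind: "indep_set (sets ?F) (sets ?V)" by (rule indep_set_initial_driving_filtration[OF prob BM Y0 t])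
 have "sigma_sets (space M) {f -` A \<inter> space M |A. A \<in> sets borel} \<subseteq> sets ?F"
  using sets.sigma_sets_subset[of "{f -` A \<inter> space M |A. A \<in> sets borel}" ?F] measurable_sets[OF f(1)] by auto
 moreover have "sigma_sets (space M) {(%w. h (Y0 w)) -` A \<inter> space M |A. A \<in> sets borel} \<subseteq> sets ?V"
 proof -
  have "(%w. h (Y0 w)) \<in> borel_measurable ?V"
   by (rule measurable_compose[OF measurable_vimage_algebra1 h(1)]) auto
  then show ?thesis
   using sets.sigma_sets_subset[of "{(%w. h (Y0 w)) -` A \<inter> space M |A. A \<in> sets borel}" ?V] measurable_sets[of "%w. h (Y0 w)" ?V borel] by auto
 qed
 ultimately have "indep_set (sigma_sets (space M) {f -` A \<inter> space M |A. A \<in> sets borel})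
   (sigma_sets (space M) {(%w. h (Y0 w)) -` A \<inter> space M |A. A \<in> sets borel})"
  using ind unfolding indep_sets2_eq by blast
 then have iv: "indep_var borel f borel (%w. h (Y0 w))" unfolding indep_var_eq using f(2) h(2) by simp
 show "integrable M (%w. f w * h (Y0 w))" "expectation (%w. f w * h (Y0 w)) = expectation f * expectation (%w. h (Y0 w))"
  using indep_var_integrable[OF iv f(2) h(2)] indep_var_lebesgue_integral[OF iv f(2) h(2)] by auto
qed

lemma strong_solution_cong_drift:
 assumes "\<forall>t\<in>{0..T}. \<forall>x. b t x = \<beta> t x" "strong_solution M T W b \<sigma> X0 X"
 shows "strong_solution M T W \<beta> \<sigma> X0 X"
proof -
 have "(LINT s:{0..t}|lborel. b s (X s w)) = (LINT s:{0..t}|lborel. \<beta> s (X s w))" if "t \<in> {0..T}" for t w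
  using assms(1) that by (intro set_lebesgue_integral_cong) auto
 then show ?thesis using assms(2) unfolding strong_solution_def by simp
qed

text \<open>
 The prescribed law has two atoms, so the variable obtained takes these values almost surely;
 composing it with a map onto \<open>{x, y}\<close> makes this hold everywhere.
\<close>

lemma two_point_initial_value:
 assumes rich: "rich_enough M T W" and u: "0 \<le> u" "u \<le> 1" and ne: "x \<noteq> y"
 shows "\<exists>Y0. indep_of_process M T W (%w. (c :: real, Y0 w :: real)) \<and> indep_of_process M T W Y0 \<and>
  (\<forall>w. Y0 w \<noteq> x --> Y0 w = y) \<and> prob {w\<in>space M. Y0 w = x} = 1 - u"
proof -
 define \<nu> where "\<nu> = distr (measure_pmf (bernoulli_pmf u)) borel (%b. (0 :: real, if b then y else x))"
 have ps: "prob_space \<nu>" unfolding \<nu>_def by (rule prob_space.prob_space_distr[OF measure_pmf.prob_space_axioms]) simp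
 have "integrable (measure_pmf (bernoulli_pmf u)) (%b. (0 :: real, if b then y else x))"
  by (rule integrable_measure_pmf_finite) simp
 then have "integrable \<nu> (%z. z)" unfolding \<nu>_def by (subst integrable_distr_eq) auto
 moreover have "sets \<nu> = sets borel" by (simp add: \<nu>_def)
 ultimately obtain Z where Z: "indep_of_process M T W Z" "distr M borel Z = \<nu>"
  using rich ps unfolding rich_enough_def by blast
 define f where "f z = (if snd z = x then x else y)" for z :: "real \<times> real"
 have sndm [measurable]: "(snd :: real \<times> real => real) \<in> borel_measurable borel"
  by (intro borel_measurable_continuous_onI continuous_on_snd continuous_on_id)
 have fm: "f \<in> borel_measurable borel" "(%z. (c, f z)) \<in> borel_measurable borel"
 proof -
  have "{z \<in> space borel. snd z = x} \<in> sets (borel :: (real \<times> real) measure)"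
   using measurable_sets[OF sndm, of "{x}"] by (simp add: vimage_def)
  then show f: "f \<in> borel_measurable borel" unfolding f_def by (intro measurable_If) auto
  show "(%z. (c, f z)) \<in> borel_measurable borel" using f by (intro borel_measurable_Pair borel_measurable_const)
 qed
 have Zm [measurable]: "Z \<in> borel_measurable M" using Z(1) by (simp add: indep_of_process_def)
 have S: "{z :: real \<times> real. snd z = x} \<in> sets borel"
 proof -
  show ?thesis using measurable_sets[OF sndm, of "{x}"] by (simp add: vimage_def)
 qed
 have "{w\<in>space M. f (Z w) = x} = Z -` {z. snd z = x} \<inter> space M" using ne by (auto simp: f_def)
 then have "prob {w\<in>space M. f (Z w) = x} = measure (distr M borel Z) {z. snd z = x}"
  using S by (simp add: measure_distr)
 also have "... = measure (measure_pmf (bernoulli_pmf u)) ((%b. (0 :: real, if b then y else x)) -` {z. snd z = x})"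
  unfolding Z(2) \<nu>_def using S by (subst measure_distr) auto
 also have "(%b. (0 :: real, if b then y else x)) -` {z. snd z = x} = {False}" using ne by auto
 also have "measure (measure_pmf (bernoulli_pmf u)) {False} = 1 - u" using u by (simp add: measure_pmf_single)
 finally have "prob {w\<in>space M. f (Z w) = x} = 1 - u" .
 moreover have "indep_of_process M T W (%w. (c, f (Z w)))" by (rule indep_of_process_compose[OF prob BM Z(1) fm(2)])
 moreover have "indep_of_process M T W (%w. f (Z w))" by (rule indep_of_process_compose[OF prob BM Z(1) fm(1)])
 ultimately show ?thesis by (intro exI[of _ "%w. f (Z w)"]) (auto simp: f_def)
qed

text \<open>
 Convexity at a mixture is the comparison of the solution started at the barycentre with the
 mixture of the two solutions started at the end points, which is itself a solution.
\<close>

lemma propagates_imp_convex: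
 assumes rich: "rich_enough M T W" and b: "\<forall>t\<in>{0..T}. \<forall>x. b t x = l t + m t * x" and \<beta>: "\<forall>t\<in>{0..T}. \<forall>x. \<beta> t x = l t + m t * x"
  and adm: "admissible_coefficient T \<sigma>" and propag: "propagates_two_marginal_cvx M T W b \<sigma> \<beta> \<sigma>"
  and Xx: "\<And>x. strong_solution M T W b \<sigma> (%_. x) (Xx x)" and s: "s \<in> {0..T}"
 shows "convex_on UNIV (%x. expectation (%w. \<bar>\<sigma> s (Xx x s w)\<bar>))"
proof (rule convex_onI)
 fix u x y :: real assume u: "0 < u" "u < 1"
 let ?c = "(1 - u) *\<^sub>R x + u *\<^sub>R y"
 let ?e = "%x. expectation (%w. \<bar>\<sigma> s (Xx x s w)\<bar>)"
 show "?e ?c \<le> (1 - u) * ?e x + u * ?e y"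
 proof (cases "x = y")
  case True
  then have "?c = y" by (simp add: algebra_simps)
  then show ?thesis using True by (simp add: algebra_simps)
 next
  case False
  obtain Y0 where Y0: "indep_of_process M T W (%w. (?c, Y0 w))" "indep_of_process M T W Y0"
   "\<And>w. Y0 w \<noteq> x ==> Y0 w = y" "prob {w\<in>space M. Y0 w = x} = 1 - u"
   using two_point_initial_value[OF rich _ _ False, of u ?c] u by auto
  have Y0m [measurable]: "Y0 \<in> borel_measurable M" using Y0(2) by (simp add: indep_of_process_def)
  define A where "A w = (if Y0 w = x then 1 else 0 :: real)" for w
  have [measurable]: "A \<in> borel_measurable M" unfolding A_def by measurable
  have Am: "integrable M A"
   by (rule integrable_const_bound[where B=1]) (auto simp: A_def)
  have EA: "expectation A = 1 - u"
  proof -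
   have "expectation A = expectation (indicator {w\<in>space M. Y0 w = x})"
    by (intro Bochner_Integration.integral_cong) (auto simp: A_def indicator_def)
   then show ?thesis using Y0(4) by simp
  qed
  have fY0: "f (Y0 w) = f y + (f x - f y) * A w" for f :: "real => real" and w
   using Y0(3)[of w] by (cases "Y0 w = x") (auto simp: A_def)
  have fi: "integrable M (%w. f (Y0 w))" "expectation (%w. f (Y0 w)) = (1 - u) * f x + u * f y" for f :: "real => real"
  proof -
   show "integrable M (%w. f (Y0 w))" unfolding fY0[of f] using Am by simp
   have "expectation (%w. f (Y0 w)) = f y + (f x - f y) * expectation A"
    unfolding fY0[of f] using Am by (simp add: prob_space)
   then show "expectation (%w. f (Y0 w)) = (1 - u) * f x + u * f y"
    unfolding EA by (simp add: algebra_simps)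
  qed
  have Y0i: "integrable M Y0" using fi(1)[of "%z. z"] by simp
  have cvx: "cvx_le M (%_. ?c) Y0"
   unfolding cvx_le_def
  proof (intro conjI allI impI)
   show "integrable M (%_. ?c)" by simp
   show "integrable M Y0" by (rule Y0i)
   fix f :: "real => real" assume f: "convex_on UNIV f"
   have "f ?c \<le> (1 - u) * f x + u * f y" using convex_onD[OF f, of u x y] u by simp
   then show "ext_expectation M (%w. f ?c) \<le> ext_expectation M (%w. f (Y0 w))"
    using ext_expectation_integrable[of M "%w. f ?c"] ext_expectation_integrable[OF fi(1)[of f]] fi(2)[of f] by (simp add: prob_space)
  qed
  let ?Y = "%t w. if Y0 w = x then Xx x t w else Xx y t w"
  have Y: "strong_solution M T W b \<sigma> Y0 ?Y" by (rule mixed_strong_solution[OF Y0(2) Xx Xx Y0(3)])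
  have Y': "strong_solution M T W \<beta> \<sigma> Y0 ?Y" by (rule strong_solution_cong_drift[OF _ Y]) (use b \<beta> in simp)
  have ci: "integrable M (%_. ?c)" by simp
  have dom: "two_marginal_cvx_dominated M T (Xx ?c) ?Y"
   using propag Y0(1) Y0i ci cvx Xx[of ?c] Y' unfolding propagates_two_marginal_cvx_def by blast
  have "?e ?c \<le> expectation (%w. \<bar>\<sigma> s (?Y s w)\<bar>)"
   by (rule dominated_diffusion_le[OF b \<beta> adm adm ci indep_const Y0i Y0(2) Xx Y' dom s])
  also have "... = (1 - u) * ?e x + u * ?e y"
  proof -
   have Hi: "integrable M (%w. \<bar>\<sigma> s (Xx z s w)\<bar>)" for z
    using strong_solution_asymptotics(1)[OF b adm _ indep_const Xx s, of z] by simp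
   have HF: "(%w. \<bar>\<sigma> s (Xx z s w)\<bar>) \<in> borel_measurable (aug_filtration M W (%_. z) s)" for z
   proof -
    have "Xx z s \<in> borel_measurable (aug_filtration M W (%_. z) s)" using Xx[of z] s unfolding strong_solution_def by blast
    from measurable_compose[OF this admissible_borel[OF adm s]] show ?thesis by (intro borel_measurable_abs)
   qed
   define h h' :: "real => real" where "h z = (if z = x then 1 else 0)" and "h' z = (if z = x then 0 else 1)" for z
   have hm: "h \<in> borel_measurable borel" "h' \<in> borel_measurable borel" unfolding h_def h'_def by measurable
   have Eh: "expectation (%w. h (Y0 w)) = 1 - u" "expectation (%w. h' (Y0 w)) = u"
    using fi(2)[of h] fi(2)[of h'] False by (simp_all add: h_def h'_def)
   note 1 = expectation_initial_indep[OF Y0(2) s HF Hi hm(1) fi(1), of x]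
   note 2 = expectation_initial_indep[OF Y0(2) s HF Hi hm(2) fi(1), of y]
   have "expectation (%w. \<bar>\<sigma> s (?Y s w)\<bar>) = expectation (%w. \<bar>\<sigma> s (Xx x s w)\<bar> * h (Y0 w) + \<bar>\<sigma> s (Xx y s w)\<bar> * h' (Y0 w))"
    by (intro Bochner_Integration.integral_cong) (auto simp: h_def h'_def)
   also have "... = expectation (%w. \<bar>\<sigma> s (Xx x s w)\<bar> * h (Y0 w)) + expectation (%w. \<bar>\<sigma> s (Xx y s w)\<bar> * h' (Y0 w))"
    using 1(1) 2(1) by (rule Bochner_Integration.integral_add)
   finally show ?thesis unfolding 1(2) 2(2) Eh by (simp add: mult.commute)
  qed
  finally show ?thesis .
 qed
qed simp

end

section \<open>Existence of solutions by Euler approximation\<close>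

lemma Borel_Cantelli_geometric:
 assumes A: "\<And>k. A k \<in> sets M" and le: "\<And>k::nat. emeasure M (A k) \<le> ennreal (c * (1/2)^k)" and c: "0 \<le> c"
 shows "AE w in M. \<forall>\<^sub>F k in sequentially. w \<notin> A k"
proof -
 have "AE w in M. \<forall>\<^sub>F k in sequentially. w \<in> space M - A k"
 proof (rule borel_cantelli_AE1)
  show "A k \<in> sets M" for k by (rule A)
  show "emeasure M (A k) < \<infinity>" for k using le[of k] by (auto intro: le_less_trans)
  show "summable (%k. measure M (A k))"
  proof (rule summable_comparison_test)
   show "summable (%k. c * (1/2::real)^k)" by (intro summable_mult summable_geometric) simp
   have "norm (measure M (A k)) \<le> c * (1/2)^k" for k
    using le[of k] c by (simp add: measure_def enn2real_leI)
   then show "\<exists>N. \<forall>k\<ge>N. norm (measure M (A k)) \<le> c * (1/2)^k" by blast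
  qed
 qed
 then show ?thesis
 proof eventually_elim
  case (elim w)
  then show ?case by eventually_elim simp
 qed
qed

lemma uniform_limit_of_geometric_increments:
 fixes f :: "nat => real => real"
 assumes ev: "\<forall>\<^sub>F k in sequentially. \<forall>t\<in>S. \<bar>f (Suc k) t - f k t\<bar> \<le> c * (1/2)^k"
 shows "\<exists>g. uniform_limit S f g sequentially"
proof -
 have "uniform_limit S (%n t. \<Sum>k<n. f (Suc k) t - f k t) (%t. \<Sum>k. f (Suc k) t - f k t) sequentially"
 proof (rule Weierstrass_m_test_ev)
  show "\<forall>\<^sub>F k in sequentially. \<forall>t\<in>S. norm (f (Suc k) t - f k t) \<le> c * (1/2)^k" using ev by simp
  show "summable (%k. c * (1/2::real)^k)" by (intro summable_mult summable_geometric) simp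
 qed
 then have "uniform_limit S (%n t. f 0 t + (\<Sum>k<n. f (Suc k) t - f k t)) (%t. f 0 t + (\<Sum>k. f (Suc k) t - f k t)) sequentially"
  by (intro uniform_limit_add uniform_limit_const)
 moreover have "f 0 t + (\<Sum>k<n. f (Suc k) t - f k t) = f n t" for n t
  by (simp add: sum_lessThan_telescope[of "%k. f k t"])
 ultimately have "uniform_limit S f (%t. f 0 t + (\<Sum>k. f (Suc k) t - f k t)) sequentially" by simp
 then show ?thesis by blast
qed

lemma tail_le_of_geometric_increments:
 fixes f :: "nat => real"
 assumes inc: "\<And>j. k \<le> j ==> \<bar>f (Suc j) - f j\<bar> \<le> (1/2)^j" and lim: "f \<longlonglongrightarrow> g"
 shows "\<bar>f k - g\<bar> \<le> 2 * (1/2)^k"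
proof -
 have "\<bar>f k - f (k + n)\<bar> \<le> 2 * (1/2)^k - 2 * (1/2)^(k + n)" for n
 proof (induction n)
  case (Suc n)
  have "\<bar>f k - f (k + Suc n)\<bar> \<le> \<bar>f k - f (k + n)\<bar> + \<bar>f (Suc (k + n)) - f (k + n)\<bar>" by simp
  also have "... \<le> (2 * (1/2)^k - 2 * (1/2)^(k + n)) + (1/2)^(k + n)" using Suc.IH inc[of "k + n"] by (intro add_mono) auto
  also have "... = 2 * (1/2)^k - 2 * (1/2)^(k + Suc n)" by simp
  finally show ?case .
 qed simp
 moreover have "0 \<le> 2 * (1/2::real)^(k + n)" for n by simp
 ultimately have le: "\<bar>f k - f (k + n)\<bar> \<le> 2 * (1/2)^k" for n by (smt (verit, best))
 have "(%n. f (n + k)) \<longlonglongrightarrow> g" using lim by (rule LIMSEQ_ignore_initial_segment)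
 then have "(%n. \<bar>f k - f (k + n)\<bar>) \<longlonglongrightarrow> \<bar>f k - g\<bar>" by (intro tendsto_intros) (simp add: add.commute)
 then show ?thesis by (rule LIMSEQ_le_const2) (use le in blast)
qed

text \<open>A simple process driven by time itself is integrated like any other step function.\<close>

lemma LINT_simple_process:
 assumes g: "grid T n p" and t: "0 \<le> s" "s \<le> t" "t \<le> T"
 shows "set_integrable lborel {s..t} (%r. simple_process n p \<beta> r w)"
  "(LINT r:{s..t}|lborel. simple_process n p \<beta> r w) = simple_ito (%u _. u) n p \<beta> t w - simple_ito (%u _. u) n p \<beta> s w"
proof -
 have i1: "integrable lborel (%r. \<beta> i w * indicator ({p i<..p (Suc i)} \<inter> {s..t}) r)" for i
 proof -
  have "{p i<..p (Suc i)} \<inter> {s..t} \<in> sets lborel" by simp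
  moreover have "emeasure lborel ({p i<..p (Suc i)} \<inter> {s..t}) < \<infinity>"
   using emeasure_mono[of "{p i<..p (Suc i)} \<inter> {s..t}" "{s..t}" lborel] t by (auto intro: le_less_trans)
  ultimately show ?thesis by (intro integrable_mult_right integrable_real_indicator)
 qed
 have eq: "indicator {s..t} r *\<^sub>R simple_process n p \<beta> r w = (\<Sum>i<n. \<beta> i w * indicator ({p i<..p (Suc i)} \<inter> {s..t}) r)" for r
  unfolding simple_process_def real_scaleR_def sum_distrib_left
  by (intro sum.cong refl) (auto simp: indicator_def)
 show "set_integrable lborel {s..t} (%r. simple_process n p \<beta> r w)"
  unfolding set_integrable_def eq using i1 by (intro Bochner_Integration.integrable_sum)
 have m: "measure lborel ({p i<..p (Suc i)} \<inter> {s..t}) = (min t (p (Suc i)) - min t (p i)) - (min s (p (Suc i)) - min s (p i))" if "i < n" for i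
 proof -
  have pi: "p i \<le> p (Suc i)" using grid_mono[OF g, of i "Suc i"] that by simp
  have e: "{p i<..p (Suc i)} \<inter> {s..t} = (if p i < s then {s..min t (p (Suc i))} else {p i<..min t (p (Suc i))})" by auto
  show ?thesis
  proof (cases "p i < s")
   case True
   show ?thesis unfolding e using True pi t by (cases "s \<le> p (Suc i)"; cases "t \<le> p (Suc i)") (simp_all add: min_def)
  next
   case False
   show ?thesis unfolding e using False pi t by (cases "p i \<le> t"; cases "t \<le> p (Suc i)"; cases "s = p (Suc i)") (simp_all add: min_def)
  qed
 qed
 have "(LINT r:{s..t}|lborel. simple_process n p \<beta> r w) = (\<Sum>i<n. \<beta> i w * measure lborel ({p i<..p (Suc i)} \<inter> {s..t}))"
  unfolding set_lebesgue_integral_def eq using i1 by (subst Bochner_Integration.integral_sum) auto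
 also have "... = (\<Sum>i<n. \<beta> i w * ((min t (p (Suc i)) - min t (p i)) - (min s (p (Suc i)) - min s (p i))))"
  by (intro sum.cong refl) (simp add: m)
 also have "... = simple_ito (%u _. u) n p \<beta> t w - simple_ito (%u _. u) n p \<beta> s w"
  unfolding simple_ito_def by (simp add: right_diff_distrib sum_subtractf)
 finally show "(LINT r:{s..t}|lborel. simple_process n p \<beta> r w) = simple_ito (%u _. u) n p \<beta> t w - simple_ito (%u _. u) n p \<beta> s w" .
qed

context brownian_filtration
begin

lemma square_integrable_zero: "square_integrable (%_. 0)" by simp

lemma isometry_between:
 assumes e: "elementary F T W square_integrable h J" and st: "0 \<le> s" "s \<le> t" "t \<le> T"
 shows "(EE w. ennreal ((J t w - J s w)^2)) \<le> (EE w. (TI {s..t} (%r. ennreal ((h r w)^2))))"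
proof -
 have in_T: "s \<in> {0..T}" "t \<in> {0..T}" using st by auto
 have "elementary F T W square_integrable (%r w. if s < r then 1 * h r w else 0) (%u w. 1 * (J u w - J (min u s) w))"
  by (rule elementary_restart[OF e in_T(1) _ square_integrable_zero]) auto
 from elementary_stop[OF this in_T(2) square_integrable_zero square_integrable_diff]
 have e': "elementary F T W square_integrable (%r w. if r \<le> t then if s < r then 1 * h r w else 0 else 0)
   (%u w. 1 * (J (min u t) w - J (min (min u t) s) w))" .
 have "min T t = t" "min t s = s" using st by auto
 then have "(EE w. ennreal ((J t w - J s w)^2)) = (EE w. (TI {0..T} (%r. ennreal ((if r \<le> t then if s < r then 1 * h r w else 0 else 0)^2))))"
  using ito_isometry(1)[OF e'] by simp
 also have "... \<le> (EE w. (TI {s..t} (%r. ennreal ((h r w)^2))))"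
  by (intro nn_integral_mono) (auto simp: indicator_def)
 finally show ?thesis .
qed

text \<open>Kolmogorov's inequality turns convergence of the energies into uniform convergence of the integrals.\<close>

lemma null_in_probability_sup_elementary:
 assumes e: "\<And>k::nat. elementary F T W square_integrable (h k) (J k)"
  and lim: "(%k. (EE w. (TI {0..T} (%s. ennreal ((h k s w)^2))))) \<longlonglongrightarrow> 0"
 shows "null_in_probability M (%k w. SUP t\<in>{0..T}. ennreal \<bar>J k t w\<bar>)"
 unfolding null_in_probability_def
proof (intro allI impI)
 fix \<epsilon> :: real assume \<epsilon>: "0 < \<epsilon>"
 have "\<forall>\<^sub>F k in sequentially. (EE w. (TI {0..T} (%s. ennreal ((h k s w)^2)))) < ennreal (\<epsilon>^2 * \<epsilon>)"
  using \<epsilon> by (intro order_tendstoD(2)[OF lim]) simp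
 then show "\<forall>\<^sub>F k in sequentially. \<exists>A\<in>events. emeasure M A < ennreal \<epsilon> \<and> (\<forall>w\<in>space M - A. (SUP t\<in>{0..T}. ennreal \<bar>J k t w\<bar>) \<le> ennreal \<epsilon>)"
 proof eventually_elim
  case (elim k)
  note ks = kolmogorov_sup[OF e[of k] \<epsilon>]
  obtain A where A: "A \<in> events" "ennreal (\<epsilon>^2) * emeasure M A \<le> (EE w. (TI {0..T} (%s. ennreal ((h k s w)^2))))"
   "\<forall>w\<in>space M - A. \<forall>t\<in>{0..T}. \<bar>J k t w\<bar> \<le> \<epsilon>"
   using ks by (elim bexE conjE)
  have "ennreal (\<epsilon>^2) * emeasure M A < ennreal (\<epsilon>^2) * ennreal \<epsilon>"
   using A(2) elim \<epsilon> by (simp add: ennreal_mult[symmetric] le_less_trans)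
  then have "emeasure M A < ennreal \<epsilon>"
   using mult_left_mono[of "ennreal \<epsilon>" "emeasure M A" "ennreal (\<epsilon>^2)"] by (meson leD le_less_linear zero_le)
  moreover have "(SUP t\<in>{0..T}. ennreal \<bar>J k t w\<bar>) \<le> ennreal \<epsilon>" if "w \<in> space M - A" for w
   using A(3) that by (intro SUP_least ennreal_leI) simp
  ultimately show ?case using A(1) by blast
 qed
qed

text \<open>The definition of the Ito integral asks for bounded coefficients; clipping provides them.\<close>

lemma elementary_clip:
 assumes e: "elementary F T W square_integrable h J" and \<epsilon>: "0 < \<epsilon>"
 shows "\<exists>h' J'. elementary F T W uniformly_bounded h' J' \<and> (EE w. (TI {0..T} (%s. ennreal ((h' s w - h s w)^2)))) < ennreal \<epsilon>"
proof -
 obtain n p \<xi> where g: "grid T n p" and on: "elementary_on F W square_integrable n p \<xi> h J" using e unfolding elementary_def by blast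
 have x: "\<xi> i \<in> borel_measurable (F (p i))" "square_integrable (\<xi> i)" if "i < n" for i using on that unfolding elementary_on_def by auto
 have xM: "\<xi> i \<in> borel_measurable M" if "i < n" for i by (rule elementary_on_coeff_measurable[OF g on that])
 define y where "y N i w = max (- real N) (min (real N) (\<xi> i w))" for N :: nat and i w
 have yF: "y N i \<in> borel_measurable (F (p i))" if "i < n" for N i unfolding y_def using x(1)[OF that] by measurable
 have yb: "uniformly_bounded (y N i)" for N i unfolding y_def by (intro exI[of _ "real N"]) auto
 have on': "elementary_on F W uniformly_bounded n p (y N) (simple_process n p (y N)) (simple_ito W n p (y N))" for N
  by (rule elementary_on_simple[OF g]) (auto simp: yF yb)
 have energy: "(TI {0..T} (%s. ennreal ((simple_process n p (y N) s w - h s w)^2))) = ennreal (\<Sum>i<n. (y N i w - \<xi> i w)^2 * (p (Suc i) - p i))" for N w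
 proof -
  have "elementary_on (%_. count_space UNIV) W (%_. True) n p (%i w. y N i w - \<xi> i w) (simple_process n p (%i w. y N i w - \<xi> i w)) (simple_ito W n p (%i w. y N i w - \<xi> i w))"
   by (rule elementary_on_simple[OF g]) auto
  from elementary_on_energy[OF g this]
  have "(TI {0..T} (%s. ennreal ((simple_process n p (%i w. y N i w - \<xi> i w) s w)^2))) = ennreal (\<Sum>i<n. (y N i w - \<xi> i w)^2 * (p (Suc i) - p i))" .
  moreover have "simple_process n p (%i w. y N i w - \<xi> i w) s w = simple_process n p (y N) s w - h s w" for s
  proof -
   have "h s w = simple_process n p \<xi> s w" using on unfolding elementary_on_def by (simp add: simple_process_eq_step_sum[OF g])
   then show ?thesis unfolding simple_process_def by (simp add: left_diff_distrib sum_subtractf)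
  qed
  ultimately show ?thesis by simp
 qed
 have "(%N. (EE w. ennreal (\<Sum>i<n. (y N i w - \<xi> i w)^2 * (p (Suc i) - p i)))) \<longlonglongrightarrow> (EE w. 0)"
 proof (rule nn_integral_dominated_convergence[where w="%w. ennreal (\<Sum>i<n. (\<xi> i w)^2 * (p (Suc i) - p i))"])
  have yM: "y N i \<in> borel_measurable M" if "i < n" for N i unfolding y_def using xM[OF that] by measurable
  show "(%w. ennreal (\<Sum>i<n. (y N i w - \<xi> i w)^2 * (p (Suc i) - p i))) \<in> borel_measurable M" for N
   using yM xM by (intro measurable_compose[OF _ measurable_ennreal] borel_measurable_sum borel_measurable_times borel_measurable_power borel_measurable_diff borel_measurable_const) auto
  show "(%w. ennreal (\<Sum>i<n. (\<xi> i w)^2 * (p (Suc i) - p i))) \<in> borel_measurable M"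
   using xM by (intro measurable_compose[OF _ measurable_ennreal] borel_measurable_sum borel_measurable_times borel_measurable_power borel_measurable_const) auto
  show "AE w in M. ennreal (\<Sum>i<n. (y N i w - \<xi> i w)^2 * (p (Suc i) - p i)) \<le> ennreal (\<Sum>i<n. (\<xi> i w)^2 * (p (Suc i) - p i))" for N
  proof (intro AE_I2 ennreal_leI sum_mono mult_right_mono)
   fix w i assume "i \<in> {..<n}"
   then show "0 \<le> p (Suc i) - p i" using grid_mono[OF g, of i "Suc i"] by simp
   have "\<bar>y N i w - \<xi> i w\<bar> \<le> \<bar>\<xi> i w\<bar>" unfolding y_def by (auto simp: max_def min_def)
   then show "(y N i w - \<xi> i w)^2 \<le> (\<xi> i w)^2" by (simp only: abs_le_square_iff)
  qed
  show "(EE w. ennreal (\<Sum>i<n. (\<xi> i w)^2 * (p (Suc i) - p i))) < \<infinity>"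
  proof -
   have "integrable M (%w. \<Sum>i<n. (\<xi> i w)^2 * (p (Suc i) - p i))" using x(2) by (intro Bochner_Integration.integrable_sum) auto
   moreover have "AE w in M. 0 \<le> (\<Sum>i<n. (\<xi> i w)^2 * (p (Suc i) - p i))"
    using grid_mono[OF g] by (intro AE_I2 sum_nonneg mult_nonneg_nonneg) auto
   ultimately show ?thesis by (simp add: nn_integral_eq_integral)
  qed
  show "AE w in M. (%N. ennreal (\<Sum>i<n. (y N i w - \<xi> i w)^2 * (p (Suc i) - p i))) \<longlonglongrightarrow> 0"
  proof (rule AE_I2)
   fix w
   have "(%N. y N i w) \<longlonglongrightarrow> \<xi> i w" for i
   proof (rule tendsto_eventually)
    obtain N0 :: nat where N0: "\<bar>\<xi> i w\<bar> \<le> real N0" using real_arch_simple by blast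
    have "y N i w = \<xi> i w" if "N0 \<le> N" for N
    proof -
     have "real N0 \<le> real N" using that by simp
     then show ?thesis using N0 unfolding y_def by (auto simp: max_def min_def)
    qed
    then show "\<forall>\<^sub>F N in sequentially. y N i w = \<xi> i w" unfolding eventually_sequentially by blast
   qed
   then have "(%N. ennreal (\<Sum>i<n. (y N i w - \<xi> i w)^2 * (p (Suc i) - p i))) \<longlonglongrightarrow> ennreal (\<Sum>i<n. (\<xi> i w - \<xi> i w)^2 * (p (Suc i) - p i))"
    by (intro tendsto_ennrealI tendsto_sum tendsto_mult tendsto_power tendsto_diff tendsto_const)
   then show "(%N. ennreal (\<Sum>i<n. (y N i w - \<xi> i w)^2 * (p (Suc i) - p i))) \<longlonglongrightarrow> 0" by simp
  qed
 qed simp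
 then have "\<forall>\<^sub>F N in sequentially. (EE w. ennreal (\<Sum>i<n. (y N i w - \<xi> i w)^2 * (p (Suc i) - p i))) < ennreal \<epsilon>"
  using \<epsilon> by (intro order_tendstoD(2)) auto
 then obtain N where N: "(EE w. ennreal (\<Sum>i<n. (y N i w - \<xi> i w)^2 * (p (Suc i) - p i))) < ennreal \<epsilon>"
  using eventually_happens'[OF sequentially_bot] by blast
 have "elementary F T W uniformly_bounded (simple_process n p (y N)) (simple_ito W n p (y N))" using g on'[of N] unfolding elementary_def by blast
 then show ?thesis using N unfolding energy[symmetric] by blast
qed

end

text \<open>The Euler scheme on the uniform grid with \<open>n\<close> steps, for a constant initial value.\<close>

locale euler_scheme = brownian_filtration +
 fixes x K :: real and l m s0 :: "real => real"
 assumes l_cont: "continuous_on {0..T} l" and m_cont: "continuous_on {0..T} m"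
  and K_nonneg: "0 \<le> K" and s0_lipschitz: "\<And>a c. \<bar>s0 a - s0 c\<bar> \<le> K * \<bar>a - c\<bar>" and s0_growth: "\<And>a. \<bar>s0 a\<bar> \<le> K * (1 + \<bar>a\<bar>)"
  and m_bound: "\<And>t. t \<in> {0..T} ==> \<bar>m t\<bar> \<le> K" and drift_growth: "\<And>t a. t \<in> {0..T} ==> \<bar>l t + m t * a\<bar> \<le> K * (1 + \<bar>a\<bar>)"
begin

definition pt :: "nat => nat => real" where "pt n i = T * real i / real n"

definition drift :: "real => real => real" where "drift t a = l t + m t * a"

primrec V :: "nat => nat => 'a => real" where
 "V n 0 = (%_. x)"
| "V n (Suc i) = (%w. V n i w + drift (pt n i) (V n i w) * (T / real n) + s0 (V n i w) * (W (pt n (Suc i)) w - W (pt n i) w))"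

text \<open>
 The scheme interpolated in two ways: \<open>y\<close> keeps the value of the last grid point, and \<open>X\<close> is continuous
 with drift part \<open>D\<close> and martingale part \<open>J\<close>. The integrands \<open>h\<close> and \<open>\<beta>\<close> of these parts are the
 coefficients evaluated at \<open>y\<close>.
\<close>

definition y :: "nat => real => 'a => real" where "y n = simple_process n (pt n) (V n)"
definition h :: "nat => real => 'a => real" where "h n = simple_process n (pt n) (%i w. s0 (V n i w))"
definition J :: "nat => real => 'a => real" where "J n = simple_ito W n (pt n) (%i w. s0 (V n i w))"
definition \<beta> :: "nat => real => 'a => real" where "\<beta> n = simple_process n (pt n) (%i w. drift (pt n i) (V n i w))"
definition D :: "nat => real => 'a => real" where "D n = simple_ito (%u _. u) n (pt n) (%i w. drift (pt n i) (V n i w))"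
definition X :: "nat => real => 'a => real" where "X n t w = x + D n t w + J n t w"

lemma pt_grid: "0 < n ==> grid T n (pt n)"
 unfolding grid_def pt_def using T_pos by (simp add: divide_strict_right_mono)

lemma pt_step: "pt n (Suc i) - pt n i = T / real n"
 unfolding pt_def by (simp add: diff_divide_distrib[symmetric] algebra_simps)

lemma pt_in: "0 < n ==> i \<le> n ==> pt n i \<in> {0..T}"
 by (rule grid_in[OF pt_grid])

lemma growth_square: "\<bar>b\<bar> \<le> K * (1 + \<bar>a\<bar>) ==> b^2 \<le> 2 * K^2 * (1 + a^2)" for a b :: real
proof -
 assume le: "\<bar>b\<bar> \<le> K * (1 + \<bar>a\<bar>)"
 have "b^2 \<le> (K * (1 + \<bar>a\<bar>))^2" using power_mono[OF le abs_ge_zero, of 2] by simp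
 also have "... = K^2 * (1 + \<bar>a\<bar>)^2" by (simp add: power_mult_distrib)
 also have "... \<le> K^2 * (2 * (1 + a^2))"
 proof (rule mult_left_mono)
  have "0 \<le> (1 - \<bar>a\<bar>)^2" by simp
  then show "(1 + \<bar>a\<bar>)^2 \<le> 2 * (1 + a^2)" by (simp add: power2_sum power2_diff)
 qed simp
 finally show ?thesis by (simp add: algebra_simps)
qed

lemma s0_square: "(s0 a)^2 \<le> 2 * K^2 * (1 + a^2)" by (rule growth_square[OF s0_growth])

lemma drift_square: "t \<in> {0..T} ==> (drift t a)^2 \<le> 2 * K^2 * (1 + a^2)"
 unfolding drift_def by (rule growth_square[OF drift_growth])

lemma s0_continuous: "continuous_on UNIV s0"
proof (rule continuous_onI)
 fix a e :: real assume e: "0 < e"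
 have "dist (s0 c) (s0 a) \<le> e" if "dist c a < e / (K + 1)" for c
 proof -
  have "dist (s0 c) (s0 a) \<le> K * dist c a" using s0_lipschitz[of c a] by (simp add: dist_real_def)
  also have "... \<le> (K + 1) * dist c a" by (simp add: distrib_right)
  also have "... \<le> (K + 1) * (e / (K + 1))" using that K_nonneg by (intro mult_left_mono) auto
  also have "... = e" using K_nonneg by simp
  finally show ?thesis .
 qed
 then show "\<exists>d>0. \<forall>c\<in>UNIV. dist c a < d --> dist (s0 c) (s0 a) \<le> e"
  using e K_nonneg by (intro exI[of _ "e / (K + 1)"]) auto
qed

lemma s0_borel [measurable]: "s0 \<in> borel_measurable borel"
 by (rule borel_measurable_continuous_onI[OF s0_continuous])

lemma square_integrable_growth:
 assumes [measurable]: "f \<in> borel_measurable M" "g \<in> borel_measurable M" and g: "square_integrable g" and le: "\<And>w. (f w)^2 \<le> 2 * K^2 * (1 + (g w)^2)"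
 shows "square_integrable f" "expectation (%w. (f w)^2) \<le> 2 * K^2 * (1 + expectation (%w. (g w)^2))"
proof -
 have ib: "integrable M (%w. 2 * K^2 * (1 + (g w)^2))" using g by simp
 show f: "square_integrable f"
  using le by (intro Bochner_Integration.integrable_bound[OF ib]) (auto intro!: AE_I2 simp: abs_of_nonneg)
 have "expectation (%w. (f w)^2) \<le> expectation (%w. 2 * K^2 * (1 + (g w)^2))"
  by (rule integral_mono[OF f ib]) (rule le)
 then show "expectation (%w. (f w)^2) \<le> 2 * K^2 * (1 + expectation (%w. (g w)^2))" using g by (simp add: prob_space)
qed

lemma square_integrable_times_const: "square_integrable f ==> square_integrable (%w. f w * c)" for c :: real
 unfolding power_mult_distrib by (intro integrable_mult_left)

lemma drift_measurable: "f \<in> borel_measurable N ==> (%w. drift t (f w)) \<in> borel_measurable N"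
 unfolding drift_def by measurable

lemma V_adapted: "0 < n ==> i \<le> n ==> V n i \<in> borel_measurable (F (pt n i)) \<and> square_integrable (V n i)"
proof (induction i)
 case (Suc i)
 have i: "i < n" using Suc.prems by simp
 have IH: "V n i \<in> borel_measurable (F (pt n i))" "square_integrable (V n i)" using Suc by auto
 have p: "0 \<le> pt n i" "pt n i < pt n (Suc i)" "pt n (Suc i) \<le> T" "pt n i \<in> {0..T}" "pt n (Suc i) \<in> {0..T}"
  using pt_in[OF Suc.prems(1), of i] pt_in[OF Suc.prems(1), of "Suc i"] grid_strict[OF pt_grid[OF Suc.prems(1)], of i "Suc i"] i by auto
 have VM: "V n i \<in> borel_measurable M" by (rule F_measurable_M[OF p(4) IH(1)])
 have dF: "(%w. drift (pt n i) (V n i w)) \<in> borel_measurable (F (pt n i))" and sF: "(%w. s0 (V n i w)) \<in> borel_measurable (F (pt n i))"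
  by (rule drift_measurable[OF IH(1)], rule measurable_compose[OF IH(1) s0_borel])
 have dsq: "square_integrable (%w. drift (pt n i) (V n i w))"
  by (rule square_integrable_growth(1)[OF F_measurable_M[OF p(4) dF] VM IH(2) drift_square[OF p(4)]])
 have ssq: "square_integrable (%w. s0 (V n i w))"
  by (rule square_integrable_growth(1)[OF F_measurable_M[OF p(4) sF] VM IH(2) s0_square])
 let ?N = "%w. V n i w + drift (pt n i) (V n i w) * (T / real n)"
 have NF: "?N \<in> borel_measurable (F (pt n i))" using IH(1) dF by (intro borel_measurable_add borel_measurable_times borel_measurable_const)
 have "square_integrable (%w. drift (pt n i) (V n i w) * (T / real n))" using dsq by (rule square_integrable_times_const)
 then have Nsq: "square_integrable ?N"
  using F_measurable_M[OF p(4) dF] VM IH(2) by (intro square_integrable_add) auto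
 have "V n (Suc i) \<in> borel_measurable (F (pt n (Suc i)))"
 proof -
  have "?N \<in> borel_measurable (F (pt n (Suc i)))" "(%w. s0 (V n i w)) \<in> borel_measurable (F (pt n (Suc i)))"
   "W (pt n i) \<in> borel_measurable (F (pt n (Suc i)))" "W (pt n (Suc i)) \<in> borel_measurable (F (pt n (Suc i)))"
   using F_measurable_mono[OF p(1) less_imp_le[OF p(2)] p(3)] NF sF W_adapted p(4,5) by auto
  then show ?thesis unfolding V.simps by (intro borel_measurable_add[of ?N] borel_measurable_times borel_measurable_diff)
 qed
 moreover have "square_integrable (V n (Suc i))"
  using isometry_step(1)[OF p(1-3) NF sF Nsq ssq] by simp
 ultimately show ?case by simp
qed simp

text \<open>The rate at which the second moment may grow, and the bound that results over \<open>[0, T]\<close>.\<close>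

definition c0 :: real where "c0 = 1 + 2 * K^2 * (1 + T) + 2 * K^2"
definition C0 :: real where "C0 = (1 + x^2) * exp (c0 * T)"

lemma c0_nonneg: "0 \<le> c0" unfolding c0_def using T_pos by (intro add_nonneg_nonneg mult_nonneg_nonneg) auto

lemma C0_ge: "1 \<le> C0"
proof -
 have "1 * 1 \<le> (1 + x^2) * exp (c0 * T)" using c0_nonneg T_pos by (intro mult_mono) auto
 then show ?thesis by (simp add: C0_def)
qed

text \<open>
 A discrete Gronwall inequality: a step of length \<open>d\<close> multiplies \<open>1 + E V\<^sup>2\<close> by at most \<open>1 + c\<^sub>0 d\<close>, so the
 bound is uniform in the number of steps.
\<close>

lemma V_moment:
 assumes n: "0 < n" and i: "i \<le> n"
 shows "1 + expectation (%w. (V n i w)^2) \<le> C0"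
proof -
 let ?d = "T / real n"
 have d: "0 \<le> ?d" "?d \<le> T" using T_pos n by (auto simp: divide_le_eq)
 have step: "1 + expectation (%w. (V n i w)^2) \<le> (1 + x^2) * (1 + c0 * ?d) ^ i" if "i \<le> n" for i
  using that
 proof (induction i)
  case (Suc i)
  have i: "i < n" using Suc.prems by simp
  have p: "0 \<le> pt n i" "pt n i < pt n (Suc i)" "pt n (Suc i) \<le> T" "pt n i \<in> {0..T}"
   using pt_in[OF n, of i] pt_in[OF n, of "Suc i"] grid_strict[OF pt_grid[OF n], of i "Suc i"] i by auto
  have V: "V n i \<in> borel_measurable (F (pt n i))" "square_integrable (V n i)" using V_adapted[OF n, of i] i by auto
  note VM = F_measurable_M[OF p(4) V(1)]
  have dF: "(%w. drift (pt n i) (V n i w)) \<in> borel_measurable (F (pt n i))" and sF: "(%w. s0 (V n i w)) \<in> borel_measurable (F (pt n i))"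
   by (rule drift_measurable[OF V(1)], rule measurable_compose[OF V(1) s0_borel])
  note dM = F_measurable_M[OF p(4) dF] and sM = F_measurable_M[OF p(4) sF]
  note dsq = square_integrable_growth[OF dM VM V(2) drift_square[OF p(4)]]
  note ssq = square_integrable_growth[OF sM VM V(2) s0_square]
  let ?N = "%w. V n i w + drift (pt n i) (V n i w) * ?d"
  let ?e = "expectation (%w. (V n i w)^2)"
  have NF: "?N \<in> borel_measurable (F (pt n i))" using V(1) dF by (intro borel_measurable_add borel_measurable_times borel_measurable_const)
  have "square_integrable (%w. drift (pt n i) (V n i w) * ?d)" using dsq(1) by (rule square_integrable_times_const)
  then have Nsq: "square_integrable ?N" using dM VM V(2) by (intro square_integrable_add) auto
  have e0: "0 \<le> ?e" by simp
  have EN: "expectation (%w. (?N w)^2) \<le> (1 + ?d) * ?e + (?d + ?d^2) * (2 * K^2 * (1 + ?e))"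
  proof -
   have "expectation (%w. (?N w)^2) \<le> expectation (%w. (1 + ?d) * (V n i w)^2 + (?d + ?d^2) * (drift (pt n i) (V n i w))^2)"
   proof (rule integral_mono[OF Nsq])
    show "integrable M (%w. (1 + ?d) * (V n i w)^2 + (?d + ?d^2) * (drift (pt n i) (V n i w))^2)" using V(2) dsq(1) by simp
    fix w
    have "(v + b * d)^2 \<le> (1 + d) * v^2 + (d + d^2) * b^2" if "0 \<le> d" for v b d :: real
    proof -
     have "0 \<le> d * (v - b)^2" using that by simp
     then show ?thesis by (simp add: power2_eq_square algebra_simps)
    qed
    from this[OF d(1)] show "(?N w)^2 \<le> (1 + ?d) * (V n i w)^2 + (?d + ?d^2) * (drift (pt n i) (V n i w))^2" .
   qed
   also have "... = (1 + ?d) * ?e + (?d + ?d^2) * expectation (%w. (drift (pt n i) (V n i w))^2)" using V(2) dsq(1) by simp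
   also have "... \<le> (1 + ?d) * ?e + (?d + ?d^2) * (2 * K^2 * (1 + ?e))"
    using dsq(2) d by (intro add_left_mono mult_left_mono) auto
   finally show ?thesis .
  qed
  have "1 + expectation (%w. (V n (Suc i) w)^2) = 1 + expectation (%w. (?N w)^2) + expectation (%w. (s0 (V n i w))^2) * ?d"
   using isometry_step(2)[OF p(1-3) NF sF Nsq ssq(1)] pt_step[of n i] by simp
  also have "... \<le> 1 + ((1 + ?d) * ?e + (?d + ?d^2) * (2 * K^2 * (1 + ?e))) + (2 * K^2 * (1 + ?e)) * ?d"
   using EN ssq(2) d by (intro add_mono mult_right_mono order_refl) auto
  also have "... \<le> (1 + c0 * ?d) * (1 + ?e)"
  proof -
   have "?d^2 \<le> T * ?d" unfolding power2_eq_square by (rule mult_right_mono[OF d(2) d(1)])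
   then have "?d^2 * (2 * K^2 * (1 + ?e)) \<le> T * ?d * (2 * K^2 * (1 + ?e))" using e0 by (intro mult_right_mono) auto
   moreover have "1 + ((1 + q) * e + (q + z) * (k * (1 + e))) + (k * (1 + e)) * q \<le> (1 + (1 + k * (1 + T) + k) * q) * (1 + e)"
    if "z * (k * (1 + e)) \<le> T * q * (k * (1 + e))" "0 \<le> q" for e q z k
    using that by (simp add: algebra_simps)
   from this[of "?d^2" "2 * K^2" ?e ?d] calculation d(1) show ?thesis unfolding c0_def by simp
  qed
  also have "... \<le> (1 + c0 * ?d) * ((1 + x^2) * (1 + c0 * ?d) ^ i)"
   using Suc c0_nonneg d by (intro mult_left_mono) auto
  finally show ?case by (simp add: mult.left_commute)
 qed (simp add: prob_space)
 have "(1 + c0 * ?d) ^ i \<le> exp (c0 * T)"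
 proof -
  have "(1 + c0 * ?d) ^ i \<le> (exp (c0 * ?d)) ^ i" using c0_nonneg d by (intro power_mono exp_ge_add_one_self) auto
  also have "... = exp (real i * (c0 * ?d))" by (rule exp_of_nat_mult[symmetric])
  also have "... \<le> exp (c0 * T)"
  proof -
   have "real i * (c0 * ?d) = c0 * T * (real i / real n)" by simp
   also have "... \<le> c0 * T * 1" using i n c0_nonneg T_pos by (intro mult_left_mono) auto
   finally show ?thesis by simp
  qed
  finally show ?thesis .
 qed
 then have "(1 + x^2) * (1 + c0 * ?d) ^ i \<le> C0" unfolding C0_def by (intro mult_left_mono) auto
 then show ?thesis using step[OF i] by simp
qed

lemma on_y: "0 < n ==> elementary_on F W square_integrable n (pt n) (V n) (y n) (simple_ito W n (pt n) (V n))"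
 unfolding y_def by (rule elementary_on_simple[OF pt_grid]) (simp_all add: V_adapted)

lemma coeff_props:
 assumes n: "0 < n" and i: "i < n"
 shows "V n i \<in> borel_measurable M" "square_integrable (V n i)"
  "(%w. s0 (V n i w)) \<in> borel_measurable (F (pt n i))" "square_integrable (%w. s0 (V n i w))"
  "(%w. drift (pt n i) (V n i w)) \<in> borel_measurable (F (pt n i))" "square_integrable (%w. drift (pt n i) (V n i w))"
  "expectation (%w. (s0 (V n i w))^2) \<le> 2 * K^2 * C0" "expectation (%w. (drift (pt n i) (V n i w))^2) \<le> 2 * K^2 * C0"
proof -
 have p: "pt n i \<in> {0..T}" using pt_in[OF n, of i] i by simp
 have V: "V n i \<in> borel_measurable (F (pt n i))" "square_integrable (V n i)" using V_adapted[OF n, of i] i by auto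
 show VM: "V n i \<in> borel_measurable M" by (rule F_measurable_M[OF p V(1)])
 show "square_integrable (V n i)" by (rule V(2))
 show sF: "(%w. s0 (V n i w)) \<in> borel_measurable (F (pt n i))" by (rule measurable_compose[OF V(1) s0_borel])
 show dF: "(%w. drift (pt n i) (V n i w)) \<in> borel_measurable (F (pt n i))" by (rule drift_measurable[OF V(1)])
 note s = square_integrable_growth[OF F_measurable_M[OF p sF] VM V(2) s0_square]
 note d = square_integrable_growth[OF F_measurable_M[OF p dF] VM V(2) drift_square[OF p]]
 show "square_integrable (%w. s0 (V n i w))" "square_integrable (%w. drift (pt n i) (V n i w))" by (rule s(1), rule d(1))
 have "2 * K^2 * (1 + expectation (%w. (V n i w)^2)) \<le> 2 * K^2 * C0"
  using V_moment[OF n, of i] i by (intro mult_left_mono) auto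
 then show "expectation (%w. (s0 (V n i w))^2) \<le> 2 * K^2 * C0" "expectation (%w. (drift (pt n i) (V n i w))^2) \<le> 2 * K^2 * C0"
  using s(2) d(2) by linarith+
qed

lemma on_h: "0 < n ==> elementary_on F W square_integrable n (pt n) (%i w. s0 (V n i w)) (h n) (J n)"
 unfolding h_def J_def by (rule elementary_on_simple[OF pt_grid]) (simp_all add: coeff_props(3) coeff_props(4))

lemma on_\<beta>: "0 < n ==> elementary_on F W square_integrable n (pt n) (%i w. drift (pt n i) (V n i w)) (\<beta> n) (simple_ito W n (pt n) (%i w. drift (pt n i) (V n i w)))"
 unfolding \<beta>_def by (rule elementary_on_simple[OF pt_grid]) (simp_all add: coeff_props(5) coeff_props(6))

lemma el_y: "0 < n ==> elementary F T W square_integrable (y n) (simple_ito W n (pt n) (V n))"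
 unfolding elementary_def using pt_grid on_y by blast

lemma el_h: "0 < n ==> elementary F T W square_integrable (h n) (J n)"
 unfolding elementary_def using pt_grid on_h by blast

lemma el_\<beta>: "0 < n ==> elementary F T W square_integrable (\<beta> n) (simple_ito W n (pt n) (%i w. drift (pt n i) (V n i w)))"
 unfolding elementary_def using pt_grid on_\<beta> by blast

lemma joint: "0 < n ==> (%z. y n (snd z) (fst z)) \<in> borel_measurable (M \<Otimes>\<^sub>M lborel)"
 "0 < n ==> (%z. h n (snd z) (fst z)) \<in> borel_measurable (M \<Otimes>\<^sub>M lborel)"
 "0 < n ==> (%z. \<beta> n (snd z) (fst z)) \<in> borel_measurable (M \<Otimes>\<^sub>M lborel)"
 using elementary_measurable[OF el_y] elementary_measurable[OF el_h] elementary_measurable[OF el_\<beta>] by (simp_all add: case_prod_beta')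

lemma section_measurable:
 assumes "(%z. f (snd z) (fst z)) \<in> borel_measurable (M \<Otimes>\<^sub>M lborel)"
 shows "f t \<in> borel_measurable M"
proof -
 have "(%w. (w, t)) \<in> M \<rightarrow>\<^sub>M (M \<Otimes>\<^sub>M lborel)" by (rule measurable_Pair2') simp
 from measurable_compose[OF this assms] show ?thesis by (simp only: fst_conv snd_conv)
qed

lemma X_grid: "0 < n ==> k \<le> n ==> X n (pt n k) w = V n k w"
proof -
 assume n: "0 < n" and k: "k \<le> n"
 have onD: "elementary_on (%_. count_space UNIV) (%u _. u) (%_. True) n (pt n) (%i w. drift (pt n i) (V n i w)) (\<beta> n) (D n)"
  unfolding \<beta>_def D_def by (rule elementary_on_simple[OF pt_grid[OF n]]) auto
 have V_eq: "V n k w = x + (\<Sum>i<k. drift (pt n i) (V n i w) * (pt n (Suc i) - pt n i)) + (\<Sum>i<k. s0 (V n i w) * (W (pt n (Suc i)) w - W (pt n i) w))" for k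
  by (induction k) (simp_all add: pt_step)
 show "X n (pt n k) w = V n k w"
  unfolding X_def elementary_on_integral_at_grid[OF pt_grid[OF n] onD k] elementary_on_integral_at_grid[OF pt_grid[OF n] on_h[OF n] k] by (rule V_eq[symmetric])
qed

lemma frozen_values:
 assumes n: "0 < n" and t: "0 < t" "t \<le> T"
 shows "\<exists>i<n. pt n i < t \<and> t \<le> pt n (Suc i) \<and> t - pt n i \<le> T / real n \<and> pt n i \<in> {0..T} \<and>
  (\<forall>w. y n t w = V n i w \<and> h n t w = s0 (V n i w) \<and> \<beta> n t w = drift (pt n i) (V n i w) \<and> X n (pt n i) w = V n i w)"
proof -
 obtain i where i: "i < n" "pt n i < t" "t \<le> pt n (Suc i)" using grid_locate_left[OF pt_grid[OF n] t] by blast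
 have "t - pt n i \<le> T / real n" using i(3) pt_step[of n i] by linarith
 then show ?thesis
  using i elementary_on_value[OF pt_grid[OF n] on_y[OF n] i] elementary_on_value[OF pt_grid[OF n] on_h[OF n] i]
   elementary_on_value[OF pt_grid[OF n] on_\<beta>[OF n] i] X_grid[OF n, of i] pt_in[OF n, of i]
  by (intro exI[of _ i]) simp
qed

lemma frozen_moments:
 assumes n: "0 < n"
 shows "(EE w. ennreal ((y n t w)^2)) \<le> ennreal (C0 - 1)" "(EE w. ennreal ((h n t w)^2)) \<le> ennreal (2 * K^2 * C0)"
  "(EE w. ennreal ((\<beta> n t w)^2)) \<le> ennreal (2 * K^2 * C0)"
proof -
 have "(EE w. ennreal ((y n t w)^2)) \<le> ennreal (C0 - 1) \<and> (EE w. ennreal ((h n t w)^2)) \<le> ennreal (2 * K^2 * C0) \<and>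
  (EE w. ennreal ((\<beta> n t w)^2)) \<le> ennreal (2 * K^2 * C0)"
 proof (cases "0 < t \<and> t \<le> T")
  case True
  then obtain i where i: "i < n" "\<And>w. y n t w = V n i w" "\<And>w. h n t w = s0 (V n i w)" "\<And>w. \<beta> n t w = drift (pt n i) (V n i w)"
   using frozen_values[OF n] by blast
  note cp = coeff_props[OF n i(1)]
  have "expectation (%w. (V n i w)^2) \<le> C0 - 1" using V_moment[OF n, of i] i(1) by simp
  then show ?thesis unfolding i(2-4)
   using cp by (simp add: nn_integral_eq_integral ennreal_leI)
 next
  case False
  then have z: "y n t w = 0" "h n t w = 0" "\<beta> n t w = 0" for w
   using elementary_outside[OF el_y[OF n]] elementary_outside[OF el_h[OF n]] elementary_outside[OF el_\<beta>[OF n]] by auto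
  show ?thesis unfolding z by simp
 qed
 then show "(EE w. ennreal ((y n t w)^2)) \<le> ennreal (C0 - 1)" "(EE w. ennreal ((h n t w)^2)) \<le> ennreal (2 * K^2 * C0)"
  "(EE w. ennreal ((\<beta> n t w)^2)) \<le> ennreal (2 * K^2 * C0)" by auto
qed

lemma nn_integral_interval_le:
 assumes f: "(%z. f (snd z) (fst z)) \<in> borel_measurable (M \<Otimes>\<^sub>M lborel)"
  and le: "\<And>r. r \<in> {s..t} ==> (EE w. ennreal (f r w)) \<le> ennreal C" and C: "0 \<le> C" and st: "s \<le> t"
 shows "(EE w. (TI {s..t} (%r. ennreal (f r w)))) \<le> ennreal (C * (t - s))"
proof -
 have "(%z. ennreal (f (snd z) (fst z))) \<in> borel_measurable (M \<Otimes>\<^sub>M lborel)" using f by measurable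
 then have "(%(w, r). ennreal (f r w)) \<in> borel_measurable (M \<Otimes>\<^sub>M lborel)" by (simp add: case_prod_beta')
 then have "(EE w. (TI {s..t} (%r. ennreal (f r w)))) = (TI {s..t} (%r. (EE w. ennreal (f r w))))"
  by (rule nn_integral_swap_set) simp
 also have "... \<le> (\<integral>\<^sup>+r. ennreal C * indicator {s..t} r \<partial>lborel)"
 proof (rule nn_integral_mono)
  fix r show "(EE w. ennreal (f r w)) * indicator {s..t} r \<le> ennreal C * indicator {s..t} r"
   using le[of r] by (cases "r \<in> {s..t}") auto
 qed
 also have "... = ennreal (C * (t - s))" using st C by (simp add: nn_integral_cmult_indicator ennreal_mult)
 finally show ?thesis .
qed

lemma D_eq: "0 < n ==> 0 \<le> s ==> s \<le> t ==> t \<le> T ==> set_integrable lborel {s..t} (%r. \<beta> n r w)"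
 "0 < n ==> 0 \<le> s ==> s \<le> t ==> t \<le> T ==> (LINT r:{s..t}|lborel. \<beta> n r w) = D n t w - D n s w"
 unfolding \<beta>_def D_def by (rule LINT_simple_process(1)[OF pt_grid], assumption+) (rule LINT_simple_process(2)[OF pt_grid], assumption+)

lemma D_zero: "0 < n ==> D n 0 w = 0"
 unfolding D_def simple_ito_def using pt_in by (intro sum.neutral) auto

lemma J_zero: "0 < n ==> J n 0 w = 0"
 using elementary_on_integral_at_grid[OF pt_grid on_h, of n 0] by (simp add: pt_def)

lemma nn_integral_square_sum_le:
 assumes [measurable]: "f \<in> borel_measurable M" "g \<in> borel_measurable M"
 shows "(EE w. ennreal ((f w + g w)^2)) \<le> 2 * (EE w. ennreal ((f w)^2)) + 2 * (EE w. ennreal ((g w)^2))"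
proof -
 have "(EE w. ennreal ((f w + g w)^2)) \<le> (EE w. 2 * ennreal ((f w)^2) + 2 * ennreal ((g w)^2))"
 proof (rule nn_integral_mono)
  fix w
  have "0 \<le> (f w - g w)^2" by simp
  then have "(f w + g w)^2 \<le> 2 * (f w)^2 + 2 * (g w)^2" by (simp add: power2_eq_square algebra_simps)
  then have "ennreal ((f w + g w)^2) \<le> ennreal (2 * (f w)^2 + 2 * (g w)^2)" by (rule ennreal_leI)
  then show "ennreal ((f w + g w)^2) \<le> 2 * ennreal ((f w)^2) + 2 * ennreal ((g w)^2)"
   by (simp add: ennreal_plus ennreal_mult'[of 2])
 qed
 also have "... = 2 * (EE w. ennreal ((f w)^2)) + 2 * (EE w. ennreal ((g w)^2))"
  by (simp add: nn_integral_add nn_integral_cmult)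
 finally show ?thesis .
qed

lemma D_measurable: "0 < n ==> D n t \<in> borel_measurable M"
proof -
 assume n: "0 < n"
 have "(%w. drift (pt n i) (V n i w) * (min t (pt n (Suc i)) - min t (pt n i))) \<in> borel_measurable M" if "i < n" for i
  using drift_measurable[OF coeff_props(1)[OF n that]] by (intro borel_measurable_times borel_measurable_const)
 then show ?thesis unfolding D_def simple_ito_def[abs_def] by (intro borel_measurable_sum) auto
qed

lemma J_measurable: "0 < n ==> t \<in> {0..T} ==> J n t \<in> borel_measurable M"
 using F_measurable_M elementary_adapted[OF el_h] by blast

lemma X_measurable: "0 < n ==> t \<in> {0..T} ==> X n t \<in> borel_measurable M"
 unfolding X_def[abs_def] using D_measurable J_measurable by (intro borel_measurable_add borel_measurable_const) auto

definition C2 :: real where "C2 = 4 * K^2 * C0 * (T + 1)"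

lemma C2_nonneg: "0 \<le> C2" unfolding C2_def using C0_ge T_pos by simp

lemma X_increment:
 assumes n: "0 < n" and st: "0 \<le> s" "s \<le> t" "t \<le> T"
 shows "(EE w. ennreal ((X n t w - X n s w)^2)) \<le> ennreal (C2 * (t - s))"
proof -
 let ?C = "2 * K^2 * C0"
 have C: "0 \<le> ?C" using C0_ge by simp
 have in_T: "s \<in> {0..T}" "t \<in> {0..T}" using st by auto
 have sqm: "(%z. (h n (snd z) (fst z))^2) \<in> borel_measurable (M \<Otimes>\<^sub>M lborel)" "(%z. (\<beta> n (snd z) (fst z))^2) \<in> borel_measurable (M \<Otimes>\<^sub>M lborel)"
  using joint[OF n] by (intro borel_measurable_power; simp)+
 have Db: "(EE w. ennreal ((D n t w - D n s w)^2)) \<le> ennreal (?C * (t - s)^2)"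
 proof -
  have "(EE w. ennreal ((D n t w - D n s w)^2)) \<le> (EE w. ennreal (t - s) * (TI {s..t} (%r. ennreal ((\<beta> n r w)^2))))"
   unfolding D_eq(2)[OF n st, symmetric] by (intro nn_integral_mono square_set_integral_le D_eq(1)[OF n st] st)
  also have "... = ennreal (t - s) * (EE w. (TI {s..t} (%r. ennreal ((\<beta> n r w)^2))))"
  proof (rule nn_integral_cmult)
   have "(%z. ennreal ((\<beta> n (snd z) (fst z))^2) * indicator {s..t} (snd z)) \<in> borel_measurable (M \<Otimes>\<^sub>M lborel)" using sqm(2) by measurable
   then show "(%w. (TI {s..t} (%r. ennreal ((\<beta> n r w)^2)))) \<in> borel_measurable M"
    by (intro lborel.borel_measurable_nn_integral) (simp add: case_prod_beta')
  qed
  also have "... \<le> ennreal (t - s) * ennreal (?C * (t - s))"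
   by (intro mult_left_mono[OF _ zero_le] nn_integral_interval_le sqm frozen_moments n C st)
  also have "... = ennreal (?C * (t - s)^2)" 
  proof -
   have "0 \<le> t - s" "0 \<le> ?C * (t - s)" using st mult_nonneg_nonneg[OF C, of "t - s"] by auto
   then have "ennreal (t - s) * ennreal (?C * (t - s)) = ennreal ((t - s) * (?C * (t - s)))" by (rule ennreal_mult[symmetric])
   then show ?thesis by (simp add: power2_eq_square mult_ac)
  qed
  finally show ?thesis .
 qed
 have Jb: "(EE w. ennreal ((J n t w - J n s w)^2)) \<le> ennreal (?C * (t - s))"
  by (rule order_trans[OF isometry_between[OF el_h[OF n] st]], intro nn_integral_interval_le sqm frozen_moments n C st)
 have "(EE w. ennreal ((X n t w - X n s w)^2)) = (EE w. ennreal (((D n t w - D n s w) + (J n t w - J n s w))^2))"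
  by (simp add: X_def algebra_simps)
 also have "... \<le> 2 * (EE w. ennreal ((D n t w - D n s w)^2)) + 2 * (EE w. ennreal ((J n t w - J n s w)^2))"
  by (intro nn_integral_square_sum_le borel_measurable_diff D_measurable J_measurable n in_T)
 also have "... \<le> 2 * ennreal (?C * (t - s)^2) + 2 * ennreal (?C * (t - s))" by (intro add_mono mult_left_mono Db Jb) auto
 also have "... = ennreal (2 * (?C * (t - s)^2) + 2 * (?C * (t - s)))"
 proof -
  have "2 * ennreal a + 2 * ennreal b = ennreal (2 * a + 2 * b)" if "0 \<le> a" "0 \<le> b" for a b :: real
   using that by (simp add: ennreal_plus ennreal_mult)
  moreover have "0 \<le> ?C * (t - s)^2" "0 \<le> ?C * (t - s)" using mult_nonneg_nonneg[OF C, of "(t - s)^2"] mult_nonneg_nonneg[OF C, of "t - s"] st by auto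
  ultimately show ?thesis by blast
 qed
 also have "... \<le> ennreal (C2 * (t - s))"
 proof (rule ennreal_leI)
  have "(t - s)^2 \<le> T * (t - s)" unfolding power2_eq_square using st by (intro mult_right_mono) auto
  then have "?C * (t - s)^2 \<le> ?C * (T * (t - s))" by (rule mult_left_mono[OF _ C])
  then show "2 * (?C * (t - s)^2) + 2 * (?C * (t - s)) \<le> C2 * (t - s)" unfolding C2_def by (simp add: algebra_simps)
 qed
 finally show ?thesis .
qed

end

context euler_scheme
begin

text \<open>
 Two schemes freeze the linear drift at different grid points; \<open>v\<close> bounds the resulting oscillation of
 its coefficients.
\<close>

lemma frozen_differences:
 assumes n: "0 < n" "0 < n'" and v: "0 \<le> v"
  and osc: "\<forall>q\<in>{0..T}. \<forall>q'\<in>{0..T}. \<bar>q - q'\<bar> \<le> T / real n + T / real n' --> \<bar>l q - l q'\<bar> \<le> v \<and> \<bar>m q - m q'\<bar> \<le> v"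
 shows "(h n t w - h n' t w)^2 \<le> K^2 * (y n t w - y n' t w)^2"
  "(\<beta> n t w - \<beta> n' t w)^2 \<le> 2 * K^2 * (y n t w - y n' t w)^2 + 4 * v^2 * (1 + (y n' t w)^2)"
proof -
 have "(h n t w - h n' t w)^2 \<le> K^2 * (y n t w - y n' t w)^2 \<and>
  (\<beta> n t w - \<beta> n' t w)^2 \<le> 2 * K^2 * (y n t w - y n' t w)^2 + 4 * v^2 * (1 + (y n' t w)^2)"
 proof (cases "0 < t \<and> t \<le> T")
  case True
  obtain i where i: "i < n" "pt n i < t" "t - pt n i \<le> T / real n" "pt n i \<in> {0..T}"
   "y n t w = V n i w" "h n t w = s0 (V n i w)" "\<beta> n t w = drift (pt n i) (V n i w)"
   using frozen_values[OF n(1)] True by blast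
  obtain j where j: "j < n'" "pt n' j < t" "t - pt n' j \<le> T / real n'" "pt n' j \<in> {0..T}"
   "y n' t w = V n' j w" "h n' t w = s0 (V n' j w)" "\<beta> n' t w = drift (pt n' j) (V n' j w)"
   using frozen_values[OF n(2)] True by blast
  let ?a = "V n i w" and ?c = "V n' j w" and ?q = "pt n i" and ?q' = "pt n' j"
  have "\<bar>?q - ?q'\<bar> \<le> T / real n + T / real n'" using i(2,3) j(2,3) by linarith
  then have o: "\<bar>l ?q - l ?q'\<bar> \<le> v" "\<bar>m ?q - m ?q'\<bar> \<le> v" using osc i(4) j(4) by auto
  have "(s0 ?a - s0 ?c)^2 \<le> (K * \<bar>?a - ?c\<bar>)^2" using power_mono[OF s0_lipschitz abs_ge_zero, of ?a ?c 2] by simp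
  moreover have "(drift ?q ?a - drift ?q' ?c)^2 \<le> 2 * K^2 * (?a - ?c)^2 + 4 * v^2 * (1 + ?c^2)"
  proof -
   let ?p = "K * \<bar>?a - ?c\<bar>" and ?r = "v * (1 + \<bar>?c\<bar>)"
   have "drift ?q ?a - drift ?q' ?c = m ?q * (?a - ?c) + ((l ?q - l ?q') + (m ?q - m ?q') * ?c)"
    unfolding drift_def by (simp add: algebra_simps)
   moreover have "\<bar>m ?q * (?a - ?c)\<bar> \<le> ?p" unfolding abs_mult by (rule mult_right_mono[OF m_bound[OF i(4)]]) simp
   moreover have "\<bar>(m ?q - m ?q') * ?c\<bar> \<le> v * \<bar>?c\<bar>" unfolding abs_mult by (rule mult_right_mono[OF o(2)]) simp
   ultimately have "\<bar>drift ?q ?a - drift ?q' ?c\<bar> \<le> ?p + ?r" using o(1) by (simp add: distrib_left)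
   then have "(drift ?q ?a - drift ?q' ?c)^2 \<le> (?p + ?r)^2" using power_mono[OF _ abs_ge_zero, of _ _ 2] by fastforce
   also have "... \<le> 2 * ?p^2 + 2 * ?r^2"
   proof -
    have "0 \<le> (?p - ?r)^2" by simp
    then show ?thesis unfolding power2_sum power2_diff by simp
   qed
   also have "?r^2 \<le> v^2 * (2 * (1 + ?c^2))"
    unfolding power_mult_distrib
   proof (rule mult_left_mono)
    have "0 \<le> (1 - \<bar>?c\<bar>)^2" by simp
    then show "(1 + \<bar>?c\<bar>)^2 \<le> 2 * (1 + ?c^2)" unfolding power2_sum power2_diff by simp
   qed simp
   finally show ?thesis by (simp add: power_mult_distrib algebra_simps)
  qed
  ultimately show ?thesis unfolding i(5-7) j(5-7) by (simp add: power_mult_distrib)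
 next
  case False
  then have "y n t w = 0" "h n t w = 0" "\<beta> n t w = 0" "y n' t w = 0" "h n' t w = 0" "\<beta> n' t w = 0"
   using elementary_outside[OF el_y[OF n(1)]] elementary_outside[OF el_h[OF n(1)]] elementary_outside[OF el_\<beta>[OF n(1)]]
    elementary_outside[OF el_y[OF n(2)]] elementary_outside[OF el_h[OF n(2)]] elementary_outside[OF el_\<beta>[OF n(2)]] by auto
  then show ?thesis by simp
 qed
 then show "(h n t w - h n' t w)^2 \<le> K^2 * (y n t w - y n' t w)^2"
  "(\<beta> n t w - \<beta> n' t w)^2 \<le> 2 * K^2 * (y n t w - y n' t w)^2 + 4 * v^2 * (1 + (y n' t w)^2)" by simp_all
qed

lemma joint_square_diff:
 fixes f g :: "real => 'a => real" and a b :: real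
 assumes "(%z. f (snd z) (fst z)) \<in> borel_measurable (M \<Otimes>\<^sub>M lborel)" "(%z. g (snd z) (fst z)) \<in> borel_measurable (M \<Otimes>\<^sub>M lborel)"
 shows "(%z. ((f (snd z) (fst z) - g (snd z) (fst z))^2 :: real)) \<in> borel_measurable (M \<Otimes>\<^sub>M lborel)"
  "(%(w, r). ennreal ((f r w - g r w)^2)) \<in> borel_measurable (M \<Otimes>\<^sub>M lborel)"
  "(%w. (TI {a..b} (%r. ennreal ((f r w - g r w)^2)))) \<in> borel_measurable M"
proof -
 show 1: "(%z. ((f (snd z) (fst z) - g (snd z) (fst z))^2 :: real)) \<in> borel_measurable (M \<Otimes>\<^sub>M lborel)"
  using assms by (intro borel_measurable_power borel_measurable_diff)
 then have 2: "(%z. ennreal ((f (snd z) (fst z) - g (snd z) (fst z))^2)) \<in> borel_measurable (M \<Otimes>\<^sub>M lborel)" by measurable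
 then show "(%(w, r). ennreal ((f r w - g r w)^2)) \<in> borel_measurable (M \<Otimes>\<^sub>M lborel)" by (simp add: case_prod_beta')
 have "(%z. ennreal ((f (snd z) (fst z) - g (snd z) (fst z))^2) * indicator {a..b} (snd z)) \<in> borel_measurable (M \<Otimes>\<^sub>M lborel)" using 2 by measurable
 then show "(%w. (TI {a..b} (%r. ennreal ((f r w - g r w)^2)))) \<in> borel_measurable M"
  by (intro lborel.borel_measurable_nn_integral) (simp add: case_prod_beta')
qed

definition c1 :: real where "c1 = 16 * T * K^2 + 8 * K^2"

lemma c1_nonneg: "0 \<le> c1" unfolding c1_def using T_pos by simp

lemma mean_square_drift_difference:
 assumes n: "0 < n" "0 < n'" and v: "0 \<le> v"
  and osc: "\<forall>q\<in>{0..T}. \<forall>q'\<in>{0..T}. \<bar>q - q'\<bar> \<le> T / real n + T / real n' --> \<bar>l q - l q'\<bar> \<le> v \<and> \<bar>m q - m q'\<bar> \<le> v"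
 shows "(EE w. ennreal ((h n r w - h n' r w)^2)) \<le> ennreal (K^2) * (EE w. ennreal ((y n r w - y n' r w)^2))"
  "(EE w. ennreal ((\<beta> n r w - \<beta> n' r w)^2)) \<le> ennreal (2 * K^2) * (EE w. ennreal ((y n r w - y n' r w)^2)) + ennreal (4 * v^2 * C0)"
proof -
 have yM[measurable]: "y n r \<in> borel_measurable M" "y n' r \<in> borel_measurable M" using section_measurable joint(1) n by blast+
 have "(EE w. ennreal ((h n r w - h n' r w)^2)) \<le> (EE w. ennreal (K^2) * ennreal ((y n r w - y n' r w)^2))"
  using frozen_differences(1)[OF assms] by (intro nn_integral_mono) (simp add: ennreal_mult[symmetric] ennreal_leI)
 also have "... = ennreal (K^2) * (EE w. ennreal ((y n r w - y n' r w)^2))" by (rule nn_integral_cmult) measurable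
 finally show "(EE w. ennreal ((h n r w - h n' r w)^2)) \<le> ennreal (K^2) * (EE w. ennreal ((y n r w - y n' r w)^2))" .
 have "(EE w. ennreal ((\<beta> n r w - \<beta> n' r w)^2))
  \<le> (EE w. ennreal (2 * K^2) * ennreal ((y n r w - y n' r w)^2) + ennreal (4 * v^2) * (1 + ennreal ((y n' r w)^2)))"
 proof (rule nn_integral_mono)
  fix w
  have "ennreal ((\<beta> n r w - \<beta> n' r w)^2) \<le> ennreal (2 * K^2 * (y n r w - y n' r w)^2 + 4 * v^2 * (1 + (y n' r w)^2))"
   by (rule ennreal_leI[OF frozen_differences(2)[OF assms]])
  also have "... = ennreal (2 * K^2) * ennreal ((y n r w - y n' r w)^2) + ennreal (4 * v^2) * (1 + ennreal ((y n' r w)^2))"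
  proof -
   have e: "ennreal (a * b + c * (1 + d)) = ennreal a * ennreal b + ennreal c * (1 + ennreal d)" if "0 \<le> a" "0 \<le> b" "0 \<le> c" "0 \<le> d" for a b c d
    using that by (simp add: ennreal_plus ennreal_mult)
   show ?thesis by (rule e) simp_all
  qed
  finally show "ennreal ((\<beta> n r w - \<beta> n' r w)^2) \<le> ennreal (2 * K^2) * ennreal ((y n r w - y n' r w)^2) + ennreal (4 * v^2) * (1 + ennreal ((y n' r w)^2))" .
 qed
 also have "... = ennreal (2 * K^2) * (EE w. ennreal ((y n r w - y n' r w)^2)) + ennreal (4 * v^2) * (1 + (EE w. ennreal ((y n' r w)^2)))"
  by (simp add: nn_integral_add nn_integral_cmult emeasure_space_1)
 also have "... \<le> ennreal (2 * K^2) * (EE w. ennreal ((y n r w - y n' r w)^2)) + ennreal (4 * v^2) * (1 + ennreal (C0 - 1))"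
  by (intro add_left_mono mult_left_mono frozen_moments(1)[OF n(2)]) auto
 also have "ennreal (4 * v^2) * (1 + ennreal (C0 - 1)) = ennreal (4 * v^2 * C0)"
  using C0_ge ennreal_plus[of 1 "C0 - 1"] by (simp add: ennreal_mult)
 finally show "(EE w. ennreal ((\<beta> n r w - \<beta> n' r w)^2)) \<le> ennreal (2 * K^2) * (EE w. ennreal ((y n r w - y n' r w)^2)) + ennreal (4 * v^2 * C0)" .
qed

text \<open>
 Between the frozen values lie two increments of the interpolated schemes over at most a grid
 step, and the distance of the interpolated schemes, which is controlled by the mean square
 distance of the frozen values at earlier times. Gronwall's inequality closes the loop.
\<close>

lemma mean_square_distance:
 assumes n: "0 < n" "0 < n'" and v: "0 \<le> v"
  and osc: "\<forall>q\<in>{0..T}. \<forall>q'\<in>{0..T}. \<bar>q - q'\<bar> \<le> T / real n + T / real n' --> \<bar>l q - l q'\<bar> \<le> v \<and> \<bar>m q - m q'\<bar> \<le> v"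
 shows "(EE w. ennreal ((y n t w - y n' t w)^2)) \<le> ennreal ((4 * C2 * (T / real n + T / real n') + 32 * T^2 * v^2 * C0) * exp (c1 * T))"
proof -
 define d where "d t = (EE w. ennreal ((y n t w - y n' t w)^2))" for t
 define a where "a = 4 * C2 * (T / real n + T / real n') + 32 * T^2 * v^2 * C0"
 have a: "0 \<le> a" unfolding a_def using C2_nonneg C0_ge T_pos by simp
 have jy: "(%(w, r). ennreal ((y n r w - y n' r w)^2)) \<in> borel_measurable (M \<Otimes>\<^sub>M lborel)"
  by (rule joint_square_diff(2)[OF joint(1)[OF n(1)] joint(1)[OF n(2)]])
 have dm: "d \<in> borel_measurable lborel"
 proof -
  have "(%(r, w). ennreal ((y n r w - y n' r w)^2)) \<in> borel_measurable (lborel \<Otimes>\<^sub>M M)"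
   using measurable_compose[OF measurable_pair_swap' jy] by (simp add: case_prod_beta')
  then show ?thesis unfolding d_def by (intro borel_measurable_nn_integral)
 qed
 have yM: "y n t \<in> borel_measurable M" "y n' t \<in> borel_measurable M" for t using section_measurable joint(1) n by blast+
 have X0: "D n 0 w = 0" "D n' 0 w = 0" "J n 0 w = 0" "J n' 0 w = 0" for w using D_zero J_zero n by auto
 have zero: "d t = 0" if "\<not> (0 < t \<and> t \<le> T)" for t
 proof -
  have "y n t w = 0" "y n' t w = 0" for w
   using elementary_outside[OF el_y[OF n(1)]] elementary_outside[OF el_y[OF n(2)]] that by auto
  then show ?thesis unfolding d_def by simp
 qed
 have bound: "d t \<le> ennreal (4 * C0)" for t
 proof -
  have fm: "(EE w. ennreal ((y k t w)^2)) \<le> ennreal C0" if "0 < k" for k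
   by (rule order_trans[OF frozen_moments(1)[OF that]]) (simp add: ennreal_leI)
  have "d t = (EE w. ennreal ((y n t w + - y n' t w)^2))" unfolding d_def by simp
  also have "... \<le> 2 * (EE w. ennreal ((y n t w)^2)) + 2 * (EE w. ennreal ((- y n' t w)^2))"
   using yM by (intro nn_integral_square_sum_le) auto
  also have "... \<le> 2 * ennreal C0 + 2 * ennreal C0"
   using fm[OF n(1)] fm[OF n(2)] by (intro add_mono mult_left_mono) auto
  also have "... = ennreal (4 * C0)"
  proof -
   have "2 * ennreal z + 2 * ennreal z = ennreal (4 * z)" if "0 \<le> z" for z
    using that ennreal_plus[of "2 * z" "2 * z"] by (simp add: ennreal_mult)
   then show ?thesis using C0_ge by simp
  qed
  finally show ?thesis .
 qed
 have ineq: "d t \<le> ennreal a + ennreal c1 * (TI {0..t} d)" if t: "t \<in> {0..T}" for t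
 proof (cases "0 < t")
  case True
  have t: "0 < t" "t \<le> T" "0 \<le> t" "0 \<le> T" using True t T_pos by auto
  let ?I = "TI {0..t} d"
  have "(EE w. ennreal ((D n t w - D n' t w)^2)) \<le> ennreal T * (ennreal (2 * K^2) * ?I + ennreal (4 * v^2 * C0 * T))"
  proof -
   have si: "set_integrable lborel {0..t} (%r. \<beta> n r w)" "set_integrable lborel {0..t} (%r. \<beta> n' r w)" for w
    using D_eq(1)[OF _ order_refl t(3,2)] n by auto
   have Deq: "D n t w - D n' t w = (LINT r:{0..t}|lborel. \<beta> n r w - \<beta> n' r w)" for w
    using D_eq(2)[OF n(1) order_refl t(3,2), of w] D_eq(2)[OF n(2) order_refl t(3,2), of w] X0
    by (simp add: set_integral_diff(2)[OF si])
   have "(EE w. ennreal ((D n t w - D n' t w)^2)) \<le> (EE w. ennreal T * (TI {0..t} (%r. ennreal ((\<beta> n r w - \<beta> n' r w)^2))))"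
   proof (rule nn_integral_mono)
    fix w
    have "ennreal ((D n t w - D n' t w)^2) \<le> ennreal (t - 0) * (TI {0..t} (%r. ennreal ((\<beta> n r w - \<beta> n' r w)^2)))"
     unfolding Deq by (rule square_set_integral_le[OF set_integral_diff(1)[OF si] t(3)])
    also have "... \<le> ennreal T * (TI {0..t} (%r. ennreal ((\<beta> n r w - \<beta> n' r w)^2)))"
     using t by (intro mult_right_mono ennreal_leI) auto
    finally show "ennreal ((D n t w - D n' t w)^2) \<le> ennreal T * (TI {0..t} (%r. ennreal ((\<beta> n r w - \<beta> n' r w)^2)))" .
   qed
   also have "... = ennreal T * (EE w. (TI {0..t} (%r. ennreal ((\<beta> n r w - \<beta> n' r w)^2))))"
    by (rule nn_integral_cmult[OF joint_square_diff(3)[OF joint(3)[OF n(1)] joint(3)[OF n(2)]]])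
   also have "(EE w. (TI {0..t} (%r. ennreal ((\<beta> n r w - \<beta> n' r w)^2)))) = (TI {0..t} (%r. (EE w. ennreal ((\<beta> n r w - \<beta> n' r w)^2))))"
    by (rule nn_integral_swap_set[OF joint_square_diff(2)[OF joint(3)[OF n(1)] joint(3)[OF n(2)]]]) simp
   also have "... \<le> (\<integral>\<^sup>+r. ennreal (2 * K^2) * (d r * indicator {0..t} r) + ennreal (4 * v^2 * C0) * indicator {0..t} r \<partial>lborel)"
   proof (rule nn_integral_mono)
    fix r show "(EE w. ennreal ((\<beta> n r w - \<beta> n' r w)^2)) * indicator {0..t} r \<le> ennreal (2 * K^2) * (d r * indicator {0..t} r) + ennreal (4 * v^2 * C0) * indicator {0..t} r"
     using mean_square_drift_difference(2)[OF assms, of r] by (cases "r \<in> {0..t}") (simp_all add: d_def)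
   qed
   also have "... = ennreal (2 * K^2) * ?I + ennreal (4 * v^2 * C0) * ennreal t"
    using dm t(3) by (subst nn_integral_add) (simp_all add: nn_integral_cmult nn_integral_cmult_indicator)
   also have "ennreal (4 * v^2 * C0) * ennreal t \<le> ennreal (4 * v^2 * C0) * ennreal T" using t by (intro mult_left_mono ennreal_leI) auto
   also have "... = ennreal (4 * v^2 * C0 * T)" using C0_ge t by (intro ennreal_mult[symmetric]) auto
   finally show ?thesis by (simp add: mult_left_mono)
  qed
  moreover have "(EE w. ennreal ((J n t w - J n' t w)^2)) \<le> ennreal (K^2) * ?I"
  proof -
   have "(EE w. ennreal ((J n t w - J n' t w)^2)) \<le> (EE w. (TI {0..t} (%r. ennreal ((h n r w - h n' r w)^2))))"
    using isometry_between[OF elementary_diff[OF el_h[OF n(1)] el_h[OF n(2)] square_integrable_diff] order_refl t(3,2)] by (simp add: X0)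
   also have "... = (TI {0..t} (%r. (EE w. ennreal ((h n r w - h n' r w)^2))))"
    by (rule nn_integral_swap_set[OF joint_square_diff(2)[OF joint(2)[OF n(1)] joint(2)[OF n(2)]]]) simp
   also have "... \<le> (\<integral>\<^sup>+r. ennreal (K^2) * (d r * indicator {0..t} r) \<partial>lborel)"
   proof (rule nn_integral_mono)
    fix r show "(EE w. ennreal ((h n r w - h n' r w)^2)) * indicator {0..t} r \<le> ennreal (K^2) * (d r * indicator {0..t} r)"
     using mean_square_drift_difference(1)[OF assms, of r] by (cases "r \<in> {0..t}") (simp_all add: d_def)
   qed
   also have "... = ennreal (K^2) * ?I" using dm by (simp add: nn_integral_cmult)
   finally show ?thesis .
  qed
  ultimately have X: "(EE w. ennreal ((X n t w - X n' t w)^2)) \<le> 2 * (ennreal T * (ennreal (2 * K^2) * ?I + ennreal (4 * v^2 * C0 * T))) + 2 * (ennreal (K^2) * ?I)"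
  proof -
   assume 1: "(EE w. ennreal ((D n t w - D n' t w)^2)) \<le> ennreal T * (ennreal (2 * K^2) * ?I + ennreal (4 * v^2 * C0 * T))"
    and 2: "(EE w. ennreal ((J n t w - J n' t w)^2)) \<le> ennreal (K^2) * ?I"
   have "(EE w. ennreal ((X n t w - X n' t w)^2)) = (EE w. ennreal (((D n t w - D n' t w) + (J n t w - J n' t w))^2))"
    by (simp add: X_def algebra_simps)
   also have "... \<le> 2 * (EE w. ennreal ((D n t w - D n' t w)^2)) + 2 * (EE w. ennreal ((J n t w - J n' t w)^2))"
    using t by (intro nn_integral_square_sum_le borel_measurable_diff D_measurable J_measurable n) auto
   also have "... \<le> 2 * (ennreal T * (ennreal (2 * K^2) * ?I + ennreal (4 * v^2 * C0 * T))) + 2 * (ennreal (K^2) * ?I)"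
    by (intro add_mono mult_left_mono 1 2) auto
   finally show ?thesis .
  qed
  obtain i where i: "i < n" "pt n i < t" "t - pt n i \<le> T / real n" "pt n i \<in> {0..T}" "\<forall>w. y n t w = X n (pt n i) w"
   using frozen_values[OF n(1) t(1,2)] by metis
  obtain j where j: "j < n'" "pt n' j < t" "t - pt n' j \<le> T / real n'" "pt n' j \<in> {0..T}" "\<forall>w. y n' t w = X n' (pt n' j) w"
   using frozen_values[OF n(2) t(1,2)] by metis
  have near: "(EE w. ennreal ((X k t w - X k q w)^2)) \<le> ennreal (C2 * (T / real k))"
   if "0 < k" "q < t" "t - q \<le> T / real k" "q \<in> {0..T}" for k q
   using X_increment[OF that(1), of q t] mult_left_mono[OF that(3) C2_nonneg] that t by (auto intro: order_trans ennreal_leI)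
  have XM: "X n t \<in> borel_measurable M" "X n' t \<in> borel_measurable M" "X n (pt n i) \<in> borel_measurable M" "X n' (pt n' j) \<in> borel_measurable M"
   using X_measurable n t i(4) j(4) by auto
  have "d t = (EE w. ennreal (((X n (pt n i) w - X n t w) + ((X n t w - X n' t w) + (X n' t w - X n' (pt n' j) w)))^2))"
   unfolding d_def using i(5) j(5) by simp
  also have "... \<le> 2 * (EE w. ennreal ((X n (pt n i) w - X n t w)^2)) + 2 * (EE w. ennreal (((X n t w - X n' t w) + (X n' t w - X n' (pt n' j) w))^2))"
   by (intro nn_integral_square_sum_le borel_measurable_diff borel_measurable_add XM)
  also have "... \<le> 2 * (EE w. ennreal ((X n t w - X n (pt n i) w)^2)) + 2 * (2 * (EE w. ennreal ((X n t w - X n' t w)^2)) + 2 * (EE w. ennreal ((X n' t w - X n' (pt n' j) w)^2)))"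
   unfolding power2_commute[of "X n (pt n i) _"]
   by (intro add_left_mono mult_left_mono nn_integral_square_sum_le borel_measurable_diff XM) auto
  also have "... \<le> 2 * ennreal (C2 * (T / real n)) + 2 * (2 * (2 * (ennreal T * (ennreal (2 * K^2) * ?I + ennreal (4 * v^2 * C0 * T))) + 2 * (ennreal (K^2) * ?I)) + 2 * ennreal (C2 * (T / real n')))"
   by (intro add_mono mult_left_mono X near[OF n(1) i(2-4)] near[OF n(2) j(2-4)]) auto
  also have "... \<le> ennreal a + ennreal c1 * ?I"
  proof -
   have "?I < \<top>"
   proof -
    have "?I \<le> (\<integral>\<^sup>+s. ennreal (4 * C0) * indicator {0..t} s \<partial>lborel)" by (intro nn_integral_mono mult_right_mono bound) auto
    also have "... < \<top>" using t(3) by (simp add: nn_integral_cmult_indicator ennreal_mult_less_top)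
    finally show ?thesis .
   qed
   then obtain z where z: "?I = ennreal z" "0 \<le> z" by (cases ?I) auto
   have e: "2 * ennreal p + 2 * (2 * (2 * (ennreal T * (ennreal k * ennreal z + ennreal w)) + 2 * (ennreal k' * ennreal z)) + 2 * ennreal p')
    = ennreal (2 * p + 2 * (2 * (2 * (T * (k * z + w)) + 2 * (k' * z)) + 2 * p'))" if "0 \<le> p" "0 \<le> k" "0 \<le> w" "0 \<le> k'" "0 \<le> p'" for p k w k' p'
    using that z(2) t(4) by (simp add: ennreal_plus ennreal_mult)
   have nn: "0 \<le> C2 * (T / real n)" "0 \<le> C2 * (T / real n')" "0 \<le> 4 * v^2 * C0 * T"
    using C2_nonneg C0_ge t(4) by (auto intro!: mult_nonneg_nonneg)
   have "2 * (C2 * (T / real n)) + 2 * (2 * (2 * (T * ((2 * K^2) * z + 4 * v^2 * C0 * T)) + 2 * (K^2 * z)) + 2 * (C2 * (T / real n'))) \<le> a + c1 * z"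
   proof -
    have "2 * p + 2 * (2 * (2 * (T * ((2 * k) * z + u * T)) + 2 * (k * z)) + 2 * p') \<le> (4 * (p + p') + 8 * T^2 * u) + (16 * T * k + 8 * k) * z"
     if "0 \<le> p" "0 \<le> k" for p p' k u
    proof -
     have "(4 * (p + p') + 8 * T^2 * u) + (16 * T * k + 8 * k) * z - (2 * p + 2 * (2 * (2 * (T * ((2 * k) * z + u * T)) + 2 * (k * z)) + 2 * p')) = 2 * p"
      by (simp add: algebra_simps power2_eq_square)
     then show ?thesis using that(1) by linarith
    qed
    from this[OF nn(1), of "K^2" "4 * v^2 * C0" "C2 * (T / real n')"] show ?thesis
     unfolding a_def c1_def by (simp add: algebra_simps)
   qed
   then show ?thesis
    unfolding z(1) using e[OF nn(1) _ nn(3) _ nn(2), of "2 * K^2" "K^2"] a c1_nonneg z(2)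
    by (simp add: ennreal_plus[symmetric] ennreal_mult[symmetric] ennreal_leI del: ennreal_plus)
  qed
  finally show ?thesis .
 next
  case False
  then show ?thesis using zero by simp
 qed
 have nz: "d t \<le> ennreal (a * exp (c1 * T))"
 proof (cases "t \<in> {0..T}")
  case True
  have "d t \<le> ennreal (a * exp (c1 * t))"
   by (rule gronwall_bounded[OF a c1_nonneg _ bound ineq True]) (use C0_ge in simp)
  also have "... \<le> ennreal (a * exp (c1 * T))" using True a c1_nonneg by (intro ennreal_leI mult_left_mono) (auto intro: mult_left_mono)
  finally show ?thesis .
 next
  case False
  then show ?thesis using zero by auto
 qed
 then show ?thesis unfolding d_def a_def .
qed

end

context euler_scheme
begin

text \<open>Uniform continuity of the coefficients of the drift makes the oscillation \<open>v\<close> small on fine grids.\<close>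

lemma schemes_Cauchy:
 assumes \<eta>: "0 < \<eta>"
 shows "\<exists>N>0. \<forall>n\<ge>N. \<forall>n'\<ge>N. \<forall>t. (EE w. ennreal ((h n t w - h n' t w)^2)) \<le> ennreal \<eta> \<and> (EE w. ennreal ((\<beta> n t w - \<beta> n' t w)^2)) \<le> ennreal \<eta>"
proof -
 let ?E = "exp (c1 * T)"
 \<comment> \<open>the factors of the mesh and of \<open>v^2\<close> in the bound for the drift; each contribution gets half of \<open>\<eta>\<close>\<close>
 define A where "A = 8 * K^2 * ?E * C2 + 1"
 define B where "B = 64 * K^2 * T^2 * C0 * ?E + 4 * C0"
 have A: "0 < A" unfolding A_def using C2_nonneg by (intro add_nonneg_pos mult_nonneg_nonneg) auto
 have B: "0 < B" unfolding B_def using C0_ge by (intro add_nonneg_pos mult_nonneg_nonneg) auto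
 define v where "v = sqrt (\<eta> / (2 * B))"
 have v: "0 < v" "B * v^2 = \<eta> / 2" unfolding v_def using \<eta> B by auto
 have "uniformly_continuous_on {0..T} l" "uniformly_continuous_on {0..T} m"
  using l_cont m_cont by (auto intro: compact_uniformly_continuous)
 then obtain d1 d2 where d1: "0 < d1" "\<And>q q'. q \<in> {0..T} ==> q' \<in> {0..T} ==> dist q' q < d1 ==> dist (l q') (l q) < v"
  and d2: "0 < d2" "\<And>q q'. q \<in> {0..T} ==> q' \<in> {0..T} ==> dist q' q < d2 ==> dist (m q') (m q) < v"
  using v(1) unfolding uniformly_continuous_on_def by metis
 define \<delta> where "\<delta> = min (min d1 d2) (\<eta> / (2 * A))"
 have \<delta>: "0 < \<delta>" "\<delta> \<le> d1" "\<delta> \<le> d2" "\<delta> \<le> \<eta> / (2 * A)" unfolding \<delta>_def using d1(1) d2(1) \<eta> A by auto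
 obtain N :: nat where N: "2 * T / \<delta> < real N" using reals_Archimedean2 by blast
 have "0 < 2 * T / \<delta>" using T_pos \<delta>(1) by simp
 then have N0: "0 < N" using N by (intro gr0I) simp
 have "2 * (T / real N) < \<delta>" using N N0 \<delta>(1) by (simp add: field_simps)
 moreover have "T / real n \<le> T / real N" if "N \<le> n" for n using that N0 T_pos by (intro divide_left_mono) auto
 ultimately have small: "T / real n + T / real n' < \<delta>" if "N \<le> n" "N \<le> n'" for n n' using that by (smt (verit))
 have "(EE w. ennreal ((h n t w - h n' t w)^2)) \<le> ennreal \<eta> \<and> (EE w. ennreal ((\<beta> n t w - \<beta> n' t w)^2)) \<le> ennreal \<eta>"
  if nn: "N \<le> n" "N \<le> n'" for n n' t
 proof -
  let ?u = "T / real n + T / real n'"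
  have n: "0 < n" "0 < n'" using nn N0 by auto
  have u: "0 \<le> ?u" "?u \<le> \<eta> / (2 * A)" using small[OF nn] \<delta>(4) T_pos by auto
  have osc: "\<forall>q\<in>{0..T}. \<forall>q'\<in>{0..T}. \<bar>q - q'\<bar> \<le> ?u --> \<bar>l q - l q'\<bar> \<le> v \<and> \<bar>m q - m q'\<bar> \<le> v"
  proof (intro ballI impI)
   fix q q' assume q: "q \<in> {0..T}" "q' \<in> {0..T}" "\<bar>q - q'\<bar> \<le> ?u"
   then have "dist q q' < d1" "dist q q' < d2" using small[OF nn] \<delta>(2,3) by (auto simp: dist_real_def)
   then show "\<bar>l q - l q'\<bar> \<le> v \<and> \<bar>m q - m q'\<bar> \<le> v"
    using d1(2)[OF q(2,1)] d2(2)[OF q(2,1)] by (simp add: dist_real_def less_imp_le)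
  qed
  define a where "a = (4 * C2 * ?u + 32 * T^2 * v^2 * C0) * ?E"
  have a: "0 \<le> a" unfolding a_def using C2_nonneg C0_ge T_pos by (intro mult_nonneg_nonneg add_nonneg_nonneg) auto
  have y: "(EE w. ennreal ((y n t w - y n' t w)^2)) \<le> ennreal a"
   unfolding a_def by (rule mean_square_distance[OF n less_imp_le[OF v(1)] osc])
  have "A * ?u \<le> \<eta> / 2" using u(2) A by (simp add: field_simps)
  moreover have "2 * K^2 * a + 4 * v^2 * C0 = (A - 1) * ?u + B * v^2" unfolding a_def A_def B_def by (simp add: algebra_simps)
  ultimately have le: "2 * K^2 * a + 4 * v^2 * C0 \<le> \<eta>" using v(2) u(1) by (simp add: left_diff_distrib)
  have nn2: "0 \<le> K^2 * a" "0 \<le> 4 * v^2 * C0" using a C0_ge by (auto intro!: mult_nonneg_nonneg)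
  note md = mean_square_drift_difference[OF n less_imp_le[OF v(1)] osc, of t]
  have "(EE w. ennreal ((h n t w - h n' t w)^2)) \<le> ennreal (K^2) * ennreal a"
   by (rule order_trans[OF md(1) mult_left_mono[OF y]]) simp
  also have "... = ennreal (K^2 * a)" using a by (intro ennreal_mult[symmetric]) auto
  also have "... \<le> ennreal \<eta>" using le nn2 by (intro ennreal_leI) linarith
  finally have 1: "(EE w. ennreal ((h n t w - h n' t w)^2)) \<le> ennreal \<eta>" .
  have "(EE w. ennreal ((\<beta> n t w - \<beta> n' t w)^2)) \<le> ennreal (2 * K^2) * ennreal a + ennreal (4 * v^2 * C0)"
   by (rule order_trans[OF md(2) add_right_mono[OF mult_left_mono[OF y]]]) simp
  also have "... = ennreal (2 * K^2 * a + 4 * v^2 * C0)"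
  proof -
   have e: "ennreal p * ennreal a + ennreal q = ennreal (p * a + q)" if "0 \<le> p" "0 \<le> q" for p q
    using that a by (simp add: ennreal_plus ennreal_mult)
   show ?thesis by (rule e[OF _ nn2(2)]) simp
  qed
  also have "... \<le> ennreal \<eta>" by (rule ennreal_leI[OF le])
  finally show ?thesis using 1 by blast
 qed
 then show ?thesis using N0 by blast
qed

text \<open>
 The rate \<open>8\<^sup>-\<^sup>k\<close> in mean square leaves room for deviations of order \<open>2\<^sup>-\<^sup>k\<close> outside events whose
 measure is of order \<open>2\<^sup>-\<^sup>k\<close>; both are summable.
\<close>

lemma close_schemes:
 assumes n: "0 < n" "0 < n'"
  and h: "\<forall>t. (EE w. ennreal ((h n t w - h n' t w)^2)) \<le> ennreal ((1/8)^k)"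
  and \<beta>: "\<forall>t. (EE w. ennreal ((\<beta> n t w - \<beta> n' t w)^2)) \<le> ennreal ((1/8)^k)"
 shows "\<exists>A\<in>events. emeasure M A \<le> ennreal (2 * T * (1/2)^k) \<and>
  (\<forall>w\<in>space M - A. \<forall>t\<in>{0..T}. \<bar>J n t w - J n' t w\<bar> \<le> (1/2)^k \<and> \<bar>D n t w - D n' t w\<bar> \<le> sqrt T * (1/2)^k)"
proof -
 have T: "0 \<le> T" using T_pos by simp
 have int: "(EE w. (TI {0..T} (%r. ennreal ((h n r w - h n' r w)^2)))) \<le> ennreal ((1/8)^k * (T - 0))"
  "(EE w. (TI {0..T} (%r. ennreal ((\<beta> n r w - \<beta> n' r w)^2)))) \<le> ennreal ((1/8)^k * (T - 0))"
  using h \<beta> T joint_square_diff(1)[OF joint(2)[OF n(1)] joint(2)[OF n(2)]] joint_square_diff(1)[OF joint(3)[OF n(1)] joint(3)[OF n(2)]]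
  by (intro nn_integral_interval_le; simp)+
 have p4: "ennreal (4^k) * ennreal ((1/8)^k * (T - 0)) = ennreal (T * (1/2)^k)" "ennreal (4^k) * ennreal ((1/4)^k) = 1" "((1/2::real)^k)^2 = (1/4)^k"
  using T by (simp_all add: ennreal_mult[symmetric] power_mult_distrib[symmetric] power2_eq_square mult.commute[of _ T] mult.left_commute[of _ T])
 have ed: "elementary F T W square_integrable (%s w. h n s w - h n' s w) (%t w. J n t w - J n' t w)"
  by (rule elementary_diff[OF el_h[OF n(1)] el_h[OF n(2)] square_integrable_diff])
 have half: "0 < (1/2::real)^k" by simp
 obtain A1 where A1: "A1 \<in> events" "ennreal (((1/2)^k)^2) * emeasure M A1 \<le> (EE w. (TI {0..T} (%r. ennreal ((h n r w - h n' r w)^2))))"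
  "\<forall>w\<in>space M - A1. \<forall>t\<in>{0..T}. \<bar>J n t w - J n' t w\<bar> \<le> (1/2)^k"
  using kolmogorov_sup[OF ed half] by (elim bexE conjE)
 have m1: "emeasure M A1 \<le> ennreal (T * (1/2)^k)"
 proof -
  have "emeasure M A1 = ennreal (4^k) * (ennreal ((1/4)^k) * emeasure M A1)" by (simp add: mult.assoc[symmetric] p4(2))
  also have "... \<le> ennreal (4^k) * ennreal ((1/8)^k * (T - 0))"
   using order_trans[OF A1(2) int(1)] unfolding p4(3) by (intro mult_left_mono) auto
  finally show ?thesis unfolding p4(1) .
 qed
 define u where "u w = (TI {0..T} (%r. ennreal ((\<beta> n r w - \<beta> n' r w)^2)))" for w
 have um: "u \<in> borel_measurable M" unfolding u_def by (rule joint_square_diff(3)[OF joint(3)[OF n(1)] joint(3)[OF n(2)]])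
 define A2 where "A2 = {w\<in>space M. 1 \<le> ennreal (4^k) * u w}"
 have A2: "A2 \<in> events" unfolding A2_def using um by measurable
 have m2: "emeasure M A2 \<le> ennreal (T * (1/2)^k)"
 proof -
  have "emeasure M A2 \<le> ennreal (4^k) * (EE w. u w * indicator (space M) w)"
   unfolding A2_def using um by (intro nn_integral_Markov_inequality) auto
  also have "(EE w. u w * indicator (space M) w) = (EE w. u w)" by (intro nn_integral_cong) simp
  also have "ennreal (4^k) * (EE w. u w) \<le> ennreal (4^k) * ennreal ((1/8)^k * (T - 0))"
   unfolding u_def by (intro mult_left_mono int) auto
  finally show ?thesis unfolding p4(1) .
 qed
 have D: "\<bar>D n t w - D n' t w\<bar> \<le> sqrt T * (1/2)^k" if w: "w \<in> space M - A2" and t: "t \<in> {0..T}" for w t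
 proof -
  have t': "0 \<le> t" "t \<le> T" using t by auto
  have "ennreal (4^k) * u w \<le> 1" using w unfolding A2_def by (auto simp: not_le less_imp_le)
  then have "ennreal ((1/4)^k) * (ennreal (4^k) * u w) \<le> ennreal ((1/4)^k) * 1" by (rule mult_left_mono) simp
  moreover have "ennreal ((1/4)^k) * (ennreal (4^k) * u w) = ennreal (4^k) * ennreal ((1/4)^k) * u w" by (simp only: mult_ac)
  ultimately have u: "u w \<le> ennreal ((1/4)^k)" by (simp only: p4(2) mult_1 mult_1_right)
  have si: "set_integrable lborel {0..t} (%r. \<beta> n r w)" "set_integrable lborel {0..t} (%r. \<beta> n' r w)"
   using D_eq(1)[OF _ order_refl t'] n by auto
  have Deq: "D n t w - D n' t w = (LINT r:{0..t}|lborel. \<beta> n r w - \<beta> n' r w)"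
   using D_eq(2)[OF n(1) order_refl t', of w] D_eq(2)[OF n(2) order_refl t', of w] D_zero[OF n(1)] D_zero[OF n(2)]
   by (simp add: set_integral_diff(2)[OF si])
  have "ennreal ((D n t w - D n' t w)^2) \<le> ennreal (t - 0) * (TI {0..t} (%r. ennreal ((\<beta> n r w - \<beta> n' r w)^2)))"
   unfolding Deq by (rule square_set_integral_le[OF set_integral_diff(1)[OF si] t'(1)])
  also have "... \<le> ennreal T * u w"
   unfolding u_def using t' by (intro mult_mono ennreal_leI nn_integral_mono) (auto simp: indicator_def)
  also have "... \<le> ennreal T * ennreal ((1/4)^k)" by (rule mult_left_mono[OF u]) simp
  also have "... = ennreal (T * (1/4)^k)" using T by (simp add: ennreal_mult)
  finally have "(D n t w - D n' t w)^2 \<le> T * (1/4)^k" using T by simp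
  also have "... = (sqrt T * (1/2)^k)^2" using T by (simp add: power_mult_distrib p4(3))
  finally have "\<bar>D n t w - D n' t w\<bar> \<le> \<bar>sqrt T * (1/2)^k\<bar>" by (simp only: abs_le_square_iff)
  then show ?thesis using T by simp
 qed
 have "emeasure M (A1 \<union> A2) \<le> ennreal (T * (1/2)^k) + ennreal (T * (1/2)^k)"
  by (rule order_trans[OF emeasure_subadditive[OF A1(1) A2] add_mono[OF m1 m2]])
 also have "... = ennreal (2 * T * (1/2)^k)" using T by (simp add: ennreal_plus[symmetric] del: ennreal_plus)
 finally show ?thesis using A1(1,3) A2 D by (intro bexI[of _ "A1 \<union> A2"]) auto
qed

lemma X_path_continuous:
 assumes n: "0 < n" and c: "continuous_on {0..T} (%t. W t w)"
 shows "continuous_on {0..T} (%t. J n t w)" "continuous_on {0..T} (%t. X n t w)"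
proof -
 show J: "continuous_on {0..T} (%t. J n t w)" by (rule elementary_continuous[OF el_h[OF n] c])
 have "continuous_on {0..T} (%t. D n t w)" unfolding D_def simple_ito_def by (intro continuous_intros)
 then show "continuous_on {0..T} (%t. X n t w)" unfolding X_def using J by (intro continuous_intros)
qed

lemma X_adapted:
 assumes n: "0 < n" and t: "t \<in> {0..T}"
 shows "X n t \<in> borel_measurable (F t)"
proof -
 have "(%w. drift (pt n i) (V n i w) * (min t (pt n (Suc i)) - min t (pt n i))) \<in> borel_measurable (F t)" if i: "i < n" for i
 proof (cases "pt n i \<le> t")
  case True
  have "(%w. drift (pt n i) (V n i w)) \<in> borel_measurable (F t)"
   using F_measurable_mono[OF _ True _ coeff_props(5)[OF n i]] pt_in[OF n, of i] i t by auto
  then show ?thesis by (intro borel_measurable_times borel_measurable_const)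
 next
  case False
  have "pt n i \<le> pt n (Suc i)" using grid_mono[OF pt_grid[OF n], of i "Suc i"] i by simp
  then have "min t (pt n (Suc i)) - min t (pt n i) = 0" using False by simp
  then show ?thesis by simp
 qed
 then have "D n t \<in> borel_measurable (F t)" unfolding D_def simple_ito_def[abs_def] by (intro borel_measurable_sum) auto
 then show ?thesis unfolding X_def[abs_def] using elementary_adapted[OF el_h[OF n] t] by (intro borel_measurable_add borel_measurable_const)
qed

text \<open>Along a path on which the schemes converge uniformly, everything in the equation converges.\<close>

lemma frozen_limits:
 assumes r: "\<And>k. k < r k" and u: "uniform_limit {0..T} (%k t. X (r k) t w) Z sequentially" and c: "continuous_on {0..T} Z"
 shows "s \<in> {0<..T} ==> (%k. h (r k) s w) \<longlonglongrightarrow> s0 (Z s)"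
  "t \<in> {0..T} ==> (%k. D (r k) t w) \<longlonglongrightarrow> (LINT s:{0..t}|lborel. l s + m s * Z s)"
proof -
 have r0: "0 < r k" for k using r[of k] by simp
 have ex: "\<exists>q. q \<in> {0..T} \<and> \<bar>s - q\<bar> \<le> T / real (r k) \<and> h (r k) s w = s0 (X (r k) q w) \<and> \<beta> (r k) s w = drift q (X (r k) q w)" if s: "s \<in> {0<..T}" for k s
 proof -
  obtain i where i: "pt (r k) i < s" "s - pt (r k) i \<le> T / real (r k)" "pt (r k) i \<in> {0..T}"
   "h (r k) s w = s0 (V (r k) i w)" "\<beta> (r k) s w = drift (pt (r k) i) (V (r k) i w)" "X (r k) (pt (r k) i) w = V (r k) i w"
   using frozen_values[OF r0, of s k] s by auto
  then show ?thesis by (intro exI[of _ "pt (r k) i"]) auto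
 qed
 define q where "q k s = (SOME q. q \<in> {0..T} \<and> \<bar>s - q\<bar> \<le> T / real (r k) \<and> h (r k) s w = s0 (X (r k) q w) \<and> \<beta> (r k) s w = drift q (X (r k) q w))" for k s
 have q: "q k s \<in> {0..T} \<and> \<bar>s - q k s\<bar> \<le> T / real (r k) \<and> h (r k) s w = s0 (X (r k) (q k s) w) \<and> \<beta> (r k) s w = drift (q k s) (X (r k) (q k s) w)"
  if "s \<in> {0<..T}" for k s
  using someI_ex[OF ex[OF that, of k]] unfolding q_def .
 have mesh: "(%k. T / real (r k)) \<longlonglongrightarrow> 0"
 proof (rule real_tendsto_sandwich[OF _ _ tendsto_const])
  show "(%k. T / real (Suc k)) \<longlonglongrightarrow> 0" using tendsto_mult_right_zero[OF LIMSEQ_inverse_real_of_nat, of T] by (simp add: divide_inverse)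
  show "\<forall>\<^sub>F k in sequentially. 0 \<le> T / real (r k)" using T_pos by simp
  have "T / real (r k) \<le> T / real (Suc k)" for k
  proof (rule divide_left_mono)
   show "real (Suc k) \<le> real (r k)" using Suc_leI[OF r[of k]] by (simp only: of_nat_le_iff)
   show "0 < real (r k) * real (Suc k)" using r0[of k] by (intro mult_pos_pos) simp_all
  qed (use T_pos in simp)
  then show "\<forall>\<^sub>F k in sequentially. T / real (r k) \<le> T / real (Suc k)" by simp
 qed
 have lims: "(%k. q k s) \<longlonglongrightarrow> s" "(%k. X (r k) (q k s) w) \<longlonglongrightarrow> Z s" if s: "s \<in> {0<..T}" for s
 proof -
  have sT: "s \<in> {0..T}" using s by auto
  have "(%k. s - q k s) \<longlonglongrightarrow> 0" by (rule Lim_null_comparison[OF _ mesh]) (use q[OF s] in simp)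
  from tendsto_diff[OF tendsto_const[of s] this] show qs: "(%k. q k s) \<longlonglongrightarrow> s" by simp
  have Zq: "(%k. Z (q k s)) \<longlonglongrightarrow> Z s"
   by (rule continuous_on_tendsto_compose[OF c qs sT]) (use q[OF s] in simp)
  have "(%k. X (r k) (q k s) w - Z (q k s)) \<longlonglongrightarrow> 0"
  proof (rule tendstoI)
   fix e :: real assume "0 < e"
   from uniform_limitD[OF u this] show "\<forall>\<^sub>F k in sequentially. dist (X (r k) (q k s) w - Z (q k s)) 0 < e"
    by eventually_elim (use q[OF s] in \<open>simp add: dist_real_def\<close>)
  qed
  from tendsto_add[OF this Zq] show "(%k. X (r k) (q k s) w) \<longlonglongrightarrow> Z s" by simp
 qed
 have s0_cont: "isCont s0 a" for a using s0_continuous by (simp add: continuous_on_eq_continuous_at)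
 show "(%k. h (r k) s w) \<longlonglongrightarrow> s0 (Z s)" if s: "s \<in> {0<..T}"
  using isCont_tendsto_compose[OF s0_cont lims(2)[OF s]] q[OF s] by simp
 have \<beta>_lim: "(%k. \<beta> (r k) s w) \<longlonglongrightarrow> drift s (Z s)" if s: "s \<in> {0<..T}" for s
 proof -
  have sT: "s \<in> {0..T}" using s by auto
  have "(%k. l (q k s)) \<longlonglongrightarrow> l s" "(%k. m (q k s)) \<longlonglongrightarrow> m s"
   using continuous_on_tendsto_compose[OF l_cont lims(1)[OF s] sT] continuous_on_tendsto_compose[OF m_cont lims(1)[OF s] sT] q[OF s] by auto
  then have "(%k. l (q k s) + m (q k s) * X (r k) (q k s) w) \<longlonglongrightarrow> l s + m s * Z s" using lims(2)[OF s] by (intro tendsto_intros)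
  then show ?thesis unfolding drift_def using q[OF s] by (simp add: drift_def)
 qed
 obtain z where z: "\<forall>s\<in>{0..T}. \<bar>Z s\<bar> \<le> z"
  using compact_imp_bounded[OF compact_continuous_image[OF c compact_Icc]] unfolding bounded_real by auto
 from uniform_limitD[OF u zero_less_one] obtain k0 where k0: "\<forall>k\<ge>k0. \<forall>t\<in>{0..T}. \<bar>X (r k) t w - Z t\<bar> < 1"
  unfolding eventually_sequentially by (auto simp: dist_real_def)
 have \<beta>_le: "\<bar>\<beta> (r (k + k0)) s w\<bar> \<le> K * (z + 2)" if s: "s \<in> {0<..T}" for s k
 proof -
  let ?q = "q (k + k0) s" and ?x = "X (r (k + k0)) (q (k + k0) s) w"
  have q': "?q \<in> {0..T}" "\<beta> (r (k + k0)) s w = drift ?q ?x" using q[OF s] by auto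
  have "\<bar>drift ?q ?x\<bar> \<le> K * (1 + \<bar>?x\<bar>)" unfolding drift_def by (rule drift_growth[OF q'(1)])
  also have "... \<le> K * (z + 2)" using k0[rule_format, of "k + k0", OF _ q'(1)] bspec[OF z q'(1)] K_nonneg by (intro mult_left_mono) auto
  finally show ?thesis unfolding q'(2) .
 qed
 show "(%k. D (r k) t w) \<longlonglongrightarrow> (LINT s:{0..t}|lborel. l s + m s * Z s)" if t: "t \<in> {0..T}"
 proof (rule LIMSEQ_offset[where k=k0])
  have t': "0 \<le> t" "t \<le> T" using t by auto
  have D: "D (r k) t w = (\<integral>s. indicator {0<..t} s *\<^sub>R \<beta> (r k) s w \<partial>lborel)" for k
  proof -
   have "D (r k) t w = (LINT s:{0..t}|lborel. \<beta> (r k) s w)" using D_eq(2)[OF r0 order_refl t'] D_zero[OF r0] by simp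
   also have "... = (\<integral>s. indicator {0<..t} s *\<^sub>R \<beta> (r k) s w \<partial>lborel)"
    unfolding set_lebesgue_integral_def using elementary_outside[OF el_\<beta>[OF r0], of 0 k]
    by (intro Bochner_Integration.integral_cong refl) (auto simp: indicator_def)
   finally show ?thesis .
  qed
  have meas: "(%s. indicator {0<..t} s *\<^sub>R \<beta> (r k) s w) \<in> borel_measurable lborel" for k
   using elementary_path_measurable[OF el_\<beta>[OF r0[of k]]] by (intro borel_measurable_scaleR borel_measurable_indicator) auto
  have L: "(%k. indicator {0<..t} s *\<^sub>R \<beta> (r (k + k0)) s w) \<longlonglongrightarrow> indicator {0<..t} s *\<^sub>R drift s (Z s)" for s
   using LIMSEQ_ignore_initial_segment[OF \<beta>_lim, of s k0] t' by (cases "s \<in> {0<..t}") auto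
  have "(%k. \<integral>s. indicator {0<..t} s *\<^sub>R \<beta> (r (k + k0)) s w \<partial>lborel) \<longlonglongrightarrow> (\<integral>s. indicator {0<..t} s *\<^sub>R drift s (Z s) \<partial>lborel)"
  proof (rule integral_dominated_convergence[where w="%s. (K * (z + 2)) * indicator {0<..t} s"])
   show "(%s. indicator {0<..t} s *\<^sub>R drift s (Z s)) \<in> borel_measurable lborel"
    by (rule borel_measurable_LIMSEQ_real[OF L meas])
   show "integrable lborel (%s. (K * (z + 2)) * indicator {0<..t} s)" using t' by (intro integrable_mult_right integrable_real_indicator) auto
   show "AE s in lborel. norm (indicator {0<..t} s *\<^sub>R \<beta> (r (k + k0)) s w) \<le> (K * (z + 2)) * indicator {0<..t} s" for k
    using \<beta>_le t' by (intro AE_I2) (auto simp: indicator_def)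
  qed (use meas L in auto)
  also have "(\<integral>s. indicator {0<..t} s *\<^sub>R drift s (Z s) \<partial>lborel) = (LINT s:{0..t}|lborel. l s + m s * Z s)"
   unfolding set_lebesgue_integral_def drift_def
  proof (rule integral_cong_AE)
   show "AE s in lborel. indicator {0<..t} s *\<^sub>R (l s + m s * Z s) = indicator {0..t} s *\<^sub>R (l s + m s * Z s)"
    using AE_lborel_singleton[of 0] by eventually_elim (auto simp: indicator_def)
   show "(%s. indicator {0<..t} s *\<^sub>R (l s + m s * Z s)) \<in> borel_measurable lborel"
    using borel_measurable_LIMSEQ_real[OF L meas] unfolding drift_def .
   have "continuous_on {0..t} (%s. l s + m s * Z s)"
    using continuous_on_subset[of "{0..T}" _ "{0..t}"] l_cont m_cont c t' by (intro continuous_intros) auto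
   from borel_measurable_continuous_on_indicator[OF _ this] show "(%s. indicator {0..t} s *\<^sub>R (l s + m s * Z s)) \<in> borel_measurable lborel" by simp
  qed
  finally show "(%k. D (r (k + k0)) t w) \<longlonglongrightarrow> (LINT s:{0..t}|lborel. l s + m s * Z s)" unfolding D .
 qed
qed

end

context euler_scheme
begin

text \<open>
 Along a fast subsequence \<open>r\<close> the schemes converge uniformly on almost every path, which gives the
 continuous limit and the equation. The integrands of the schemes approximate the limiting one in
 energy by Fatou's lemma, so after clipping they witness the Ito integral.
\<close>

lemma solution_exists:
 "\<exists>Z I. (\<forall>t\<in>{0..T}. Z t \<in> borel_measurable (F t)) \<and> (AE w in M. continuous_on {0..T} (%t. Z t w)) \<and>
  (\<forall>t\<in>{0..T}. I t \<in> borel_measurable (F t)) \<and> (AE w in M. continuous_on {0..T} (%t. I t w)) \<and>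
  approximable (%s w. s0 (Z s w)) I \<and>
  (AE w in M. \<forall>t\<in>{0..T}. Z t w = x + (LINT s:{0..t}|lborel. l s + m s * Z s w) + I t w)"
proof -
 have "\<forall>k. \<exists>N>0. \<forall>n\<ge>N. \<forall>n'\<ge>N. \<forall>t. (EE w. ennreal ((h n t w - h n' t w)^2)) \<le> ennreal ((1/8)^k) \<and> (EE w. ennreal ((\<beta> n t w - \<beta> n' t w)^2)) \<le> ennreal ((1/8)^k)"
  by (intro allI schemes_Cauchy) simp
 then obtain N :: "nat => nat" where N: "\<forall>k. N k > 0 \<and> (\<forall>n\<ge>N k. \<forall>n'\<ge>N k. \<forall>t. (EE w. ennreal ((h n t w - h n' t w)^2)) \<le> ennreal ((1/8)^k) \<and> (EE w. ennreal ((\<beta> n t w - \<beta> n' t w)^2)) \<le> ennreal ((1/8)^k))"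
  by (rule choice[THEN exE])
 \<comment> \<open>a sum rather than \<open>N k\<close>, so that \<open>r j \<ge> N k\<close> for all \<open>j \<ge> k\<close> and the mesh tends to 0\<close>
 define r where "r k = (\<Sum>j\<le>k. N j)" for k
 have r_ge: "N k \<le> r j" if "k \<le> j" for k j unfolding r_def using that by (intro member_le_sum) auto
 have rk: "k < r k" for k
 proof -
  have "(\<Sum>j\<le>k. 1) \<le> r k" unfolding r_def using N by (intro sum_mono) (simp add: Suc_le_eq)
  then show ?thesis by simp
 qed
 have r0: "0 < r k" for k using rk[of k] by simp
 have close: "(EE w. ennreal ((h (r i) t w - h (r j) t w)^2)) \<le> ennreal ((1/8)^k)"
  "(EE w. ennreal ((\<beta> (r i) t w - \<beta> (r j) t w)^2)) \<le> ennreal ((1/8)^k)" if "k \<le> i" "k \<le> j" for i j k t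
  using N[rule_format, of k] r_ge[OF that(1)] r_ge[OF that(2)] by auto
 have "\<forall>k. \<exists>A. A \<in> events \<and> emeasure M A \<le> ennreal (2 * T * (1/2)^k) \<and>
  (\<forall>w\<in>space M - A. \<forall>t\<in>{0..T}. \<bar>J (r (Suc k)) t w - J (r k) t w\<bar> \<le> (1/2)^k \<and> \<bar>D (r (Suc k)) t w - D (r k) t w\<bar> \<le> sqrt T * (1/2)^k)"
 proof
  fix k
  from close_schemes[OF r0 r0, of "Suc k" k k] close[of k "Suc k" k]
  show "\<exists>A. A \<in> events \<and> emeasure M A \<le> ennreal (2 * T * (1/2)^k) \<and>
   (\<forall>w\<in>space M - A. \<forall>t\<in>{0..T}. \<bar>J (r (Suc k)) t w - J (r k) t w\<bar> \<le> (1/2)^k \<and> \<bar>D (r (Suc k)) t w - D (r k) t w\<bar> \<le> sqrt T * (1/2)^k)"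
   unfolding Bex_def by simp
 qed
 then obtain A where "\<forall>k. A k \<in> events \<and> emeasure M (A k) \<le> ennreal (2 * T * (1/2)^k) \<and>
  (\<forall>w\<in>space M - A k. \<forall>t\<in>{0..T}. \<bar>J (r (Suc k)) t w - J (r k) t w\<bar> \<le> (1/2)^k \<and> \<bar>D (r (Suc k)) t w - D (r k) t w\<bar> \<le> sqrt T * (1/2)^k)"
  by (rule choice[THEN exE])
 then have A: "\<And>k. A k \<in> events" "\<And>k. emeasure M (A k) \<le> ennreal ((2 * T) * (1/2)^k)"
  and inc: "\<And>k w t. w \<in> space M - A k ==> t \<in> {0..T} ==> \<bar>J (r (Suc k)) t w - J (r k) t w\<bar> \<le> (1/2)^k"
   "\<And>k w t. w \<in> space M - A k ==> t \<in> {0..T} ==> \<bar>D (r (Suc k)) t w - D (r k) t w\<bar> \<le> sqrt T * (1/2)^k"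
  by simp_all
 have BC: "AE w in M. \<forall>\<^sub>F k in sequentially. w \<notin> A k" using T_pos by (intro Borel_Cantelli_geometric[OF A(1,2)]) simp
 obtain S where S: "S \<in> null_sets M" and good: "\<And>w. w \<in> space M - S ==> continuous_on {0..T} (%t. W t w) \<and> (\<forall>\<^sub>F k in sequentially. w \<notin> A k)"
  using AE_conjI[OF W_cont BC] by (rule AE_E3) blast
 define I where "I t w = (if w \<in> S then 0 else lim (%k. J (r k) t w))" for t w
 define Z where "Z t w = (if w \<in> S then 0 else lim (%k. X (r k) t w))" for t w
 have adapted: "(%w. if w \<in> S then 0 else lim (%k. f k w)) \<in> borel_measurable (F t)"
  if t: "t \<in> {0..T}" and f: "\<And>k. f k \<in> borel_measurable (F t)" for t and f :: "nat => 'a => real"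
  using F_null[OF t S] sets.Int_space_eq2[OF F_null[OF t S]] by (intro measurable_If_set borel_measurable_lim_metric f) auto
 have I_F: "I t \<in> borel_measurable (F t)" and Z_F: "Z t \<in> borel_measurable (F t)" if t: "t \<in> {0..T}" for t
  unfolding I_def[abs_def] Z_def[abs_def] using elementary_adapted[OF el_h[OF r0] t] X_adapted[OF r0 t] by (intro adapted[OF t]; simp)+
 have lims: "uniform_limit {0..T} (%k t. J (r k) t w) (%t. I t w) sequentially" "uniform_limit {0..T} (%k t. X (r k) t w) (%t. Z t w) sequentially"
  if w: "w \<in> space M - S" for w
 proof -
  have ev: "\<forall>\<^sub>F k in sequentially. w \<notin> A k" using good[OF w] by blast
  have "\<forall>\<^sub>F k in sequentially. \<forall>t\<in>{0..T}. \<bar>J (r (Suc k)) t w - J (r k) t w\<bar> \<le> 1 * (1/2)^k"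
   using ev by eventually_elim (use inc(1) w in simp)
  from uniform_limit_of_geometric_increments[of "{0..T}" "%k t. J (r k) t w", OF this]
  obtain g where g: "uniform_limit {0..T} (%k t. J (r k) t w) g sequentially" by blast
  have "\<forall>\<^sub>F k in sequentially. \<forall>t\<in>{0..T}. \<bar>D (r (Suc k)) t w - D (r k) t w\<bar> \<le> sqrt T * (1/2)^k"
   using ev by eventually_elim (use inc(2) w in simp)
  from uniform_limit_of_geometric_increments[of "{0..T}" "%k t. D (r k) t w", OF this]
  obtain g' where g': "uniform_limit {0..T} (%k t. D (r k) t w) g' sequentially" by blast
  have gX: "uniform_limit {0..T} (%k t. X (r k) t w) (%t. x + g' t + g t) sequentially"
   unfolding X_def by (intro uniform_limit_add uniform_limit_const g g')
  have "I t w = g t" "Z t w = x + g' t + g t" if "t \<in> {0..T}" for t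
   using limI[OF tendsto_uniform_limitI[OF g that]] limI[OF tendsto_uniform_limitI[OF gX that]] w unfolding I_def Z_def by simp_all
  then show "uniform_limit {0..T} (%k t. J (r k) t w) (%t. I t w) sequentially" "uniform_limit {0..T} (%k t. X (r k) t w) (%t. Z t w) sequentially"
   using uniform_limit_cong'[of "{0..T}" "%k t. J (r k) t w" "%k t. J (r k) t w" g "%t. I t w"] g
    uniform_limit_cong'[of "{0..T}" "%k t. X (r k) t w" "%k t. X (r k) t w" "%t. x + g' t + g t" "%t. Z t w"] gX by simp_all
 qed
 have cont: "continuous_on {0..T} (%t. I t w)" "continuous_on {0..T} (%t. Z t w)" if w: "w \<in> space M - S" for w
 proof -
  have W: "continuous_on {0..T} (%t. W t w)" using good[OF w] by blast
  show "continuous_on {0..T} (%t. I t w)"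
   by (rule uniform_limit_theorem[OF _ lims(1)[OF w]]) (simp_all add: X_path_continuous(1)[OF r0 W])
  show "continuous_on {0..T} (%t. Z t w)"
   by (rule uniform_limit_theorem[OF _ lims(2)[OF w]]) (simp_all add: X_path_continuous(2)[OF r0 W])
 qed
 have J_lim: "(%k. J (r k) t w) \<longlonglongrightarrow> I t w" and X_lim: "(%k. X (r k) t w) \<longlonglongrightarrow> Z t w" if "w \<in> space M - S" "t \<in> {0..T}" for w t
  using tendsto_uniform_limitI[OF lims(1)[OF that(1)] that(2)] tendsto_uniform_limitI[OF lims(2)[OF that(1)] that(2)] by auto
 have equation: "Z t w = x + (LINT s:{0..t}|lborel. l s + m s * Z s w) + I t w" if w: "w \<in> space M - S" and t: "t \<in> {0..T}" for w t
 proof -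
  have "(%k. X (r k) t w) \<longlonglongrightarrow> x + (LINT s:{0..t}|lborel. l s + m s * Z s w) + I t w"
   unfolding X_def by (intro tendsto_add tendsto_const J_lim w t frozen_limits(2)[OF rk lims(2)[OF w] cont(2)[OF w] t])
  from LIMSEQ_unique[OF X_lim[OF w t] this] show ?thesis .
 qed
 have H_path: "(%s. indicator {0..T} s * s0 (Z s w)) \<in> borel_measurable lborel" if w: "w \<in> space M - S" for w
 proof -
  have "(%s. indicator {0..T} s *\<^sub>R Z s w) \<in> borel_measurable borel" by (rule borel_measurable_continuous_on_indicator[OF _ cont(2)[OF w]]) simp
  from measurable_compose[OF this s0_borel] have "(%s. indicator {0..T} s * s0 (indicator {0..T} s *\<^sub>R Z s w)) \<in> borel_measurable lborel"
   by (intro borel_measurable_times borel_measurable_indicator) auto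
  moreover have "indicator {0..T} s * s0 (indicator {0..T} s *\<^sub>R Z s w) = indicator {0..T} s * s0 (Z s w)" for s
   by (simp add: indicator_def)
  ultimately show ?thesis by (simp only:)
 qed
 let ?dist = "%i j w. (TI {0..T} (%s. ennreal ((h (r i) s w - h (r j) s w)^2)))"
 have dist_meas: "?dist i j \<in> borel_measurable M" for i j by (rule joint_square_diff(3)[OF joint(2)[OF r0] joint(2)[OF r0]])
 \<comment> \<open>Fatou, along each path: the schemes converge at every positive time\<close>
 have energy: "(TI {0..T} (%s. ennreal ((h (r k) s w - s0 (Z s w))^2))) \<le> liminf (%j. ?dist k j w)" if w: "w \<in> space M - S" for k w
 proof -
  have lim: "(%j. ennreal ((h (r k) s w - h (r j) s w)^2) * indicator {0..T} s) \<longlonglongrightarrow> ennreal ((h (r k) s w - s0 (Z s w))^2) * indicator {0..T} s" if "s \<noteq> 0" for s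
  proof (cases "s \<in> {0<..T}")
   case True
   then have "(%j. (h (r k) s w - h (r j) s w)^2) \<longlonglongrightarrow> (h (r k) s w - s0 (Z s w))^2"
    by (intro tendsto_power tendsto_diff tendsto_const frozen_limits(1)[OF rk lims(2)[OF w] cont(2)[OF w]])
   then show ?thesis using True by (simp add: tendsto_ennrealI)
  next
   case False
   then show ?thesis using that by auto
  qed
  have "(TI {0..T} (%s. ennreal ((h (r k) s w - s0 (Z s w))^2))) = (\<integral>\<^sup>+s. liminf (%j. ennreal ((h (r k) s w - h (r j) s w)^2) * indicator {0..T} s) \<partial>lborel)"
  proof (rule nn_integral_cong_AE)
   show "AE s in lborel. ennreal ((h (r k) s w - s0 (Z s w))^2) * indicator {0..T} s = liminf (%j. ennreal ((h (r k) s w - h (r j) s w)^2) * indicator {0..T} s)"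
    using AE_lborel_singleton[of 0]
   proof eventually_elim
    case (elim s)
    show ?case by (rule lim_imp_Liminf[OF sequentially_bot lim[OF elim], symmetric])
   qed
  qed
  also have "... \<le> liminf (%j. ?dist k j w)"
  proof (rule nn_integral_liminf)
   fix j
   have "(%s. (h (r k) s w - h (r j) s w)^2) \<in> borel_measurable lborel"
    using elementary_path_measurable[OF el_h[OF r0]] by (intro borel_measurable_power borel_measurable_diff)
   then show "(%s. ennreal ((h (r k) s w - h (r j) s w)^2) * indicator {0..T} s) \<in> borel_measurable lborel" by measurable
  qed
  finally show ?thesis .
 qed
 have dist_le: "(EE w. ?dist k j w) \<le> ennreal (T * (1/8)^k)" if "k \<le> j" for k j
 proof -
  have "(EE w. ?dist k j w) \<le> ennreal ((1/8)^k * (T - 0))"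
   using T_pos by (intro nn_integral_interval_le joint_square_diff(1)[OF joint(2)[OF r0] joint(2)[OF r0]] close(1)[OF order_refl that]) auto
  then show ?thesis by (simp add: mult.commute)
 qed
 have energy_null: "null_in_probability M (%k w. liminf (%j. ?dist k j w))"
 proof (rule null_in_probability_nn_integral)
  show "(%w. liminf (%j. ?dist k j w)) \<in> borel_measurable M" for k by (intro borel_measurable_liminf dist_meas)
  have le: "(EE w. liminf (%j. ?dist k j w)) \<le> ennreal (T * (1/8)^k)" for k
  proof -
   have "(EE w. liminf (%j. ?dist k j w)) \<le> liminf (%j. (EE w. ?dist k j w))" by (rule nn_integral_liminf[OF dist_meas])
   also have "... \<le> liminf (%j. ennreal (T * (1/8)^k))"
    by (rule Liminf_mono) (use dist_le in \<open>auto simp: eventually_sequentially\<close>)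
   also have "... = ennreal (T * (1/8)^k)" by (simp add: Liminf_const)
   finally show ?thesis .
  qed
  have "(%k. T * (1/8::real)^k) \<longlonglongrightarrow> T * 0" by (intro tendsto_mult tendsto_const LIMSEQ_realpow_zero) auto
  then have to0: "(%k. ennreal (T * (1/8)^k)) \<longlonglongrightarrow> 0" using tendsto_ennrealI by fastforce
  show "(%k. (EE w. liminf (%j. ?dist k j w))) \<longlonglongrightarrow> 0"
   by (rule tendsto_sandwich[OF _ _ tendsto_const to0]) (use le in auto)
 qed
 \<comment> \<open>a measurable bound for the uniform distance, infinite where a later increment is still large\<close>
 have sup_null: "null_in_probability M (%k w. \<top> * indicator (\<Union>j\<in>{k..}. A j) w + ennreal (2 * (1/2)^k))"
 proof (rule null_in_probability_AE[OF finite_measure_axioms])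
  show "(%w. \<top> * indicator (\<Union>j\<in>{k..}. A j) w + ennreal (2 * (1/2)^k)) \<in> borel_measurable M" for k
   using A(1) by (intro borel_measurable_add borel_measurable_times_ennreal borel_measurable_indicator borel_measurable_const) auto
  have "(%k. 2 * (1/2::real)^k) \<longlonglongrightarrow> 2 * 0" by (intro tendsto_mult tendsto_const LIMSEQ_realpow_zero) auto
  then have to0: "(%k. ennreal (2 * (1/2)^k)) \<longlonglongrightarrow> 0" using tendsto_ennrealI by fastforce
  show "AE w in M. (%k. \<top> * indicator (\<Union>j\<in>{k..}. A j) w + ennreal (2 * (1/2)^k)) \<longlonglongrightarrow> 0"
   using BC
  proof eventually_elim
   case (elim w)
   then obtain k0 where "\<And>k. k0 \<le> k ==> w \<notin> A k" unfolding eventually_sequentially by blast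
   then have "\<forall>\<^sub>F k in sequentially. ennreal (2 * (1/2)^k) = \<top> * indicator (\<Union>j\<in>{k..}. A j) w + ennreal (2 * (1/2)^k)"
    unfolding eventually_sequentially by (intro exI[of _ k0]) auto
   from Lim_transform_eventually[OF to0 this] show ?case .
  qed
 qed
 have tail: "ennreal \<bar>J (r k) t w - I t w\<bar> \<le> \<top> * indicator (\<Union>j\<in>{k..}. A j) w + ennreal (2 * (1/2)^k)" if w: "w \<in> space M - S" and t: "t \<in> {0..T}" for k t w
 proof (cases "w \<in> (\<Union>j\<in>{k..}. A j)")
  case False
  have "\<bar>J (r k) t w - I t w\<bar> \<le> 2 * (1/2)^k"
   by (rule tail_le_of_geometric_increments[of k "%k. J (r k) t w", OF _ J_lim[OF w t]]) (use False w inc(1) t in auto)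
  then have "ennreal \<bar>J (r k) t w - I t w\<bar> \<le> ennreal (2 * (1/2)^k)" by (rule ennreal_leI)
  then show ?thesis using False by simp
 qed simp
 have "\<forall>k. \<exists>hJ. elementary F T W uniformly_bounded (fst hJ) (snd hJ) \<and> (EE w. (TI {0..T} (%s. ennreal ((fst hJ s w - h (r k) s w)^2)))) < ennreal ((1/2)^k)"
 proof
  fix k :: nat
  have half: "0 < (1/2::real)^k" by simp
  obtain h' J' where "elementary F T W uniformly_bounded h' J'" "(EE w. (TI {0..T} (%s. ennreal ((h' s w - h (r k) s w)^2)))) < ennreal ((1/2)^k)"
   using elementary_clip[OF el_h[OF r0[of k]] half] by (elim exE conjE)
  then show "\<exists>hJ. elementary F T W uniformly_bounded (fst hJ) (snd hJ) \<and> (EE w. (TI {0..T} (%s. ennreal ((fst hJ s w - h (r k) s w)^2)))) < ennreal ((1/2)^k)"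
   by (intro exI[of _ "(h', J')"]) simp
 qed
 then obtain hJ where hJ: "\<forall>k. elementary F T W uniformly_bounded (fst (hJ k)) (snd (hJ k)) \<and> (EE w. (TI {0..T} (%s. ennreal ((fst (hJ k) s w - h (r k) s w)^2)))) < ennreal ((1/2)^k)"
  by (rule choice[THEN exE])
 define hb where "hb k = fst (hJ k)" for k
 define Jb where "Jb k = snd (hJ k)" for k
 have eb: "elementary F T W uniformly_bounded (hb k) (Jb k)" and clip: "(EE w. (TI {0..T} (%s. ennreal ((hb k s w - h (r k) s w)^2)))) < ennreal ((1/2)^k)" for k
  using hJ unfolding hb_def Jb_def by auto
 have ed: "elementary F T W square_integrable (%s w. hb k s w - h (r k) s w) (%t w. Jb k t w - J (r k) t w)" for k
  by (rule elementary_diff[OF elementary_bounded_imp_square[OF eb] el_h[OF r0] square_integrable_diff])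
 have clip_lim: "(%k. (EE w. (TI {0..T} (%s. ennreal ((hb k s w - h (r k) s w)^2))))) \<longlonglongrightarrow> 0"
 proof (rule tendsto_sandwich[OF _ _ tendsto_const])
  have "(%k. (1/2::real)^k) \<longlonglongrightarrow> 0" by (intro LIMSEQ_realpow_zero) auto
  then show "(%k. ennreal ((1/2)^k)) \<longlonglongrightarrow> 0" using tendsto_ennrealI by fastforce
  show "\<forall>\<^sub>F k in sequentially. (EE w. (TI {0..T} (%s. ennreal ((hb k s w - h (r k) s w)^2)))) \<le> ennreal ((1/2)^k)"
   using clip by (intro always_eventually allI less_imp_le)
 qed simp
 have jb: "(%z. hb k (snd z) (fst z)) \<in> borel_measurable (M \<Otimes>\<^sub>M lborel)" for k using elementary_measurable[OF eb] by (simp add: case_prod_beta')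
 have clip_null: "null_in_probability M (%k w. (TI {0..T} (%s. ennreal ((hb k s w - h (r k) s w)^2))))"
  by (rule null_in_probability_nn_integral[OF _ clip_lim]) (rule joint_square_diff(3)[OF jb joint(2)[OF r0]])
 have "approximable (%s w. s0 (Z s w)) I"
 proof (rule approximableI[OF _ eb])
  show "AE w in M. (%s. indicator {0..T} s * s0 (Z s w)) \<in> borel_measurable lborel"
   by (rule AE_I'[OF S]) (use H_path in blast)
  show "null_in_probability M (%k w. (TI {0..T} (%s. ennreal ((hb k s w - s0 (Z s w))^2))))"
  proof (rule null_in_probability_le[OF null_in_probability_add[OF clip_null energy_null] S, where c=2])
   fix k w assume w: "w \<in> space M - S"
   have p: "(%s. indicator {0..T} s * hb k s w) \<in> borel_measurable lborel" "(%s. indicator {0..T} s * h (r k) s w) \<in> borel_measurable lborel"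
    using elementary_path_measurable[OF eb] elementary_path_measurable[OF el_h[OF r0]] by (intro borel_measurable_times borel_measurable_indicator; simp)+
   have "(TI {0..T} (%s. ennreal ((hb k s w - s0 (Z s w))^2)))
    \<le> ennreal 2 * ((TI {0..T} (%s. ennreal ((hb k s w - h (r k) s w)^2))) + (TI {0..T} (%s. ennreal ((h (r k) s w - s0 (Z s w))^2))))"
   proof (rule nn_integral_square_diff_le[OF p p(2) H_path[OF w]])
    have "(a - c)^2 \<le> 2 * ((a - b)^2 + (b - c)^2)" for a b c :: real
    proof -
     have "0 \<le> ((a - b) - (b - c))^2" by simp
     then show ?thesis by (simp add: power2_eq_square algebra_simps)
    qed
    then show "AE s in lborel. s \<in> {0..T} --> (hb k s w - s0 (Z s w))^2 \<le> 2 * ((hb k s w - h (r k) s w)^2 + (h (r k) s w - s0 (Z s w))^2)" by simp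
   qed simp
   also have "... \<le> ennreal 2 * ((TI {0..T} (%s. ennreal ((hb k s w - h (r k) s w)^2))) + liminf (%j. ?dist k j w))"
    by (intro mult_left_mono add_left_mono energy[OF w]) simp
   finally show "(TI {0..T} (%s. ennreal ((hb k s w - s0 (Z s w))^2)))
    \<le> ennreal 2 * ((TI {0..T} (%s. ennreal ((hb k s w - h (r k) s w)^2))) + liminf (%j. ?dist k j w))" .
  qed simp
  show "null_in_probability M (%k w. SUP t\<in>{0..T}. ennreal \<bar>Jb k t w - I t w\<bar>)"
  proof (rule null_in_probability_le[OF null_in_probability_add[OF null_in_probability_sup_elementary[OF ed clip_lim] sup_null] S, where c=1])
   fix k w assume w: "w \<in> space M - S"
   show "(SUP t\<in>{0..T}. ennreal \<bar>Jb k t w - I t w\<bar>)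
    \<le> ennreal 1 * ((SUP t\<in>{0..T}. ennreal \<bar>Jb k t w - J (r k) t w\<bar>) + (\<top> * indicator (\<Union>j\<in>{k..}. A j) w + ennreal (2 * (1/2)^k)))"
   proof (rule SUP_least)
    fix t assume t: "t \<in> {0..T}"
    have "ennreal \<bar>Jb k t w - I t w\<bar> \<le> ennreal (\<bar>Jb k t w - J (r k) t w\<bar> + \<bar>J (r k) t w - I t w\<bar>)" by (rule ennreal_leI) simp
    also have "... = ennreal \<bar>Jb k t w - J (r k) t w\<bar> + ennreal \<bar>J (r k) t w - I t w\<bar>" by (rule ennreal_plus) simp_all
    also have "... \<le> (SUP t\<in>{0..T}. ennreal \<bar>Jb k t w - J (r k) t w\<bar>) + (\<top> * indicator (\<Union>j\<in>{k..}. A j) w + ennreal (2 * (1/2)^k))"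
     by (intro add_mono tail[OF w t] SUP_upper t)
    finally show "ennreal \<bar>Jb k t w - I t w\<bar> \<le> ennreal 1 * ((SUP t\<in>{0..T}. ennreal \<bar>Jb k t w - J (r k) t w\<bar>) + (\<top> * indicator (\<Union>j\<in>{k..}. A j) w + ennreal (2 * (1/2)^k)))"
     by (simp only: ennreal_1 mult_1)
   qed
  qed simp
 qed
 moreover have "AE w in M. continuous_on {0..T} (%t. Z t w)" "AE w in M. continuous_on {0..T} (%t. I t w)"
  "AE w in M. \<forall>t\<in>{0..T}. Z t w = x + (LINT s:{0..t}|lborel. l s + m s * Z s w) + I t w"
  by (rule AE_I'[OF S]; use cont equation in blast)+
 ultimately show ?thesis using Z_F I_F by (intro exI[of _ Z] exI[of _ I] conjI ballI)
qed

end

section \<open>Convexity of an autonomous diffusion coefficient\<close>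

context linear_drift_equation
begin

lemma strong_solution_exists:
 assumes b: "\<forall>t\<in>{0..T}. \<forall>x. b t x = l t + m t * x" and adm: "admissible_coefficient T \<sigma>"
  and aut: "\<forall>t\<in>{0..T}. \<forall>x. \<sigma> t x = s0 x"
 shows "\<exists>X. strong_solution M T W b \<sigma> (%_. x) X"
proof -
 let ?F = "aug_filtration M W (%_. x)"
 interpret bf: brownian_filtration M T W ?F by (rule filtration[OF indep_const])
 obtain L where L: "0 \<le> L" "\<forall>t\<in>{0..T}. \<forall>x y. \<bar>\<sigma> t x - \<sigma> t y\<bar> \<le> L * \<bar>x - y\<bar>" "\<forall>t\<in>{0..T}. \<forall>x. \<bar>\<sigma> t x\<bar> \<le> L * (1 + \<bar>x\<bar>)"
  using admissible_coefficient_bounds[OF adm] by blast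
 obtain B1 where B1: "0 \<le> B1" "\<forall>t\<in>{0..T}. \<bar>l t\<bar> \<le> B1" using bounded_on_interval[OF l_cont] by blast
 obtain B2 where B2: "0 \<le> B2" "\<forall>t\<in>{0..T}. \<bar>m t\<bar> \<le> B2" using bounded_on_interval[OF m_cont] by blast
 have T0: "0 \<in> {0..T}" using T_pos by simp
 interpret euler_scheme M T W ?F x "L + B1 + B2" l m s0
 proof
  show "continuous_on {0..T} l" "continuous_on {0..T} m" by (rule l_cont, rule m_cont)
  show "0 \<le> L + B1 + B2" using L B1 B2 by simp
  show "\<bar>s0 a - s0 c\<bar> \<le> (L + B1 + B2) * \<bar>a - c\<bar>" for a c
  proof -
   have "\<bar>s0 a - s0 c\<bar> \<le> L * \<bar>a - c\<bar>" using L(2) aut T0 by metis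
   also have "... \<le> (L + B1 + B2) * \<bar>a - c\<bar>" using B1 B2 by (intro mult_right_mono) auto
   finally show ?thesis .
  qed
  show "\<bar>s0 a\<bar> \<le> (L + B1 + B2) * (1 + \<bar>a\<bar>)" for a
  proof -
   have "\<bar>s0 a\<bar> \<le> L * (1 + \<bar>a\<bar>)" using L(3) aut T0 by metis
   also have "... \<le> (L + B1 + B2) * (1 + \<bar>a\<bar>)" using B1 B2 by (intro mult_right_mono) auto
   finally show ?thesis .
  qed
  show "\<bar>m t\<bar> \<le> L + B1 + B2" if "t \<in> {0..T}" for t using B2(2)[rule_format, OF that] L(1) B1(1) by simp
  show "\<bar>l t + m t * a\<bar> \<le> (L + B1 + B2) * (1 + \<bar>a\<bar>)" if t: "t \<in> {0..T}" for t a
  proof -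
   have "\<bar>l t + m t * a\<bar> \<le> B1 + B2 * \<bar>a\<bar>"
    using abs_triangle_ineq[of "l t" "m t * a"] B1(2)[rule_format, OF t] mult_right_mono[OF B2(2)[rule_format, OF t] abs_ge_zero[of a]] by (simp add: abs_mult)
   also have "... \<le> (L + B1 + B2) * (1 + \<bar>a\<bar>)"
   proof -
    have "0 \<le> L * (1 + \<bar>a\<bar>) + B1 * \<bar>a\<bar> + B2" using L(1) B1(1) B2(1) by simp
    then show ?thesis by (simp add: algebra_simps)
   qed
   finally show ?thesis .
  qed
 qed
 obtain Z I where Z: "\<forall>t\<in>{0..T}. Z t \<in> borel_measurable (?F t)" "AE w in M. continuous_on {0..T} (%t. Z t w)"
  and I: "\<forall>t\<in>{0..T}. I t \<in> borel_measurable (?F t)" "AE w in M. continuous_on {0..T} (%t. I t w)"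
  and ap: "bf.approximable (%s w. s0 (Z s w)) I"
  and eq: "AE w in M. \<forall>t\<in>{0..T}. Z t w = x + (LINT s:{0..t}|lborel. l s + m s * Z s w) + I t w"
  using solution_exists by (elim exE conjE)
 have "bf.approximable (%s w. \<sigma> s (Z s w)) I"
  by (rule bf.approximable_cong[OF ap, of "{}"]) (use aut in auto)
 then have "ito_integral M ?F T W (%s w. \<sigma> s (Z s w)) I" unfolding bf.ito_integral_iff_approximable using I by blast
 moreover have "AE w in M. \<forall>t\<in>{0..T}. Z t w = x + (LINT s:{0..t}|lborel. b s (Z s w)) + I t w"
  using eq
 proof eventually_elim
  case (elim w)
  have "(LINT s:{0..t}|lborel. b s (Z s w)) = (LINT s:{0..t}|lborel. l s + m s * Z s w)" if "t \<in> {0..T}" for t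
   using that b by (intro set_lebesgue_integral_cong) auto
  then show ?case using elim by simp
 qed
 ultimately show ?thesis using Z unfolding strong_solution_def by (intro exI[of _ Z] conjI exI[of _ I])
qed

lemma strong_solution_initial_value:
 assumes X: "strong_solution M T W b \<sigma> (%_. x) X"
 shows "AE w in M. X 0 w = x"
proof -
 interpret bf: brownian_filtration M T W "aug_filtration M W (%_. x)" by (rule filtration[OF indep_const])
 obtain I where I: "ito_integral M (aug_filtration M W (%_. x)) T W (%s w. \<sigma> s (X s w)) I"
  and eq: "AE w in M. \<forall>t\<in>{0..T}. X t w = x + (LINT s:{0..t}|lborel. b s (X s w)) + I t w"
  using X unfolding strong_solution_def by blast
 have "AE w in M. I 0 w = 0"
  using I unfolding bf.ito_integral_iff_approximable by (intro bf.approximable_zero) blast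
 then show ?thesis using eq
 proof eventually_elim
  case (elim w)
  have "(LINT s:{0..0}|lborel. b s (X s w)) = 0"
   unfolding set_lebesgue_integral_def
  proof (rule integral_eq_zero_AE)
   show "AE s in lborel. indicator {0..0} s *\<^sub>R b s (X s w) = 0"
    using AE_lborel_singleton[of 0] by eventually_elim (simp add: indicator_def)
  qed
  then show ?case using elim(2)[rule_format, of 0] elim(1) T_pos by simp
 qed
qed

text \<open>At time 0 the solution still is its initial value, so part (b) reads off the coefficient.\<close>

lemma propagates_imp_convex_coefficient:
 assumes rich: "rich_enough M T W" and b: "\<forall>t\<in>{0..T}. \<forall>x. b t x = l t + m t * x" and \<beta>: "\<forall>t\<in>{0..T}. \<forall>x. \<beta> t x = l t + m t * x"
  and adm: "admissible_coefficient T \<sigma>" and propag: "propagates_two_marginal_cvx M T W b \<sigma> \<beta> \<sigma>"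
  and aut: "\<forall>t\<in>{0..T}. \<forall>x. \<sigma> t x = s0 x"
 shows "convex_on UNIV (%x. \<bar>s0 x\<bar>)"
proof -
 interpret prob_space M by (rule prob)
 have "\<forall>x. \<exists>X. strong_solution M T W b \<sigma> (%_. x) X" using strong_solution_exists[OF b adm aut] by blast
 then obtain Xx where Xx: "\<forall>x. strong_solution M T W b \<sigma> (%_. x) (Xx x)" by (rule choice[THEN exE])
 have T0: "0 \<in> {0..T}" using T_pos by simp
 have "convex_on UNIV (%x. expectation (%w. \<bar>\<sigma> 0 (Xx x 0 w)\<bar>))"
  by (rule propagates_imp_convex[OF rich b \<beta> adm propag Xx[rule_format] T0])
 moreover have "expectation (%w. \<bar>\<sigma> 0 (Xx x 0 w)\<bar>) = \<bar>s0 x\<bar>" for x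
 proof -
  have "expectation (%w. \<bar>\<sigma> 0 (Xx x 0 w)\<bar>) = expectation (%_. \<bar>s0 x\<bar>)"
  proof (rule integral_cong_AE)
   have "Xx x 0 \<in> borel_measurable M" by (rule strong_solution_measurable[OF _ Xx[rule_format] T0]) simp
   from measurable_compose[OF this admissible_borel[OF adm T0]]
   show "(%w. \<bar>\<sigma> 0 (Xx x 0 w)\<bar>) \<in> borel_measurable M" by (rule borel_measurable_abs)
   show "AE w in M. \<bar>\<sigma> 0 (Xx x 0 w)\<bar> = \<bar>s0 x\<bar>"
    using strong_solution_initial_value[OF Xx[rule_format, of x]] by eventually_elim (use aut T0 in simp)
  qed simp
  then show ?thesis by (simp add: prob_space)
 qed
 ultimately show ?thesis by simp
qed

end

theorem proposition3p3:
  fixes M :: "'a measure" and T :: real and W :: "real \<Rightarrow> 'a \<Rightarrow> real"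
    and \<sigma> \<theta> b \<beta> :: "real \<Rightarrow> real \<Rightarrow> real" and l m :: "real \<Rightarrow> real"
  assumes "T > 0"
    and "prob_space M"
    and "brownian_motion M T W"
    and "rich_enough M T W"
    and "admissible_coefficient T \<sigma>"
    and "admissible_coefficient T \<theta>"
    and "continuous_on {0..T} l"
    and "continuous_on {0..T} m"
    and "\<And>t x. t \<in> {0..T} \<Longrightarrow> b t x = l t + m t * x"
    and "\<And>t x. t \<in> {0..T} \<Longrightarrow> \<beta> t x = l t + m t * x"
  shows
    "(\<forall>X0 Y0 X Y.
        integrable M X0 \<and> integrable M Y0 \<and> indep_of_process M T W (\<lambda>\<omega>. (X0 \<omega>, Y0 \<omega>)) \<and>
        strong_solution M T W b \<sigma> X0 X \<and> strong_solution M T W \<beta> \<theta> Y0 Y \<and>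
        two_marginal_cvx_dominated M T X Y \<longrightarrow>
        (\<forall>t\<in>{0..T}. (\<integral>\<omega>. \<bar>\<sigma> t (X t \<omega>)\<bar> \<partial>M) \<le> (\<integral>\<omega>. \<bar>\<theta> t (Y t \<omega>)\<bar> \<partial>M)))
     \<and> (\<theta> = \<sigma> \<and> propagates_two_marginal_cvx M T W b \<sigma> \<beta> \<theta> \<longrightarrow>
        (\<forall>Xx. (\<forall>x. strong_solution M T W b \<sigma> (\<lambda>_. x) (Xx x)) \<longrightarrow>
           (\<forall>s\<in>{0..T}. convex_on UNIV (\<lambda>x. \<integral>\<omega>. \<bar>\<sigma> s (Xx x s \<omega>)\<bar> \<partial>M))))
     \<and> (\<theta> = \<sigma> \<and> propagates_two_marginal_cvx M T W b \<sigma> \<beta> \<theta> \<longrightarrow>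
        (\<forall>\<sigma>0. (\<forall>t\<in>{0..T}. \<forall>x. \<sigma> t x = \<sigma>0 x) \<longrightarrow> convex_on UNIV (\<lambda>x. \<bar>\<sigma>0 x\<bar>)))"
proof -
  interpret linear_drift_equation M T W l m by (rule linear_drift_equation.intro) (rule assms)+
  have b: "\<forall>t\<in>{0..T}. \<forall>x. b t x = l t + m t * x" and \<beta>: "\<forall>t\<in>{0..T}. \<forall>x. \<beta> t x = l t + m t * x"
    using assms(9,10) by auto
  show ?thesis
  proof (intro conjI allI impI ballI; elim conjE)
    fix X0 Y0 X Y t
    assume X0: "integrable M X0" and Y0: "integrable M Y0" and ind: "indep_of_process M T W (\<lambda>\<omega>. (X0 \<omega>, Y0 \<omega>))"
      and sol: "strong_solution M T W b \<sigma> X0 X" "strong_solution M T W \<beta> \<theta> Y0 Y"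
      and dom: "two_marginal_cvx_dominated M T X Y" and t: "t \<in> {0..T}"
    have "indep_of_process M T W X0" "indep_of_process M T W Y0"
      using indep_of_process_compose[OF assms(2,3) ind borel_measurable_continuous_onI[OF continuous_on_fst[OF continuous_on_id]]]
        indep_of_process_compose[OF assms(2,3) ind borel_measurable_continuous_onI[OF continuous_on_snd[OF continuous_on_id]]] by simp_all
    from dominated_diffusion_le[OF b \<beta> assms(5,6) X0 this(1) Y0 this(2) sol dom t]
    show "(\<integral>\<omega>. \<bar>\<sigma> t (X t \<omega>)\<bar> \<partial>M) \<le> (\<integral>\<omega>. \<bar>\<theta> t (Y t \<omega>)\<bar> \<partial>M)" .
  next
    fix Xx s assume eq: "\<theta> = \<sigma>" and pr: "propagates_two_marginal_cvx M T W b \<sigma> \<beta> \<theta>"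
      and Xx: "\<forall>x. strong_solution M T W b \<sigma> (\<lambda>_. x) (Xx x)" and s: "s \<in> {0..T}"
    show "convex_on UNIV (\<lambda>x. \<integral>\<omega>. \<bar>\<sigma> s (Xx x s \<omega>)\<bar> \<partial>M)"
      by (rule propagates_imp_convex[OF assms(4) b \<beta> assms(5) pr[unfolded eq] Xx[rule_format] s])
  next
    fix \<sigma>0 assume eq: "\<theta> = \<sigma>" and pr: "propagates_two_marginal_cvx M T W b \<sigma> \<beta> \<theta>"
      and aut: "\<forall>t\<in>{0..T}. \<forall>x. \<sigma> t x = \<sigma>0 x"
    show "convex_on UNIV (\<lambda>x. \<bar>\<sigma>0 x\<bar>)"
      by (rule propagates_imp_convex_coefficient[OF assms(4) b \<beta> assms(5) pr[unfolded eq] aut])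
  qed
qed

end
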